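(* Let $n\ge 3$ be odd, let $K$ be an algebraically closed field containing an element $v$ transcendental over a subfield $F\subseteq K$, and let $TL(\widehat{A}_{n-1})$ be the affine Temperley--Lieb algebra over $K$ (realised inside $D_n$ as below). For a finite-dimensional irreducible representation $\rho$ of $TL(\widehat{A}_{n-1})$ other than the trivial one, let $t$ be the unique integer such that $\rho$ vanishes on every diagram of $TL(\widehat{A}_{n-1})$ with fewer than $t$ vertical edges but not on all diagrams of $TL(\widehat{A}_{n-1})$ with at most $t$ vertical edges, and let $\alpha\in K\setminus\{0\}$ be the scalar satisfying $\rho([S_1,S_2,w+2])=\alpha\,\rho([S_1,S_2,w])$ for all $S_1,S_2\in \mathrm{Ann}(n)\cap I(t)$ and all $w\in\mathbb{Z}$ with $[S_1,S_2,w]\in TL(\widehat{A}_{n-1})$. Then $\rho\mapsto(\alpha,t)$ is a well-defined bijection from the isomorphism classes of nontrivial finite-dimensional irreducible representations of $TL(\widehat{A}_{n-1})$ over $K$ onto the set of pairs $(\alpha,t)$ with $t$ an odd integer, $1\le t\le n-2$, and $\alpha\in K\setminus\{0\}$. The only other finite-dimensional irreducible representation is the trivial one: the one-dimensional representation sending the identity to $1$ and every generator $E_i$ to $0$.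
   Context: Put $[2]=v+v^{-1}$. An affine $n$-diagram consists of the nodes $\mathbb{Z}\times\{0,1\}\subset\mathbb{R}^2$ (bottom row $\mathbb{Z}\times\{0\}$, top row $\mathbb{Z}\times\{1\}$) together with curves called edges such that: (i) every node is an endpoint of exactly one edge; (ii) every edge lies in the strip $\mathbb{R}\times[0,1]$; (iii) an edge not joining two nodes is an infinite horizontal line meeting no node, and there are finitely many such edges; (iv) no two edges intersect; (v) the diagram is invariant under horizontal translation by $n$. Diagrams are taken up to isotopy; equivalently they are drawn on a cylinder with $n$ nodes labelled $1,\dots,n$ (indices mod $n$) on a top circle and on a bottom circle. An edge is vertical if it joins a top node to a bottom node, horizontal if it joins two nodes in the same row. The product $AB$ of two diagrams is formed by placing $A$ on top of $B$, identifying the bottom row of $A$ with the top row of $B$, and removing the $x$ closed loops formed, giving a diagram $C$; then $AB=[2]^xC$. $D_n$ is the $K$-algebra with basis the affine $n$-diagrams and this multiplication. For $1\le i\le n$, $E_i$ is the diagram having, for each $k\equiv i\pmod n$, minimal horizontal edges joining $(k,1)$ to $(k+1,1)$ and $(k,0)$ to $(k+1,0)$, and straight vertical edges joining $(j,0)$ to $(j,1)$ for all $j\not\equiv i,i+1 \pmod n$. $TL(\widehat{A}_{n-1})$ is the subalgebra of $D_n$ generated by $E_1,\dots,E_n$; its diagrams are the identity diagram and the diagrams having at least one horizontal edge and meeting each line $x=i+\tfrac12$ ($i\in\mathbb{Z}$) an even number of times (minimal count over isotopic representatives). An involution $S$ of $\{1,\dots,n\}$ is annular if for each pair $i<j$ interchanged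 by $S$: $S(\{i,\dots,j\})=\{i,\dots,j\}$, and $\{i,\dots,j\}$ contains either no fixed point of $S$ or all fixed points of $S$. $\mathrm{Ann}(n)$ is the set of annular involutions, $I(t)$ the set of involutions with exactly $t$ fixed points. For a diagram $D$ with a vertical edge let $w_1(D)$ be the number of pairs $(i,j)\in\mathbb{Z}^2$ with $i>j$ such that bottom node $(j,0)$ is joined to top node $(i,1)$ by an edge crossing the line $x=1/2$, $w_2(D)$ the same with $i<j$, and $w(D)=w_1(D)-w_2(D)$. Sending $D$ to $(S_1,S_2,w(D))$, where $S_1$ (resp. $S_2$) interchanges $i,j$ iff top (resp. bottom) nodes $i,j$ are joined in $D$, is a bijection from diagrams with at least one vertical edge onto triples with $S_1,S_2\in\mathrm{Ann}(n)\cap I(t)$, $t>0$, $w\in\mathbb{Z}$; $[S_1,S_2,w]$ denotes the corresponding diagram. *)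

theory Defs
  imports "Jordan_Normal_Form.Matrix" "HOL-Computational_Algebra.Polynomial"
begin

definition is_subfield :: "'k::field set \<Rightarrow> bool" where
  "is_subfield F \<longleftrightarrow> 0 \<in> F \<and> 1 \<in> F \<and>
     (\<forall>x\<in>F. \<forall>y\<in>F. x + y \<in> F \<and> x * y \<in> F) \<and>
     (\<forall>x\<in>F. - x \<in> F \<and> inverse x \<in> F)"

definition transcendental_over :: "'k::field set \<Rightarrow> 'k \<Rightarrow> bool" where
  "transcendental_over F v \<longleftrightarrow>
     (\<forall>p :: 'k poly. p \<noteq> 0 \<longrightarrow> (\<forall>i. coeff p i \<in> F) \<longrightarrow> poly p v \<noteq> 0)"

definition qtwo :: "'k::field \<Rightarrow> 'k" where
  "qtwo v = v + inverse v"

text \<open>A node is (x, row) with row True = top row (y = 1), False = bottom row (y = 0).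
  An affine diagram is recorded (up to isotopy) by the perfect matching m of its nodes
  in the universal cover Z x {0,1} together with the number k of infinite horizontal lines.\<close>

type_synonym node = "int \<times> bool"
type_synonym diagram = "(node \<Rightarrow> node) \<times> nat"

definition is_diagram :: "nat \<Rightarrow> diagram \<Rightarrow> bool" where
  "is_diagram n D \<longleftrightarrow> (let m = fst D; k = snd D in
     (\<forall>p. m p \<noteq> p \<and> m (m p) = p) \<and>
     (\<forall>i r. m (i + int n, r) = (fst (m (i, r)) + int n, snd (m (i, r)))) \<and>
     \<comment> \<open>no crossings: nodes strictly inside a horizontal edge are joined among themselves\<close>
     (\<forall>a b c r. m (a, r) = (b, r) \<and> a < c \<and> c < b \<longrightarrow>
         snd (m (c, r)) = r \<and> a < fst (m (c, r)) \<and> fst (m (c, r)) < b) \<and>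
     \<comment> \<open>no crossings: vertical edges are order preserving\<close>
     (\<forall>a b c d. m (a, True) = (b, False) \<and> m (c, True) = (d, False) \<and> a < c \<longrightarrow> b < d) \<and>
     \<comment> \<open>infinite horizontal lines can only occur when there is no vertical edge\<close>
     (k > 0 \<longrightarrow> (\<forall>a. snd (m (a, True)) = True)))"

definition id_diagram :: diagram where
  "id_diagram = ((\<lambda>(j, r). (j, \<not> r)), 0)"

definition E_diagram :: "nat \<Rightarrow> nat \<Rightarrow> diagram" where
  "E_diagram n i = ((\<lambda>(j, r).
      if j mod int n = int i mod int n then (j + 1, r)
      else if j mod int n = (int i + 1) mod int n then (j - 1, r)
      else (j, \<not> r)), 0)"

text \<open>Stacking A on top of B: nodes of the stacked picture are (x, level) with level 2 = top
  row of A, level 1 = the identified middle row, level 0 = bottom row of B.\<close>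

definition liftA :: "node \<Rightarrow> int \<times> nat" where
  "liftA p = (fst p, if snd p then 2 else 1)"

definition liftB :: "node \<Rightarrow> int \<times> nat" where
  "liftB p = (fst p, if snd p then 1 else 0)"

definition stack_edges :: "diagram \<Rightarrow> diagram \<Rightarrow> ((int \<times> nat) \<times> (int \<times> nat)) set" where
  "stack_edges A B = {(liftA p, liftA (fst A p)) | p. True} \<union> {(liftB p, liftB (fst B p)) | p. True}"

definition stack_conn :: "diagram \<Rightarrow> diagram \<Rightarrow> ((int \<times> nat) \<times> (int \<times> nat)) set" where
  "stack_conn A B = (stack_edges A B)\<^sup>*"

definition outer_node :: "int \<times> nat \<Rightarrow> bool" where
  "outer_node u \<longleftrightarrow> snd u = 0 \<or> snd u = 2"

definition comp_match :: "diagram \<Rightarrow> diagram \<Rightarrow> node \<Rightarrow> node" where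
  "comp_match A B p = (let u = (fst p, if snd p then 2 else 0);
      w = (THE w. outer_node w \<and> w \<noteq> u \<and> (u, w) \<in> stack_conn A B)
    in (fst w, snd w = 2))"

definition closed_mid :: "diagram \<Rightarrow> diagram \<Rightarrow> int \<times> nat \<Rightarrow> bool" where
  "closed_mid A B u \<longleftrightarrow> snd u = 1 \<and> \<not> (\<exists>w. outer_node w \<and> (u, w) \<in> stack_conn A B)"

definition comp_set :: "diagram \<Rightarrow> diagram \<Rightarrow> int \<times> nat \<Rightarrow> (int \<times> nat) set" where
  "comp_set A B u = {w. (u, w) \<in> stack_conn A B}"

text \<open>Translation orbit of a component (components on the cylinder).\<close>
definition comp_orbit :: "nat \<Rightarrow> diagram \<Rightarrow> diagram \<Rightarrow> int \<times> nat \<Rightarrow> (int \<times> nat) set set" where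
  "comp_orbit n A B u = {comp_set A B (fst u + z * int n, snd u) | z. True}"

text \<open>Number of closed (contractible) loops formed.\<close>
definition num_loops :: "nat \<Rightarrow> diagram \<Rightarrow> diagram \<Rightarrow> nat" where
  "num_loops n A B = card {comp_orbit n A B u | u. closed_mid A B u \<and> finite (comp_set A B u)}"

text \<open>Number of new infinite horizontal lines (non-contractible closed curves) formed.\<close>
definition num_new_lines :: "nat \<Rightarrow> diagram \<Rightarrow> diagram \<Rightarrow> nat" where
  "num_new_lines n A B = card {comp_orbit n A B u | u. closed_mid A B u \<and> infinite (comp_set A B u)}"

text \<open>The diagram C with AB = [2]^x C.\<close>
definition diag_comp :: "nat \<Rightarrow> diagram \<Rightarrow> diagram \<Rightarrow> diagram" where
  "diag_comp n A B = (comp_match A B, snd A + snd B + num_new_lines n A B)"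

text \<open>TL is the subalgebra of D_n generated by E_1..E_n; every word in the generators is a
  power of [2] times a diagram, so TL is spanned by the diagrams below.\<close>
inductive_set TL_diagrams :: "nat \<Rightarrow> diagram set" for n where
  TL_id: "id_diagram \<in> TL_diagrams n"
| TL_E: "1 \<le> i \<Longrightarrow> i \<le> n \<Longrightarrow> E_diagram n i \<in> TL_diagrams n"
| TL_mult: "A \<in> TL_diagrams n \<Longrightarrow> B \<in> TL_diagrams n \<Longrightarrow> diag_comp n A B \<in> TL_diagrams n"

definition num_vertical :: "nat \<Rightarrow> diagram \<Rightarrow> nat" where
  "num_vertical n D = card {a \<in> {1..int n}. snd (fst D (a, True)) = False}"

definition lab :: "nat \<Rightarrow> int \<Rightarrow> nat" where
  "lab n j = nat ((j - 1) mod int n) + 1"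

definition row_inv :: "nat \<Rightarrow> bool \<Rightarrow> diagram \<Rightarrow> nat \<Rightarrow> nat" where
  "row_inv n r D i = (if 1 \<le> i \<and> i \<le> n \<and> snd (fst D (int i, r)) = r
                      then lab n (fst (fst D (int i, r))) else i)"

definition w1 :: "diagram \<Rightarrow> nat" where
  "w1 D = card {(i, j). i > j \<and> fst D (j, False) = (i, True) \<and> j \<le> 0 \<and> 1 \<le> i}"

definition w2 :: "diagram \<Rightarrow> nat" where
  "w2 D = card {(i, j). i < j \<and> fst D (j, False) = (i, True) \<and> i \<le> 0 \<and> 1 \<le> j}"

definition wnum :: "diagram \<Rightarrow> int" where
  "wnum D = int (w1 D) - int (w2 D)"

definition is_involution :: "nat \<Rightarrow> (nat \<Rightarrow> nat) \<Rightarrow> bool" where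
  "is_involution n S \<longleftrightarrow> (\<forall>i. (i < 1 \<or> n < i) \<longrightarrow> S i = i) \<and>
     (\<forall>i\<in>{1..n}. S i \<in> {1..n} \<and> S (S i) = i)"

definition fixed_points :: "nat \<Rightarrow> (nat \<Rightarrow> nat) \<Rightarrow> nat set" where
  "fixed_points n S = {i \<in> {1..n}. S i = i}"

definition in_I :: "nat \<Rightarrow> nat \<Rightarrow> (nat \<Rightarrow> nat) \<Rightarrow> bool" where
  "in_I n t S \<longleftrightarrow> is_involution n S \<and> card (fixed_points n S) = t"

definition annular :: "nat \<Rightarrow> (nat \<Rightarrow> nat) \<Rightarrow> bool" where
  "annular n S \<longleftrightarrow> is_involution n S \<and>
     (\<forall>i j. 1 \<le> i \<and> i < j \<and> j \<le> n \<and> S i = j \<longrightarrow>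
        S ` {i..j} = {i..j} \<and>
        ({i..j} \<inter> fixed_points n S = {} \<or> fixed_points n S \<subseteq> {i..j}))"

definition bracket :: "nat \<Rightarrow> (nat \<Rightarrow> nat) \<Rightarrow> (nat \<Rightarrow> nat) \<Rightarrow> int \<Rightarrow> diagram" where
  "bracket n S1 S2 w = (THE D. is_diagram n D \<and> num_vertical n D > 0 \<and>
      row_inv n True D = S1 \<and> row_inv n False D = S2 \<and> wnum D = w)"

text \<open>A d-dimensional representation of TL over K: a unital algebra homomorphism
  TL -> K^(d x d), given by its values on the diagram basis of TL.\<close>
definition is_rep :: "nat \<Rightarrow> 'k::field \<Rightarrow> nat \<Rightarrow> (diagram \<Rightarrow> 'k mat) \<Rightarrow> bool" where
  "is_rep n v d \<rho> \<longleftrightarrow>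
     (\<forall>D\<in>TL_diagrams n. \<rho> D \<in> carrier_mat d d) \<and>
     \<rho> id_diagram = 1\<^sub>m d \<and>
     (\<forall>A\<in>TL_diagrams n. \<forall>B\<in>TL_diagrams n.
        \<rho> A * \<rho> B = (qtwo v ^ num_loops n A B) \<cdot>\<^sub>m \<rho> (diag_comp n A B))"

definition is_subspace :: "nat \<Rightarrow> 'k::field vec set \<Rightarrow> bool" where
  "is_subspace d W \<longleftrightarrow> W \<subseteq> carrier_vec d \<and> 0\<^sub>v d \<in> W \<and>
     (\<forall>x\<in>W. \<forall>y\<in>W. x + y \<in> W) \<and> (\<forall>c. \<forall>x\<in>W. c \<cdot>\<^sub>v x \<in> W)"

definition is_irrep :: "nat \<Rightarrow> 'k::field \<Rightarrow> nat \<Rightarrow> (diagram \<Rightarrow> 'k mat) \<Rightarrow> bool" where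
  "is_irrep n v d \<rho> \<longleftrightarrow> is_rep n v d \<rho> \<and> d > 0 \<and>
     (\<forall>W. is_subspace d W \<and> (\<forall>D\<in>TL_diagrams n. \<forall>x\<in>W. \<rho> D *\<^sub>v x \<in> W) \<longrightarrow>
        W = {0\<^sub>v d} \<or> W = carrier_vec d)"

definition rep_iso :: "nat \<Rightarrow> nat \<Rightarrow> (diagram \<Rightarrow> 'k::field mat) \<Rightarrow> nat \<Rightarrow> (diagram \<Rightarrow> 'k mat) \<Rightarrow> bool" where
  "rep_iso n d1 \<rho>1 d2 \<rho>2 \<longleftrightarrow> d1 = d2 \<and>
     (\<exists>P \<in> carrier_mat d1 d1. invertible_mat P \<and> (\<forall>D\<in>TL_diagrams n. P * \<rho>1 D = \<rho>2 D * P))"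

definition is_trivial_rep :: "nat \<Rightarrow> 'k::field \<Rightarrow> nat \<Rightarrow> (diagram \<Rightarrow> 'k mat) \<Rightarrow> bool" where
  "is_trivial_rep n v d \<rho> \<longleftrightarrow> is_rep n v d \<rho> \<and> d = 1 \<and>
     (\<forall>i\<in>{1..n}. \<rho> (E_diagram n i) = 0\<^sub>m 1 1)"

definition is_nontrivial_irrep :: "nat \<Rightarrow> 'k::field \<Rightarrow> nat \<Rightarrow> (diagram \<Rightarrow> 'k mat) \<Rightarrow> bool" where
  "is_nontrivial_irrep n v d \<rho> \<longleftrightarrow> is_irrep n v d \<rho> \<and>
     \<not> (\<exists>\<sigma>. is_trivial_rep n v 1 \<sigma> \<and> rep_iso n d \<rho> 1 \<sigma>)"

definition t_prop :: "nat \<Rightarrow> nat \<Rightarrow> (diagram \<Rightarrow> 'k::field mat) \<Rightarrow> nat \<Rightarrow> bool" where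
  "t_prop n d \<rho> t \<longleftrightarrow>
     (\<forall>D\<in>TL_diagrams n. num_vertical n D < t \<longrightarrow> \<rho> D = 0\<^sub>m d d) \<and>
     (\<exists>D\<in>TL_diagrams n. num_vertical n D \<le> t \<and> \<rho> D \<noteq> 0\<^sub>m d d)"

definition rep_t :: "nat \<Rightarrow> nat \<Rightarrow> (diagram \<Rightarrow> 'k::field mat) \<Rightarrow> nat" where
  "rep_t n d \<rho> = (THE t. t_prop n d \<rho> t)"

definition alpha_prop :: "nat \<Rightarrow> (diagram \<Rightarrow> 'k::field mat) \<Rightarrow> nat \<Rightarrow> 'k \<Rightarrow> bool" where
  "alpha_prop n \<rho> t \<alpha> \<longleftrightarrow> \<alpha> \<noteq> 0 \<and>
     (\<forall>S1 S2 w. annular n S1 \<and> in_I n t S1 \<and> annular n S2 \<and> in_I n t S2 \<and>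
        bracket n S1 S2 w \<in> TL_diagrams n \<and> bracket n S1 S2 (w + 2) \<in> TL_diagrams n \<longrightarrow>
        \<rho> (bracket n S1 S2 (w + 2)) = \<alpha> \<cdot>\<^sub>m \<rho> (bracket n S1 S2 w))"

definition rep_alpha :: "nat \<Rightarrow> nat \<Rightarrow> (diagram \<Rightarrow> 'k::field mat) \<Rightarrow> 'k" where
  "rep_alpha n d \<rho> = (THE \<alpha>. alpha_prop n \<rho> (rep_t n d \<rho>) \<alpha>)"

definition rep_invariant :: "nat \<Rightarrow> nat \<Rightarrow> (diagram \<Rightarrow> 'k::field mat) \<Rightarrow> 'k \<times> nat" where
  "rep_invariant n d \<rho> = (rep_alpha n d \<rho>, rep_t n d \<rho>)"

end

theory Submission
  imports Defs "Jordan_Normal_Form.Char_Poly"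
begin

text \<open>Modulo diagrams with fewer than \<open>t\<close> vertical edges, a product keeping \<open>t\<close> vertical edges
  depends only on the two outer halves of its factors and on offsets that add up. For an idempotent
  diagram \<open>e\<close> with \<open>t\<close> vertical edges, the corner at \<open>e\<close> is therefore, modulo smaller diagrams,
  spanned by the powers of a rotation by two steps; it is commutative. An irreducible representation
  that kills the smaller diagrams but not \<open>e\<close> contains an eigenvector \<open>u\<close> of this corner, with the
  rotation acting by \<open>\<alpha>\<close>, and the coefficients of \<open>e C y\<close> along \<open>u\<close>, for \<open>C\<close> in the algebra,
  separate the vectors \<open>y\<close> and depend only on \<open>(\<alpha>, t)\<close>. Conversely, specialising the
  rotation to \<open>\<alpha>\<close> in the cell module gives a finite-dimensional representation on which \<open>e\<close> is
  not zero, and a subquotient of minimal dimension with that property is irreducible. All of this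
  uses that \<open>[2]\<close> is invertible, so that loops do not annihilate products.\<close>

text \<open>The algebra is given by generators, whereas the argument must know exactly which
  diagrams occur. Every even diagram with fewer than n vertical edges is a word: generators are
  split off so that the total horizontal displacement drops, until all edges are as short as
  possible, and flat diagrams are dealt with directly. Evenness is the origin of the step by two:
  once both halves are fixed it fixes the parity of the offset, so the diagrams of the algebra with
  given halves form one orbit of the rotation by two. Oddness of n gives every diagram a vertical
  edge, which bounds the length of horizontal edges and makes a diagram recoverable from its two
  halves and one offset; it also makes t odd. Products are defined through connectivity in an
  infinite stacked picture, so associativity and loop counts are derived by walking along
  alternating edges. The two bracketings of a triple product are compared inside one stack of three
  diagrams, which favours neither.\<close>

declare One_nat_def [simp del] split_paired_All [simp del] split_paired_Ex [simp del]

text \<open>Let F i be the i-th iterate of \<open>b \<circ> a\<close> at u and k its period. Both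
  involutions reverse this cycle, so they preserve it, and F i is fixed only if i = 0, k = 2 * i (by
  \<open>b\<close>) or k = 2 * i + 1 (by \<open>a\<close>). Apart from u this leaves one index,
  halfway round the cycle: the other end of the path.\<close>

lemma dihedral_path:
  fixes a b :: "'x \<Rightarrow> 'x"
  assumes a: "\<And>x. a (a x) = x" and b: "\<And>x. b (b x) = x"
    and u: "b u = u" "a u \<noteq> u" and per: "\<exists>k>0. ((b \<circ> a) ^^ k) u = u"
  shows "\<exists>V w. finite V \<and> u \<in> V \<and> w \<in> V \<and> w \<noteq> u \<and> (a w = w \<or> b w = w) \<and>
      (\<forall>x\<in>V. a x \<in> V \<and> b x \<in> V) \<and> (\<forall>x\<in>V. (a x = x \<or> b x = x) \<longrightarrow> x = u \<or> x = w) \<and>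
      (\<forall>x\<in>V. \<exists>i. x = ((b \<circ> a) ^^ i) u)"
proof -
  define F where "F i = ((b \<circ> a) ^^ i) u" for i :: nat
  define k where "k = (LEAST k. k > 0 \<and> F k = u)"
  have kk: "k > 0 \<and> F k = u"
    unfolding k_def by (rule LeastI_ex) (use per in \<open>auto simp: F_def\<close>)
  have min: "F j \<noteq> u" if "0 < j" "j < k" for j
    using that not_less_Least[of j "\<lambda>k. k > 0 \<and> F k = u"] unfolding k_def by blast
  have F0: "F 0 = u" by (simp add: F_def)
  have FS: "F (Suc i) = b (a (F i))" for i by (simp add: F_def)
  \<comment> \<open>Modulo k, \<open>b\<close> sends the index i to -i and \<open>a\<close> sends it
    to -1 - i.\<close>
  have rev: "b (F i) = F (k - i) \<and> (i < k \<longrightarrow> a (F i) = F (k - Suc i))" if "i \<le> k" for i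
    using that
  proof (induction i)
    case 0
    have "F k = b (a (F (k - 1)))" using kk FS[of "k - 1"] by simp
    then have "a u = F (k - 1)" using kk a b u by metis
    then show ?case using kk u F0 by (simp add: One_nat_def)
  next
    case (Suc i)
    have e1: "b (F (Suc i)) = F (k - Suc i)" using Suc FS[of i] b by simp
    have "a (F (Suc i)) = F (k - Suc (Suc i))" if lt: "Suc i < k"
    proof -
      have "F (k - Suc i) = b (a (F (k - Suc (Suc i))))"
        using FS[of "k - Suc (Suc i)"] lt by (simp add: Suc_diff_Suc)
      then show ?thesis using e1 a b by metis
    qed
    with e1 show ?case by simp
  qed
  have injf: "F i = F j \<Longrightarrow> F (i + d) = F (j + d)" for i j d
    by (induction d) (auto simp: FS)
  have injb: "F (i + d) = F (j + d) \<Longrightarrow> F i = F j" for i j d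
  proof (induction d)
    case (Suc d)
    then have "b (a (F (i + d))) = b (a (F (j + d)))" using FS by simp
    then have "F (i + d) = F (j + d)" using a b by metis
    then show ?case using Suc by simp
  qed simp
  have inj: "i = j" if "F i = F j" "i < k" "j < k" for i j
  proof (rule ccontr)
    assume "i \<noteq> j"
    then consider "i < j" | "j < i" by linarith
    then show False
    proof cases
      case 1
      then have "F 0 = F (j - i)" using injb[of 0 i "j - i"] that by simp
      then show False using min[of "j - i"] F0 1 that by (metis less_imp_diff_less zero_less_diff)
    next
      case 2
      then have "F 0 = F (i - j)" using injb[of 0 j "i - j"] that by simp
      then show False using min[of "i - j"] F0 2 that by (metis less_imp_diff_less zero_less_diff)
    qed
  qed
  define V where "V = F ` {..<k}"
  define m where "m = (if even k then k div 2 else (k - 1) div 2)"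
  have k1: "k \<noteq> 1" using kk FS[of 0] F0 u b by (metis One_nat_def)
  have mk: "m < k" "m \<noteq> 0" using kk k1 by (auto simp: m_def elim!: oddE evenE)
  have FK: "F (k - i) \<in> V" if "i \<le> k" for i
    using that kk F0 by (cases "i = 0") (auto simp: V_def)
  have cl: "a x \<in> V \<and> b x \<in> V" if "x \<in> V" for x
    using that rev FK by (auto simp: V_def)
  have fm: "a (F m) = F m \<or> b (F m) = F m"
  proof (cases "even k")
    case True
    then have "k - m = m" by (auto simp: m_def)
    then show ?thesis using rev[of m] mk by simp
  next
    case False
    then have "k - Suc m = m" by (auto simp: m_def elim!: oddE)
    then show ?thesis using rev[of m] mk by simp
  qed
  have un: "x = u \<or> x = F m" if xV: "x \<in> V" and fx: "a x = x \<or> b x = x" for x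
  proof -
    obtain i where i: "i < k" "x = F i" using xV by (auto simp: V_def)
    show ?thesis
    proof (cases "b x = x")
      case True
      then have eq: "F i = F (k - i)" using rev[of i] i by simp
      show ?thesis
      proof (cases "i = 0")
        case True then show ?thesis using i F0 by simp
      next
        case False
        then have "i = k - i" using inj[OF eq] i by simp
        then have "k = 2 * i" using i by simp
        then have "m = i" by (simp add: m_def)
        then show ?thesis using i by simp
      qed
    next
      case False
      then have "a x = x" using fx by simp
      then have "F i = F (k - Suc i)" using rev[of i] i by simp
      then have "i = k - Suc i" using inj i by simp
      then have "k = 2 * i + 1" using i by simp
      then have "m = i" by (simp add: m_def)
      then show ?thesis using i by simp
    qed
  qed
  have "F m \<noteq> u" using min mk by simp
  moreover have "F m \<in> V" "u \<in> V" using mk F0 kk by (auto simp: V_def)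
  moreover have "\<forall>x\<in>V. \<exists>i. x = ((b \<circ> a) ^^ i) u" by (auto simp: V_def F_def)
  moreover have "finite V" by (simp add: V_def)
  ultimately show ?thesis using fm cl un by blast
qed

section \<open>Matchings and connectivity in the stack of two diagrams\<close>

definition shiftx :: "int \<Rightarrow> int \<times> 'a \<Rightarrow> int \<times> 'a" where
  "shiftx k p = (fst p + k, snd p)"

lemma shiftx_simps [simp]: "shiftx k (x, l) = (x + k, l)" "fst (shiftx k p) = fst p + k"
  "snd (shiftx k p) = snd p" "shiftx 0 p = p" "shiftx j (shiftx k p) = shiftx (k + j) p"
  by (auto simp: shiftx_def algebra_simps)

lemma shiftx_inj [simp]: "shiftx k p = shiftx k q \<longleftrightarrow> p = q"
  by (auto simp: shiftx_def prod_eq_iff)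

text \<open>Planarity is left out on purpose: composition, its associativity and the loop counts are
  established for arbitrary periodic matchings, so planarity of products can be treated
  separately.\<close>

definition good :: "nat \<Rightarrow> diagram \<Rightarrow> bool" where
  "good n D \<longleftrightarrow> (\<forall>p. fst D p \<noteq> p \<and> fst D (fst D p) = p) \<and>
     (\<forall>z p. fst D (shiftx (z * int n) p) = shiftx (z * int n) (fst D p))"

lemma good_periodI:
  assumes "\<And>i r. m (i + int n, r) = (fst (m (i, r)) + int n, snd (m (i, r)))"
  shows "m (shiftx (z * int n) p) = shiftx (z * int n) (m p)"
proof -
  have one: "m (shiftx (int n) p) = shiftx (int n) (m p)" for p
    using assms[of "fst p" "snd p"] by (simp add: shiftx_def)
  have nat: "m (shiftx (int j * int n) p) = shiftx (int j * int n) (m p)" for j p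
  proof (induction j)
    case (Suc j)
    have "shiftx (int (Suc j) * int n) p = shiftx (int n) (shiftx (int j * int n) p)"
      by (simp add: shiftx_def algebra_simps)
    then show ?case using one[of "shiftx (int j * int n) p"] Suc by (simp add: shiftx_def algebra_simps)
  qed simp
  show ?thesis
  proof (cases "z \<ge> 0")
    case True then show ?thesis using nat[of "nat z" p] by simp
  next
    case False
    then have "int (nat (- z)) = - z" by simp
    from nat[of "nat (- z)" "shiftx (z * int n) p", unfolded this]
    have "m p = shiftx (- (z * int n)) (m (shiftx (z * int n) p))"
      by simp
    then have "shiftx (z * int n) (m p) = shiftx (z * int n) (shiftx (- (z * int n)) (m (shiftx (z * int n) p)))"
      by (rule arg_cong)
    then show ?thesis by simp
  qed
qed

lemma good_invol: "good n D \<Longrightarrow> fst D (fst D p) = p"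
  and good_nofix: "good n D \<Longrightarrow> fst D p \<noteq> p"
  and good_shift: "good n D \<Longrightarrow> fst D (shiftx (z * int n) p) = shiftx (z * int n) (fst D p)"
  unfolding good_def by blast+

lemma good_eqD: "good n D \<Longrightarrow> fst D p = q \<Longrightarrow> fst D q = p"
  using good_invol by blast

text \<open>Extended by the identity to the levels that the diagram does not touch. Both maps are
  then involutions of the whole stack, and the outer nodes, where paths end, become their fixed
  points.\<close>

definition actA :: "diagram \<Rightarrow> int \<times> nat \<Rightarrow> int \<times> nat" where
  "actA D u = (if snd u = 2 \<or> snd u = 1 then liftA (fst D (fst u, snd u = 2)) else u)"

definition actB :: "diagram \<Rightarrow> int \<times> nat \<Rightarrow> int \<times> nat" where
  "actB D u = (if snd u = 1 \<or> snd u = 0 then liftB (fst D (fst u, snd u = 1)) else u)"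

lemma actA_lift [simp]: "actA D (liftA p) = liftA (fst D p)"
  by (cases p; cases "snd p") (simp_all add: actA_def liftA_def)

lemma actB_lift [simp]: "actB D (liftB p) = liftB (fst D p)"
  by (cases p; cases "snd p") (simp_all add: actB_def liftB_def)

lemma liftA_inj [simp]: "liftA p = liftA q \<longleftrightarrow> p = q"
  and liftB_inj [simp]: "liftB p = liftB q \<longleftrightarrow> p = q"
  by (auto simp: liftA_def liftB_def prod_eq_iff split: if_splits)

lemma ex_liftA: "snd u = 2 \<or> snd u = 1 \<Longrightarrow> \<exists>p. u = liftA p"
  by (rule exI[of _ "(fst u, snd u = 2)"]) (auto simp: liftA_def prod_eq_iff)

lemma ex_liftB: "snd u = 1 \<or> snd u = 0 \<Longrightarrow> \<exists>p. u = liftB p"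
  by (rule exI[of _ "(fst u, snd u = 1)"]) (auto simp: liftB_def prod_eq_iff)

lemma snd_liftA: "snd (liftA p) = 2 \<or> snd (liftA p) = 1"
  and snd_liftB: "snd (liftB p) = 1 \<or> snd (liftB p) = 0"
  by (auto simp: liftA_def liftB_def)

lemma actA_invol: "good n D \<Longrightarrow> actA D (actA D u) = u"
proof (cases "snd u = 2 \<or> snd u = 1")
  case True
  moreover assume "good n D"
  ultimately show ?thesis using ex_liftA[OF True] by (auto simp: good_invol)
qed (simp add: actA_def)

lemma actB_invol: "good n D \<Longrightarrow> actB D (actB D u) = u"
proof (cases "snd u = 1 \<or> snd u = 0")
  case True
  moreover assume "good n D"
  ultimately show ?thesis using ex_liftB[OF True] by (auto simp: good_invol)
qed (simp add: actB_def)

lemma actA_fix: "good n D \<Longrightarrow> actA D u = u \<longleftrightarrow> \<not> (snd u = 2 \<or> snd u = 1)"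
proof (cases "snd u = 2 \<or> snd u = 1")
  case True
  moreover assume "good n D"
  ultimately show ?thesis using ex_liftA[OF True] by (metis actA_lift liftA_inj good_nofix)
qed (simp add: actA_def)

lemma actB_fix: "good n D \<Longrightarrow> actB D u = u \<longleftrightarrow> \<not> (snd u = 1 \<or> snd u = 0)"
proof (cases "snd u = 1 \<or> snd u = 0")
  case True
  moreover assume "good n D"
  ultimately show ?thesis using ex_liftB[OF True] by (metis actB_lift liftB_inj good_nofix)
qed (simp add: actB_def)

lemma lift_shiftx: "liftA (shiftx k p) = shiftx k (liftA p)" "liftB (shiftx k p) = shiftx k (liftB p)"
  by (auto simp: liftA_def liftB_def shiftx_def)

lemma actA_shift: "good n D \<Longrightarrow> actA D (shiftx (z * int n) u) = shiftx (z * int n) (actA D u)"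
  using good_shift[of n D z "(fst u, snd u = 2)"] by (auto simp: actA_def lift_shiftx)

lemma actB_shift: "good n D \<Longrightarrow> actB D (shiftx (z * int n) u) = shiftx (z * int n) (actB D u)"
  using good_shift[of n D z "(fst u, snd u = 1)"] by (auto simp: actB_def lift_shiftx)

lemma actA_level: "snd u \<le> 2 \<Longrightarrow> snd (actA D u) \<le> 2"
  and actB_level: "snd u \<le> 2 \<Longrightarrow> snd (actB D u) \<le> 2"
  by (auto simp: actA_def actB_def liftA_def liftB_def)

lemma stack_edge_cases:
  "(u, w) \<in> stack_edges A B \<longleftrightarrow>
     (snd u = 2 \<or> snd u = 1) \<and> w = actA A u \<or> (snd u = 1 \<or> snd u = 0) \<and> w = actB B u"
proof
  assume "(u, w) \<in> stack_edges A B"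
  then consider p where "u = liftA p" "w = liftA (fst A p)" | p where "u = liftB p" "w = liftB (fst B p)"
    unfolding stack_edges_def by blast
  then show "(snd u = 2 \<or> snd u = 1) \<and> w = actA A u \<or> (snd u = 1 \<or> snd u = 0) \<and> w = actB B u"
    by cases (simp_all add: snd_liftA snd_liftB)
next
  assume "(snd u = 2 \<or> snd u = 1) \<and> w = actA A u \<or> (snd u = 1 \<or> snd u = 0) \<and> w = actB B u"
  then consider p where "u = liftA p" "w = liftA (fst A p)" | p where "u = liftB p" "w = liftB (fst B p)"
    using ex_liftA[of u] ex_liftB[of u] by (metis actA_lift actB_lift)
  then show "(u, w) \<in> stack_edges A B"
    by cases (auto simp: stack_edges_def)
qed

lemma conn_refl [simp]: "(u, u) \<in> stack_conn A B"
  by (simp add: stack_conn_def)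

lemma conn_trans: "(u, w) \<in> stack_conn A B \<Longrightarrow> (w, x) \<in> stack_conn A B \<Longrightarrow> (u, x) \<in> stack_conn A B"
  by (auto simp: stack_conn_def)

lemma conn_actA: "(u, actA A u) \<in> stack_conn A B"
proof (cases "snd u = 2 \<or> snd u = 1")
  case True then show ?thesis using stack_edge_cases[of u "actA A u" A B] by (auto simp: stack_conn_def)
qed (simp add: actA_def)

lemma conn_actB: "(u, actB B u) \<in> stack_conn A B"
proof (cases "snd u = 1 \<or> snd u = 0")
  case True then show ?thesis using stack_edge_cases[of u "actB B u" A B] by (auto simp: stack_conn_def)
qed (simp add: actB_def)

text \<open>The working induction rule for connectivity: a component is bounded by exhibiting a set
  that is closed under the two edge maps.\<close>

lemma conn_least:
  assumes "(u, w) \<in> stack_conn A B" "u \<in> V"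
    and "\<And>x. x \<in> V \<Longrightarrow> snd x = 2 \<or> snd x = 1 \<Longrightarrow> actA A x \<in> V"
    and "\<And>x. x \<in> V \<Longrightarrow> snd x = 1 \<or> snd x = 0 \<Longrightarrow> actB B x \<in> V"
  shows "w \<in> V"
  using assms(1,2) unfolding stack_conn_def
proof (induction rule: rtrancl_induct)
  case (step y z)
  then show ?case using assms(3,4)[of y] stack_edge_cases[of y z A B] by auto
qed

lemma conn_sym:
  assumes "good n A" "good n B" "(u, w) \<in> stack_conn A B"
  shows "(w, u) \<in> stack_conn A B"
proof -
  have bk: "(actA A x, x) \<in> stack_conn A B" "(actB B x, x) \<in> stack_conn A B" for x
    using conn_actA[of "actA A x" A B] conn_actB[of "actB B x" B A]
    by (simp_all add: actA_invol[OF assms(1)] actB_invol[OF assms(2)])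
  have "w \<in> {w. (w, u) \<in> stack_conn A B}"
    by (rule conn_least[OF assms(3)]) (auto intro: conn_trans[OF bk(1)] conn_trans[OF bk(2)])
  then show ?thesis by simp
qed

lemma conn_shift:
  assumes "good n A" "good n B" "(u, w) \<in> stack_conn A B"
  shows "(shiftx (z * int n) u, shiftx (z * int n) w) \<in> stack_conn A B"
proof -
  have "w \<in> {w. (shiftx (z * int n) u, shiftx (z * int n) w) \<in> stack_conn A B}"
    by (rule conn_least[OF assms(3)])
      (auto simp flip: actA_shift[OF assms(1)] actB_shift[OF assms(2)] intro: conn_trans conn_actA conn_actB)
  then show ?thesis by simp
qed

lemma conn_level: "(u, w) \<in> stack_conn A B \<Longrightarrow> snd u \<le> 2 \<Longrightarrow> snd w \<le> 2"
  using conn_least[of u w A B "{w. snd w \<le> 2}"] actA_level actB_level by auto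

lemma comp_closed:
  assumes "u \<in> comp_set A B x"
  shows "actA A u \<in> comp_set A B x" "actB B u \<in> comp_set A B x"
  using assms conn_trans conn_actA conn_actB by (auto simp: comp_set_def)

text \<open>The two sides of the next lemma are the two reflections of a dihedral group acting on the
  stacked picture; an end of a path cannot be moved by a translation, because reversing the path
  would reverse the translation.\<close>

lemma dihedral_periodic:
  fixes a b :: "int \<times> nat \<Rightarrow> int \<times> nat"
  assumes n: "n > 0" and a: "\<And>x. a (a x) = x" and b: "\<And>x. b (b x) = x"
    and sa: "\<And>z x. a (shiftx (z * int n) x) = shiftx (z * int n) (a x)"
    and sb: "\<And>z x. b (shiftx (z * int n) x) = shiftx (z * int n) (b x)"
    and la: "\<And>x. snd x \<le> 2 \<Longrightarrow> snd (a x) \<le> 2" and lb: "\<And>x. snd x \<le> 2 \<Longrightarrow> snd (b x) \<le> 2"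
    and u: "snd u \<le> 2" "b u = u"
  shows "\<exists>k>0. ((b \<circ> a) ^^ k) u = u"
proof -
  define F where "F i = ((b \<circ> a) ^^ i) u" for i :: nat
  have FS: "F (Suc i) = b (a (F i))" and F0: "F 0 = u" for i by (simp_all add: F_def)
  have lev: "snd (F i) \<le> 2" for i by (induction i) (auto simp: FS F0 u la lb)
  \<comment> \<open>Modulo translation only finitely many nodes are available, so the walk repeats
    up to a translation by z periods.\<close>
  define c where "c i = (fst (F i) mod int n, snd (F i))" for i
  have "range c \<subseteq> {0..<int n} \<times> {..2}" using n lev by (auto simp: c_def)
  then have "finite (range c)" by (rule finite_subset) auto
  then have "\<not> inj c" using finite_imageD[of c UNIV] by auto
  then obtain i d where ne: "c i = c (i + d)" and d: "d > 0"
    by (metis (no_types, lifting) injI le_Suc_ex nat_le_linear add_0_right gr0I)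
  have "\<exists>z. F (i + d) = shiftx (z * int n) (F i)"
  proof -
    have "fst (F i) mod int n = fst (F (i + d)) mod int n" using ne by (simp add: c_def)
    then obtain z where "fst (F (i + d)) - fst (F i) = int n * z"
      by (metis mod_eq_dvd_iff dvdE)
    then show ?thesis using ne by (intro exI[of _ z]) (auto simp: c_def prod_eq_iff algebra_simps)
  qed
  then obtain z where "F (i + d) = shiftx (z * int n) (F i)" by blast
  then have z: "F d = shiftx (z * int n) u"
  proof (induction i)
    case (Suc i)
    then have "b (a (F (i + d))) = b (a (shiftx (z * int n) (F i)))" by (simp add: FS sa sb)
    then show ?case using Suc a b by metis
  qed (simp add: F0)
  have F: "((b \<circ> a) ^^ i) (shiftx (y * int n) u) = shiftx (y * int n) (F i)" for i y
    by (induction i) (auto simp: FS F0 sa sb)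
  \<comment> \<open>Walking on from \<open>b (F i)\<close> retraces the path to its start. At i = d
    this moves u by 2 * z periods and yet returns u, so z = 0.\<close>
  have "((b \<circ> a) ^^ i) (b (F i)) = b u" for i
  proof (induction i)
    case (Suc i)
    have "((b \<circ> a) ^^ Suc i) (b (F (Suc i))) = ((b \<circ> a) ^^ i) (b (a (b (F (Suc i)))))"
      unfolding funpow_Suc_right by simp
    also have "\<dots> = ((b \<circ> a) ^^ i) (b (F i))" using a b FS by simp
    finally show ?case using Suc by (rule trans)
  qed (simp add: F0)
  from this[of d] have "shiftx (z * int n) (shiftx (z * int n) u) = u"
    using z F[of d z] by (simp add: sb u)
  then have "z = 0" using n by (auto simp: shiftx_def prod_eq_iff)
  then show ?thesis using z d by (auto simp: F_def)
qed

text \<open>Outer nodes are the fixed points of the two involutions on levels 0 to 2, so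
  \<open>dihedral_path\<close> describes the component of u. For a start in the bottom row the two
  involutions exchange roles.\<close>

lemma outer_component:
  assumes n: "n > 0" and A: "good n A" and B: "good n B" and u: "outer_node u"
  shows "finite (comp_set A B u)"
    and "\<exists>!w. outer_node w \<and> w \<noteq> u \<and> (u, w) \<in> stack_conn A B"
proof -
  have out: "outer_node x \<longleftrightarrow> snd x \<le> 2 \<and> (actA A x = x \<or> actB B x = x)" for x
    using actA_fix[OF A, of x] actB_fix[OF B, of x] by (auto simp: outer_node_def)
  have ul: "snd u \<le> 2" using u by (auto simp: outer_node_def)
  have main: "finite (comp_set A B u) \<and> (\<exists>!w. outer_node w \<and> w \<noteq> u \<and> (u, w) \<in> stack_conn A B)"
    if ab: "\<And>x. a (a x) = x" "\<And>x. b (b x) = x"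
      "\<And>z x. a (shiftx (z * int n) x) = shiftx (z * int n) (a x)"
      "\<And>z x. b (shiftx (z * int n) x) = shiftx (z * int n) (b x)"
      "\<And>x. snd x \<le> 2 \<Longrightarrow> snd (a x) \<le> 2" "\<And>x. snd x \<le> 2 \<Longrightarrow> snd (b x) \<le> 2"
      "b u = u" "a u \<noteq> u" "{a, b} = {actA A, actB B}" for a b
  proof -
    obtain V w where V: "finite V" "u \<in> V" "w \<in> V" "w \<noteq> u" "a w = w \<or> b w = w"
      "\<forall>x\<in>V. a x \<in> V \<and> b x \<in> V" "\<forall>x\<in>V. a x = x \<or> b x = x \<longrightarrow> x = u \<or> x = w"
      "\<forall>x\<in>V. \<exists>i. x = ((b \<circ> a) ^^ i) u"
      using dihedral_path[OF ab(1,2,7,8) dihedral_periodic[OF n ab(1-6) ul ab(7)]] by blast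
    have ab': "\<And>x. (u, x) \<in> stack_conn A B \<Longrightarrow> (u, a x) \<in> stack_conn A B \<and> (u, b x) \<in> stack_conn A B"
      using ab(9) conn_actA conn_actB conn_trans by (metis doubleton_eq_iff)
    have "(u, ((b \<circ> a) ^^ i) u) \<in> stack_conn A B" for i
      by (induction i) (auto simp: ab')
    then have sub1: "V \<subseteq> comp_set A B u" using V(8) by (auto simp: comp_set_def)
    have "x \<in> V" if "(u, x) \<in> stack_conn A B" for x
      by (rule conn_least[OF that V(2)]) (use V(6) ab(9) in \<open>metis doubleton_eq_iff\<close>)+
    then have eq: "V = comp_set A B u" using sub1 by (auto simp: comp_set_def)
    have abfix: "(a x = x \<or> b x = x) \<longleftrightarrow> (actA A x = x \<or> actB B x = x)" for x
      using ab(9) by (metis doubleton_eq_iff)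
    have "\<exists>!w. outer_node w \<and> w \<noteq> u \<and> (u, w) \<in> stack_conn A B"
    proof (rule ex1I[of _ w])
      show "outer_node w \<and> w \<noteq> u \<and> (u, w) \<in> stack_conn A B"
        using V(3,4,5) eq conn_level ul abfix out by (auto simp: comp_set_def)
    next
      fix y assume "outer_node y \<and> y \<noteq> u \<and> (u, y) \<in> stack_conn A B"
      then have "y \<in> V" "actA A y = y \<or> actB B y = y" "y \<noteq> u"
        using eq out by (auto simp: comp_set_def)
      then show "y = w" using V(7) abfix by blast
    qed
    then show ?thesis using V(1) eq by simp
  qed
  have "finite (comp_set A B u) \<and> (\<exists>!w. outer_node w \<and> w \<noteq> u \<and> (u, w) \<in> stack_conn A B)"
  proof (cases "snd u = 2")
    case True
    show ?thesis
      by (rule main[of "actA A" "actB B"])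
        (use True in \<open>auto simp: actA_invol[OF A] actB_invol[OF B] actA_shift[OF A] actB_shift[OF B]
           actA_level actB_level actA_fix[OF A] actB_fix[OF B]\<close>)
  next
    case False
    then have "snd u = 0" using u by (auto simp: outer_node_def)
    then show ?thesis
      by (intro main[of "actB B" "actA A"])
        (auto simp: actA_invol[OF A] actB_invol[OF B] actA_shift[OF A] actB_shift[OF B]
           actA_level actB_level actA_fix[OF A] actB_fix[OF B])
  qed
  then show "finite (comp_set A B u)" "\<exists>!w. outer_node w \<and> w \<noteq> u \<and> (u, w) \<in> stack_conn A B"
    by blast+
qed

definition onode :: "node \<Rightarrow> int \<times> nat" where
  "onode p = (fst p, if snd p then 2 else 0)"

lemma onode_inj [simp]: "onode p = onode q \<longleftrightarrow> p = q"
  by (auto simp: onode_def prod_eq_iff split: if_splits)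

lemma outer_onode [simp]: "outer_node (onode p)"
  by (auto simp: onode_def outer_node_def)

lemma onode_shiftx: "onode (shiftx k p) = shiftx k (onode p)"
  by (auto simp: onode_def shiftx_def)

lemma outer_eq_onode: "outer_node w \<Longrightarrow> \<exists>p. w = onode p"
  by (rule exI[of _ "(fst w, snd w = 2)"]) (auto simp: onode_def outer_node_def prod_eq_iff)

lemma comp_match_eqI:
  assumes "n > 0" "good n A" "good n B" "(onode p, onode q) \<in> stack_conn A B" "q \<noteq> p"
  shows "comp_match A B p = q"
proof -
  have "(THE w. outer_node w \<and> w \<noteq> onode p \<and> (onode p, w) \<in> stack_conn A B) = onode q"
    by (rule the1_equality[OF outer_component(2)[OF assms(1-3)]]) (use assms in auto)
  then show ?thesis by (auto simp: comp_match_def Let_def onode_def[symmetric]) (auto simp: onode_def prod_eq_iff)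
qed

lemma comp_match_conn:
  assumes "n > 0" "good n A" "good n B"
  shows "(onode p, onode (comp_match A B p)) \<in> stack_conn A B" "comp_match A B p \<noteq> p"
proof -
  obtain q where "(onode p, onode q) \<in> stack_conn A B" "q \<noteq> p"
    using outer_component(2)[OF assms, of "onode p"] outer_eq_onode by (metis outer_onode)
  then show "(onode p, onode (comp_match A B p)) \<in> stack_conn A B" "comp_match A B p \<noteq> p"
    using comp_match_eqI[OF assms] by auto
qed

lemma conn_onode:
  assumes "n > 0" "good n A" "good n B" "(onode p, onode q) \<in> stack_conn A B"
  shows "q = p \<or> q = comp_match A B p"
  using comp_match_eqI[OF assms] by auto

lemma good_comp:
  assumes "n > 0" "good n A" "good n B"
  shows "good n (diag_comp n A B)"
proof -
  note C = comp_match_conn[OF assms]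
  have "comp_match A B (comp_match A B p) = p" for p
    using comp_match_eqI[OF assms conn_sym[OF assms(2,3) C(1)] C(2)[symmetric]] .
  moreover have "comp_match A B (shiftx (z * int n) p) = shiftx (z * int n) (comp_match A B p)" for z p
    by (rule comp_match_eqI[OF assms])
      (use conn_shift[OF assms(2,3) C(1)] C(2) in \<open>auto simp: onode_shiftx\<close>)
  ultimately show ?thesis using C(2) by (auto simp: good_def diag_comp_def)
qed

section \<open>Counting closed components up to translation\<close>

lemma card_image_eqI:
  assumes "\<And>x. x \<in> S \<Longrightarrow> h x \<in> T" "\<And>x y. x \<in> S \<Longrightarrow> y \<in> S \<Longrightarrow> f x = f y \<longleftrightarrow> g (h x) = g (h y)"
    and "\<And>y. y \<in> T \<Longrightarrow> \<exists>x\<in>S. g (h x) = g y"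
  shows "card (f ` S) = card (g ` T)"
proof (rule bij_betw_same_card)
  \<comment> \<open>Elements stand for classes here: the class of x goes to the class of
    \<open>h x\<close>, whichever representative is chosen, and only classes of T have to be
    hit.\<close>
  let ?k = "\<lambda>c. g (h (SOME x. x \<in> S \<and> f x = c))"
  have k: "?k (f x) = g (h x)" if "x \<in> S" for x
  proof -
    have "(SOME y. y \<in> S \<and> f y = f x) \<in> S \<and> f (SOME y. y \<in> S \<and> f y = f x) = f x"
      by (rule someI[of _ x]) (use that in auto)
    then show ?thesis using assms(2) that by blast
  qed
  show "bij_betw ?k (f ` S) (g ` T)"
    unfolding bij_betw_def
  proof
    show "inj_on ?k (f ` S)"
    proof (rule inj_onI)
      fix c d assume "c \<in> f ` S" "d \<in> f ` S" and e: "?k c = ?k d"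
      then obtain x y where xy: "x \<in> S" "y \<in> S" "c = f x" "d = f y" by blast
      then have "g (h x) = g (h y)" using e k by metis
      then show "c = d" using assms(2) xy by blast
    qed
    show "?k ` f ` S = g ` T"
    proof
      show "?k ` f ` S \<subseteq> g ` T"
      proof
        fix c assume "c \<in> ?k ` f ` S"
        then obtain x where "x \<in> S" "c = ?k (f x)" by blast
        then show "c \<in> g ` T" using k[of x] assms(1)[of x] by auto
      qed
      show "g ` T \<subseteq> ?k ` f ` S"
      proof
        fix c assume "c \<in> g ` T"
        then obtain x where "x \<in> S" "c = g (h x)" using assms(3) by (metis imageE)
        then have "c = ?k (f x)" "f x \<in> f ` S" using k[of x] by auto
        then show "c \<in> ?k ` f ` S" by (rule image_eqI)
      qed
    qed
  qed
qed

definition mid_nodes :: "diagram \<Rightarrow> diagram \<Rightarrow> bool \<Rightarrow> (int \<times> nat) set" where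
  "mid_nodes A B Q = {u. closed_mid A B u \<and> (finite (comp_set A B u) \<longleftrightarrow> Q)}"

text \<open>The flag covers both counts at once: finite closed components are loops, infinite ones
  are new horizontal lines. Every counting fact is then proved for both together.\<close>

definition num_comps :: "nat \<Rightarrow> diagram \<Rightarrow> diagram \<Rightarrow> bool \<Rightarrow> nat" where
  "num_comps n A B Q = card (comp_orbit n A B ` mid_nodes A B Q)"

lemma num_loops_conv: "num_loops n A B = num_comps n A B True"
  and num_new_lines_conv: "num_new_lines n A B = num_comps n A B False"
  by (auto simp: num_loops_def num_new_lines_def num_comps_def mid_nodes_def intro!: arg_cong[of _ _ card])

lemma comp_set_eqI:
  assumes "good n A" "good n B" "(u, w) \<in> stack_conn A B"
  shows "comp_set A B u = comp_set A B w"
  using assms conn_sym[OF assms] by (auto simp: comp_set_def intro: conn_trans)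

lemma comp_orbit_alt: "comp_orbit n A B u = {comp_set A B (shiftx (z * int n) u) | z. True}"
  by (simp add: comp_orbit_def shiftx_def)

lemma comp_orbit_eq_iff:
  assumes "good n A" "good n B"
  shows "comp_orbit n A B u = comp_orbit n A B w \<longleftrightarrow> (\<exists>z. (u, shiftx (z * int n) w) \<in> stack_conn A B)"
proof
  assume eq: "comp_orbit n A B u = comp_orbit n A B w"
  have "comp_set A B u \<in> comp_orbit n A B u"
    unfolding comp_orbit_alt by (auto intro!: exI[of _ 0])
  then obtain z where "comp_set A B u = comp_set A B (shiftx (z * int n) w)"
    unfolding eq unfolding comp_orbit_alt by blast
  moreover have "shiftx (z * int n) w \<in> comp_set A B (shiftx (z * int n) w)" by (simp add: comp_set_def)
  ultimately have "shiftx (z * int n) w \<in> comp_set A B u" by simp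
  then show "\<exists>z. (u, shiftx (z * int n) w) \<in> stack_conn A B" by (auto simp: comp_set_def)
next
  have sub: "comp_orbit n A B u \<subseteq> comp_orbit n A B w"
    if zz: "(u, shiftx (z * int n) w) \<in> stack_conn A B" for u w z
  proof
    fix c assume "c \<in> comp_orbit n A B u"
    then obtain y where "c = comp_set A B (shiftx (y * int n) u)" unfolding comp_orbit_alt by blast
    also have "\<dots> = comp_set A B (shiftx (y * int n) (shiftx (z * int n) w))"
      by (rule comp_set_eqI[OF assms conn_shift[OF assms zz]])
    also have "\<dots> = comp_set A B (shiftx ((y + z) * int n) w)" by (simp add: algebra_simps)
    finally show "c \<in> comp_orbit n A B w" unfolding comp_orbit_alt by blast
  qed
  assume "\<exists>z. (u, shiftx (z * int n) w) \<in> stack_conn A B"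
  then obtain z where z: "(u, shiftx (z * int n) w) \<in> stack_conn A B" by blast
  from conn_shift[OF assms conn_sym[OF assms z], of "- z"]
  have "(w, shiftx (- z * int n) u) \<in> stack_conn A B" by simp
  then show "comp_orbit n A B u = comp_orbit n A B w" using sub z by blast
qed

section \<open>Dependence on the adjacent halves\<close>

text \<open>A fixed point marks the end of a vertical edge. This makes a half an involution of the
  integers and forgets only where the vertical edges lead.\<close>

definition half :: "bool \<Rightarrow> diagram \<Rightarrow> int \<Rightarrow> int" where
  "half r D x = (if snd (fst D (x, r)) = r then fst (fst D (x, r)) else x)"

lemma half_halfI: "good n D \<Longrightarrow> half r D = half r D' \<Longrightarrow> good n D' \<Longrightarrow>
    snd (fst D (x, r)) = r \<Longrightarrow> fst D' (x, r) = fst D (x, r)"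
proof -
  assume *: "good n D" "half r D = half r D'" "good n D'" "snd (fst D (x, r)) = r"
  have "half r D x = fst (fst D (x, r))" using *(4) by (simp add: half_def)
  moreover have "fst (fst D (x, r)) \<noteq> x" using good_nofix[OF *(1), of "(x, r)"] *(4) by (auto simp: prod_eq_iff)
  moreover have "half r D x = half r D' x" using *(2) by simp
  ultimately have "snd (fst D' (x, r)) = r" "fst (fst D' (x, r)) = fst (fst D (x, r))"
    unfolding half_def by (metis, metis)
  then show "fst D' (x, r) = fst D (x, r)" using *(4) by (simp add: prod_eq_iff)
qed

lemma closed_mid_level:
  assumes "closed_mid A B u" "(u, x) \<in> stack_conn A B"
  shows "snd x = 1"
proof -
  have "snd x \<le> 2" using conn_level[OF assms(2)] assms(1) by (simp add: closed_mid_def)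
  moreover have "snd x \<noteq> 0" "snd x \<noteq> 2" using assms by (auto simp: closed_mid_def outer_node_def)
  ultimately show ?thesis by linarith
qed

text \<open>A closed component never leaves the middle row, so it uses only edges lying within the
  bottom row of A or the top row of B, and these are recorded by the two halves.\<close>

lemma closed_mid_halves:
  assumes g: "good n A" "good n B" "good n A'" "good n B'"
    and h: "half False A = half False A'" "half True B = half True B'"
    and u: "closed_mid A B u"
  shows "comp_set A' B' u \<subseteq> comp_set A B u \<and> closed_mid A' B' u"
proof -
  have lev: "snd x = 1" if "x \<in> comp_set A B u" for x
    using closed_mid_level[OF u] that by (simp add: comp_set_def)
  have clA: "actA A' x \<in> comp_set A B u" if x: "x \<in> comp_set A B u" for x
  proof -
    have "snd (actA A x) = 1" "snd x = 1" using lev comp_closed x by blast+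
    then have "snd (fst A (fst x, False)) = False" by (auto simp: actA_def liftA_def split: if_splits)
    then have "fst A' (fst x, False) = fst A (fst x, False)" using half_halfI[OF g(1) h(1) g(3)] by simp
    then have "actA A' x = actA A x" using \<open>snd x = 1\<close> by (simp add: actA_def)
    then show ?thesis using comp_closed(1)[OF x] by simp
  qed
  have clB: "actB B' x \<in> comp_set A B u" if x: "x \<in> comp_set A B u" for x
  proof -
    have "snd (actB B x) = 1" "snd x = 1" using lev comp_closed x by blast+
    then have "snd (fst B (fst x, True)) = True" by (auto simp: actB_def liftB_def split: if_splits)
    then have "fst B' (fst x, True) = fst B (fst x, True)" using half_halfI[OF g(2) h(2) g(4)] by simp
    then have "actB B' x = actB B x" using \<open>snd x = 1\<close> by (simp add: actB_def)
    then show ?thesis using comp_closed(2)[OF x] by simp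
  qed
  have sub: "comp_set A' B' u \<subseteq> comp_set A B u"
  proof
    fix w assume "w \<in> comp_set A' B' u"
    then have "(u, w) \<in> stack_conn A' B'" by (simp add: comp_set_def)
    then show "w \<in> comp_set A B u"
      by (rule conn_least) (use clA clB in \<open>auto simp: comp_set_def\<close>)
  qed
  moreover have "closed_mid A' B' u"
    using u sub lev by (fastforce simp: closed_mid_def comp_set_def outer_node_def)
  ultimately show ?thesis by blast
qed

text \<open>Rotating a factor changes none of its halves; this is why loop numbers will be
  insensitive to rotations.\<close>

lemma num_comps_halves:
  assumes g: "good n A" "good n B" "good n A'" "good n B'"
    and h: "half False A = half False A'" "half True B = half True B'"
  shows "num_comps n A B Q = num_comps n A' B' Q"
proof -
  note L = closed_mid_halves[OF g h] and R = closed_mid_halves[OF g(3,4,1,2) h[symmetric]]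
  have eq: "comp_set A B u = comp_set A' B' u" if "closed_mid A B u" for u
    using L R that by blast
  have cm: "closed_mid A B u \<longleftrightarrow> closed_mid A' B' u" for u using L R by blast
  have "mid_nodes A B Q = mid_nodes A' B' Q" using eq cm by (auto simp: mid_nodes_def)
  moreover have "comp_orbit n A B u = comp_orbit n A B w \<longleftrightarrow> comp_orbit n A' B' u = comp_orbit n A' B' w"
    if "closed_mid A B u" for u w
    using eq[OF that] unfolding comp_orbit_eq_iff[OF g(1,2)] comp_orbit_eq_iff[OF g(3,4)]
    by (auto simp: comp_set_def)
  ultimately show ?thesis unfolding num_comps_def
    by (intro card_image_eqI[where h = "\<lambda>x. x"]) (unfold mid_nodes_def, blast+)
qed

section \<open>Reflection in a horizontal line\<close>

definition flipn :: "node \<Rightarrow> node" where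
  "flipn p = (fst p, \<not> snd p)"

text \<open>An anti-automorphism that fixes the generators. Facts about one factor of a product are
  carried over to the other factor by it.\<close>

definition flipd :: "diagram \<Rightarrow> diagram" where
  "flipd D = (flipn \<circ> fst D \<circ> flipn, snd D)"

definition flipl :: "nat \<Rightarrow> int \<times> nat \<Rightarrow> int \<times> nat" where
  "flipl k u = (fst u, k - snd u)"

lemma flipn_simps [simp]: "flipn (flipn p) = p" "flipn (x, r) = (x, \<not> r)" "fst (flipn p) = fst p"
  "snd (flipn p) = (\<not> snd p)" "flipn (shiftx k p) = shiftx k (flipn p)"
  by (auto simp: flipn_def shiftx_def)

lemma flipd_simps [simp]: "flipd (flipd D) = D" "fst (flipd D) p = flipn (fst D (flipn p))"
  "snd (flipd D) = snd D"
  by (auto simp: flipd_def o_def)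

lemma good_flipd [simp]: "good n (flipd D) \<longleftrightarrow> good n D"
proof -
  have "good n (flipd D)" if g: "good n D" for D
    unfolding good_def
  proof (intro conjI allI)
    fix p z
    show "fst (flipd D) p \<noteq> p" using good_nofix[OF g, of "flipn p"] by (metis flipd_simps(2) flipn_simps(1))
    show "fst (flipd D) (fst (flipd D) p) = p" by (simp add: good_invol[OF g])
    show "fst (flipd D) (shiftx (z * int n) p) = shiftx (z * int n) (fst (flipd D) p)"
      by (simp add: good_shift[OF g])
  qed
  then show ?thesis using flipd_simps(1) by metis
qed

lemma flipl_simps [simp]: "fst (flipl k u) = fst u" "snd (flipl k u) = k - snd u"
  "snd u \<le> k \<Longrightarrow> flipl k (flipl k u) = u" "flipl k (shiftx z u) = shiftx z (flipl k u)"
  by (auto simp: flipl_def shiftx_def prod_eq_iff)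

lemma flipl_lift: "flipl 2 (liftA p) = liftB (flipn p)" "flipl 2 (liftB p) = liftA (flipn p)"
  "flipl 2 (onode p) = onode (flipn p)"
  by (auto simp: flipl_def liftA_def liftB_def flipn_def onode_def)

lemma actA_flip: "snd u \<le> 2 \<Longrightarrow> actA (flipd D) (flipl 2 u) = flipl 2 (actB D u)"
proof (cases "snd u = 1 \<or> snd u = 0")
  case True
  then obtain p where "u = liftB p" using ex_liftB by blast
  then show ?thesis by (simp add: flipl_lift)
qed (auto simp: actA_def actB_def)

lemma actB_flip: "snd u \<le> 2 \<Longrightarrow> actB (flipd D) (flipl 2 u) = flipl 2 (actA D u)"
proof (cases "snd u = 2 \<or> snd u = 1")
  case True
  then obtain p where "u = liftA p" using ex_liftA by blast
  then show ?thesis by (simp add: flipl_lift)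
qed (auto simp: actA_def actB_def)

lemma conn_flip:
  assumes "snd u \<le> 2" "(u, w) \<in> stack_conn A B"
  shows "(flipl 2 u, flipl 2 w) \<in> stack_conn (flipd B) (flipd A)"
proof -
  have "w \<in> {w. snd w \<le> 2 \<and> (flipl 2 u, flipl 2 w) \<in> stack_conn (flipd B) (flipd A)}"
  proof (rule conn_least[OF assms(2)])
    fix x assume x: "x \<in> {w. snd w \<le> 2 \<and> (flipl 2 u, flipl 2 w) \<in> stack_conn (flipd B) (flipd A)}"
    then show "actA A x \<in> {w. snd w \<le> 2 \<and> (flipl 2 u, flipl 2 w) \<in> stack_conn (flipd B) (flipd A)}"
      using conn_trans[OF _ conn_actB[of "flipl 2 x" "flipd A" "flipd B"]] actA_level by (auto simp: actB_flip)
    from x show "actB B x \<in> {w. snd w \<le> 2 \<and> (flipl 2 u, flipl 2 w) \<in> stack_conn (flipd B) (flipd A)}"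
      using conn_trans[OF _ conn_actA[of "flipl 2 x" "flipd B" "flipd A"]] actB_level by (auto simp: actA_flip)
  qed (use assms(1) in auto)
  then show ?thesis by simp
qed

lemma conn_flip_iff:
  assumes "snd u \<le> 2" "snd w \<le> 2"
  shows "(flipl 2 u, flipl 2 w) \<in> stack_conn (flipd B) (flipd A) \<longleftrightarrow> (u, w) \<in> stack_conn A B"
  using conn_flip[of u w A B] conn_flip[of "flipl 2 u" "flipl 2 w" "flipd B" "flipd A"] assms by auto

lemma comp_match_flip:
  assumes "n > 0" "good n A" "good n B"
  shows "comp_match (flipd B) (flipd A) p = flipn (comp_match A B (flipn p))"
proof (rule comp_match_eqI[OF assms(1)])
  note C = comp_match_conn[OF assms, of "flipn p"]
  show "(onode p, onode (flipn (comp_match A B (flipn p)))) \<in> stack_conn (flipd B) (flipd A)"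
    using conn_flip[OF _ C(1)] by (simp add: flipl_lift) (simp add: onode_def)
  show "flipn (comp_match A B (flipn p)) \<noteq> p" using C(2) by (metis flipn_simps(1))
qed (use assms in auto)

lemma num_comps_flip:
  assumes g: "good n A" "good n B"
  shows "num_comps n (flipd B) (flipd A) Q = num_comps n A B Q"
proof -
  have fl1: "flipl 2 u = u" if "snd u = 1" for u
    using that by (auto simp: prod_eq_iff)
  have cm: "closed_mid (flipd B) (flipd A) u" if "closed_mid A B u" for A B u
  proof -
    have "\<not> outer_node w" if "(u, w) \<in> stack_conn (flipd B) (flipd A)" for w
    proof
      assume ow: "outer_node w"
      have "snd u = 1" using \<open>closed_mid A B u\<close> by (simp add: closed_mid_def)
      then have "(u, flipl 2 w) \<in> stack_conn A B" using conn_flip[OF _ that] fl1 by simp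
      moreover have "outer_node (flipl 2 w)" using ow by (auto simp: outer_node_def)
      ultimately show False using \<open>closed_mid A B u\<close> by (auto simp: closed_mid_def)
    qed
    then show ?thesis using that by (auto simp: closed_mid_def)
  qed
  have fin: "finite (comp_set (flipd B) (flipd A) u)" if "finite (comp_set A B u)" "closed_mid A B u" for A B u
  proof (rule finite_surj[OF that(1), of _ "flipl 2"], rule)
    fix w assume "w \<in> comp_set (flipd B) (flipd A) u"
    then have w: "(u, w) \<in> stack_conn (flipd B) (flipd A)" by (simp add: comp_set_def)
    have u: "snd u = 1" using that(2) by (simp add: closed_mid_def)
    have "snd w \<le> 2" using conn_level[OF w] u by simp
    moreover have "(u, flipl 2 w) \<in> stack_conn A B" using conn_flip[OF _ w] u fl1 by simp
    ultimately show "w \<in> flipl 2 ` comp_set A B u" by (auto simp: comp_set_def intro!: image_eqI[of _ _ "flipl 2 w"])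
  qed
  have mn: "mid_nodes (flipd B) (flipd A) Q = mid_nodes A B Q"
    using cm[of A B] cm[of "flipd B" "flipd A"] fin[of A B] fin[of "flipd B" "flipd A"]
    by (auto simp: mid_nodes_def)
  have "comp_orbit n (flipd B) (flipd A) u = comp_orbit n (flipd B) (flipd A) w \<longleftrightarrow> comp_orbit n A B u = comp_orbit n A B w"
    if "snd u = 1" "snd w = 1" for u w
    using conn_flip_iff[of u "shiftx z w" B A for z] that fl1
    by (auto simp: comp_orbit_eq_iff g)
  then show ?thesis unfolding num_comps_def mn
    by (intro card_image_eqI[where h = "\<lambda>x. x"]) (auto simp: mid_nodes_def closed_mid_def)
qed

section \<open>Stacks of three diagrams\<close>

definition up :: "int \<times> nat \<Rightarrow> int \<times> nat" where
  "up u = (fst u, snd u + 1)"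

definition dn :: "int \<times> nat \<Rightarrow> int \<times> nat" where
  "dn u = (fst u, snd u - 1)"

lemma up_simps [simp]: "dn (up u) = u" "fst (up u) = fst u" "snd (up u) = snd u + 1"
  "snd u \<ge> 1 \<Longrightarrow> up (dn u) = u" "up u = up w \<longleftrightarrow> u = w" "up (shiftx z u) = shiftx z (up u)"
  by (auto simp: up_def dn_def prod_eq_iff shiftx_def)

text \<open>In the stack of three, A joins levels 3 and 2, B joins 2 and 1, C joins 1 and 0. The
  guard keeps level 0 in place; truncated subtraction followed by \<open>up\<close> would move it to
  level 1.\<close>

definition a4 :: "diagram \<Rightarrow> int \<times> nat \<Rightarrow> int \<times> nat" where
  "a4 A u = (if snd u \<ge> 1 then up (actA A (dn u)) else u)"

definition b4 :: "diagram \<Rightarrow> int \<times> nat \<Rightarrow> int \<times> nat" where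
  "b4 B u = (if snd u \<ge> 1 then up (actB B (dn u)) else u)"

definition conn4 :: "diagram \<Rightarrow> diagram \<Rightarrow> diagram \<Rightarrow> ((int \<times> nat) \<times> (int \<times> nat)) set" where
  "conn4 A B C = ({(u, a4 A u) | u. True} \<union> {(u, b4 B u) | u. True} \<union> {(u, actB C u) | u. True})\<^sup>*"

lemma ab4_up [simp]: "a4 A (up u) = up (actA A u)" "b4 B (up u) = up (actB B u)"
  by (auto simp: a4_def b4_def)

lemma conn4_refl [simp]: "(u, u) \<in> conn4 A B C"
  by (simp add: conn4_def)

lemma conn4_trans: "(u, w) \<in> conn4 A B C \<Longrightarrow> (w, x) \<in> conn4 A B C \<Longrightarrow> (u, x) \<in> conn4 A B C"
  by (auto simp: conn4_def)

lemma conn4_steps: "(u, a4 A u) \<in> conn4 A B C" "(u, b4 B u) \<in> conn4 A B C" "(u, actB C u) \<in> conn4 A B C"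
  unfolding conn4_def by (rule r_into_rtrancl, blast)+

lemma conn4_least:
  assumes "(u, w) \<in> conn4 A B C" "u \<in> V"
    and "\<And>x. x \<in> V \<Longrightarrow> a4 A x \<in> V" "\<And>x. x \<in> V \<Longrightarrow> b4 B x \<in> V" "\<And>x. x \<in> V \<Longrightarrow> actB C x \<in> V"
  shows "w \<in> V"
  using assms(1,2) unfolding conn4_def
  by (induction rule: rtrancl_induct) (use assms(3,4,5) in auto)

lemma a4_level: "snd u \<le> 3 \<Longrightarrow> snd (a4 A u) \<le> 3"
  and b4_level: "snd u \<le> 3 \<Longrightarrow> snd (b4 A u) \<le> 3"
  and c4_level: "snd u \<le> 3 \<Longrightarrow> snd (actB A u) \<le> 3"
  using actA_level[of "dn u" A] actB_level[of "dn u" A] actB_level[of u A]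
  by (auto simp: a4_def b4_def dn_def) (auto simp: actB_def liftB_def)

lemma conn4_level: "(u, w) \<in> conn4 A B C \<Longrightarrow> snd u \<le> 3 \<Longrightarrow> snd w \<le> 3"
  using conn4_least[of u w A B C "{w. snd w \<le> 3}"] a4_level b4_level c4_level by auto

lemma conn4_sym:
  assumes "good n A" "good n B" "good n C" "(u, w) \<in> conn4 A B C"
  shows "(w, u) \<in> conn4 A B C"
proof -
  have "snd (actA A (dn x)) \<ge> 0" for x by simp
  have inv: "a4 A (a4 A x) = x" "b4 B (b4 B x) = x" "actB C (actB C x) = x" for x
    using actA_invol[OF assms(1)] actB_invol[OF assms(2)] actB_invol[OF assms(3)]
    by (auto simp: a4_def b4_def)
  have bk: "(a4 A x, x) \<in> conn4 A B C" "(b4 B x, x) \<in> conn4 A B C" "(actB C x, x) \<in> conn4 A B C" for x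
    using conn4_steps(1)[of "a4 A x" A B C] conn4_steps(2)[of "b4 B x" B A C]
      conn4_steps(3)[of "actB C x" C A B] inv by simp_all
  have "w \<in> {w. (w, u) \<in> conn4 A B C}"
    by (rule conn4_least[OF assms(4)]) (auto intro: conn4_trans[OF bk(1)] conn4_trans[OF bk(2)] conn4_trans[OF bk(3)])
  then show ?thesis by simp
qed

lemma conn4_shift:
  assumes "good n A" "good n B" "good n C" "(u, w) \<in> conn4 A B C"
  shows "(shiftx (z * int n) u, shiftx (z * int n) w) \<in> conn4 A B C"
proof -
  have dn: "dn (shiftx k x) = shiftx k (dn x)" for k x by (simp add: dn_def shiftx_def)
  have s: "a4 A (shiftx (z * int n) x) = shiftx (z * int n) (a4 A x)"
    "b4 B (shiftx (z * int n) x) = shiftx (z * int n) (b4 B x)"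
    "actB C (shiftx (z * int n) x) = shiftx (z * int n) (actB C x)" for x
    by (simp_all add: a4_def b4_def dn actA_shift[OF assms(1)] actB_shift[OF assms(2)] actB_shift[OF assms(3)])
  have "w \<in> {w. (shiftx (z * int n) u, shiftx (z * int n) w) \<in> conn4 A B C}"
    by (rule conn4_least[OF assms(4)])
      (auto simp flip: s intro: conn4_trans[OF _ conn4_steps(1)] conn4_trans[OF _ conn4_steps(2)] conn4_trans[OF _ conn4_steps(3)])
  then show ?thesis by simp
qed

lemma conn_up: "(u, w) \<in> stack_conn A B \<Longrightarrow> (up u, up w) \<in> conn4 A B C"
proof -
  assume "(u, w) \<in> stack_conn A B"
  then have "w \<in> {w. (up u, up w) \<in> conn4 A B C}"
    by (rule conn_least) (auto simp flip: ab4_up intro: conn4_trans[OF _ conn4_steps(1)] conn4_trans[OF _ conn4_steps(2)])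
  then show ?thesis by simp
qed

text \<open>Places the stack of AB over C inside the stack of three: its top row becomes level 3,
  and level 2, the seam between A and B, stays invisible.\<close>

definition j1 :: "int \<times> nat \<Rightarrow> int \<times> nat" where
  "j1 u = (fst u, if snd u = 2 then 3 else snd u)"

lemma j1_liftA: "j1 (liftA p) = up (onode p)"
  by (auto simp: j1_def liftA_def up_def onode_def)

lemma j1_id: "snd u \<noteq> 2 \<Longrightarrow> j1 u = u"
  by (auto simp: j1_def)

lemma j1_inj: "snd u \<le> 2 \<Longrightarrow> snd w \<le> 2 \<Longrightarrow> j1 u = j1 w \<Longrightarrow> u = w"
  by (auto simp: j1_def prod_eq_iff split: if_splits)

definition stack_comp :: "diagram \<Rightarrow> diagram \<Rightarrow> diagram \<Rightarrow> int \<times> nat \<Rightarrow> (int \<times> nat) set" where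
  "stack_comp A B C u = {w. (u, w) \<in> conn4 A B C}"

definition stack_orbit :: "nat \<Rightarrow> diagram \<Rightarrow> diagram \<Rightarrow> diagram \<Rightarrow> int \<times> nat \<Rightarrow> (int \<times> nat) set set" where
  "stack_orbit n A B C u = {stack_comp A B C (shiftx (z * int n) u) | z. True}"

definition stack_nodes :: "diagram \<Rightarrow> diagram \<Rightarrow> diagram \<Rightarrow> bool \<Rightarrow> (int \<times> nat) set" where
  "stack_nodes A B C Q = {u. snd u \<in> {1, 2} \<and>
     (\<forall>w\<in>stack_comp A B C u. snd w \<noteq> 0 \<and> snd w \<noteq> 3) \<and> (finite (stack_comp A B C u) \<longleftrightarrow> Q)}"

context
  fixes n :: nat and A B C :: diagram
  assumes n: "n > 0" and gA: "good n A" and gB: "good n B" and gC: "good n C"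
begin

abbreviation (input) "AB \<equiv> diag_comp n A B"

lemma fst_AB: "fst AB = comp_match A B"
  by (simp add: diag_comp_def)

lemma conn_j1:
  assumes "snd u \<le> 2" "(u, w) \<in> stack_conn AB C"
  shows "(j1 u, j1 w) \<in> conn4 A B C"
proof -
  have "w \<in> {w. snd w \<le> 2 \<and> (j1 u, j1 w) \<in> conn4 A B C}"
  proof (rule conn_least[OF assms(2)])
    fix x assume x: "x \<in> {w. snd w \<le> 2 \<and> (j1 u, j1 w) \<in> conn4 A B C}"
    show "actA AB x \<in> {w. snd w \<le> 2 \<and> (j1 u, j1 w) \<in> conn4 A B C}" if lev: "snd x = 2 \<or> snd x = 1"
    proof -
      obtain p where p: "x = liftA p" using ex_liftA lev by blast
      have "(up (onode p), up (onode (comp_match A B p))) \<in> conn4 A B C"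
        by (rule conn_up[OF comp_match_conn(1)[OF n gA gB]])
      then have "(j1 x, j1 (actA AB x)) \<in> conn4 A B C" by (simp add: p fst_AB j1_liftA)
      then show ?thesis using x actA_level[of x] conn4_trans[of "j1 u" "j1 x"] by blast
    qed
    show "actB C x \<in> {w. snd w \<le> 2 \<and> (j1 u, j1 w) \<in> conn4 A B C}" if lev: "snd x = 1 \<or> snd x = 0"
    proof -
      have "snd (actB C x) \<noteq> 2" using lev by (auto simp: actB_def liftB_def)
      then have "j1 x = x" "j1 (actB C x) = actB C x" using lev by (auto simp: j1_id)
      then show ?thesis using x actB_level conn4_trans[OF _ conn4_steps(3)] by auto
    qed
  qed (use assms in auto)
  then show ?thesis by simp
qed

text \<open>A walk in the stack of three is either at a visible node or inside A over B, on the path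
  entered from the visible node p. When C can act on such a hidden walk, it has reached an end of
  that path, hence p or its partner under AB, and the walk becomes visible again.\<close>

lemma conn4_j1_cases:
  assumes u: "snd u \<le> 2" and c: "(j1 u, x) \<in> conn4 A B C"
  shows "\<exists>u'. (u, u') \<in> stack_conn AB C \<and>
      (x = j1 u' \<or> (\<exists>p y. u' = liftA p \<and> x = up y \<and> (onode p, y) \<in> stack_conn A B))"
proof -
  define V where "V = {x. \<exists>u'. (u, u') \<in> stack_conn AB C \<and>
      (x = j1 u' \<or> (\<exists>p y. u' = liftA p \<and> x = up y \<and> (onode p, y) \<in> stack_conn A B))}"
  have V1: "j1 u' \<in> V" if "(u, u') \<in> stack_conn AB C" for u' using that by (auto simp: V_def)
  have V2: "up y \<in> V" if "(u, liftA p) \<in> stack_conn AB C" "(onode p, y) \<in> stack_conn A B" for p y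
    using that by (auto simp: V_def)
  have form: "(\<exists>p y. (u, liftA p) \<in> stack_conn AB C \<and> x = up y \<and> (onode p, y) \<in> stack_conn A B) \<or>
      ((u, x) \<in> stack_conn AB C \<and> snd x = 0)" if xV: "x \<in> V" for x
  proof -
    obtain u' where u': "(u, u') \<in> stack_conn AB C"
      "x = j1 u' \<or> (\<exists>p y. u' = liftA p \<and> x = up y \<and> (onode p, y) \<in> stack_conn A B)"
      using xV by (auto simp: V_def)
    show ?thesis
    proof (cases "x = j1 u'")
      case True
      show ?thesis
      proof (cases "snd u' = 0")
        case False
        have "snd u' \<le> 2" using conn_level[OF u'(1)] u by simp
        with False have "snd u' = 2 \<or> snd u' = 1" by linarith
        then obtain p where "u' = liftA p" using ex_liftA by blast
        then show ?thesis using u' True j1_liftA by (intro disjI1 exI[of _ p] exI[of _ "onode p"]) auto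
      qed (use True u' j1_id in auto)
    qed (use u' in blast)
  qed
  have "x \<in> V"
  proof (rule conn4_least[OF c])
    show "j1 u \<in> V" by (rule V1) simp
  next
    fix x assume "x \<in> V"
    from form[OF this] have "a4 A x \<in> V \<and> b4 B x \<in> V \<and> actB C x \<in> V"
    proof (elim disjE exE conjE)
      fix p y assume *: "(u, liftA p) \<in> stack_conn AB C" "x = up y" "(onode p, y) \<in> stack_conn A B"
      have "actB C x \<in> V"
      proof (cases "snd y = 0")
        case True
        then obtain q where q: "y = onode q" using outer_eq_onode[of y] by (auto simp: outer_node_def)
        then have "q = p \<or> q = fst AB p" using conn_onode[OF n gA gB] * fst_AB by auto
        then have "(u, liftA q) \<in> stack_conn AB C"
          using *(1) conn_actA[of "liftA p" AB C] by (auto intro: conn_trans)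
        then have "(u, actB C (liftA q)) \<in> stack_conn AB C" using conn_actB conn_trans by blast
        moreover have "j1 (actB C (liftA q)) = actB C x"
          using True q * by (auto simp: liftA_def onode_def up_def actB_def liftB_def j1_def split: if_splits)
        ultimately show ?thesis using V1 by metis
      next
        case False
        then have "actB C x = x" using * by (auto simp: actB_def)
        then show ?thesis using V2 * by simp
      qed
      then show ?thesis using V2[OF *(1)] * conn_actA conn_actB conn_trans by (auto intro: conn_trans)
    next
      assume *: "(u, x) \<in> stack_conn AB C" "snd x = 0"
      have "(u, actB C x) \<in> stack_conn AB C" using * conn_actB conn_trans by blast
      moreover have "j1 (actB C x) = actB C x" using * by (auto simp: j1_def actB_def liftB_def)
      ultimately show ?thesis using V1[of "actB C x"] V1[OF *(1)] * j1_id[of x] by (auto simp: a4_def b4_def)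
    qed
    then show "a4 A x \<in> V" "b4 B x \<in> V" "actB C x \<in> V" by auto
  qed
  then show ?thesis by (simp add: V_def)
qed

lemma conn4_j1_iff:
  assumes u: "snd u \<le> 2" "snd w \<le> 2"
  shows "(j1 u, j1 w) \<in> conn4 A B C \<longleftrightarrow> (u, w) \<in> stack_conn AB C"
proof
  assume "(j1 u, j1 w) \<in> conn4 A B C"
  from conn4_j1_cases[OF u(1) this] obtain u' where u': "(u, u') \<in> stack_conn AB C"
    "j1 w = j1 u' \<or> (\<exists>p y. u' = liftA p \<and> j1 w = up y \<and> (onode p, y) \<in> stack_conn A B)" by blast
  have "snd u' \<le> 2" using conn_level[OF u'(1)] u by simp
  from u'(2) show "(u, w) \<in> stack_conn AB C"
  proof (elim disjE exE conjE)
    assume "j1 w = j1 u'"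
    then show ?thesis using j1_inj u \<open>snd u' \<le> 2\<close> u'(1) by metis
  next
    fix p y assume *: "u' = liftA p" "j1 w = up y" "(onode p, y) \<in> stack_conn A B"
    have "snd w = 2 \<or> snd w = 1" using * u by (auto simp: j1_def up_def split: if_splits)
    then obtain q where q: "w = liftA q" using ex_liftA by blast
    then have "y = onode q" using * j1_liftA by simp
    then have "q = p \<or> q = fst AB p" using conn_onode[OF n gA gB] * fst_AB by auto
    then show ?thesis using u'(1) * q conn_actA[of "liftA p" AB C] by (auto intro: conn_trans)
  qed
qed (use conn_j1 u in auto)

abbreviation (input) "comp4 \<equiv> stack_comp A B C"
abbreviation (input) "orb4 \<equiv> stack_orbit n A B C"
abbreviation (input) "nodes4 \<equiv> stack_nodes A B C"
abbreviation (input) "nodes4a Q \<equiv> {u \<in> nodes4 Q. snd u = 2 \<and> (\<forall>w\<in>comp4 u. snd w = 2)}"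
abbreviation (input) "nodes4b Q \<equiv> {u \<in> nodes4 Q. snd u = 1}"

lemma comp4_eqI: "(u, w) \<in> conn4 A B C \<Longrightarrow> comp4 u = comp4 w"
  unfolding stack_comp_def using conn4_sym[OF gA gB gC, of u w] conn4_trans by blast

lemma orb4_eq_iff: "orb4 u = orb4 w \<longleftrightarrow> (\<exists>z. (u, shiftx (z * int n) w) \<in> conn4 A B C)"
proof
  assume eq: "orb4 u = orb4 w"
  have "comp4 u \<in> orb4 u"
    unfolding stack_orbit_def by (auto intro!: exI[of _ 0])
  then obtain z where "comp4 u = comp4 (shiftx (z * int n) w)"
    unfolding eq unfolding stack_orbit_def by blast
  moreover have "shiftx (z * int n) w \<in> comp4 (shiftx (z * int n) w)" by (simp add: stack_comp_def)
  ultimately have "shiftx (z * int n) w \<in> comp4 u" by simp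
  then show "\<exists>z. (u, shiftx (z * int n) w) \<in> conn4 A B C" by (auto simp: stack_comp_def)
next
  have sub: "orb4 u \<subseteq> orb4 w"
    if zz: "(u, shiftx (z * int n) w) \<in> conn4 A B C" for u w z
  proof
    fix c assume "c \<in> orb4 u"
    then obtain y where "c = comp4 (shiftx (y * int n) u)" unfolding stack_orbit_def by blast
    also have "\<dots> = comp4 (shiftx (y * int n) (shiftx (z * int n) w))"
      by (rule comp4_eqI[OF conn4_shift[OF gA gB gC zz]])
    also have "\<dots> = comp4 (shiftx ((y + z) * int n) w)" by (simp add: algebra_simps)
    finally show "c \<in> orb4 w" unfolding stack_orbit_def by blast
  qed
  assume "\<exists>z. (u, shiftx (z * int n) w) \<in> conn4 A B C"
  then obtain z where z: "(u, shiftx (z * int n) w) \<in> conn4 A B C" by blast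
  from conn4_shift[OF gA gB gC conn4_sym[OF gA gB gC z], of "- z"]
  have "(w, shiftx (- z * int n) u) \<in> conn4 A B C" by simp
  then show "orb4 u = orb4 w" using sub z by blast
qed

text \<open>A closed component either stays on level 2, and then it closes up already inside A over
  B, or it meets level 1, and then it is closed in the stack of AB over C.\<close>

lemma card_nodes4: "card (orb4 ` nodes4 Q) = card (orb4 ` nodes4a Q) + card (orb4 ` nodes4b Q)"
proof -
  have fin: "finite (orb4 ` nodes4 Q)"
  proof (rule finite_subset)
    show "orb4 ` nodes4 Q \<subseteq> orb4 ` ({0..<int n} \<times> {1, 2})"
    proof
      fix c assume "c \<in> orb4 ` nodes4 Q"
      then obtain u where u: "u \<in> nodes4 Q" "c = orb4 u" by blast
      have "u = shiftx (fst u div int n * int n) (fst u mod int n, snd u)"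
        by (auto simp: prod_eq_iff)
      then have "orb4 u = orb4 (fst u mod int n, snd u)"
        unfolding orb4_eq_iff by (intro exI[of _ "fst u div int n"]) (metis conn4_refl)
      moreover have "(fst u mod int n, snd u) \<in> {0..<int n} \<times> {1, 2}"
        using u n by (auto simp: stack_nodes_def)
      ultimately show "c \<in> orb4 ` ({0..<int n} \<times> {1, 2})" using u(2) by blast
    qed
  qed auto
  have un: "orb4 ` nodes4 Q = orb4 ` nodes4a Q \<union> orb4 ` nodes4b Q"
  proof
    show "orb4 ` nodes4 Q \<subseteq> orb4 ` nodes4a Q \<union> orb4 ` nodes4b Q"
    proof
      fix c assume "c \<in> orb4 ` nodes4 Q"
      then obtain u where u: "u \<in> nodes4 Q" "c = orb4 u" by blast
      show "c \<in> orb4 ` nodes4a Q \<union> orb4 ` nodes4b Q"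
      proof (cases "u \<in> nodes4a Q \<or> u \<in> nodes4b Q")
        case False
        then obtain w where w: "w \<in> comp4 u" "snd w \<noteq> 2" and u2: "snd u = 2"
          using u by (auto simp: stack_nodes_def)
        have cw: "(u, w) \<in> conn4 A B C" using w by (simp add: stack_comp_def)
        have "snd w \<le> 3" using conn4_level[OF cw] u2 by simp
        moreover have "snd w \<noteq> 0" "snd w \<noteq> 3" using u w by (auto simp: stack_nodes_def)
        ultimately have "snd w = 1" using w by linarith
        moreover have "comp4 u = comp4 w" using comp4_eqI[OF cw] .
        ultimately have "w \<in> nodes4b Q" using u by (auto simp: stack_nodes_def)
        moreover have "orb4 u = orb4 w" unfolding orb4_eq_iff using cw by (intro exI[of _ 0]) simp
        ultimately show ?thesis using u by blast
      qed (use u in blast)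
    qed
  qed (auto simp:)
  have "orb4 ` nodes4a Q \<inter> orb4 ` nodes4b Q = {}"
  proof -
    have False if "u \<in> nodes4a Q" "w \<in> nodes4b Q" and eq: "orb4 u = orb4 w" for u w
    proof -
      obtain z where "(u, shiftx (z * int n) w) \<in> conn4 A B C"
        using iffD1[OF orb4_eq_iff eq] by blast
      then have "snd (shiftx (z * int n) w) = 2" using that by (auto simp: stack_comp_def)
      then show False using that by (simp add:)
    qed
    then show ?thesis by blast
  qed
  then show ?thesis using un fin card_Un_disjoint[of "orb4 ` nodes4a Q" "orb4 ` nodes4b Q"] by simp
qed

lemma comp4_up:
  assumes "closed_mid A B y"
  shows "comp4 (up y) = up ` comp_set A B y"
proof
  show "up ` comp_set A B y \<subseteq> comp4 (up y)"
    unfolding stack_comp_def comp_set_def using conn_up by blast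
  have lev: "snd x \<noteq> 0" if "x \<in> comp_set A B y" for x
    using that assms by (auto simp: closed_mid_def comp_set_def outer_node_def)
  show "comp4 (up y) \<subseteq> up ` comp_set A B y"
  proof
    fix w assume "w \<in> comp4 (up y)"
    then have "(up y, w) \<in> conn4 A B C" by (simp add: stack_comp_def)
    then show "w \<in> up ` comp_set A B y"
    proof (rule conn4_least)
      show "up y \<in> up ` comp_set A B y" by (simp add: comp_set_def)
    next
      fix x assume "x \<in> up ` comp_set A B y"
      then obtain t where t: "t \<in> comp_set A B y" "x = up t" by blast
      then show "a4 A x \<in> up ` comp_set A B y" "b4 B x \<in> up ` comp_set A B y"
        using comp_closed by auto
      have "actB C x = x" using t lev[OF t(1)] by (auto simp: actB_def)
      then show "actB C x \<in> up ` comp_set A B y" using t by simp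
    qed
  qed
qed

lemma nodes4a_card: "card (orb4 ` nodes4a Q) = num_comps n A B Q"
  unfolding num_comps_def
proof (rule sym, rule card_image_eqI[where h = up])
  have inj: "inj_on up S" for S by (auto intro: inj_onI)
  show *: "up y \<in> nodes4a Q" if "y \<in> mid_nodes A B Q" for y
  proof -
    have cy: "closed_mid A B y" and fy: "finite (comp_set A B y) \<longleftrightarrow> Q" using that by (auto simp: mid_nodes_def)
    have "snd x = 1" if "x \<in> comp_set A B y" for x
      using closed_mid_level[OF cy] that by (simp add: comp_set_def)
    then show ?thesis using comp4_up[OF cy] fy cy finite_image_iff[OF inj]
      by (auto simp: stack_nodes_def closed_mid_def)
  qed
  fix u assume u: "u \<in> nodes4a Q"
  then have "snd u \<ge> 1" by (simp add:)
  then have uu: "up (dn u) = u" by simp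
  have s1: "snd (dn u) = 1" using u by (auto simp: dn_def)
  have "snd x = 1" if "(dn u, x) \<in> stack_conn A B" for x
  proof -
    have "snd (up x) = 2" using conn_up[OF that, of C] u unfolding uu stack_comp_def by blast
    then show ?thesis by simp
  qed
  then have "\<not> outer_node x" if "(dn u, x) \<in> stack_conn A B" for x
    using that unfolding outer_node_def by (metis one_neq_zero one_eq_numeral_iff num.distinct(1))
  then have cm: "closed_mid A B (dn u)" using s1 by (auto simp: closed_mid_def)
  then have "dn u \<in> mid_nodes A B Q"
    using comp4_up[OF cm] uu u finite_image_iff[OF inj] by (auto simp: mid_nodes_def stack_nodes_def)
  then show "\<exists>y\<in>mid_nodes A B Q. orb4 (up y) = orb4 u" using uu by (intro bexI[of _ "dn u"]) auto
next
  fix x y assume "x \<in> mid_nodes A B Q" "y \<in> mid_nodes A B Q"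
  then have cx: "closed_mid A B x" by (auto simp: mid_nodes_def)
  have "(x, w) \<in> stack_conn A B \<longleftrightarrow> (up x, up w) \<in> conn4 A B C" for w
  proof
    assume "(up x, up w) \<in> conn4 A B C"
    then have "up w \<in> comp4 (up x)" by (simp add: stack_comp_def)
    then have "up w \<in> up ` comp_set A B x" unfolding comp4_up[OF cx] .
    then show "(x, w) \<in> stack_conn A B" by (auto simp: comp_set_def)
  qed (rule conn_up)
  then show "comp_orbit n A B x = comp_orbit n A B y \<longleftrightarrow> orb4 (up x) = orb4 (up y)"
    unfolding comp_orbit_eq_iff[OF gA gB] orb4_eq_iff by (simp flip: up_simps(6))
qed

lemma nodes4b_eq: "nodes4b Q = mid_nodes AB C Q"
proof -
  have gAB: "good n AB" by (rule good_comp[OF n gA gB])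
  have "u \<in> nodes4b Q \<longleftrightarrow> u \<in> mid_nodes AB C Q" if u: "snd u = 1" for u
  proof -
    have ju: "j1 u = u" and u2: "snd u \<le> 2" using u by (auto simp: j1_id)
    have iff: "(u, j1 w) \<in> conn4 A B C \<longleftrightarrow> (u, w) \<in> stack_conn AB C" if "snd w \<le> 2" for w
      using conn4_j1_iff[OF u2 that] ju by simp
    have cm: "closed_mid AB C u \<longleftrightarrow> (\<forall>w\<in>comp4 u. snd w \<noteq> 0 \<and> snd w \<noteq> 3)"
    proof
      assume c: "closed_mid AB C u"
      show "\<forall>w\<in>comp4 u. snd w \<noteq> 0 \<and> snd w \<noteq> 3"
      proof (rule ballI, rule ccontr)
        fix w assume w: "w \<in> comp4 u" "\<not> (snd w \<noteq> 0 \<and> snd w \<noteq> 3)"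
        define w' where "w' = (fst w, if snd w = 3 then 2 else 0 :: nat)"
        have "w = j1 w'" "snd w' \<le> 2" "outer_node w'"
          using w(2) by (auto simp: w'_def j1_def prod_eq_iff outer_node_def)
        then show False using iff[of w'] w c by (auto simp: stack_comp_def closed_mid_def)
      qed
    next
      assume c: "\<forall>w\<in>comp4 u. snd w \<noteq> 0 \<and> snd w \<noteq> 3"
      have False if "outer_node w" "(u, w) \<in> stack_conn AB C" for w
      proof -
        have "snd w \<le> 2" "snd (j1 w) = 0 \<or> snd (j1 w) = 3" using that by (auto simp: outer_node_def j1_def)
        then show False using iff[of w] that c by (auto simp: stack_comp_def)
      qed
      then show "closed_mid AB C u" using u by (auto simp: closed_mid_def)
    qed
    have "finite (comp_set AB C u)" if "finite (comp4 u)"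
    proof -
      have "j1 ` comp_set AB C u \<subseteq> comp4 u"
        using conn_j1[OF u2] ju by (auto simp: stack_comp_def comp_set_def)
      then have "finite (j1 ` comp_set AB C u)" using that finite_subset by blast
      moreover have "inj_on j1 (comp_set AB C u)"
        by (rule inj_onI) (use j1_inj conn_level u2 in \<open>auto simp: comp_set_def\<close>)
      ultimately show ?thesis using finite_image_iff by blast
    qed
    \<comment> \<open>The hidden part of the component consists of paths of A over B that start at
      visible nodes; each of them is finite and only finitely many occur.\<close>
    moreover have "finite (comp4 u)" if fin: "finite (comp_set AB C u)"
    proof -
      define P where "P = {p. liftA p \<in> comp_set AB C u}"
      have "inj liftA" by (auto intro: injI)
      then have "finite P" unfolding P_def
        using finite_vimageI[OF fin] by (simp add: vimage_def)
      have "comp4 u \<subseteq> j1 ` comp_set AB C u \<union> (\<Union>p\<in>P. up ` comp_set A B (onode p))"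
      proof
        fix x assume "x \<in> comp4 u"
        then have "(j1 u, x) \<in> conn4 A B C" using ju by (simp add: stack_comp_def)
        from conn4_j1_cases[OF u2 this] show "x \<in> j1 ` comp_set AB C u \<union> (\<Union>p\<in>P. up ` comp_set A B (onode p))"
          by (auto simp: P_def comp_set_def)
      qed
      moreover have "finite (j1 ` comp_set AB C u \<union> (\<Union>p\<in>P. up ` comp_set A B (onode p)))"
        using fin \<open>finite P\<close> outer_component(1)[OF n gA gB] by auto
      ultimately show ?thesis by (rule finite_subset)
    qed
    ultimately show ?thesis using cm u by (auto simp: stack_nodes_def mid_nodes_def)
  qed
  then show ?thesis by (auto simp: mid_nodes_def closed_mid_def)
qed

lemma nodes4b_card: "card (orb4 ` nodes4b Q) = num_comps n AB C Q"
  unfolding num_comps_def nodes4b_eq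
proof (rule card_image_eqI[where h = "\<lambda>x. x"])
  fix x y assume "x \<in> mid_nodes AB C Q" "y \<in> mid_nodes AB C Q"
  then have s: "snd x = 1" "snd y = 1" by (auto simp: mid_nodes_def closed_mid_def)
  have "j1 x = x" "j1 (shiftx z y) = shiftx z y" for z using s by (auto simp: j1_id)
  then have "(x, shiftx z y) \<in> conn4 A B C \<longleftrightarrow> (x, shiftx z y) \<in> stack_conn AB C" for z
    using conn4_j1_iff[of x "shiftx z y"] s by simp
  then show "orb4 x = orb4 y \<longleftrightarrow> comp_orbit n AB C x = comp_orbit n AB C y"
    unfolding comp_orbit_eq_iff[OF good_comp[OF n gA gB] gC] orb4_eq_iff by simp
qed auto

lemma num4: "card (orb4 ` nodes4 Q) = num_comps n A B Q + num_comps n AB C Q"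
  using card_nodes4 nodes4a_card nodes4b_card by simp

end

lemma ab4_flip:
  assumes "snd u \<le> 3"
  shows "a4 (flipd D) (flipl 3 u) = flipl 3 (actB D u)"
    and "b4 (flipd D) (flipl 3 u) = flipl 3 (b4 D u)"
    and "actB (flipd D) (flipl 3 u) = flipl 3 (a4 D u)"
proof -
  have d: "dn (flipl 3 u) = flipl 2 u" by (auto simp: dn_def flipl_def)
  have d2: "flipl 3 u = flipl 2 (dn u)" if "snd u \<ge> 1" using that by (auto simp: dn_def flipl_def)
  show "a4 (flipd D) (flipl 3 u) = flipl 3 (actB D u)"
  proof (cases "snd u = 3")
    case True then show ?thesis by (simp add: a4_def actB_def)
  next
    case False
    then have u: "snd u \<le> 2" using assms by simp
    have "actA (flipd D) (dn (flipl 3 u)) = flipl 2 (actB D u)" using actA_flip[OF u] d by simp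
    moreover have "up (flipl 2 (actB D u)) = flipl 3 (actB D u)" using actB_level[OF u] by (auto simp: prod_eq_iff)
    moreover have "snd (flipl 3 u) \<ge> 1" using u by simp
    ultimately show ?thesis by (simp add: a4_def)
  qed
  show "actB (flipd D) (flipl 3 u) = flipl 3 (a4 D u)"
  proof (cases "snd u = 0")
    case True then show ?thesis by (simp add: a4_def actB_def)
  next
    case False
    then have u: "snd u \<ge> 1" "snd (dn u) \<le> 2" using assms by (auto simp: dn_def)
    have "actB (flipd D) (flipl 3 u) = flipl 2 (actA D (dn u))" using actB_flip[OF u(2)] d2 u by simp
    moreover have "flipl 2 (actA D (dn u)) = flipl 3 (up (actA D (dn u)))" by (auto simp: prod_eq_iff)
    ultimately show ?thesis using u by (simp add: a4_def)
  qed
  show "b4 (flipd D) (flipl 3 u) = flipl 3 (b4 D u)"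
  proof -
    consider "snd u = 0" | "snd u = 3" | "snd u = 1 \<or> snd u = 2" using assms by linarith
    then show ?thesis
    proof cases
      case 1 then show ?thesis by (simp add: b4_def actB_def dn_def) (simp add: prod_eq_iff)
    next
      case 2 then show ?thesis by (simp add: b4_def actB_def dn_def) (simp add: prod_eq_iff)
    next
      case 3
      define r where "r = (snd u = 2)"
      have "fst (flipd D) (fst u, \<not> r) = flipn (fst D (fst u, r))" by simp
      then show ?thesis using 3
        by (auto simp: b4_def actB_def dn_def up_def r_def liftB_def prod_eq_iff)
    qed
  qed
qed

lemma conn4_flip:
  assumes "snd u \<le> 3" "(u, w) \<in> conn4 A B C"
  shows "(flipl 3 u, flipl 3 w) \<in> conn4 (flipd C) (flipd B) (flipd A)"
proof -
  have "w \<in> {w. snd w \<le> 3 \<and> (flipl 3 u, flipl 3 w) \<in> conn4 (flipd C) (flipd B) (flipd A)}"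
    by (rule conn4_least[OF assms(2)])
      (use assms(1) a4_level b4_level c4_level in \<open>auto simp flip: ab4_flip
        intro: conn4_trans[OF _ conn4_steps(1)] conn4_trans[OF _ conn4_steps(2)] conn4_trans[OF _ conn4_steps(3)]\<close>)
  then show ?thesis by simp
qed

lemma conn4_flip_iff:
  assumes "snd u \<le> 3" "snd w \<le> 3"
  shows "(flipl 3 u, flipl 3 w) \<in> conn4 (flipd C) (flipd B) (flipd A) \<longleftrightarrow> (u, w) \<in> conn4 A B C"
  using conn4_flip[of u w A B C] conn4_flip[of "flipl 3 u" "flipl 3 w" "flipd C" "flipd B" "flipd A"] assms by auto

text \<open>The reflected stack, read with its first two diagrams multiplied, is the reflection of A
  over BC. So one count of components serves both bracketings.\<close>

lemma card_nodes4_flip: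
  assumes n: "n > 0" and g: "good n A" "good n B" "good n C"
  shows "card (stack_orbit n A B C ` stack_nodes A B C Q) =
    card (stack_orbit n (flipd C) (flipd B) (flipd A) ` stack_nodes (flipd C) (flipd B) (flipd A) Q)"
proof -
  have c4: "stack_comp (flipd C) (flipd B) (flipd A) (flipl 3 u) = flipl 3 ` stack_comp A B C u" if "snd u \<le> 3" for u A B C
  proof
    show "flipl 3 ` stack_comp A B C u \<subseteq> stack_comp (flipd C) (flipd B) (flipd A) (flipl 3 u)"
    proof
      fix w assume "w \<in> flipl 3 ` stack_comp A B C u"
      then obtain y where "w = flipl 3 y" "(u, y) \<in> conn4 A B C" by (auto simp: stack_comp_def)
      then show "w \<in> stack_comp (flipd C) (flipd B) (flipd A) (flipl 3 u)"
        using conn4_flip[OF that, of y A B C] by (simp add: stack_comp_def)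
    qed
    show "stack_comp (flipd C) (flipd B) (flipd A) (flipl 3 u) \<subseteq> flipl 3 ` stack_comp A B C u"
    proof
      fix w assume "w \<in> stack_comp (flipd C) (flipd B) (flipd A) (flipl 3 u)"
      then have w: "(flipl 3 u, w) \<in> conn4 (flipd C) (flipd B) (flipd A)" by (simp add: stack_comp_def)
      then have "snd w \<le> 3" using conn4_level by (metis flipl_simps(2) diff_le_self)
      moreover have "(u, flipl 3 w) \<in> conn4 A B C" using conn4_flip[OF _ w] that by simp
      ultimately show "w \<in> flipl 3 ` stack_comp A B C u" by (intro image_eqI[of _ _ "flipl 3 w"]) (auto simp: stack_comp_def)
    qed
  qed
  have inj: "inj_on (flipl 3) (stack_comp A B C u)" if "snd u \<le> 3" for u A B C
    by (rule inj_onI) (metis stack_comp_def conn4_level flipl_simps(3) mem_Collect_eq that)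
  have mem: "flipl 3 u \<in> stack_nodes (flipd C) (flipd B) (flipd A) Q" if "u \<in> stack_nodes A B C Q" for u A B C
  proof -
    have u: "snd u \<in> {1, 2}" using that by (simp add: stack_nodes_def)
    then have u3: "snd u \<le> 3" by auto
    have lev: "snd w = 1 \<or> snd w = 2" if "w \<in> stack_comp A B C u" for w
    proof -
      have "snd w \<le> 3" using conn4_level u3 that by (auto simp: stack_comp_def)
      moreover have "snd w \<noteq> 0" "snd w \<noteq> 3" using that \<open>u \<in> stack_nodes A B C Q\<close> by (auto simp: stack_nodes_def)
      ultimately show ?thesis by linarith
    qed
    then have "\<forall>w\<in>flipl 3 ` stack_comp A B C u. snd w \<noteq> 0 \<and> snd w \<noteq> 3" by fastforce
    then show ?thesis using that u c4[OF u3] finite_image_iff[OF inj[OF u3]] by (auto simp: stack_nodes_def)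
  qed
  have gf: "good n (flipd C)" "good n (flipd B)" "good n (flipd A)" using g by simp_all
  show ?thesis
  proof (rule card_image_eqI[where h = "flipl 3"])
    fix u assume "u \<in> stack_nodes (flipd C) (flipd B) (flipd A) Q"
    then have "flipl 3 u \<in> stack_nodes A B C Q" "flipl 3 (flipl 3 u) = u"
      using mem[of u "flipd C" "flipd B" "flipd A"] by (auto simp: stack_nodes_def)
    then show "\<exists>x\<in>stack_nodes A B C Q. stack_orbit n (flipd C) (flipd B) (flipd A) (flipl 3 x) = stack_orbit n (flipd C) (flipd B) (flipd A) u"
      by metis
  next
    fix x y assume "x \<in> stack_nodes A B C Q" "y \<in> stack_nodes A B C Q"
    then have "snd x \<le> 3" "snd y \<le> 3" by (auto simp: stack_nodes_def)
    then show "stack_orbit n A B C x = stack_orbit n A B C y \<longleftrightarrow>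
        stack_orbit n (flipd C) (flipd B) (flipd A) (flipl 3 x) = stack_orbit n (flipd C) (flipd B) (flipd A) (flipl 3 y)"
      unfolding orb4_eq_iff[OF n g] orb4_eq_iff[OF n gf]
      by (simp flip: flipl_simps(4) add: conn4_flip_iff)
  qed (use mem in blast)
qed

lemma num_comps_cong:
  assumes "fst A = fst A'" "fst B = fst B'"
  shows "num_comps n A B Q = num_comps n A' B' Q"
proof -
  have "stack_conn A B = stack_conn A' B'" using assms by (simp add: stack_conn_def stack_edges_def)
  then show ?thesis
    by (simp add: num_comps_def mid_nodes_def comp_orbit_def comp_set_def closed_mid_def image_def)
qed

lemma fst_comp_flip:
  assumes "n > 0" "good n A" "good n B"
  shows "fst (diag_comp n (flipd B) (flipd A)) = fst (flipd (diag_comp n A B))"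
  using comp_match_flip[OF assms] by (auto simp: diag_comp_def)

text \<open>Both sides count the closed components of the stack of three diagrams.\<close>

lemma num_comps_cocycle:
  assumes n: "n > 0" and g: "good n A" "good n B" "good n C"
  shows "num_comps n A B Q + num_comps n (diag_comp n A B) C Q =
         num_comps n B C Q + num_comps n A (diag_comp n B C) Q"
proof -
  have "num_comps n A B Q + num_comps n (diag_comp n A B) C Q = card (stack_orbit n A B C ` stack_nodes A B C Q)"
    using num4[OF n g] by simp
  also have "\<dots> = num_comps n (flipd C) (flipd B) Q + num_comps n (diag_comp n (flipd C) (flipd B)) (flipd A) Q"
    unfolding card_nodes4_flip[OF n g] by (rule num4) (use n g in auto)
  also have "num_comps n (diag_comp n (flipd C) (flipd B)) (flipd A) Q =
      num_comps n (flipd (diag_comp n B C)) (flipd A) Q"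
    by (rule num_comps_cong) (use fst_comp_flip[OF n g(2,3)] in auto)
  finally show ?thesis using num_comps_flip g good_comp[OF n g(2,3)] by simp
qed

text \<open>Connectivity in the stack of three does not depend on a bracketing:
  \<open>conn4_j1_iff\<close> reads it as (AB)C, and after a reflection as A(BC).\<close>

lemma comp_match_assoc:
  assumes n: "n > 0" and g: "good n A" "good n B" "good n C"
  shows "comp_match (diag_comp n A B) C = comp_match A (diag_comp n B C)"
proof
  fix p
  have gAB: "good n (diag_comp n A B)" and gBC: "good n (diag_comp n B C)"
    using good_comp n g by auto
  define q where "q = comp_match (diag_comp n A B) C p"
  have q: "(onode p, onode q) \<in> stack_conn (diag_comp n A B) C" "q \<noteq> p"
    using comp_match_conn[OF n gAB g(3)] by (auto simp: q_def)
  have lev: "snd (onode p) \<le> 2" for p by (simp add: onode_def)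
  have ju: "flipl 3 (j1 (onode p)) = j1 (flipl 2 (onode p))" for p
    by (auto simp: j1_def onode_def flipl_def)
  have "(j1 (onode p), j1 (onode q)) \<in> conn4 A B C" using conn_j1[OF n g lev q(1)] .
  then have "(j1 (flipl 2 (onode p)), j1 (flipl 2 (onode q))) \<in> conn4 (flipd C) (flipd B) (flipd A)"
    using conn4_flip[of "j1 (onode p)" "j1 (onode q)"] by (simp add: ju) (simp add: j1_def onode_def)
  then have "(flipl 2 (onode p), flipl 2 (onode q)) \<in> stack_conn (diag_comp n (flipd C) (flipd B)) (flipd A)"
    by (subst (asm) conn4_j1_iff[OF n]) (use g lev in auto)
  also have "stack_conn (diag_comp n (flipd C) (flipd B)) (flipd A) = stack_conn (flipd (diag_comp n B C)) (flipd A)"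
    using fst_comp_flip[OF n g(2,3)] by (simp add: stack_conn_def stack_edges_def)
  finally have "(onode p, onode q) \<in> stack_conn A (diag_comp n B C)"
    using conn_flip_iff lev by blast
  then show "comp_match (diag_comp n A B) C p = comp_match A (diag_comp n B C) p"
    using comp_match_eqI[OF n g(1) gBC] q by (simp add: q_def)
qed

text \<open>Besides the matchings, the numbers of infinite lines must agree; this is the cocycle
  identity for infinite components.\<close>

lemma diag_comp_assoc:
  assumes "n > 0" "good n A" "good n B" "good n C"
  shows "diag_comp n (diag_comp n A B) C = diag_comp n A (diag_comp n B C)"
  using comp_match_assoc[OF assms] num_comps_cocycle[OF assms, of False]
  by (simp add: diag_comp_def[of n "diag_comp n A B"] diag_comp_def[of n A "diag_comp n B C"] num_new_lines_conv)
    (simp add: diag_comp_def num_new_lines_conv)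

lemma flipd_comp:
  assumes "n > 0" "good n A" "good n B"
  shows "flipd (diag_comp n A B) = diag_comp n (flipd B) (flipd A)"
proof (rule prod_eqI)
  show "fst (flipd (diag_comp n A B)) = fst (diag_comp n (flipd B) (flipd A))"
    using fst_comp_flip[OF assms] by simp
  show "snd (flipd (diag_comp n A B)) = snd (diag_comp n (flipd B) (flipd A))"
    using num_comps_flip[OF assms(2,3)] by (simp add: diag_comp_def num_new_lines_conv)
qed

section \<open>Planarity as a parity condition\<close>

text \<open>The boundary of the strip is read as one linear order: the top row from left to right, then
  the bottom row from right to left. Two edges cross iff their ends interleave; interleaving is
  additive modulo 2 along paths, which makes planarity of products a formal consequence of the
  planarity of the factors.\<close>

definition prec :: "node \<Rightarrow> node \<Rightarrow> bool" where
  "prec p q \<longleftrightarrow> (if snd p then snd q \<longrightarrow> fst p < fst q else \<not> snd q \<and> fst q < fst p)"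

definition btw :: "node \<Rightarrow> node \<Rightarrow> node \<Rightarrow> bool" where
  "btw p q r \<longleftrightarrow> prec p r \<noteq> prec q r"

definition cross :: "node \<Rightarrow> node \<Rightarrow> node \<Rightarrow> node \<Rightarrow> bool" where
  "cross p q r s \<longleftrightarrow> btw p q r \<noteq> btw p q s"

definition planar :: "(node \<Rightarrow> node) \<Rightarrow> bool" where
  "planar m \<longleftrightarrow> (\<forall>p r. r \<noteq> p \<and> r \<noteq> m p \<longrightarrow> \<not> cross p (m p) r (m r))"

lemma cross_trans: "cross p q r s \<longleftrightarrow> (cross p t r s \<noteq> cross t q r s)"
  by (auto simp: cross_def btw_def)

lemma cross_trans2: "cross p q r s \<longleftrightarrow> (cross p q r t \<noteq> cross p q t s)"
  by (auto simp: cross_def)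

lemma prec_antisym: "p \<noteq> q \<Longrightarrow> prec p q \<longleftrightarrow> \<not> prec q p"
  by (auto simp: prec_def prod_eq_iff)

lemma cross_sym:
  assumes "p \<noteq> r" "p \<noteq> s" "q \<noteq> r" "q \<noteq> s"
  shows "cross p q r s \<longleftrightarrow> cross r s p q"
  using assms prec_antisym[of p r] prec_antisym[of p s] prec_antisym[of q r] prec_antisym[of q s]
  by (auto simp: cross_def btw_def)

lemma is_diagram_planar:
  assumes "is_diagram n D"
  shows "good n D" "planar (fst D)"
proof -
  define m where "m = fst D"
  have inv: "m p \<noteq> p" "m (m p) = p" for p using assms by (auto simp: is_diagram_def Let_def m_def)
  have per: "m (i + int n, r) = (fst (m (i, r)) + int n, snd (m (i, r)))" for i r
    using assms by (auto simp: is_diagram_def Let_def m_def)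
  have nest: "m (a, r) = (b, r) \<Longrightarrow> a < c \<Longrightarrow> c < b \<Longrightarrow>
      snd (m (c, r)) = r \<and> a < fst (m (c, r)) \<and> fst (m (c, r)) < b" for a b c r
    using assms by (simp add: is_diagram_def Let_def m_def)
  have mon: "m (a, True) = (b, False) \<Longrightarrow> m (c, True) = (d, False) \<Longrightarrow> a < c \<Longrightarrow> b < d" for a b c d
    using assms unfolding is_diagram_def Let_def m_def by blast
  have "m (shiftx (z * int n) p) = shiftx (z * int n) (m p)" for z p
    by (rule good_periodI) (rule per)
  then show "good n D" using inv unfolding good_def m_def by blast
  \<comment> \<open>One implication is enough: since m is an involution, r and m r can be exchanged,
    which gives the equivalence demanded by \<open>planar\<close>.\<close>
  have key: "btw p (m p) (m r)" if r: "r \<noteq> p" "r \<noteq> m p" and b: "btw p (m p) r" for p r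
  proof -
    obtain a ra where p: "p = (a, ra)" by (cases p)
    obtain b rb where q: "m p = (b, rb)" by (cases "m p")
    obtain c rc where rr: "r = (c, rc)" by (cases r)
    obtain d rd where s: "m r = (d, rd)" by (cases "m r")
    have mq: "m (b, rb) = (a, ra)" "m (a, ra) = (b, rb)" using inv(2)[of p] p q by auto
    have ms: "m (d, rd) = (c, rc)" "m (c, rc) = (d, rd)" using inv(2)[of r] rr s by auto
    have dist: "(d, rd) \<noteq> (a, ra)" "(d, rd) \<noteq> (b, rb)" "(c, rc) \<noteq> (a, ra)" "(c, rc) \<noteq> (b, rb)"
      using mq ms r rr p q s inv(2) by (metis)+
    show ?thesis
    proof (cases "ra = rb")
      case True
      have "rc = ra \<and> min a b < c \<and> c < max a b"
        using b p q rr True dist by (auto simp: btw_def prec_def split: if_splits)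
      then have "rd = ra \<and> min a b < d \<and> d < max a b"
        using nest[of a ra b c] nest[of b ra a c] mq ms True by (cases "a < b") auto
      then show ?thesis using p q s True by (auto simp: btw_def prec_def)
    next
      case False
      define x where "x = (if ra then a else b)"
      define y where "y = (if ra then b else a)"
      have xy: "m (x, True) = (y, False)" "m (y, False) = (x, True)" using False mq by (auto simp: x_def y_def)
      have bt: "btw p (m p) (e, re) \<longleftrightarrow> (if re then x < e else y < e)" if "(e, re) \<noteq> (a, ra)" "(e, re) \<noteq> (b, rb)" for e re
        using that False p q by (auto simp: btw_def prec_def x_def y_def)
      have cb: "if rc then x < c else y < c" using b bt dist rr by auto
      have "if rd then x < d else y < d"
      proof (cases "rc = rd")
        case True
        have ne: "d \<noteq> (if rd then x else y)" using dist False by (auto simp: x_def y_def)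
        have "\<not> d < (if rd then x else y)"
        proof
          assume "d < (if rd then x else y)"
          then have "snd (m (if rd then x else y, rd)) = rd"
            using nest[of d rd c "if rd then x else y"] ms True cb by (auto split: if_splits)
          then show False using xy by (auto split: if_splits)
        qed
        then show ?thesis using ne by (auto split: if_splits)
      next
        case F: False
        show ?thesis
        proof (cases rc)
          case True
          then show ?thesis using F mon[of x y c d] xy ms cb by auto
        next
          case rc: False
          have "x \<noteq> d" using dist F rc False by (auto simp: x_def)
          moreover have "\<not> d < x" using mon[of d c x y] xy ms cb F rc by auto
          ultimately show ?thesis using F rc by auto
        qed
      qed
      then show ?thesis using bt dist s by auto
    qed
  qed
  show "planar (fst D)"
    unfolding planar_def cross_def m_def[symmetric]
  proof (intro allI impI)
    fix p r assume r: "r \<noteq> p \<and> r \<noteq> m p"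
    have "m r \<noteq> p" "m r \<noteq> m p" using r inv by metis+
    then show "\<not> btw p (m p) r \<noteq> btw p (m p) (m r)" using key[of r p] key[of "m r" p] r inv by auto
  qed
qed

lemma planar_is_diagram:
  assumes g: "good n D" and pl: "planar (fst D)" and k: "snd D = 0"
  shows "is_diagram n D"
proof -
  define m where "m = fst D"
  have inv: "m (m p) = p" for p using g by (auto simp: good_def m_def)
  have pl: "btw p (m p) r = btw p (m p) (m r)" if "r \<noteq> p" "r \<noteq> m p" for p r
    using pl that by (auto simp: planar_def cross_def m_def)
  have nest: "snd (m (c, r)) = r \<and> a < fst (m (c, r)) \<and> fst (m (c, r)) < b"
    if "m (a, r) = (b, r)" "a < c" "c < b" for a b c r
  proof -
    have "btw (a, r) (b, r) (m (c, r))" using pl[of "(c, r)" "(a, r)"] that by (auto simp: btw_def prec_def)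
    moreover have "m (c, r) \<noteq> (a, r)" "m (c, r) \<noteq> (b, r)" using that inv by (metis less_irrefl prod.inject)+
    ultimately show ?thesis using that by (cases "m (c, r)") (auto simp: btw_def prec_def split: if_splits)
  qed
  have mon: "b < d" if "m (a, True) = (b, False)" "m (c, True) = (d, False)" "a < c" for a b c d
  proof -
    have "\<not> d < b" using pl[of "(c, True)" "(a, True)"] that by (auto simp: btw_def prec_def)
    moreover have "b \<noteq> d" using that inv by (metis less_irrefl prod.inject)
    ultimately show ?thesis by simp
  qed
  have per: "m (i + int n, r) = (fst (m (i, r)) + int n, snd (m (i, r)))" for i r
    using good_shift[OF g, of 1 "(i, r)"] by (simp add: m_def shiftx_def)
  show ?thesis
    unfolding is_diagram_def Let_def m_def[symmetric]
    using good_nofix[OF g, folded m_def] inv nest mon per k by (intro conjI allI impI) (blast | simp)+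
qed

section \<open>Parity counts within a row\<close>

lemma even_card_involution:
  assumes "finite S" "\<And>x. x \<in> S \<Longrightarrow> f x \<in> S \<and> f (f x) = x \<and> f x \<noteq> x"
  shows "even (card S)"
  using assms
proof (induction "card S" arbitrary: S rule: less_induct)
  case less
  show ?case
  proof (cases "S = {}")
    case False
    then obtain x where x: "x \<in> S" by blast
    have fx: "f x \<in> S" "f (f x) = x" "f x \<noteq> x" using less(3) x by auto
    let ?T = "S - {x, f x}"
    have cT: "card S = card ?T + 2"
    proof -
      have "card {x, f x} = 2" using fx by auto
      moreover have "card ?T = card S - card {x, f x}"
        by (rule card_Diff_subset) (use x fx in auto)
      moreover have "card {x, f x} \<le> card S" by (rule card_mono) (use less x fx in auto)
      ultimately show ?thesis by simp
    qed
    have "even (card ?T)"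
    proof (rule less(1))
      show "card ?T < card S" using cT by simp
      show "finite ?T" using less by simp
      fix y assume y: "y \<in> ?T"
      then have "f y \<in> S" "f (f y) = y" "f y \<noteq> y" using less(3) by auto
      moreover have "f y \<noteq> x" "f y \<noteq> f x" using y calculation fx by (metis Diff_iff insertCI)+
      ultimately show "f y \<in> ?T \<and> f (f y) = y \<and> f y \<noteq> y" by simp
    qed
    then show ?thesis using cT by simp
  qed simp
qed

lemma mod_translate: "(x :: int) mod int n = y mod int n \<longleftrightarrow> (\<exists>z. y = x + z * int n)"
proof
  assume "x mod int n = y mod int n"
  then have "int n dvd y - x" by (metis mod_eq_dvd_iff)
  then obtain z where "y - x = int n * z" by (auto elim: dvdE)
  then show "\<exists>z. y = x + z * int n" by (intro exI[of _ z]) (simp add: algebra_simps)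
qed auto

lemma good_translate: "good n D \<Longrightarrow> fst D (x + z * int n, r) = shiftx (z * int n) (fst D (x, r))"
  using good_shift[of n D z "(x, r)"] by simp

text \<open>An edge from x to x + z * n would by periodicity also lead from x + z * n to x + 2 * z *
  n, but the matching is an involution, so it leads back to x.\<close>

lemma good_not_translate:
  assumes g: "good n D" and n: "n > 0" and e: "fst D (x, r) = (y, r)"
  shows "x mod int n \<noteq> y mod int n"
proof
  assume "x mod int n = y mod int n"
  then obtain z where z: "y = x + z * int n" using mod_translate by blast
  have "fst D (y, r) = (x, r)" using good_eqD[OF g e] .
  moreover have "fst D (y, r) = (y + z * int n, r)" unfolding z good_translate[OF g] by (simp add: e[unfolded z])
  ultimately have "z * int n = 0" using z by simp
  then have "y = x" using z by simp
  then show False using good_nofix[OF g, of "(x, r)"] e by simp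
qed

text \<open>On residues the partner map of a row is an involution, and
  \<open>good_not_translate\<close> keeps it free of fixed points.\<close>

lemma even_card_horizontal:
  assumes g: "good n D" and n: "n > 0"
  shows "even (card {x \<in> {1..int n}. snd (fst D (x, r)) = r})"
proof -
  define c where "c x = (x - 1) mod int n + 1" for x
  have c1: "c x \<in> {1..int n}" for x
  proof -
    have "(x - 1) mod int n < int n" "0 \<le> (x - 1) mod int n" using n by auto
    then have "0 + 1 \<le> (x - 1) mod int n + 1" "(x - 1) mod int n + 1 \<le> int n" by linarith+
    then show ?thesis unfolding c_def by auto
  qed
  have c2: "\<exists>z. c x = x + z * int n" for x
  proof -
    define d where "d = (x - 1) div int n"
    have "d * int n + (x - 1) mod int n = x - 1" unfolding d_def by (rule div_mult_mod_eq)
    then have "c x = x + (- d) * int n" unfolding c_def by linarith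
    then show ?thesis by blast
  qed
  have c3: "c (x + z * int n) = c x" for x z
    using mod_mult_self1[of "x - 1" z "int n"] by (simp add: c_def algebra_simps)
  have c4: "c x = x" if "x \<in> {1..int n}" for x using that by (simp add: c_def)
  show ?thesis
  proof (rule even_card_involution[where f = "\<lambda>x. c (fst (fst D (x, r)))"])
    fix x assume x: "x \<in> {x \<in> {1..int n}. snd (fst D (x, r)) = r}"
    define y where "y = fst (fst D (x, r))"
    have xy: "fst D (x, r) = (y, r)" using x by (auto simp: y_def prod_eq_iff)
    then have yx: "fst D (y, r) = (x, r)" by (rule good_eqD[OF g])
    obtain z where z: "c y = y + z * int n" using c2 by blast
    have cy: "fst D (c y, r) = (x + z * int n, r)" unfolding z good_translate[OF g] yx by simp
    have "c y mod int n = y mod int n" by (simp add: z)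
    then have "c y \<noteq> x" using good_not_translate[OF g n xy] by metis
    then show "c (fst (fst D (x, r))) \<in> {x \<in> {1..int n}. snd (fst D (x, r)) = r} \<and>
         c (fst (fst D (c (fst (fst D (x, r))), r))) = x \<and> c (fst (fst D (x, r))) \<noteq> x"
      using x c1 cy c3 c4 by (simp add: xy)
  qed (auto intro: finite_subset[of _ "{1..int n}"])
qed

lemma num_vertical_horizontal:
  "num_vertical n D + card {x \<in> {1..int n}. snd (fst D (x, True)) = True} = n"
proof -
  have "card ({a \<in> {1..int n}. snd (fst D (a, True)) = False} \<union> {x \<in> {1..int n}. snd (fst D (x, True)) = True}) =
      num_vertical n D + card {x \<in> {1..int n}. snd (fst D (x, True)) = True}"
    unfolding num_vertical_def
    by (rule card_Un_disjoint) (auto intro: finite_subset[of _ "{1..int n}"])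
  moreover have "{a \<in> {1..int n}. snd (fst D (a, True)) = False} \<union> {x \<in> {1..int n}. snd (fst D (x, True)) = True} = {1..int n}"
    by auto
  ultimately show ?thesis by simp
qed

text \<open>The local condition \<open>even_diag\<close> replaces the requirement that every line \<open>x = i + 1/2\<close> is met
  an even number of times.\<close>

definition height_parity :: "node \<Rightarrow> int" where
  "height_parity p = fst p + (if snd p then 1 else 0)"

definition even_diag :: "diagram \<Rightarrow> bool" where
  "even_diag D \<longleftrightarrow> (\<forall>p. odd (height_parity p + height_parity (fst D p)))"

lemma even_diag_same: "even_diag D \<Longrightarrow> fst D (x, r) = (y, r) \<Longrightarrow> odd (x + y)"
  unfolding even_diag_def by (drule spec[of _ "(x, r)"]) (auto simp: height_parity_def split: if_splits)

lemma even_diag_diff: "even_diag D \<Longrightarrow> fst D (x, r) = (y, \<not> r) \<Longrightarrow> even (x + y)"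
  unfolding even_diag_def by (drule spec[of _ "(x, r)"]) (auto simp: height_parity_def split: if_splits)

lemma even_diagI:
  assumes "\<And>x y r. fst D (x, r) = (y, r) \<Longrightarrow> odd (x + y)" "\<And>x y r. fst D (x, r) = (y, \<not> r) \<Longrightarrow> even (x + y)"
  shows "even_diag D"
  unfolding even_diag_def
proof
  fix p :: node
  obtain x r where p: "p = (x, r)" by (cases p)
  obtain y s where q: "fst D p = (y, s)" by (cases "fst D p")
  show "odd (height_parity p + height_parity (fst D p))"
    using assms(1)[of x r y] assms(2)[of x r y] p q by (cases "s = r") (auto simp: height_parity_def)
qed

lemma odd_num_vertical: "good n D \<Longrightarrow> odd n \<Longrightarrow> odd (num_vertical n D)"
  using even_card_horizontal[of n D True] num_vertical_horizontal[of n D] by (metis even_add odd_pos)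

locale odd_size =
  fixes n :: nat
  assumes odd_n: "odd n" and n3: "n \<ge> 3"
begin

lemma n_pos: "n > 0" using n3 by simp

text \<open>Contains the diagrams of the algebra and agrees with them below n vertical edges. With n
  vertical edges it is larger: shifts of the identity by nonzero even amounts lie in it.\<close>

definition Dg :: "diagram set" where
  "Dg = {D. good n D \<and> planar (fst D) \<and> even_diag D \<and> snd D = 0}"

text \<open>Horizontally joined nodes of a row come in pairs modulo n, so an odd number n of
  residues leaves one over.\<close>

lemma ex_vertical:
  assumes g: "good n D"
  shows "\<exists>c. snd (fst D (c, r)) \<noteq> r"
proof (rule ccontr)
  assume "\<not> ?thesis"
  then have "{x \<in> {1..int n}. snd (fst D (x, r)) = r} = {1..int n}" by auto
  then show False using even_card_horizontal[OF g n_pos, of r] odd_n by simp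
qed

lemma planar_nest:
  assumes "planar (fst D)" "good n D" "fst D (a, r) = (b, r)" "a < c" "c < b"
  shows "snd (fst D (c, r)) = r" "a < fst (fst D (c, r))" "fst (fst D (c, r)) < b"
proof -
  have "is_diagram n (fst D, 0)" by (rule planar_is_diagram) (use assms in \<open>auto simp: good_def\<close>)
  then show "snd (fst D (c, r)) = r" "a < fst (fst D (c, r))" "fst (fst D (c, r)) < b"
    using assms(3-5) unfolding is_diagram_def Let_def by auto
qed

lemma planar_mono:
  assumes "planar (fst D)" "good n D" "fst D (a, r) = (b, \<not> r)" "fst D (c, r) = (d, \<not> r)" "a < c"
  shows "b < d"
proof -
  have "is_diagram n (fst D, 0)" by (rule planar_is_diagram) (use assms in \<open>auto simp: good_def\<close>)
  then have mon: "\<And>a b c d. fst D (a, True) = (b, False) \<Longrightarrow> fst D (c, True) = (d, False) \<Longrightarrow> a < c \<Longrightarrow> b < d"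
    unfolding is_diagram_def Let_def fst_conv by blast
  have e: "fst D (b, \<not> r) = (a, r)" "fst D (d, \<not> r) = (c, r)"
    using good_eqD[OF assms(2) assms(3)] good_eqD[OF assms(2) assms(4)] by auto
  show ?thesis
  proof (cases r)
    case True then show ?thesis using mon[of a b c d] assms by auto
  next
    case False
    have "b \<noteq> d" using e assms by auto
    moreover have "\<not> d < b" using mon[of d c b a] e False assms by auto
    ultimately show ?thesis by simp
  qed
qed

text \<open>An arc of length at least n - 1 would cover every residue, hence enclose a translate of
  the end of a vertical edge, which planarity forbids.\<close>

lemma short_arc:
  assumes "planar (fst D)" "good n D" "fst D (a, r) = (b, r)"
  shows "\<bar>b - a\<bar> \<le> int n - 2"
proof -
  have main: "b - a \<le> int n - 2" if ab: "fst D (a, r) = (b, r)" "a < b" for a b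
  proof (rule ccontr)
    assume long: "\<not> ?thesis"
    obtain c where c: "snd (fst D (c, r)) \<noteq> r" using ex_vertical[OF assms(2)] by blast
    define d where "d = a + (c - a) mod int n"
    have "\<exists>z. d = c + z * int n"
    proof -
      have "d mod int n = c mod int n" by (simp add: d_def mod_simps)
      then show ?thesis using mod_translate by metis
    qed
    then have d: "snd (fst D (d, r)) \<noteq> r" using c good_translate[OF assms(2)] by auto
    have "0 \<le> (c - a) mod int n" "(c - a) mod int n < int n" using n_pos by auto
    then have "a \<le> d" "d \<le> b" using long by (auto simp: d_def)
    moreover have "d \<noteq> a" "d \<noteq> b" using d ab good_eqD[OF assms(2) ab(1)] by auto
    ultimately show False using planar_nest(1)[OF assms(1,2) ab(1), of d] d by auto
  qed
  show ?thesis
  proof (cases "a < b")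
    case True then show ?thesis using main assms(3) by simp
  next
    case False
    then have "b < a" using good_nofix[OF assms(2), of "(a, r)"] assms(3) by (cases "a = b") auto
    then show ?thesis using main[OF good_eqD[OF assms(2,3)]] by simp
  qed
qed

section \<open>Left multiplication by a generator\<close>

definition inU :: "int \<Rightarrow> node \<Rightarrow> bool" where
  "inU j p \<longleftrightarrow> snd p \<and> (fst p mod int n = j mod int n \<or> fst p mod int n = (j + 1) mod int n)"

definition eps :: "int \<Rightarrow> node \<Rightarrow> node" where
  "eps j p = (if snd p then if fst p mod int n = j mod int n then (fst p + 1, True)
     else if fst p mod int n = (j + 1) mod int n then (fst p - 1, True) else p else p)"

text \<open>For planar D the matching of E_j D. Nodes in the residues j, j + 1 of the top row take
  the upper arcs of E_j. An edge of D ending there is turned round by a lower arc of E_j and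
  continues along another edge of D; by \<open>inU_step\<close> one turn is enough.\<close>

definition Emul :: "int \<Rightarrow> (node \<Rightarrow> node) \<Rightarrow> node \<Rightarrow> node" where
  "Emul j m x = (if inU j x then eps j x else if inU j (m x) then m (eps j (m x)) else m x)"

lemma res_ne: "(j + 1) mod int n \<noteq> j mod int n"
proof
  assume "(j + 1) mod int n = j mod int n"
  then have "int n dvd 1" by (metis mod_eq_dvd_iff add_diff_cancel_left')
  then show False using n3 by auto
qed

text \<open>Here n \<ge> 3 enters: j - 1 and j + 1 are different residues, so neighbouring
  generators overlap in only one residue.\<close>

lemma res_ne2: "(j + 1) mod int n \<noteq> (j - 1) mod int n"
proof
  assume "(j + 1) mod int n = (j - 1) mod int n"
  then have "int n dvd (j + 1) - (j - 1)" by (metis mod_eq_dvd_iff)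
  then have "int n dvd 2" by simp
  then have "int n \<le> 2" by (rule zdvd_imp_le) simp
  then show False using n3 by auto
qed

lemma res_suc: "x mod int n = j mod int n \<Longrightarrow> (x + 1) mod int n = (j + 1) mod int n"
  by (rule mod_add_cong) auto

lemma res_pred: "x mod int n = (j + 1) mod int n \<Longrightarrow> (x - 1) mod int n = j mod int n"
  using mod_diff_cong[of x "int n" "j + 1" 1 1] by simp

lemma eps_cases:
  assumes "inU j p"
  obtains x where "x mod int n = j mod int n" "p = (x, True)" "eps j p = (x + 1, True)"
  | x where "x mod int n = j mod int n" "p = (x + 1, True)" "eps j p = (x, True)"
proof (cases "fst p mod int n = j mod int n")
  case True
  then show ?thesis using that(1)[of "fst p"] assms by (auto simp: inU_def eps_def prod_eq_iff)
next
  case False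
  then show ?thesis using that(2)[of "fst p - 1"] assms res_pred by (auto simp: inU_def eps_def prod_eq_iff)
qed

lemma eps_simps:
  assumes "inU j p"
  shows "inU j (eps j p)" "eps j (eps j p) = p" "eps j p \<noteq> p" "snd (eps j p)" "snd p"
proof -
  have "inU j (eps j p) \<and> eps j (eps j p) = p \<and> eps j p \<noteq> p \<and> snd (eps j p) \<and> snd p"
    using assms
  proof (cases rule: eps_cases)
    case (1 x)
    then show ?thesis using res_suc[OF 1(1)] unfolding 1(3) unfolding 1(2) by (simp add: inU_def eps_def res_ne)
  next
    case (2 x)
    then show ?thesis using res_suc[OF 2(1)] unfolding 2(3) unfolding 2(2) by (simp add: inU_def eps_def res_ne)
  qed
  then show "inU j (eps j p)" "eps j (eps j p) = p" "eps j p \<noteq> p" "snd (eps j p)" "snd p" by auto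
qed

lemma eps_shift: "eps j (shiftx (z * int n) p) = shiftx (z * int n) (eps j p)"
  and inU_shift: "inU j (shiftx (z * int n) p) \<longleftrightarrow> inU j p"
  by (auto simp: eps_def inU_def shiftx_def prod_eq_iff)

lemma eps_adjacent: "inU j y \<Longrightarrow> r \<noteq> y \<Longrightarrow> r \<noteq> eps j y \<Longrightarrow> \<not> btw y (eps j y) r"
proof -
  assume U: "inU j y" and r: "r \<noteq> y" "r \<noteq> eps j y"
  from U show ?thesis
  proof (cases rule: eps_cases)
    case (1 x)
    then show ?thesis using r unfolding 1(3) 1(2) by (cases r) (auto simp: btw_def prec_def)
  next
    case (2 x)
    then show ?thesis using r unfolding 2(3) 2(2) by (cases r) (auto simp: btw_def prec_def)
  qed
qed

text \<open>The ends have residues j and j + 1, so they are neighbours up to a translate; a nonzero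
  translate would make the arc at least n - 1 long, against \<open>short_arc\<close>.\<close>

lemma inU_pair:
  assumes D: "planar (fst D)" "good n D" and U: "inU j p" "inU j (fst D p)"
  shows "fst D p = eps j p"
proof -
  obtain x where p: "p = (x, True)" using U by (cases p) (auto simp: inU_def)
  obtain y where q: "fst D p = (y, True)" using U by (cases "fst D p") (auto simp: inU_def)
  have e: "fst D (x, True) = (y, True)" using p q by simp
  have sh: "\<bar>y - x\<bar> \<le> int n - 2" by (rule short_arc[OF D e])
  have ne: "x mod int n \<noteq> y mod int n" by (rule good_not_translate[OF D(2) n_pos e])
  have adj: "z = 0" if "\<bar>1 + z * int n\<bar> \<le> int n - 2 \<or> \<bar>- 1 + z * int n\<bar> \<le> int n - 2" for z :: int
  proof (rule ccontr)
    assume "z \<noteq> 0"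
    then have "\<bar>z * int n\<bar> \<ge> int n"
      using mult_right_mono[of 1 "\<bar>z\<bar>" "int n"] by (simp add: abs_mult)
    then show False using that by linarith
  qed
  have "x mod int n = j mod int n \<and> y mod int n = (j + 1) mod int n \<or>
      y mod int n = j mod int n \<and> x mod int n = (j + 1) mod int n"
    using U p q ne by (auto simp: inU_def)
  then show ?thesis
  proof (elim disjE conjE)
    assume a: "x mod int n = j mod int n" "y mod int n = (j + 1) mod int n"
    then have "(x + 1) mod int n = y mod int n" using res_suc[OF a(1)] by simp
    then obtain z where "y = x + 1 + z * int n" using mod_translate by blast
    moreover from this have "z = 0" using adj[of z] sh by (simp add: algebra_simps)
    ultimately show ?thesis using p q a by (simp add: eps_def)
  next
    assume a: "y mod int n = j mod int n" "x mod int n = (j + 1) mod int n"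
    then have "(x - 1) mod int n = y mod int n" using res_pred[OF a(2)] by simp
    then obtain z where "y = x - 1 + z * int n" using mod_translate by blast
    moreover from this have "\<bar>- 1 + z * int n\<bar> \<le> int n - 2" using sh by simp
    then have "z = 0" using adj[of z] by blast
    ultimately show ?thesis using p q a res_ne by (simp add: eps_def)
  qed
qed

lemma E_match:
  assumes "int i mod int n = j mod int n"
  shows "fst (E_diagram n i) p =
    (if inU j (fst p, True) then (fst (eps j (fst p, True)), snd p) else (fst p, \<not> snd p))"
proof -
  have "(int i + 1) mod int n = (j + 1) mod int n" using assms by (rule res_suc)
  then show ?thesis using assms res_ne by (cases p) (auto simp: E_diagram_def inU_def eps_def)
qed

lemma good_E: "good n (E_diagram n i)"
proof -
  define j where "j = int i"
  have m: "fst (E_diagram n i) p = (if inU j (fst p, True) then (fst (eps j (fst p, True)), snd p) else (fst p, \<not> snd p))" for p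
    by (rule E_match) (simp add: j_def)
  have e: "(fst (eps j (x, True)), True) = eps j (x, True)" if "inU j (x, True)" for x
    using eps_simps(4)[OF that] by (auto simp: prod_eq_iff)
  show ?thesis unfolding good_def
  proof (intro conjI allI)
    fix p z
    show "fst (E_diagram n i) p \<noteq> p"
    proof (cases "inU j (fst p, True)")
      case True
      then have "fst (eps j (fst p, True)) \<noteq> fst p" using eps_simps(3)[OF True] e[OF True] by (metis)
      then show ?thesis using True m by (auto simp: prod_eq_iff)
    qed (auto simp: m prod_eq_iff)
    show "fst (E_diagram n i) (fst (E_diagram n i) p) = p"
    proof (cases "inU j (fst p, True)")
      case True
      have "inU j (fst (eps j (fst p, True)), True)" using eps_simps(1)[OF True] by (simp only: e[OF True])
      moreover have "fst (eps j (fst (eps j (fst p, True)), True)) = fst p"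
        using eps_simps(2)[OF True] by (simp only: e[OF True] fst_conv)
      ultimately show ?thesis using True by (simp add: m prod_eq_iff)
    qed (auto simp: m prod_eq_iff)
    show "fst (E_diagram n i) (shiftx (z * int n) p) = shiftx (z * int n) (fst (E_diagram n i) p)"
      using eps_shift[of j z "(fst p, True)"] inU_shift[of j z "(fst p, True)"]
      by (auto simp: m shiftx_def)
  qed
qed

lemma conn_E:
  assumes i: "int i mod int n = j mod int n"
  shows "\<not> inU j y \<Longrightarrow> (liftB y, onode y) \<in> stack_conn (E_diagram n i) D"
    and "inU j y \<Longrightarrow> (liftB y, liftB (eps j y)) \<in> stack_conn (E_diagram n i) D"
    and "inU j y \<Longrightarrow> (onode y, onode (eps j y)) \<in> stack_conn (E_diagram n i) D"
proof -
  note m = E_match[OF i]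
  show "(liftB y, onode y) \<in> stack_conn (E_diagram n i) D" if U: "\<not> inU j y"
  proof (cases "snd y")
    case True
    then have y: "y = (fst y, True)" by (auto simp: prod_eq_iff)
    have "\<not> inU j (fst y, True)" using U y by metis
    then have "actA (E_diagram n i) (liftB y) = onode y"
      using True by (simp add: actA_def liftB_def onode_def m liftA_def)
    then show ?thesis using conn_actA[of "liftB y" "E_diagram n i" D] by simp
  next
    case False
    then have "liftB y = onode y" by (simp add: liftB_def onode_def)
    then show ?thesis by simp
  qed
  assume U: "inU j y"
  have y: "y = (fst y, True)" and y2: "snd (eps j y)" using eps_simps[OF U] by (auto simp: prod_eq_iff)
  have "actA (E_diagram n i) (liftB y) = liftB (eps j y)" "actA (E_diagram n i) (onode y) = onode (eps j y)"
    using U y2 eps_simps(5)[OF U] y by (auto simp: actA_def liftB_def onode_def m liftA_def)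
  then show "(liftB y, liftB (eps j y)) \<in> stack_conn (E_diagram n i) D"
    "(onode y, onode (eps j y)) \<in> stack_conn (E_diagram n i) D"
    using conn_actA[of "liftB y" "E_diagram n i" D] conn_actA[of "onode y" "E_diagram n i" D] by simp_all
qed

lemma inU_step:
  assumes D: "planar (fst D)" "good n D" and x: "\<not> inU j x" "inU j (fst D x)"
  shows "\<not> inU j (fst D (eps j (fst D x)))"
proof
  assume U: "inU j (fst D (eps j (fst D x)))"
  have "fst D (eps j (fst D x)) = eps j (eps j (fst D x))"
    by (rule inU_pair[OF D]) (use U eps_simps x in auto)
  then have "fst D (eps j (fst D x)) = fst D x" using eps_simps x by simp
  then have "eps j (fst D x) = x" using good_invol[OF D(2)] by metis
  then show False using eps_simps(1)[OF x(2)] x by simp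
qed

lemma comp_match_E:
  assumes i: "int i mod int n = j mod int n" and D: "planar (fst D)" "good n D"
  shows "comp_match (E_diagram n i) D = Emul j (fst D)"
proof
  fix x
  note E = conn_E[OF i, of _ D]
  have st: "(liftB y, liftB (fst D y)) \<in> stack_conn (E_diagram n i) D" for y
    using conn_actB[of "liftB y" D "E_diagram n i"] by simp
  show "comp_match (E_diagram n i) D x = Emul j (fst D) x"
  proof (rule comp_match_eqI[OF n_pos good_E D(2)])
    consider "inU j x" | "\<not> inU j x" "inU j (fst D x)" | "\<not> inU j x" "\<not> inU j (fst D x)" by blast
    then have "(onode x, onode (Emul j (fst D) x)) \<in> stack_conn (E_diagram n i) D \<and> Emul j (fst D) x \<noteq> x"
    proof cases
      case 1 then show ?thesis using E(3) eps_simps by (simp add: Emul_def)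
    next
      case 2
      have "Emul j (fst D) x \<noteq> x"
        using 2 good_invol[OF D(2)] eps_simps(3)[OF 2(2)] by (simp add: Emul_def) metis
      moreover have "(onode x, liftB x) \<in> stack_conn (E_diagram n i) D"
        by (rule conn_sym[OF good_E D(2) E(1)[OF 2(1)]])
      then have "(onode x, onode (fst D (eps j (fst D x)))) \<in> stack_conn (E_diagram n i) D"
        using E(1)[OF inU_step[OF D 2]] st[of x] E(2)[OF 2(2)] st[of "eps j (fst D x)"] by (blast intro: conn_trans)
      ultimately show ?thesis using 2 by (simp add: Emul_def)
    next
      case 3
      have "(onode x, liftB x) \<in> stack_conn (E_diagram n i) D"
        by (rule conn_sym[OF good_E D(2) E(1)[OF 3(1)]])
      then have "(onode x, onode (fst D x)) \<in> stack_conn (E_diagram n i) D"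
        using E(1)[OF 3(2)] st[of x] by (blast intro: conn_trans)
      then show ?thesis using 3 good_nofix[OF D(2)] by (simp add: Emul_def)
    qed
    then show "(onode x, onode (Emul j (fst D) x)) \<in> stack_conn (E_diagram n i) D" "Emul j (fst D) x \<noteq> x"
      by auto
  qed
qed

text \<open>A closed component in the middle can only visit the residues j and j + 1, where D must
  have the same arc as E_j by \<open>inU_pair\<close>. It is thus a loop through two nodes.\<close>

lemma num_lines_E:
  assumes D: "planar (fst D)" "good n D"
  shows "num_new_lines n (E_diagram n i) D = 0"
proof -
  define j where "j = int i"
  have i: "int i mod int n = j mod int n" by (simp add: j_def)
  note E = conn_E[OF i, of _ D] and m = E_match[OF i]
  have "u \<notin> mid_nodes (E_diagram n i) D False" for u
  proof
    assume u: "u \<in> mid_nodes (E_diagram n i) D False"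
    then have cm: "closed_mid (E_diagram n i) D u" by (simp add: mid_nodes_def)
    then have "snd u = 1 \<or> snd u = 0" by (simp add: closed_mid_def)
    then obtain p where p: "u = liftB p" using ex_liftB by blast
    have no: "(u, onode y) \<notin> stack_conn (E_diagram n i) D" for y
      using cm by (auto simp: closed_mid_def)
    have U: "inU j p" using E(1) no p by blast
    have up: "(u, liftB (fst D p)) \<in> stack_conn (E_diagram n i) D"
      using conn_actB[of u D "E_diagram n i"] p by simp
    then have "inU j (fst D p)" using E(1)[of "fst D p"] no conn_trans by blast
    then have Dp: "fst D p = eps j p" by (rule inU_pair[OF D U])
    have De: "fst D (eps j p) = p" using Dp good_eqD[OF D(2)] by blast
    have "comp_set (E_diagram n i) D u \<subseteq> {liftB p, liftB (eps j p)}"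
    proof
      fix w assume "w \<in> comp_set (E_diagram n i) D u"
      then have "(u, w) \<in> stack_conn (E_diagram n i) D" by (simp add: comp_set_def)
      then show "w \<in> {liftB p, liftB (eps j p)}"
      proof (rule conn_least)
        show "u \<in> {liftB p, liftB (eps j p)}" using p by simp
      next
        fix x assume x: "x \<in> {liftB p, liftB (eps j p)}"
        have "actA (E_diagram n i) (liftB y) = liftB (eps j y)" if "inU j y" for y
        proof -
          have y: "y = (fst y, True)" "snd (eps j y)" using eps_simps[OF that] by (auto simp: prod_eq_iff)
          then have "snd y" by (metis snd_conv)
          then show ?thesis using y that by (auto simp: actA_def liftB_def m liftA_def)
        qed
        from this[OF U] this[OF eps_simps(1)[OF U]]
        have "actA (E_diagram n i) (liftB p) = liftB (eps j p)" "actA (E_diagram n i) (liftB (eps j p)) = liftB p"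
          using eps_simps(2)[OF U] by simp_all
        then show "actA (E_diagram n i) x \<in> {liftB p, liftB (eps j p)}" using x by auto
        show "actB D x \<in> {liftB p, liftB (eps j p)}" using x Dp De by auto
      qed
    qed
    then have "finite (comp_set (E_diagram n i) D u)" by (rule finite_subset) simp
    then show False using u by (simp add: mid_nodes_def)
  qed
  then have "mid_nodes (E_diagram n i) D False = {}" by blast
  then show ?thesis by (simp add: num_new_lines_conv num_comps_def)
qed

text \<open>A new edge is a short arc, an old edge, or a path made of an old edge, a short arc and
  another old edge. Crossing parity is additive along such a path, old edges do not cross, and an
  arc between neighbours crosses nothing.\<close>

lemma planar_Emul:
  assumes D: "planar (fst D)" "good n D"
  shows "planar (Emul j (fst D))"
proof -
  define m where "m = fst D"
  have inv: "m (m p) = p" for p using good_invol[OF D(2)] by (simp add: m_def)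
  have nc: "\<not> cross p (m p) r (m r)" if "r \<noteq> p" "r \<noteq> m p" for p r
    using D(1) that by (auto simp: planar_def m_def)
  have adj: "\<not> cross y (eps j y) r s" if "inU j y" "r \<notin> {y, eps j y}" "s \<notin> {y, eps j y}" for y r s
    using eps_adjacent[OF that(1)] that by (auto simp: cross_def)
  have A: "\<not> cross (m y) (m (eps j y)) r (m r)"
    if y: "inU j y" and r: "r \<notin> {y, eps j y, m y, m (eps j y)}" for y r
  proof -
    have mr: "m r \<notin> {y, eps j y, m y, m (eps j y)}"
    proof -
      have inj: "a = m b" if "m a = b" for a b using that inv by metis
      show ?thesis using r inj[of r y] inj[of r "eps j y"] inj[of r "m y"] inj[of r "m (eps j y)"] inv by auto
    qed
    have "\<not> cross (m y) y r (m r)" using nc[of r "m y"] r inv by auto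
    moreover have "\<not> cross y (eps j y) r (m r)" using adj[OF y] r mr by auto
    moreover have "\<not> cross (eps j y) (m (eps j y)) r (m r)" using nc[of r "eps j y"] r by auto
    ultimately show ?thesis
      using cross_trans[of "m y" "m (eps j y)" r "m r" y] cross_trans[of y "m (eps j y)" r "m r" "eps j y"] by blast
  qed
  have st: "\<not> inU j (m (eps j (m x)))" if "\<not> inU j x" "inU j (m x)" for x
    using inU_step[OF D] that by (simp add: m_def)
  define m' where "m' = Emul j m"
  have ne: "m' p \<noteq> p" for p
    using good_nofix[OF D(2)] eps_simps inv unfolding m'_def Emul_def m_def[symmetric] by metis
  have main: "\<not> cross p (m' p) r (m' r)" if d: "r \<noteq> p" "r \<noteq> m' p" "m' r \<noteq> p" "m' r \<noteq> m' p" for p r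
  proof -
    have sym: "cross p (m' p) r (m' r) \<longleftrightarrow> cross r (m' r) p (m' p)"
      by (rule cross_sym) (use d in auto)
    consider "inU j p" | "inU j r" | "\<not> inU j p" "\<not> inU j r" by blast
    then show ?thesis
    proof cases
      case 1
      then show ?thesis using adj[OF 1, of r "m' r"] d by (auto simp: m'_def Emul_def)
    next
      case 2
      then show ?thesis unfolding sym using adj[OF 2, of p "m' p"] d by (auto simp: m'_def Emul_def)
    next
      case 3
      show ?thesis
      proof (cases "inU j (m p)")
        case p: True
        define y where "y = m p"
        have y: "inU j y" "p = m y" "m' p = m (eps j y)" "\<not> inU j (m (eps j y))" "\<not> inU j (m y)"
          using p 3 inv st by (auto simp: y_def m'_def Emul_def)
        have Uey: "inU j (eps j y)" using eps_simps y by blast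
        show ?thesis
        proof (cases "inU j (m r)")
          case r: True
          define w where "w = m r"
          have w: "inU j w" "r = m w" "m' r = m (eps j w)" "\<not> inU j (m (eps j w))" "\<not> inU j (m w)"
            using r 3 inv st by (auto simp: w_def m'_def Emul_def)
          have Uew: "inU j (eps j w)" using eps_simps w by blast
          have wy: "w \<notin> {y, eps j y}" "eps j w \<notin> {y, eps j y}"
            using d w y eps_simps(2)[OF w(1)] eps_simps(2)[OF y(1)] by (metis insert_iff singleton_iff)+
          \<comment> \<open>Both edges are of the turned kind; the second one is now split along w
            and \<open>eps j w\<close> as well.\<close>
          have "\<not> cross (m y) (m (eps j y)) (m w) w"
          proof -
            have "m w \<noteq> y" "m w \<noteq> eps j y" using w(5) y(1) Uey by metis+
            then show ?thesis using A[OF y(1), of "m w"] inv d w y by auto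
          qed
          moreover have "\<not> cross (m y) (m (eps j y)) w (eps j w)"
          proof -
            have "cross (m y) (m (eps j y)) w (eps j w) \<longleftrightarrow> cross w (eps j w) (m y) (m (eps j y))"
              by (rule cross_sym) (use w y Uew in metis)+
            moreover have "m y \<noteq> w" "m y \<noteq> eps j w" "m (eps j y) \<noteq> w" "m (eps j y) \<noteq> eps j w"
              using w(1) y Uew by metis+
            ultimately show ?thesis using adj[OF w(1), of "m y" "m (eps j y)"] by blast
          qed
          moreover have "\<not> cross (m y) (m (eps j y)) (eps j w) (m (eps j w))"
          proof -
            have "eps j w \<noteq> m y" "eps j w \<noteq> m (eps j y)" using y Uew by metis+
            then show ?thesis using A[OF y(1), of "eps j w"] wy by blast
          qed
          ultimately show ?thesis unfolding y(3) w(3) unfolding y(2) w(2)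
            using cross_trans2[of "m y" "m (eps j y)" "m w" "m (eps j w)" w]
              cross_trans2[of "m y" "m (eps j y)" w "m (eps j w)" "eps j w"] by blast
        next
          case r: False
          have "m' r = m r" using r 3 by (simp add: m'_def Emul_def)
          moreover have "r \<notin> {y, eps j y, m y, m (eps j y)}" using d y 3 Uey by auto
          ultimately show ?thesis using A[OF y(1), of r] y by simp
        qed
      next
        case p: False
        have mp: "m' p = m p" using p 3 by (simp add: m'_def Emul_def)
        show ?thesis
        proof (cases "inU j (m r)")
          case r: True
          define w where "w = m r"
          have w: "inU j w" "r = m w" "m' r = m (eps j w)"
            using r 3 inv st by (auto simp: w_def m'_def Emul_def)
          have Uew: "inU j (eps j w)" using eps_simps w by blast
          have "p \<notin> {w, eps j w, m w, m (eps j w)}" using d w 3 Uew by auto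
          then show ?thesis unfolding sym using A[OF w(1), of p] w mp by simp
        next
          case r: False
          have "m' r = m r" using r 3 by (simp add: m'_def Emul_def)
          then show ?thesis using nc[of r p] d mp by simp
        qed
      qed
    qed
  qed
  have inv': "m' (m' p) = p" for p
  proof -
    consider "inU j p" | "\<not> inU j p" "inU j (m p)" | "\<not> inU j p" "\<not> inU j (m p)" by blast
    then show ?thesis
    proof cases
      case 1 then show ?thesis using eps_simps by (simp add: m'_def Emul_def)
    next
      case 2
      then show ?thesis using st[OF 2] eps_simps[OF 2(2)] inv by (simp add: m'_def Emul_def)
    next
      case 3 then show ?thesis using inv by (simp add: m'_def Emul_def)
    qed
  qed
  show ?thesis unfolding planar_def m_def[symmetric] m'_def[symmetric]
  proof (intro allI impI)
    fix p r assume "r \<noteq> p \<and> r \<noteq> m' p"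
    then show "\<not> cross p (m' p) r (m' r)" using main[of r p] inv' by metis
  qed
qed

lemma Dg_E:
  assumes D: "D \<in> Dg" and i: "int i mod int n = j mod int n"
  shows "diag_comp n (E_diagram n i) D = (Emul j (fst D), 0)" "(Emul j (fst D), 0) \<in> Dg"
proof -
  have D': "planar (fst D)" "good n D" "even_diag D" "snd D = 0" using D by (auto simp: Dg_def)
  show eq: "diag_comp n (E_diagram n i) D = (Emul j (fst D), 0)"
    using comp_match_E[OF i D'(1,2)] num_lines_E[OF D'(1,2)] D'(4)
    by (simp add: diag_comp_def E_diagram_def)
  have "good n (Emul j (fst D), 0)"
    using good_comp[OF n_pos good_E D'(2), of i] unfolding eq .
  moreover have "even_diag (Emul j (fst D), 0)"
    unfolding even_diag_def
  proof
    fix p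
    have ep: "odd (height_parity p + height_parity (fst D p))" for p using D'(3) unfolding even_diag_def by blast
    have ee: "odd (height_parity y + height_parity (eps j y))" if "inU j y" for y
      using that by (cases rule: eps_cases[OF that]) (auto simp: height_parity_def)
    show "odd (height_parity p + height_parity (fst (Emul j (fst D), 0) p))"
    proof (cases "\<not> inU j p \<and> inU j (fst D p)")
      case True
      then have "fst (Emul j (fst D), 0) p = fst D (eps j (fst D p))" by (simp add: Emul_def)
      then show ?thesis using ep[of p] ep[of "eps j (fst D p)"] ee[of "fst D p"] True
        by simp
    next
      case False
      then have "fst (Emul j (fst D), 0) p = (if inU j p then eps j p else fst D p)" by (auto simp: Emul_def)
      then show ?thesis using ep[of p] ee[of p] by simp
    qed
  qed
  ultimately show "(Emul j (fst D), 0) \<in> Dg" using planar_Emul[OF D'(1,2)] by (simp add: Dg_def)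
qed

lemma id_match [simp]: "fst id_diagram p = (fst p, \<not> snd p)" "snd id_diagram = 0"
  by (cases p; simp add: id_diagram_def)+

lemma id_is_diagram: "is_diagram n id_diagram"
  by (auto simp: is_diagram_def Let_def)

lemma good_id: "good n id_diagram"
  by (rule is_diagram_planar[OF id_is_diagram])

lemma id_Dg: "id_diagram \<in> Dg"
  using is_diagram_planar[OF id_is_diagram] by (auto simp: Dg_def even_diag_def height_parity_def)

lemma comp_id_left:
  assumes B: "good n B"
  shows "diag_comp n id_diagram B = B"
proof -
  have c: "(liftB p, onode p) \<in> stack_conn id_diagram B" for p
  proof (cases "snd p")
    case True
    then have "actA id_diagram (liftB p) = onode p" by (simp add: actA_def liftB_def onode_def liftA_def)
    then show ?thesis using conn_actA by metis
  next
    case False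
    then have "liftB p = onode p" by (simp add: liftB_def onode_def)
    then show ?thesis by simp
  qed
  have "comp_match id_diagram B p = fst B p" for p
  proof (rule comp_match_eqI[OF n_pos good_id B])
    have "(onode p, liftB p) \<in> stack_conn id_diagram B" by (rule conn_sym[OF good_id B c])
    moreover have "(liftB p, liftB (fst B p)) \<in> stack_conn id_diagram B"
      using conn_actB[of "liftB p" B id_diagram] by simp
    ultimately show "(onode p, onode (fst B p)) \<in> stack_conn id_diagram B" using c conn_trans by blast
  qed (use good_nofix[OF B] in auto)
  moreover have "mid_nodes id_diagram B False = {}"
  proof -
    have "\<not> closed_mid id_diagram B u" for u
    proof
      assume cm: "closed_mid id_diagram B u"
      then have "snd u = 1 \<or> snd u = 0" by (simp add: closed_mid_def)
      then obtain p where "u = liftB p" using ex_liftB by blast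
      then show False using cm c[of p] outer_onode unfolding closed_mid_def by blast
    qed
    then show ?thesis by (simp add: mid_nodes_def)
  qed
  ultimately show ?thesis
    by (auto simp: diag_comp_def num_new_lines_conv num_comps_def prod_eq_iff)
qed

lemma E_comp_id: "diag_comp n (E_diagram n i) id_diagram = E_diagram n i"
proof -
  define j where "j = int i"
  have i: "int i mod int n = j mod int n" by (simp add: j_def)
  have "Emul j (fst id_diagram) p = fst (E_diagram n i) p" for p
  proof (cases "snd p")
    case True
    then have p: "(fst p, True) = p" by (auto simp: prod_eq_iff)
    show ?thesis
    proof (cases "inU j p")
      case U: True
      show ?thesis using U True eps_simps[OF U] unfolding E_match[OF i] p by (simp add: Emul_def prod_eq_iff)
    next
      case U: False
      then show ?thesis using True unfolding E_match[OF i] p by (auto simp: Emul_def inU_def)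
    qed
  next
    case False
    then show ?thesis unfolding E_match[OF i] using eps_simps[of j "(fst p, True)"]
      by (auto simp: Emul_def inU_def)
  qed
  then show ?thesis using Dg_E(1)[OF id_Dg i] by (auto simp: prod_eq_iff E_diagram_def)
qed

text \<open>By associativity it suffices to multiply by single generators from the left, which is
  the product computed by \<open>Emul\<close>.\<close>

inductive_set words :: "diagram set" where
  words_id: "id_diagram \<in> words"
| words_E: "1 \<le> i \<Longrightarrow> i \<le> n \<Longrightarrow> D \<in> words \<Longrightarrow> diag_comp n (E_diagram n i) D \<in> words"

lemma words_Dg: "D \<in> words \<Longrightarrow> D \<in> Dg"
proof (induction rule: words.induct)
  case (words_E i D)
  then show ?case using Dg_E[of D i "int i"] by simp
qed (rule id_Dg)

lemma Dg_good: "D \<in> Dg \<Longrightarrow> good n D"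
  by (simp add: Dg_def)

lemma words_mult: "A \<in> words \<Longrightarrow> B \<in> words \<Longrightarrow> diag_comp n A B \<in> words"
proof (induction arbitrary: B rule: words.induct)
  case words_id
  then show ?case using comp_id_left Dg_good words_Dg by metis
next
  case (words_E i D)
  have "diag_comp n (diag_comp n (E_diagram n i) D) B = diag_comp n (E_diagram n i) (diag_comp n D B)"
    by (rule diag_comp_assoc[OF n_pos good_E]) (use words_E Dg_good words_Dg in blast)+
  then show ?case using words_E words.words_E by simp
qed

lemma TL_words: "TL_diagrams n = words"
proof
  show "TL_diagrams n \<subseteq> words"
  proof
    fix D assume "D \<in> TL_diagrams n"
    then show "D \<in> words"
    proof induction
      case (TL_E i)
      then show ?case using words_E[OF TL_E words_id] E_comp_id by simp
    qed (auto intro: words_id words_mult)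
  qed
  show "words \<subseteq> TL_diagrams n"
  proof
    fix D assume "D \<in> words"
    then show "D \<in> TL_diagrams n"
      by induction (auto intro: TL_diagrams.intros)
  qed
qed

lemma TL_Dg: "D \<in> TL_diagrams n \<Longrightarrow> D \<in> Dg"
  using TL_words words_Dg by blast

lemma TL_good: "D \<in> TL_diagrams n \<Longrightarrow> good n D"
  using TL_Dg Dg_good by blast

lemma flip_id: "flipd id_diagram = id_diagram"
  by (simp add: prod_eq_iff fun_eq_iff flipd_def flipn_def)

lemma flip_E: "flipd (E_diagram n i) = E_diagram n i"
proof -
  have "fst (flipd (E_diagram n i)) p = fst (E_diagram n i) p" for p
    using E_match[of i "int i" p] E_match[of i "int i" "flipn p"] by (simp add: prod_eq_iff flipn_def)
  then show ?thesis by (auto simp: prod_eq_iff fun_eq_iff)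
qed

lemma TL_flip: "D \<in> TL_diagrams n \<Longrightarrow> flipd D \<in> TL_diagrams n"
proof (induction rule: TL_diagrams.induct)
  case (TL_mult A B)
  then show ?case using flipd_comp[OF n_pos TL_good TL_good, of A B] TL_diagrams.TL_mult by simp
qed (auto simp: flip_id flip_E intro: TL_diagrams.intros)

end

context odd_size
begin

section \<open>All even diagrams with a horizontal edge are products of generators\<close>

definition canon :: "int \<Rightarrow> int" where
  "canon x = (x - 1) mod int n + 1"

lemma canon_bounds: "canon x \<in> {1..int n}"
proof -
  have "(x - 1) mod int n < int n" "0 \<le> (x - 1) mod int n" using n_pos by auto
  then have "0 + 1 \<le> (x - 1) mod int n + 1" "(x - 1) mod int n + 1 \<le> int n" by linarith+
  then show ?thesis unfolding canon_def by auto
qed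

lemma canon_translate: "\<exists>z. canon x = x + z * int n"
proof -
  define d where "d = (x - 1) div int n"
  have "d * int n + (x - 1) mod int n = x - 1" unfolding d_def by (rule div_mult_mod_eq)
  then have "canon x = x + (- d) * int n" unfolding canon_def by linarith
  then show ?thesis by blast
qed

lemma canon_add [simp]: "canon (x + z * int n) = canon x"
  using mod_mult_self1[of "x - 1" z "int n"] by (simp add: canon_def algebra_simps)

lemma canon_id: "x \<in> {1..int n} \<Longrightarrow> canon x = x"
  by (simp add: canon_def)

definition cnode :: "node \<Rightarrow> node" where
  "cnode p = (canon (fst p), snd p)"

lemma cnode_shift [simp]: "cnode (shiftx (z * int n) p) = cnode p"
  by (simp add: cnode_def)

lemma cnode_ex: "\<exists>z. cnode p = shiftx (z * int n) p"
  using canon_translate[of "fst p"] by (auto simp: cnode_def shiftx_def)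

definition nodes1 :: "node set" where
  "nodes1 = {1..int n} \<times> UNIV"

lemma finite_nodes1 [simp]: "finite nodes1"
  by (simp add: nodes1_def)

lemma cnode_in: "cnode p \<in> nodes1"
  using canon_bounds by (auto simp: cnode_def nodes1_def)

lemma cnode_id: "p \<in> nodes1 \<Longrightarrow> cnode p = p"
  using canon_id by (auto simp: cnode_def nodes1_def prod_eq_iff)

definition disp :: "(node \<Rightarrow> node) \<Rightarrow> node \<Rightarrow> nat" where
  "disp m p = nat \<bar>fst (m p) - fst p\<bar>"

text \<open>The termination measure: every rewriting of a diagram that is not flat shortens the
  edges over one period in total.\<close>

definition energy :: "diagram \<Rightarrow> nat" where
  "energy D = (\<Sum>p\<in>nodes1. disp (fst D) p)"

lemma disp_shift: "good n D \<Longrightarrow> disp (fst D) (shiftx (z * int n) p) = disp (fst D) p"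
  by (simp add: disp_def good_shift)

lemma energy_flip: "energy (flipd D) = energy D"
  unfolding energy_def
  by (rule sum.reindex_bij_witness[where i = flipn and j = flipn])
    (auto simp: nodes1_def disp_def flipn_def)

text \<open>The two generators \<open>j\<close> and \<open>k\<close> overlap in exactly one node of each period.\<close>

definition adjacent :: "int \<Rightarrow> int \<Rightarrow> bool" where
  "adjacent j k \<longleftrightarrow> (\<forall>x. (inU k x \<and> \<not> inU j x \<longrightarrow> inU j (eps k x) \<and> \<not> inU k (eps j (eps k x))) \<and>
     (inU j x \<and> \<not> inU k x \<longrightarrow> inU k (eps j x) \<and> \<not> inU j (eps k (eps j x))))"

lemma adjacent_sym: "adjacent j k \<Longrightarrow> adjacent k j"
  unfolding adjacent_def by blast

lemma res_iff: "x mod int n = (j + 1) mod int n \<longleftrightarrow> (x - 1) mod int n = j mod int n"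
proof
  assume "(x - 1) mod int n = j mod int n"
  from res_suc[OF this] show "x mod int n = (j + 1) mod int n" by simp
qed (rule res_pred)

lemma inU_classes: "inU j (x, True) \<longleftrightarrow> x mod int n = j mod int n \<or> (x - 1) mod int n = j mod int n"
  unfolding inU_def res_iff by simp

lemma eps_lo: "x mod int n = j mod int n \<Longrightarrow> eps j (x, True) = (x + 1, True)"
  by (simp add: eps_def)

lemma eps_hi: "(x - 1) mod int n = j mod int n \<Longrightarrow> eps j (x, True) = (x - 1, True)"
  using res_ne[of j] unfolding eps_def fst_conv snd_conv res_iff[symmetric] by simp

lemma adjacent_Suc: "adjacent j (j + 1)"
proof -
  note s1 = res_iff[of "x - 1" j for x] and s2 = res_iff[of _ j]
  have d1: "(y + 1) mod int n \<noteq> y mod int n" "(y + 2) mod int n \<noteq> y mod int n" for y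
    using res_ne[of y] res_ne2[of "y + 1"] by (auto simp: add.commute)
  show ?thesis
    unfolding adjacent_def
  proof (intro allI conjI impI)
    fix x assume x: "inU (j + 1) x \<and> \<not> inU j x"
    obtain y where y: "x = (y, True)" using x by (cases x) (auto simp: inU_def)
    have c: "(y - 1 - 1) mod int n = j mod int n" using x unfolding y inU_classes s1 s2 by blast
    then have e: "eps (j + 1) x = (y - 1, True)" using eps_hi[of y "j + 1"] s1[of y] y by simp
    have e2: "eps j (y - 1, True) = (y - 2, True)" using eps_hi[of "y - 1" j] c by simp
    show "inU j (eps (j + 1) x)" unfolding e inU_classes using c by simp
    have "(y - 2) mod int n = j mod int n" using c by simp
    moreover have "(y - 2 - 1) mod int n \<noteq> (y - 2) mod int n" "(y - 2 - 1 - 1) mod int n \<noteq> (y - 2) mod int n"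
      using d1(1)[of "y - 3"] d1(2)[of "y - 4"] by auto
    ultimately show "\<not> inU (j + 1) (eps j (eps (j + 1) x))" unfolding e e2 inU_classes s1 s2 by metis
  next
    fix x assume x: "inU j x \<and> \<not> inU (j + 1) x"
    obtain y where y: "x = (y, True)" using x by (cases x) (auto simp: inU_def)
    have c: "y mod int n = j mod int n" using x unfolding y inU_classes s2 by blast
    then have e: "eps j x = (y + 1, True)" using eps_lo y by simp
    have c1: "(y + 1) mod int n = (j + 1) mod int n" by (rule res_suc[OF c])
    have e2: "eps (j + 1) (y + 1, True) = (y + 2, True)" using eps_lo[OF c1] by simp
    show "inU (j + 1) (eps j x)" unfolding e inU_classes using c1 by simp
    show "\<not> inU j (eps (j + 1) (eps j x))" unfolding e e2 inU_classes
      using d1[of y] c by (auto simp: algebra_simps)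
  qed
qed

text \<open>The relation E_j E_k E_j = E_j for neighbouring generators, applied to a diagram that
  already carries the upper arcs of E_j.\<close>

lemma Emul_move:
  assumes D: "good n D" and adj: "adjacent j k" and cup: "\<And>y. inU j y \<Longrightarrow> fst D y = eps j y"
  shows "Emul j (Emul k (fst D)) = fst D"
proof
  fix x
  have inv: "fst D (fst D p) = p" for p by (rule good_invol[OF D])
  have outj: "\<not> inU j (fst D x)" if "\<not> inU j x"
    using cup[of "fst D x"] inv eps_simps(1) that by metis
  consider "inU j x" | "\<not> inU j x" "inU k x" | "\<not> inU j x" "\<not> inU k x" "inU k (fst D x)"
    | "\<not> inU j x" "\<not> inU k x" "\<not> inU k (fst D x)" by blast
  then show "Emul j (Emul k (fst D)) x = fst D x"
  proof cases
    case 1 then show ?thesis using cup by (simp add: Emul_def)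
  next
    case 2
    have a: "inU j (eps k x)" "\<not> inU k (eps j (eps k x))" using adj 2 unfolding adjacent_def by blast+
    have "fst D (eps j (eps k x)) = eps k x" using cup[OF eps_simps(1)[OF a(1)]] eps_simps(2)[OF a(1)] by simp
    then show ?thesis using 2 a eps_simps[OF 2(2)] by (simp add: Emul_def)
  next
    case 3
    have a: "inU j (eps k (fst D x))" "\<not> inU k (eps j (eps k (fst D x)))"
      using adj 3 outj unfolding adjacent_def by blast+
    have f: "fst D (eps k (fst D x)) = eps j (eps k (fst D x))" using cup[OF a(1)] .
    then show ?thesis using 3 a eps_simps[OF 3(3)] eps_simps[OF a(1)] by (simp add: Emul_def)
  next
    case 4
    then show ?thesis using outj by (simp add: Emul_def)
  qed
qed

text \<open>Multiplying by E_k trades the arcs at j for arcs at k of the same length 1, and slides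
  the end x of each affected edge to \<open>eps j (eps k x)\<close>. The hypothesis
  \<open>dec\<close> says that this slide shortens the edge.\<close>

lemma energy_move:
  assumes D: "D \<in> Dg" and adj: "adjacent j k" and cup: "\<And>y. inU j y \<Longrightarrow> fst D y = eps j y"
    and dec: "\<And>x. inU k x \<Longrightarrow> \<not> inU j x \<Longrightarrow>
       \<bar>fst (fst D x) - fst (eps j (eps k x))\<bar> < \<bar>fst (fst D x) - fst x\<bar>"
    and ex: "inU k x0" "\<not> inU j x0"
  shows "energy (Emul k (fst D), 0) < energy D"
proof -
  have g: "good n D" using D by (rule Dg_good)
  define m where "m = fst D"
  define m' where "m' = Emul k m"
  have "int (nat (k mod int n)) mod int n = k mod int n" using n_pos by simp
  from Dg_E(2)[OF D this] have g': "good n (m', 0)" by (simp add: Dg_def m'_def m_def)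
  have inv: "m (m p) = p" for p unfolding m_def by (rule good_invol[OF g])
  have mcup: "inU j y \<Longrightarrow> m y = eps j y" for y using cup by (simp add: m_def)
  have outj: "\<not> inU j (m x)" if "\<not> inU j x" for x
    using mcup[of "m x"] inv eps_simps(1) that by metis
  have a1: "inU j (eps k x)" "\<not> inU k (eps j (eps k x))" if "inU k x" "\<not> inU j x" for x
    using adj that unfolding adjacent_def by blast+
  have a2: "inU k (eps j x)" "\<not> inU j (eps k (eps j x))" if "inU j x" "\<not> inU k x" for x
    using adj that unfolding adjacent_def by blast+
  have eps1: "nat \<bar>fst (eps i y) - fst y\<bar> = 1" if "inU i y" for i y
    using that by (cases rule: eps_cases[OF that]) simp_all
  \<comment> \<open>\<open>\<pi>\<close> exchanges the old end of a moved edge with its new end and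
    fixes the other nodes. The new displacement at \<open>\<pi> q\<close> is compared with the old
    one at q.\<close>
  define \<pi> where "\<pi> q = (if inU k q \<and> \<not> inU j q then eps j (eps k q)
      else if inU j q \<and> \<not> inU k q then eps k (eps j q) else q)" for q
  have pipi: "\<pi> (\<pi> q) = q" for q
  proof -
    consider "inU k q" "\<not> inU j q" | "inU j q" "\<not> inU k q" | "inU j q \<longleftrightarrow> inU k q" by blast
    then show ?thesis
    proof cases
      case 1
      then have "inU j (eps j (eps k q))" using a1[OF 1] eps_simps(1) by blast
      then show ?thesis using 1 a1[OF 1] eps_simps(2) by (simp add: \<pi>_def)
    next
      case 2
      then have "inU k (eps k (eps j q))" using a2[OF 2] eps_simps(1) by blast
      then show ?thesis using 2 a2[OF 2] eps_simps(2) by (simp add: \<pi>_def)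
    qed (simp add: \<pi>_def)
  qed
  have pish: "\<pi> (shiftx (z * int n) q) = shiftx (z * int n) (\<pi> q)" for z q
    by (simp add: \<pi>_def inU_shift eps_shift)
  have le: "disp m' (\<pi> q) \<le> disp m q \<and> (inU k q \<and> \<not> inU j q \<longrightarrow> disp m' (\<pi> q) < disp m q)" for q
  proof -
    consider "inU k q" "\<not> inU j q" | "inU j q" "\<not> inU k q" | "inU j q" "inU k q" |
      "\<not> inU j q" "\<not> inU k q" by blast
    then show ?thesis
    proof cases
      case 1
      have pq: "\<pi> q = eps j (eps k q)" using 1 by (simp add: \<pi>_def)
      have "m (eps j (eps k q)) = eps k q" using mcup a1[OF 1] eps_simps by simp
      then have "m' (\<pi> q) = m q" using a1[OF 1] eps_simps[OF 1(1)] by (simp add: pq m'_def Emul_def)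
      moreover have "\<bar>fst (m q) - fst (\<pi> q)\<bar> < \<bar>fst (m q) - fst q\<bar>" using dec[OF 1] by (simp add: pq m_def)
      ultimately have "disp m' (\<pi> q) < disp m q" by (simp add: disp_def)
      then show ?thesis by simp
    next
      case 2
      have pq: "\<pi> q = eps k (eps j q)" using 2 by (simp add: \<pi>_def)
      have U: "inU k (\<pi> q)" using pq eps_simps(1)[OF a2(1)[OF 2]] by simp
      have "m' (\<pi> q) = eps k (\<pi> q)" using U by (simp add: m'_def Emul_def)
      then show ?thesis using eps1[OF U] eps1[OF 2(1)] mcup[OF 2(1)] 2 by (simp add: disp_def)
    next
      case 3
      then show ?thesis using eps1[of k q] eps1[of j q] mcup[of q] by (simp add: disp_def \<pi>_def m'_def Emul_def)
    next
      case 4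
      have pq: "\<pi> q = q" using 4 by (simp add: \<pi>_def)
      show ?thesis
      proof (cases "inU k (m q)")
        case True
        note t = True outj[OF 4(1)]
        have "m' q = eps j (eps k (m q))" using 4 True mcup[OF a1(1)[OF t]] by (simp add: m'_def Emul_def)
        moreover have "\<bar>fst q - fst (eps j (eps k (m q)))\<bar> < \<bar>fst q - fst (m q)\<bar>"
          using dec[OF t] inv by (simp add: m_def)
        ultimately show ?thesis using 4 by (simp add: pq disp_def)
      next
        case False
        then show ?thesis using 4 by (simp add: pq m'_def Emul_def disp_def)
      qed
    qed
  qed
  have dsh: "disp m' (shiftx (z * int n) p) = disp m' p" for z p using disp_shift[OF g'] by simp
  have "energy (m', 0) = (\<Sum>q\<in>nodes1. disp m' (\<pi> q))"
    unfolding energy_def fst_conv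
  proof (rule sum.reindex_bij_witness[where i = "\<lambda>q. cnode (\<pi> q)" and j = "\<lambda>q. cnode (\<pi> q)"])
    fix q assume q: "q \<in> nodes1"
    show "cnode (\<pi> (cnode (\<pi> q))) = q"
      using cnode_ex[of "\<pi> q"] pipi[of q] cnode_id[OF q] by (auto simp: pish)
    show "disp m' (\<pi> (cnode (\<pi> q))) = disp m' q"
      using cnode_ex[of "\<pi> q"] pipi[of q] by (auto simp: pish dsh)
  next
    fix q assume q: "q \<in> nodes1"
    show "cnode (\<pi> (cnode (\<pi> q))) = q"
      using cnode_ex[of "\<pi> q"] pipi[of q] cnode_id[OF q] by (auto simp: pish)
  qed (auto simp: cnode_in)
  also have "\<dots> < (\<Sum>q\<in>nodes1. disp m q)"
  proof (rule sum_strict_mono_ex1)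
    obtain z where z: "cnode x0 = shiftx (z * int n) x0" using cnode_ex by blast
    have "inU k (cnode x0) \<and> \<not> inU j (cnode x0)" using ex by (simp add: z inU_shift)
    then show "\<exists>q\<in>nodes1. disp m' (\<pi> q) < disp m q" using le cnode_in by blast
  qed (use le in auto)
  finally show ?thesis by (simp add: energy_def m_def m'_def)
qed

lemma TL_if_Emul:
  assumes "D' \<in> TL_diagrams n" "D \<in> Dg" "fst D = Emul j (fst D')"
  shows "D \<in> TL_diagrams n"
proof -
  define i where "i = nat (canon j)"
  have cb: "1 \<le> canon j" "canon j \<le> int n" using canon_bounds[of j] by auto
  then have ii: "1 \<le> i" "i \<le> n" "int i = canon j" by (auto simp: i_def)
  obtain z where "canon j = j + z * int n" using canon_translate by blast
  then have "int i mod int n = j mod int n" using ii by simp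
  from Dg_E(1)[OF TL_Dg[OF assms(1)] this]
  have "D = diag_comp n (E_diagram n i) D'" using assms by (auto simp: Dg_def prod_eq_iff)
  then show ?thesis using TL_diagrams.TL_mult[OF TL_diagrams.TL_E[OF ii(1,2)] assms(1)] by simp
qed

lemma vertical_card:
  assumes g: "good n D"
  shows "card {x \<in> {1..int n}. snd (fst D (x, r)) \<noteq> r} = card {x \<in> {1..int n}. snd (fst D (x, \<not> r)) = r}"
proof (rule bij_betw_same_card)
  let ?f = "\<lambda>r x. canon (fst (fst D (x, r)))"
  have k: "?f r x \<in> {x \<in> {1..int n}. snd (fst D (x, \<not> r)) = r} \<and> ?f (\<not> r) (?f r x) = x"
    if x: "x \<in> {x \<in> {1..int n}. snd (fst D (x, r)) \<noteq> r}" for r x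
  proof -
    obtain y where y: "fst D (x, r) = (y, \<not> r)" using x by (cases "fst D (x, r)") auto
    then have y2: "fst D (y, \<not> r) = (x, r)" by (rule good_eqD[OF g])
    obtain z where z: "canon y = y + z * int n" using canon_translate by blast
    have "fst D (canon y, \<not> r) = (x + z * int n, r)" unfolding z good_translate[OF g] y2 by simp
    then show ?thesis using y canon_bounds canon_id x by simp
  qed
  show "bij_betw (?f r) {x \<in> {1..int n}. snd (fst D (x, r)) \<noteq> r} {x \<in> {1..int n}. snd (fst D (x, \<not> r)) = r}"
    by (rule bij_betwI[where g = "?f (\<not> r)"]) (use k[of _ r] k[of _ "\<not> r"] in auto)
qed

lemma num_vertical_row:
  assumes g: "good n D"
  shows "num_vertical n D = card {x \<in> {1..int n}. snd (fst D (x, r)) \<noteq> r}"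
proof (cases r)
  case True then show ?thesis by (simp add: num_vertical_def)
next
  case False
  have "num_vertical n D = card {x \<in> {1..int n}. snd (fst D (x, True)) \<noteq> True}" by (simp add: num_vertical_def)
  also have "\<dots> = card {x \<in> {1..int n}. snd (fst D (x, False)) = True}" using vertical_card[OF g, of True] by simp
  finally show ?thesis using False by simp
qed

lemma num_vertical_flip: "good n D \<Longrightarrow> num_vertical n (flipd D) = num_vertical n D"
  using num_vertical_row[of "flipd D" True] num_vertical_row[of D False] by simp

lemma num_vertical_less_iff:
  assumes g: "good n D"
  shows "num_vertical n D < n \<longleftrightarrow> (\<exists>x. snd (fst D (x, r)) = r)"
proof -
  let ?S = "{x \<in> {1..int n}. snd (fst D (x, r)) \<noteq> r}"
  have sub: "?S \<subseteq> {1..int n}" by auto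
  have "num_vertical n D = card ?S" by (rule num_vertical_row[OF g])
  moreover have "card ?S < n \<longleftrightarrow> ?S \<noteq> {1..int n}"
  proof
    assume "?S \<noteq> {1..int n}"
    then have "?S \<subset> {1..int n}" using sub by blast
    then have "card ?S < card {1..int n}" by (intro psubset_card_mono) auto
    then show "card ?S < n" by simp
  next
    assume "card ?S < n"
    then show "?S \<noteq> {1..int n}" by (metis card_atLeastAtMost_int diff_add_cancel less_irrefl nat_int)
  qed
  moreover have "?S \<noteq> {1..int n} \<longleftrightarrow> (\<exists>x. snd (fst D (x, r)) = r)"
  proof
    assume "\<exists>x. snd (fst D (x, r)) = r"
    then obtain x where x: "snd (fst D (x, r)) = r" by blast
    obtain z where z: "canon x = x + z * int n" using canon_translate by blast
    have "snd (fst D (canon x, r)) = r" unfolding z good_translate[OF g] using x by simp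
    then show "?S \<noteq> {1..int n}" using canon_bounds[of x] by blast
  qed blast
  ultimately show ?thesis by simp
qed

lemma Dg_flip: "D \<in> Dg \<Longrightarrow> flipd D \<in> Dg"
proof -
  assume D: "D \<in> Dg"
  have isd: "is_diagram n D" using D planar_is_diagram by (auto simp: Dg_def)
  have g: "good n (flipd D)" using D by (simp add: Dg_def)
  have nest: "snd (fst (flipd D) (c, r)) = r \<and> a < fst (fst (flipd D) (c, r)) \<and> fst (fst (flipd D) (c, r)) < b"
    if "fst (flipd D) (a, r) = (b, r)" "a < c" "c < b" for a b c r
  proof -
    have "fst D (a, \<not> r) = (b, \<not> r)" using that(1) by (auto simp: flipn_def prod_eq_iff)
    then show ?thesis using planar_nest[of D a "\<not> r" b c] that D by (auto simp: Dg_def)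
  qed
  have mon: "b < d" if "fst (flipd D) (a, True) = (b, False)" "fst (flipd D) (c, True) = (d, False)" "a < c" for a b c d
  proof -
    have "fst D (a, False) = (b, \<not> False)" "fst D (c, False) = (d, \<not> False)"
      using that by (auto simp: flipn_def prod_eq_iff)
    then show ?thesis using planar_mono[of D a False b c d] that D by (auto simp: Dg_def)
  qed
  have "is_diagram n (flipd D)"
    unfolding is_diagram_def Let_def
  proof (intro conjI allI impI)
    fix i r
    have s: "fst (flipd D) (i + int n, r) = shiftx (int n) (fst (flipd D) (i, r))"
      using good_translate[OF g, of i 1 r] by simp
    show "fst (flipd D) (i + int n, r) = (fst (fst (flipd D) (i, r)) + int n, snd (fst (flipd D) (i, r)))"
      unfolding s by (simp add: shiftx_def)
  qed (use good_nofix[OF g] good_invol[OF g] nest mon D in \<open>(blast | auto simp: Dg_def)+\<close>)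
  then have "planar (fst (flipd D))" by (rule is_diagram_planar)
  moreover have "even_diag (flipd D)"
    unfolding even_diag_def
  proof
    fix p
    have "even_diag D" using D by (simp add: Dg_def)
    then have "odd (height_parity (flipn p) + height_parity (fst D (flipn p)))" unfolding even_diag_def by blast
    then show "odd (height_parity p + height_parity (fst (flipd D) p))"
      by (auto simp: height_parity_def flipn_def split: if_splits)
  qed
  ultimately show ?thesis using g D by (simp add: Dg_def)
qed

definition flat :: "diagram \<Rightarrow> bool" where
  "flat D \<longleftrightarrow> (\<forall>x r. fst D (x, r) \<in> {(x + 1, r), (x - 1, r), (x, \<not> r)})"

lemma flat_Dg:
  assumes g: "good n D" and fl: "flat D" and k: "snd D = 0"
  shows "D \<in> Dg"
proof -
  have fl: "fst D (x, r) = (x + 1, r) \<or> fst D (x, r) = (x - 1, r) \<or> fst D (x, r) = (x, \<not> r)" for x r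
    using fl unfolding flat_def by blast
  have nest: False if "fst D (a, r) = (b, r)" "a < c" "c < b" for a b c r
    using fl[of a r] that by auto
  have mon: "b < d" if "fst D (a, True) = (b, False)" "fst D (c, True) = (d, False)" "a < c" for a b c d
    using fl[of a True] fl[of c True] that by auto
  have "is_diagram n D"
    unfolding is_diagram_def Let_def
  proof (intro conjI allI impI)
    fix i r
    have s: "fst D (i + int n, r) = shiftx (int n) (fst D (i, r))"
      using good_translate[OF g, of i 1 r] by simp
    show "fst D (i + int n, r) = (fst (fst D (i, r)) + int n, snd (fst D (i, r)))"
      unfolding s by (simp add: shiftx_def)
  qed (use good_nofix[OF g] good_invol[OF g] nest mon k in \<open>(blast | auto)+\<close>)
  then have "planar (fst D)" by (rule is_diagram_planar)
  moreover have "even_diag D"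
  proof (rule even_diagI)
    fix x y r
    show "fst D (x, r) = (y, r) \<Longrightarrow> odd (x + y)" using fl[of x r] by auto
    show "fst D (x, r) = (y, \<not> r) \<Longrightarrow> even (x + y)" using fl[of x r] by auto
  qed
  ultimately show ?thesis using g k by (simp add: Dg_def)
qed

lemma first_horizontal:
  assumes g: "good n D" and c: "snd (fst D (c, r)) \<noteq> r" and nv: "num_vertical n D < n"
  shows "\<exists>x>c. snd (fst D (x, r)) = r \<and> (\<forall>y. c \<le> y \<and> y < x \<longrightarrow> snd (fst D (y, r)) \<noteq> r)"
proof -
  obtain x0 where x0: "snd (fst D (x0, r)) = r" using num_vertical_less_iff[OF g] nv by blast
  define d where "d = (x0 - c) mod int n"
  have d0: "0 \<le> d" using n_pos by (simp add: d_def)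
  have "(c + d) mod int n = x0 mod int n" by (simp add: d_def mod_simps)
  then obtain z where "x0 = c + d + z * int n" using mod_translate by blast
  then have "snd (fst D (c + d, r)) = r" using x0 good_translate[OF g, of "c + d" z r] by simp
  then have ex: "\<exists>e. snd (fst D (c + int e, r)) = r" using d0 by (intro exI[of _ "nat d"]) simp
  define e where "e = (LEAST e. snd (fst D (c + int e, r)) = r)"
  have e1: "snd (fst D (c + int e, r)) = r" unfolding e_def by (rule LeastI_ex[OF ex])
  have e2: "snd (fst D (y, r)) \<noteq> r" if "c \<le> y" "y < c + int e" for y
  proof -
    have "nat (y - c) < e" using that by auto
    from not_less_Least[OF this[unfolded e_def]] show ?thesis using that by simp
  qed
  have "e \<noteq> 0" using e1 c by (metis add.right_neutral of_nat_0)
  then show ?thesis using e1 e2 by (intro exI[of _ "c + int e"]) auto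
qed

lemma cup_translate:
  assumes g: "good n D" and c: "fst D (j, True) = (j + 1, True)" and U: "inU j y"
  shows "fst D y = eps j y"
  using U
proof (cases rule: eps_cases)
  case (1 x)
  then obtain z where "x = j + z * int n" using mod_translate by metis
  then show ?thesis unfolding 1(3) unfolding 1(2) using good_translate[OF g, of j z True] c by simp
next
  case (2 x)
  then obtain z where z: "x = j + z * int n" using mod_translate by metis
  have "fst D (j + 1, True) = (j, True)" using good_eqD[OF g c] .
  then show ?thesis unfolding 2(3) unfolding 2(2) using good_translate[OF g, of "j + 1" z True] z by (simp add: algebra_simps)
qed

text \<open>The smaller diagram is D' = E_k D, and D = E_j D' by \<open>Emul_move\<close>. Having an
  arc at k, D' stays below n vertical edges. The nodes to be moved are all translates of x0, so the
  shortening is checked there only.\<close>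

lemma move_step:
  assumes D: "D \<in> Dg" and adj: "adjacent j k" and c: "fst D (j, True) = (j + 1, True)"
    and t: "inU k (x0, True)" "\<not> inU j (x0, True)"
    and cls: "\<And>x. inU k x \<Longrightarrow> \<not> inU j x \<Longrightarrow> \<exists>z. x = shiftx (z * int n) (x0, True)"
    and dec: "\<bar>fst (fst D (x0, True)) - fst (eps j (eps k (x0, True)))\<bar> < \<bar>fst (fst D (x0, True)) - x0\<bar>"
  shows "\<exists>D'\<in>Dg. energy D' < energy D \<and> num_vertical n D' < n \<and> (D' \<in> TL_diagrams n \<longrightarrow> D \<in> TL_diagrams n)"
proof -
  have g: "good n D" using D by (rule Dg_good)
  note cup = cup_translate[OF g c]
  define D' where "D' = (Emul k (fst D), 0 :: nat)"
  have "int (nat (k mod int n)) mod int n = k mod int n" using n_pos by simp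
  from Dg_E(2)[OF D this] have D': "D' \<in> Dg" by (simp add: D'_def)
  have "energy D' < energy D"
    unfolding D'_def
  proof (rule energy_move[OF D adj cup _ t])
    fix x assume x: "inU k x" "\<not> inU j x"
    then obtain z where "x = shiftx (z * int n) (x0, True)" using cls by blast
    then show "\<bar>fst (fst D x) - fst (eps j (eps k x))\<bar> < \<bar>fst (fst D x) - fst x\<bar>"
      using dec good_shift[OF g, of z "(x0, True)"] by (simp add: eps_shift del: shiftx_simps(1))
  qed
  moreover have "num_vertical n D' < n"
  proof -
    have "fst D' (x0, True) = eps k (x0, True)" using t by (simp add: D'_def Emul_def)
    then have "snd (fst D' (x0, True)) = True" using eps_simps(4)[OF t(1)] by simp
    then show ?thesis using num_vertical_less_iff[OF Dg_good[OF D']] by blast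
  qed
  moreover have "D \<in> TL_diagrams n" if "D' \<in> TL_diagrams n"
    by (rule TL_if_Emul[OF that D, of j]) (use Emul_move[OF g adj cup] in \<open>simp add: D'_def\<close>)
  ultimately show ?thesis using D' by blast
qed

text \<open>Among the arcs a, b with a + 1 < b take a shortest one. The partner of b - 1 lies
  between a and b, and minimality forces it to be b - 2; so the end b can be slid over this small
  arc to b - 2.\<close>

lemma unnest_step:
  assumes D: "D \<in> Dg" and ab: "fst D (a, True) = (b, True)" "a + 1 < b"
  shows "\<exists>D'\<in>Dg. energy D' < energy D \<and> num_vertical n D' < n \<and> (D' \<in> TL_diagrams n \<longrightarrow> D \<in> TL_diagrams n)"
proof -
  have g: "good n D" and pl: "planar (fst D)" using D by (auto simp: Dg_def)
  define P where "P q \<longleftrightarrow> fst D (fst q, True) = (snd q, True) \<and> fst q + 1 < snd q" for q :: "int \<times> int"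
  have "P (a, b)" using ab by (simp add: P_def)
  then obtain q where q: "P q" "\<And>q'. P q' \<Longrightarrow> nat (snd q - fst q) \<le> nat (snd q' - fst q')"
    using ex_has_least_nat[of P _ "\<lambda>q. nat (snd q - fst q)"] by blast
  define a where "a = fst q"
  define b where "b = snd q"
  have ab: "fst D (a, True) = (b, True)" "a + 1 < b" using q(1) by (auto simp: P_def a_def b_def)
  define c where "c = fst (fst D (b - 1, True))"
  have c: "fst D (b - 1, True) = (c, True)" "a < c" "c < b"
    using planar_nest[OF pl g ab(1), of "b - 1"] ab by (auto simp: c_def prod_eq_iff)
  have cb: "fst D (c, True) = (b - 1, True)" using good_eqD[OF g c(1)] .
  have "c \<noteq> b - 1" using good_nofix[OF g, of "(b - 1, True)"] c(1) by auto
  moreover have "\<not> c + 1 < b - 1"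
  proof
    assume "c + 1 < b - 1"
    then have "P (c, b - 1)" using cb by (simp add: P_def)
    from q(2)[OF this] show False using c ab by (simp add: a_def b_def)
  qed
  ultimately have c2: "c = b - 2" using c by linarith
  show ?thesis
  proof (rule move_step[OF D adjacent_Suc, of "b - 2" b])
    show "fst D (b - 2, True) = (b - 2 + 1, True)" using cb c2 by simp
    show "inU (b - 2 + 1) (b, True)" by (simp add: inU_def)
    have "b mod int n \<noteq> (b - 2) mod int n" using res_ne2[of "b - 1"] by simp
    moreover have "b mod int n \<noteq> (b - 2 + 1) mod int n" using res_ne[of "b - 1"] by simp
    ultimately show nU: "\<not> inU (b - 2) (b, True)" by (simp add: inU_def)
    show "\<exists>z. x = shiftx (z * int n) (b, True)" if x: "inU (b - 2 + 1) x" "\<not> inU (b - 2) x" for x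
    proof -
      have "snd x" "fst x mod int n = b mod int n" using x by (auto simp: inU_def)
      then obtain z where "fst x = b + z * int n" using mod_translate by metis
      then show ?thesis using \<open>snd x\<close> by (intro exI[of _ z]) (simp add: prod_eq_iff)
    qed
    have "eps (b - 2 + 1) (b, True) = (b - 1, True)" using eps_hi[of b "b - 1"] by simp
    moreover have "eps (b - 2) (b - 1, True) = (b - 2, True)" using eps_hi[of "b - 1" "b - 2"] by simp
    moreover have "fst D (b, True) = (a, True)" using good_eqD[OF g ab(1)] .
    ultimately show "\<bar>fst (fst D (b, True)) - fst (eps (b - 2) (eps (b - 2 + 1) (b, True)))\<bar> < \<bar>fst (fst D (b, True)) - b\<bar>"
      using c2 c by simp
  qed
qed

text \<open>Vertical edges keep their order, so all edges from a up to the next horizontal node x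
  lean to the right. With nested arcs excluded, x is joined to x + 1, and the upper end x - 1 of the
  last leaning edge is slid over this arc.\<close>

lemma straighten_step:
  assumes D: "D \<in> Dg" and arcs: "\<And>a b. fst D (a, True) = (b, True) \<Longrightarrow> \<not> a + 1 < b"
    and a: "fst D (a, True) = (f, False)" "a < f" and nv: "num_vertical n D < n"
  shows "\<exists>D'\<in>Dg. energy D' < energy D \<and> num_vertical n D' < n \<and> (D' \<in> TL_diagrams n \<longrightarrow> D \<in> TL_diagrams n)"
proof -
  have g: "good n D" and pl: "planar (fst D)" and ev: "even_diag D" using D by (auto simp: Dg_def)
  have "snd (fst D (a, True)) \<noteq> True" using a by simp
  then obtain x where x: "x > a" "snd (fst D (x, True))" and bet: "\<And>y. a \<le> y \<Longrightarrow> y < x \<Longrightarrow> \<not> snd (fst D (y, True))"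
    using first_horizontal[OF g _ nv, of a True] by auto
  have vert: "\<exists>h. fst D (a + int e, True) = (h, False) \<and> a + int e < h" if "a + int e < x" for e
    using that
  proof (induction e)
    case 0 then show ?case using a by simp
  next
    case (Suc e)
    then obtain h where h: "fst D (a + int e, True) = (h, False)" "a + int e < h" by auto
    obtain h' where h': "fst D (a + int (Suc e), True) = (h', False)"
      using bet[of "a + int (Suc e)"] Suc(2) by (cases "fst D (a + int (Suc e), True)") auto
    have "h < h'" using planar_mono[OF pl g, of "a + int e" True h "a + int (Suc e)" h'] h h' by simp
    then show ?case using h h' by auto
  qed
  have "\<exists>f. fst D (x - 1, True) = (f, False) \<and> x - 1 < f" using vert[of "nat (x - 1 - a)"] x by auto
  then obtain f where f: "fst D (x - 1, True) = (f, False)" "x - 1 < f" by blast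
  \<comment> \<open>Evenness excludes f = x, the one case in which sliding the upper end from x - 1
    to x + 1 would not shorten the edge.\<close>
  have "even (x - 1 + f)" using even_diag_diff[OF ev, of "x - 1" True f] f by simp
  then have f2: "x + 1 \<le> f" using f(2) by (cases "f = x") auto
  obtain y where y: "fst D (x, True) = (y, True)" using x by (cases "fst D (x, True)") auto
  then have yx: "fst D (y, True) = (x, True)" by (rule good_eqD[OF g])
  have "y \<noteq> x" using good_nofix[OF g, of "(x, True)"] y by auto
  moreover have "y \<noteq> x - 1" using yx f by auto
  ultimately have y1: "y = x + 1" using arcs[OF y] arcs[OF yx] by linarith
  have adj: "adjacent x (x - 1)" using adjacent_sym[OF adjacent_Suc[of "x - 1"]] by simp
  show ?thesis
  proof (rule move_step[OF D adj, of "x - 1"])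
    show "fst D (x, True) = (x + 1, True)" using y y1 by simp
    show "inU (x - 1) (x - 1, True)" by (simp add: inU_def)
    have "(x - 1) mod int n \<noteq> x mod int n" using res_ne[of "x - 1"] by simp
    moreover have "(x - 1) mod int n \<noteq> (x + 1) mod int n" using res_ne2[of x] by simp
    ultimately show "\<not> inU x (x - 1, True)" by (simp add: inU_def)
    show "\<exists>z. u = shiftx (z * int n) (x - 1, True)" if u: "inU (x - 1) u" "\<not> inU x u" for u
    proof -
      have "snd u" "fst u mod int n = (x - 1) mod int n" using u by (auto simp: inU_def)
      then obtain z where "fst u = x - 1 + z * int n" using mod_translate by metis
      then show ?thesis using \<open>snd u\<close> by (intro exI[of _ z]) (simp add: prod_eq_iff)
    qed
    have "eps (x - 1) (x - 1, True) = (x, True)" using eps_lo[of "x - 1" "x - 1"] by simp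
    moreover have "eps x (x, True) = (x + 1, True)" using eps_lo[of x x] by simp
    ultimately show "\<bar>fst (fst D (x - 1, True)) - fst (eps x (eps (x - 1) (x - 1, True)))\<bar> < \<bar>fst (fst D (x - 1, True)) - (x - 1)\<bar>"
      using f f2 by simp
  qed
qed

text \<open>In a flat diagram a horizontal node x next to a straight edge at x - 1 is joined to x +
  1 in both rows. Straightening this pair of arcs gives a flat D' with more vertical edges and D =
  E_x D'; the induction ends at the identity.\<close>

lemma flat_TL:
  assumes "D \<in> Dg" "flat D"
  shows "D \<in> TL_diagrams n"
  using assms
proof (induction "n - num_vertical n D" arbitrary: D rule: less_induct)
  case less
  have g: "good n D" using less by (simp add: Dg_def)
  have fl: "fst D (x, r) = (x + 1, r) \<or> fst D (x, r) = (x - 1, r) \<or> fst D (x, r) = (x, \<not> r)" for x r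
    using less unfolding flat_def by blast
  show ?case
  proof (cases "num_vertical n D < n")
    case False
    then have "snd (fst D (x, r)) \<noteq> r" for x r using num_vertical_less_iff[OF g, of r] by blast
    then have "fst D (x, r) = (x, \<not> r)" for x r using fl[of x r] by (metis snd_conv)
    then have "fst D = fst id_diagram" by (auto simp: fun_eq_iff)
    then have "D = id_diagram" using less by (simp add: Dg_def prod_eq_iff)
    then show ?thesis using TL_diagrams.TL_id by simp
  next
    case nv: True
    obtain c where "snd (fst D (c, True)) \<noteq> True" using ex_vertical[OF g] by blast
    then obtain x where x: "x > c" "snd (fst D (x, True)) = True" and
      bet: "\<And>y. c \<le> y \<Longrightarrow> y < x \<Longrightarrow> snd (fst D (y, True)) \<noteq> True"
      using first_horizontal[OF g _ nv] by blast
    have v: "fst D (x - 1, True) = (x - 1, False)" using bet[of "x - 1"] x fl[of "x - 1" True] by auto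
    have v2: "fst D (x - 1, False) = (x - 1, True)" using good_eqD[OF g v] .
    have "fst D (x, True) \<noteq> (x - 1, True)" using v good_eqD[OF g, of "(x, True)" "(x - 1, True)"] by auto
    then have t: "fst D (x, True) = (x + 1, True)" using fl[of x True] x by auto
    have "fst D (x, False) \<noteq> (x - 1, False)" using v2 good_eqD[OF g, of "(x, False)" "(x - 1, False)"] by auto
    moreover have "fst D (x, False) \<noteq> (x, True)" using t good_eqD[OF g, of "(x, False)" "(x, True)"] by auto
    ultimately have b: "fst D (x, False) = (x + 1, False)" using fl[of x False] by auto
    have tt: "fst D y = eps x y" if "inU x y" for y by (rule cup_translate[OF g t that])
    have bb: "fst D (y, False) = (fst (eps x (y, True)), False)" if "inU x (y, True)" for y
      using cup_translate[of "flipd D" x "(y, True)"] g b that eps_simps(4)[OF that] by (auto simp: flipn_def prod_eq_iff)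
    define I where "I p \<longleftrightarrow> inU x (fst p, True)" for p :: node
    define D' where "D' = ((\<lambda>p. if I p then flipn p else fst D p), 0 :: nat)"
    have ID: "I (fst D p) \<longleftrightarrow> I p" for p
    proof -
      have *: "I (fst D p)" if "I p" for p
      proof (cases "snd p")
        case True
        then have p: "p = (fst p, True)" by (auto simp: prod_eq_iff)
        then have U: "inU x p" using that I_def by metis
        then have "inU x (fst D p)" "snd (fst D p)" using tt eps_simps by auto
        then show ?thesis unfolding I_def by (metis (full_types) prod.collapse)
      next
        case False
        then have p: "p = (fst p, False)" by (auto simp: prod_eq_iff)
        have U: "inU x (fst p, True)" using that I_def by simp
        have "fst D p = (fst (eps x (fst p, True)), False)" using bb[OF U] p by simp
        then show ?thesis using eps_simps(1,4)[OF U] unfolding I_def by (metis (full_types) fst_conv prod.collapse)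
      qed
      show ?thesis using *[of p] *[of "fst D p"] good_invol[OF g] by auto
    qed
    have g': "good n D'"
      unfolding good_def D'_def fst_conv
      using good_nofix[OF g] good_invol[OF g] good_shift[OF g] ID inU_shift[of x _ "(fst p, True)" for p]
      by (auto simp: I_def[symmetric] prod_eq_iff) (auto simp: I_def flipn_def)
    have fl': "flat D'" unfolding flat_def D'_def using fl by auto
    have D': "D' \<in> Dg" by (rule flat_Dg[OF g' fl']) (simp add: D'_def)
    have "num_vertical n D < num_vertical n D'"
      unfolding num_vertical_def
    proof (rule psubset_card_mono)
      obtain z where z: "canon x = x + z * int n" using canon_translate by blast
      have "snd (fst D (canon x, True)) = True" unfolding z good_translate[OF g] using t by simp
      moreover have "I (x, True)" by (simp add: I_def inU_def)
      then have "I (canon x, True)" using inU_shift[of x z "(x, True)"] by (simp add: I_def z)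
      then have "snd (fst D' (canon x, True)) = False" by (simp add: D'_def)
      moreover have "{a \<in> {1..int n}. snd (fst D (a, True)) = False} \<subseteq> {a \<in> {1..int n}. snd (fst D' (a, True)) = False}"
        by (auto simp: D'_def)
      ultimately show "{a \<in> {1..int n}. snd (fst D (a, True)) = False} \<subset> {a \<in> {1..int n}. snd (fst D' (a, True)) = False}"
        using canon_bounds[of x] by auto
    qed (auto intro: finite_subset[of _ "{1..int n}"])
    then have "D' \<in> TL_diagrams n" using less(1)[OF _ D' fl'] nv by simp
    then show ?thesis
    proof (rule TL_if_Emul[OF _ less(2), of _ x])
      show "fst D = Emul x (fst D')"
      proof
        fix p
        show "fst D p = Emul x (fst D') p"
        proof (cases "I p")
          case True
          show ?thesis
          proof (cases "snd p")
            case sp: True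
            then have p: "(fst p, True) = p" by (auto simp: prod_eq_iff)
            then show ?thesis using tt True by (simp add: Emul_def I_def)
          next
            case sp: False
            then have p: "p = (fst p, False)" by (auto simp: prod_eq_iff)
            have U: "inU x (fst p, True)" using True by (simp add: I_def)
            have "\<not> inU x p" using sp by (simp add: inU_def)
            moreover have "fst D' p = (fst p, True)" using True sp by (simp add: D'_def prod_eq_iff)
            moreover have "I (eps x (fst p, True))"
              using eps_simps(1,4)[OF U] unfolding I_def by (metis (full_types) prod.collapse)
            ultimately show ?thesis using U bb[OF U] p eps_simps(4)[OF U]
              by (simp add: Emul_def) (auto simp: D'_def prod_eq_iff)
          qed
        next
          case False
          have "\<not> inU x p" using False unfolding I_def by (cases p) (auto simp: inU_def)
          moreover have "\<not> inU x (fst D p)" using False ID[of p] unfolding I_def by (cases "fst D p") (auto simp: inU_def)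
          ultimately show ?thesis using False by (simp add: Emul_def D'_def)
        qed
      qed
    qed
  qed
qed

text \<open>Induction on \<open>energy\<close>: long arcs are removed by \<open>unnest_step\<close>,
  leaning vertical edges by \<open>straighten_step\<close>. Arcs in the bottom row and edges leaning
  the other way are the same cases after \<open>flipd\<close>, and what remains is flat.\<close>

lemma TL_characterization:
  assumes "D \<in> Dg" "num_vertical n D < n"
  shows "D \<in> TL_diagrams n"
  using assms
proof (induction "energy D" arbitrary: D rule: less_induct)
  case less
  have step: ?case if "\<exists>D'\<in>Dg. energy D' < energy D \<and> num_vertical n D' < n \<and> (D' \<in> TL_diagrams n \<longrightarrow> D \<in> TL_diagrams n)"
    using that less(1) by blast
  have stepf: ?case if "\<exists>D'\<in>Dg. energy D' < energy (flipd D) \<and> num_vertical n D' < n \<and>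
      (D' \<in> TL_diagrams n \<longrightarrow> flipd D \<in> TL_diagrams n)"
  proof -
    have "flipd D \<in> TL_diagrams n" using that less(1) by (auto simp: energy_flip)
    then show ?thesis using TL_flip[of "flipd D"] by simp
  qed
  have g: "good n D" using less by (simp add: Dg_def)
  have DF: "flipd D \<in> Dg" by (rule Dg_flip[OF less(2)])
  have nvf: "num_vertical n (flipd D) < n" using num_vertical_flip[OF g] less by simp
  have ff: "fst (flipd D) (a, r) = (b, s) \<longleftrightarrow> fst D (a, \<not> r) = (b, \<not> s)" for a r b s
    by (auto simp: flipn_def prod_eq_iff)
  show ?case
  proof (cases "\<exists>a b r. fst D (a, r) = (b, r) \<and> a + 1 < b")
    case True
    then obtain a b r where ab: "fst D (a, r) = (b, r)" "a + 1 < b" by blast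
    show ?thesis
    proof (cases r)
      case True
      then show ?thesis using unnest_step[OF less(2)] ab step by simp
    next
      case False
      then show ?thesis using unnest_step[OF DF, of a b] ab by (intro stepf) (simp add: ff)
    qed
  next
    case arcs: False
    show ?thesis
    proof (cases "\<exists>a f. fst D (a, True) = (f, False) \<and> a \<noteq> f")
      case True
      then obtain a f where af: "fst D (a, True) = (f, False)" "a \<noteq> f" by blast
      show ?thesis
      proof (cases "a < f")
        case True
        then show ?thesis using straighten_step[OF less(2) _ af(1) True less(3)] arcs step by blast
      next
        case False
        have "fst D (f, False) = (a, True)" using good_eqD[OF g af(1)] .
        then have "fst (flipd D) (f, True) = (a, False)" by (simp add: ff)
        moreover have "\<not> x + 1 < y" if "fst (flipd D) (x, True) = (y, True)" for x y
          using arcs iffD1[OF ff that] by auto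
        ultimately show ?thesis using straighten_step[OF DF, of f a] False af nvf by (intro stepf) auto
      qed
    next
      case str: False
      have "flat D"
        unfolding flat_def
      proof (intro allI)
        fix x r
        obtain y s where y: "fst D (x, r) = (y, s)" by (cases "fst D (x, r)")
        have y2: "fst D (y, s) = (x, r)" using good_eqD[OF g y] .
        show "fst D (x, r) \<in> {(x + 1, r), (x - 1, r), (x, \<not> r)}"
        proof (cases "s = r")
          case True
          have "y \<noteq> x" using good_nofix[OF g, of "(x, r)"] y True by auto
          moreover have "\<not> x + 1 < y" "\<not> y + 1 < x" using arcs y y2 True by blast+
          ultimately have "y = x + 1 \<or> y = x - 1" by linarith
          then show ?thesis using y True by auto
        next
          case False
          then have "y = x" using str y y2 by (cases r) auto
          then show ?thesis using y False by auto
        qed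
      qed
      then show ?thesis using flat_TL less(2) by blast
    qed
  qed
qed

end

lemma strict_mono_surj_int:
  fixes g :: "int \<Rightarrow> int"
  assumes mono: "\<And>a b. a < b \<Longrightarrow> g a < g b" and surj: "\<And>k. \<exists>x. g x = k"
  shows "g k = k + g 0"
proof -
  have step: "g (k + 1) = g k + 1" for k
  proof -
    obtain l where l: "g l = g k + 1" using surj by blast
    have "\<not> l \<le> k" using mono[of l k] l by (cases "l = k") auto
    moreover have "\<not> k + 1 < l" using mono[of k "k + 1"] mono[of "k + 1" l] l by auto
    ultimately have "l = k + 1" by linarith
    then show ?thesis using l by simp
  qed
  show ?thesis
  proof (induction k rule: int_induct[where k = 0])
    case (step2 i)
    then show ?case using step[of "i - 1"] by simp
  qed (use step in auto)
qed

section \<open>Enumerating periodic sets of integers\<close>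

text \<open>\<open>cnt T\<close> numbers the elements of \<open>T\<close> from left to right, the first positive one getting the
  number 1.\<close>

definition cnt :: "int set \<Rightarrow> int \<Rightarrow> int" where
  "cnt T x = (if x \<ge> 0 then int (card (T \<inter> {1..x})) else - int (card (T \<inter> {x + 1..0})))"

definition idx :: "int set \<Rightarrow> int \<Rightarrow> int" where
  "idx T k = (THE x. x \<in> T \<and> cnt T x = k)"

lemma cnt_Suc: "cnt T (x + 1) = cnt T x + (if x + 1 \<in> T then 1 else 0)"
proof (cases "x \<ge> 0")
  case True
  have "{1..x + 1} = insert (x + 1) {1..x}" using True by auto
  then have "T \<inter> {1..x + 1} = (if x + 1 \<in> T then insert (x + 1) (T \<inter> {1..x}) else T \<inter> {1..x})" by auto
  moreover have "finite (T \<inter> {1..x})" "x + 1 \<notin> T \<inter> {1..x}" by auto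
  ultimately show ?thesis using True by (simp add: cnt_def)
next
  case False
  have "{x + 1..0} = insert (x + 1) {x + 1 + 1..0}" using False by auto
  then have *: "T \<inter> {x + 1..0} = (if x + 1 \<in> T then insert (x + 1) (T \<inter> {x + 1 + 1..0}) else T \<inter> {x + 1 + 1..0})" by auto
  have **: "finite (T \<inter> {x + 1 + 1..0})" "x + 1 \<notin> T \<inter> {x + 1 + 1..0}" by auto
  have "card (T \<inter> {x + 1..0}) = card (T \<inter> {x + 1 + 1..0}) + (if x + 1 \<in> T then 1 else 0)"
    unfolding * using ** by simp
  moreover have "cnt T (x + 1) = - int (card (T \<inter> {x + 1 + 1..0}))"
  proof (cases "x + 1 \<ge> 0")
    case True
    then have "x = -1" using False by simp
    then show ?thesis by (simp add: cnt_def)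
  qed (simp add: cnt_def)
  ultimately show ?thesis using False by (simp add: cnt_def)
qed

lemma cnt_0 [simp]: "cnt T 0 = 0"
  by (simp add: cnt_def)

lemma cnt_mono: "x \<le> y \<Longrightarrow> cnt T x \<le> cnt T y"
proof (induction y rule: int_ge_induct)
  case (step i)
  then show ?case using cnt_Suc[of T i] by (auto split: if_splits)
qed simp

lemma cnt_strict: "x < y \<Longrightarrow> y \<in> T \<Longrightarrow> cnt T x < cnt T y"
  using cnt_Suc[of T "y - 1"] cnt_mono[of x "y - 1" T] by simp

context odd_size
begin

definition periodic :: "int set \<Rightarrow> bool" where
  "periodic T \<longleftrightarrow> (\<forall>x z. x + z * int n \<in> T \<longleftrightarrow> x \<in> T) \<and> T \<noteq> {}"

definition size1 :: "int set \<Rightarrow> nat" where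
  "size1 T = card (T \<inter> {1..int n})"

lemma periodic_iff: "periodic T \<Longrightarrow> x + z * int n \<in> T \<longleftrightarrow> x \<in> T"
  by (simp add: periodic_def)

lemma size1_pos: "periodic T \<Longrightarrow> size1 T > 0"
proof -
  assume T: "periodic T"
  then obtain x where x: "x \<in> T" by (auto simp: periodic_def)
  obtain z where "canon x = x + z * int n" using canon_translate by blast
  then have "canon x \<in> T" using periodic_iff[OF T] x by simp
  then have "canon x \<in> T \<inter> {1..int n}" using canon_bounds by blast
  then show ?thesis unfolding size1_def by (metis card_gt_0_iff empty_iff finite_Int finite_atLeastAtMost_int)
qed

lemma cnt_period1: "periodic T \<Longrightarrow> cnt T (x + int n) = cnt T x + int (size1 T)"
proof (induction x rule: int_induct[where k = 0])
  case base
  then show ?case by (simp add: cnt_def size1_def)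
next
  case (step1 i)
  then show ?case using cnt_Suc[of T "i + int n"] cnt_Suc[of T i] periodic_iff[of T "i + 1" 1]
    by (simp add: algebra_simps)
next
  case (step2 i)
  then show ?case using cnt_Suc[of T "i - 1 + int n"] cnt_Suc[of T "i - 1"] periodic_iff[of T i 1]
    by (simp add: algebra_simps)
qed

lemma cnt_period: "periodic T \<Longrightarrow> cnt T (x + z * int n) = cnt T x + z * int (size1 T)"
proof (induction z rule: int_induct[where k = 0])
  case base
  then show ?case by simp
next
  case (step1 i)
  then show ?case using cnt_period1[of T "x + i * int n"] by (simp add: algebra_simps)
next
  case (step2 i)
  then show ?case using cnt_period1[of T "x + (i - 1) * int n"] by (simp add: algebra_simps)
qed

lemma cnt_surj:
  assumes T: "periodic T"
  shows "\<exists>x\<in>T. cnt T x = k"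
proof -
  have s: "int (size1 T) \<ge> 1" using size1_pos[OF T] by simp
  have big: "cnt T (\<bar>k\<bar> * int n) \<ge> k"
    using cnt_period[OF T, of 0 "\<bar>k\<bar>"] mult_left_mono[OF s, of "\<bar>k\<bar>"] by simp
  define l where "l = - (\<bar>k\<bar> + 1) * int n"
  have "cnt T l = - ((\<bar>k\<bar> + 1) * int (size1 T))"
    using cnt_period[OF T, of 0 "- (\<bar>k\<bar> + 1)"] by (simp only: l_def cnt_0 add_0 mult_minus_left)
  moreover have "(\<bar>k\<bar> + 1) * int (size1 T) \<ge> \<bar>k\<bar> + 1" using mult_left_mono[OF s, of "\<bar>k\<bar> + 1"] by simp
  ultimately have small: "cnt T l < k" by linarith
  have lb: "l < \<bar>k\<bar> * int n" using small big cnt_mono[of "\<bar>k\<bar> * int n" l T] by linarith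
  define e where "e = (LEAST e. cnt T (l + int e) \<ge> k)"
  have "cnt T (l + int (nat (\<bar>k\<bar> * int n - l))) \<ge> k" using big lb by simp
  then have e: "cnt T (l + int e) \<ge> k" unfolding e_def by (rule LeastI)
  have "e \<noteq> 0" using e small by (cases e) auto
  then obtain d where d: "e = Suc d" by (cases e) auto
  have "\<not> cnt T (l + int d) \<ge> k" using not_less_Least[of d "\<lambda>e. cnt T (l + int e) \<ge> k"] d e_def by simp
  then show ?thesis using cnt_Suc[of T "l + int d"] e d by (intro bexI[of _ "l + int e"]) (auto simp: algebra_simps split: if_splits)
qed

lemma idx_ex1: "periodic T \<Longrightarrow> \<exists>!x. x \<in> T \<and> cnt T x = k"
  using cnt_surj[of T k] cnt_strict by (metis linorder_neqE_linordered_idom less_irrefl)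

lemma idx_in: "periodic T \<Longrightarrow> idx T k \<in> T"
  and cnt_idx: "periodic T \<Longrightarrow> cnt T (idx T k) = k"
  using theI'[OF idx_ex1[of T k]] by (auto simp: idx_def)

lemma idx_cnt: "periodic T \<Longrightarrow> x \<in> T \<Longrightarrow> idx T (cnt T x) = x"
  unfolding idx_def by (rule the1_equality[OF idx_ex1]) auto

lemma idx_less_iff: "periodic T \<Longrightarrow> idx T k < idx T l \<longleftrightarrow> k < l"
  using cnt_strict[of "idx T k" "idx T l" T] cnt_mono[of "idx T l" "idx T k" T] idx_in cnt_idx
  by (metis leI not_less)

lemma idx_inj: "periodic T \<Longrightarrow> idx T k = idx T l \<longleftrightarrow> k = l"
  using cnt_idx by metis

text \<open>The numbering is anchored at the line x = 1/2, the line used in the definition of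
  \<open>wnum\<close>.\<close>

lemma idx_pos_iff: "periodic T \<Longrightarrow> idx T k \<ge> 1 \<longleftrightarrow> k \<ge> 1"
proof -
  assume T: "periodic T"
  have "k \<ge> 1" if "idx T k \<ge> 1" using cnt_strict[of 0 "idx T k" T] that idx_in[OF T] cnt_idx[OF T] by simp
  moreover have "k \<le> 0" if "idx T k \<le> 0" using cnt_mono[of "idx T k" 0 T] that cnt_idx[OF T] by simp
  ultimately show ?thesis by linarith
qed

lemma idx_period: "periodic T \<Longrightarrow> idx T (k + z * int (size1 T)) = idx T k + z * int n"
proof -
  assume T: "periodic T"
  have "idx T (cnt T (idx T k + z * int n)) = idx T k + z * int n"
    by (rule idx_cnt[OF T]) (simp add: periodic_iff[OF T] idx_in[OF T])
  then show ?thesis by (simp add: cnt_period[OF T] cnt_idx[OF T])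
qed

section \<open>Diagrams from two halves and an offset\<close>

definition thru :: "(int \<Rightarrow> int) \<Rightarrow> int set" where
  "thru h = {x. h x = x}"

text \<open>Describes, without reference to a diagram, the rows of planar diagrams with a vertical
  edge. These maps correspond to annular involutions with a fixed point through
  \<open>inv_of\<close> and \<open>half_of\<close>.\<close>

definition half_ok :: "(int \<Rightarrow> int) \<Rightarrow> bool" where
  "half_ok h \<longleftrightarrow> (\<forall>x. h (h x) = x) \<and> (\<forall>x z. h (x + z * int n) = h x + z * int n) \<and> thru h \<noteq> {} \<and>
     (\<forall>a c. a < c \<and> c < h a \<longrightarrow> h c \<noteq> c \<and> a < h c \<and> h c < h a)"

lemma half_ok_periodic: "half_ok h \<Longrightarrow> periodic (thru h)"
  by (auto simp: half_ok_def periodic_def thru_def)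

text \<open>The \<open>k\<close>-th unmatched node of the top half is joined to the \<open>(k - w)\<close>-th unmatched node of the
  bottom half.\<close>

definition mk :: "(int \<Rightarrow> int) \<Rightarrow> (int \<Rightarrow> int) \<Rightarrow> int \<Rightarrow> diagram" where
  "mk h1 h2 w = ((\<lambda>(x, r). if r then (if h1 x = x then (idx (thru h2) (cnt (thru h1) x - w), False) else (h1 x, True))
     else (if h2 x = x then (idx (thru h1) (cnt (thru h2) x + w), True) else (h2 x, False))), 0)"

definition compat :: "(int \<Rightarrow> int) \<Rightarrow> (int \<Rightarrow> int) \<Rightarrow> bool" where
  "compat h1 h2 \<longleftrightarrow> half_ok h1 \<and> half_ok h2 \<and> size1 (thru h1) = size1 (thru h2)"

lemma snd_mk [simp]: "snd (mk h1 h2 w) = 0"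
  by (simp add: mk_def)

lemma mk_horizontal: "h1 x \<noteq> x \<Longrightarrow> fst (mk h1 h2 w) (x, True) = (h1 x, True)"
  "h2 x \<noteq> x \<Longrightarrow> fst (mk h1 h2 w) (x, False) = (h2 x, False)"
  by (auto simp: mk_def)

lemma mk_vertical:
  assumes "compat h1 h2"
  shows "fst (mk h1 h2 w) (idx (thru h1) k, True) = (idx (thru h2) (k - w), False)"
    "fst (mk h1 h2 w) (idx (thru h2) k, False) = (idx (thru h1) (k + w), True)"
  using assms half_ok_periodic idx_in[of "thru h1" k] idx_in[of "thru h2" k] cnt_idx
  by (auto simp: mk_def compat_def thru_def)

lemma half_mk:
  assumes "compat h1 h2"
  shows "half True (mk h1 h2 w) = h1" "half False (mk h1 h2 w) = h2"
  by (auto simp: half_def mk_def fun_eq_iff)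

lemma mk_node_cases:
  assumes "compat h1 h2"
  obtains x where "p = (x, True)" "h1 x \<noteq> x" | x where "p = (x, False)" "h2 x \<noteq> x"
    | k where "p = (idx (thru h1) k, True)" | k where "p = (idx (thru h2) k, False)"
proof (cases p)
  case (Pair x r)
  have T: "periodic (thru h1)" "periodic (thru h2)" using assms half_ok_periodic by (auto simp: compat_def)
  show ?thesis
  proof (cases "if r then h1 x = x else h2 x = x")
    case True
    then show ?thesis using that(3)[of "cnt (thru h1) x"] that(4)[of "cnt (thru h2) x"]
        idx_cnt[OF T(1), of x] idx_cnt[OF T(2), of x] Pair
      by (cases r) (auto simp: thru_def)
  next
    case False
    then show ?thesis using that(1)[of x] that(2)[of x] Pair by (cases r) auto
  qed
qed

lemma good_mk:
  assumes c: "compat h1 h2"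
  shows "good n (mk h1 h2 w)"
proof -
  have ok: "half_ok h1" "half_ok h2" and s: "size1 (thru h1) = size1 (thru h2)" using c by (auto simp: compat_def)
  have i: "h1 (h1 x) = x" "h2 (h2 x) = x" "h1 (x + z * int n) = h1 x + z * int n" "h2 (x + z * int n) = h2 x + z * int n" for x z
    using ok by (auto simp: half_ok_def)
  note T = half_ok_periodic[OF ok(1)] half_ok_periodic[OF ok(2)]
  show ?thesis unfolding good_def
  proof (intro conjI allI)
    fix p :: node and z
    show "fst (mk h1 h2 w) p \<noteq> p"
      by (cases p rule: mk_node_cases[OF c]) (auto simp: mk_horizontal mk_vertical[OF c])
    show "fst (mk h1 h2 w) (fst (mk h1 h2 w) p) = p"
    proof (cases p rule: mk_node_cases[OF c])
      case (1 x)
      then have "h1 (h1 x) \<noteq> h1 x" using i by metis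
      then show ?thesis using 1 i by (simp add: mk_horizontal)
    next
      case (2 x)
      then have "h2 (h2 x) \<noteq> h2 x" using i by metis
      then show ?thesis using 2 i by (simp add: mk_horizontal)
    qed (auto simp: mk_vertical[OF c])
    show "fst (mk h1 h2 w) (shiftx (z * int n) p) = shiftx (z * int n) (fst (mk h1 h2 w) p)"
    proof (cases p rule: mk_node_cases[OF c])
      case (3 k)
      have "shiftx (z * int n) p = (idx (thru h1) (k + z * int (size1 (thru h1))), True)"
        using 3 idx_period[OF T(1)] by simp
      moreover have "idx (thru h2) (k + z * int (size1 (thru h1)) - w) = idx (thru h2) (k - w) + z * int n"
        using idx_period[OF T(2), of "k - w" z] s by (simp add: algebra_simps)
      ultimately show ?thesis using 3 by (simp add: mk_vertical[OF c])
    next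
      case (4 k)
      have "shiftx (z * int n) p = (idx (thru h2) (k + z * int (size1 (thru h2))), False)"
        using 4 idx_period[OF T(2)] by simp
      moreover have "idx (thru h1) (k + z * int (size1 (thru h2)) + w) = idx (thru h1) (k + w) + z * int n"
        using idx_period[OF T(1), of "k + w" z] s by (simp add: algebra_simps)
      ultimately show ?thesis using 4 by (simp add: mk_vertical[OF c])
    qed (auto simp: mk_horizontal i)
  qed
qed

lemma is_diagram_mk:
  assumes c: "compat h1 h2"
  shows "is_diagram n (mk h1 h2 w)"
proof -
  have ok: "half_ok h1" "half_ok h2" using c by (auto simp: compat_def)
  note T = half_ok_periodic[OF ok(1)] half_ok_periodic[OF ok(2)]
  note g = good_mk[OF c, of w]
  have nest: "snd (fst (mk h1 h2 w) (e, r)) = r \<and> a < fst (fst (mk h1 h2 w) (e, r)) \<and> fst (fst (mk h1 h2 w) (e, r)) < b"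
    if "fst (mk h1 h2 w) (a, r) = (b, r)" "a < e" "e < b" for a b e r
  proof (cases r)
    case True
    then have "b = h1 a" using that by (auto simp: mk_def split: if_splits)
    moreover have "a < e \<and> e < h1 a \<longrightarrow> h1 e \<noteq> e \<and> a < h1 e \<and> h1 e < h1 a"
      using ok(1) unfolding half_ok_def by blast
    ultimately show ?thesis using that True mk_horizontal(1)[of h1 e h2 w] by auto
  next
    case False
    then have "b = h2 a" using that by (auto simp: mk_def split: if_splits)
    moreover have "a < e \<and> e < h2 a \<longrightarrow> h2 e \<noteq> e \<and> a < h2 e \<and> h2 e < h2 a"
      using ok(2) unfolding half_ok_def by blast
    ultimately show ?thesis using that False mk_horizontal(2)[of h2 e h1 w] by auto
  qed
  have mon: "b < d" if "fst (mk h1 h2 w) (a, True) = (b, False)" "fst (mk h1 h2 w) (e, True) = (d, False)" "a < e" for a b e d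
  proof -
    have v: "h1 a = a" "h1 e = e" using that by (auto simp: mk_def split: if_splits)
    then have "cnt (thru h1) a < cnt (thru h1) e" using cnt_strict[of a e "thru h1"] that by (simp add: thru_def)
    then show ?thesis using that v idx_less_iff[OF T(2)] by (auto simp: mk_def)
  qed
  show ?thesis
    unfolding is_diagram_def Let_def
  proof (intro conjI allI impI)
    fix i r
    have s: "fst (mk h1 h2 w) (i + int n, r) = shiftx (int n) (fst (mk h1 h2 w) (i, r))"
      using good_translate[OF g, of i 1 r] by simp
    show "fst (mk h1 h2 w) (i + int n, r) = (fst (fst (mk h1 h2 w) (i, r)) + int n, snd (fst (mk h1 h2 w) (i, r)))"
      unfolding s by (simp add: shiftx_def)
  qed (use good_nofix[OF g] good_invol[OF g] nest mon in \<open>(blast | auto)+\<close>)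
qed

definition PD :: "diagram set" where
  "PD = {D. good n D \<and> planar (fst D) \<and> snd D = 0}"

lemma PD_mk: "compat h1 h2 \<Longrightarrow> mk h1 h2 w \<in> PD"
  using is_diagram_planar[OF is_diagram_mk] by (simp add: PD_def)

lemma Dg_PD: "D \<in> Dg \<Longrightarrow> D \<in> PD"
  by (simp add: PD_def Dg_def)

lemma half_vertical_iff: "good n D \<Longrightarrow> half r D x = x \<longleftrightarrow> snd (fst D (x, r)) \<noteq> r"
  using good_nofix[of n D "(x, r)"] by (auto simp: half_def prod_eq_iff)

lemma half_horizontal: "good n D \<Longrightarrow> half r D x \<noteq> x \<Longrightarrow> fst D (x, r) = (half r D x, r)"
  using half_vertical_iff[of D r x] by (auto simp: half_def prod_eq_iff)

lemma half_eqI: "fst D (x, r) = (y, r) \<Longrightarrow> half r D x = y"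
  by (simp add: half_def)

lemma num_vertical_size1: "good n D \<Longrightarrow> num_vertical n D = size1 (thru (half r D))"
  unfolding num_vertical_row[of D r] size1_def
  by (rule arg_cong[of _ _ card]) (auto simp: thru_def half_vertical_iff)

lemma half_ok_half:
  assumes D: "good n D" "planar (fst D)"
  shows "half_ok (half r D)"
proof -
  note v = half_vertical_iff[OF D(1), of r] and hh = half_horizontal[OF D(1), of r]
  have "half r D (half r D x) = x" for x
  proof (cases "half r D x = x")
    case False
    then show ?thesis using half_eqI[OF good_eqD[OF D(1) hh]] by blast
  qed simp
  moreover have "half r D (x + z * int n) = half r D x + z * int n" for x z
    unfolding half_def good_translate[OF D(1)] by simp
  moreover have "thru (half r D) \<noteq> {}" using ex_vertical[OF D(1), of r] v by (auto simp: thru_def)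
  moreover have "half r D c \<noteq> c \<and> a < half r D c \<and> half r D c < half r D a" if "a < c" "c < half r D a" for a c
  proof -
    have "fst D (a, r) = (half r D a, r)" using hh that by simp
    note N = planar_nest[OF D(2,1) this that]
    have "half r D c = fst (fst D (c, r))" using N(1) by (simp add: half_def)
    then show ?thesis using N v[of c] by simp
  qed
  ultimately show ?thesis unfolding half_ok_def by blast
qed

lemma compat_half:
  assumes "good n D" "planar (fst D)" "good n D'" "planar (fst D')" "num_vertical n D = num_vertical n D'"
  shows "compat (half r D) (half r' D')"
  using half_ok_half[OF assms(1,2)] half_ok_half[OF assms(3,4)] num_vertical_size1[OF assms(1)]
    num_vertical_size1[OF assms(3)] assms(5) by (simp add: compat_def)

text \<open>Read off at the vertical edge whose upper end has index 0; by \<open>mk_eq\<close> every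
  other vertical edge has the same offset.\<close>

definition woff :: "diagram \<Rightarrow> int" where
  "woff D = - cnt (thru (half False D)) (fst (fst D (idx (thru (half True D)) 0, True)))"

text \<open>On indices the vertical edges give an order preserving bijection of the integers. By
  \<open>strict_mono_surj_int\<close> it is a translation, so a single offset records all of
  them.\<close>

lemma mk_eq:
  assumes D: "D \<in> PD"
  shows "D = mk (half True D) (half False D) (woff D)"
proof -
  have g: "good n D" and pl: "planar (fst D)" and k: "snd D = 0" using D by (auto simp: PD_def)
  define h1 where "h1 = half True D"
  define h2 where "h2 = half False D"
  have c: "compat h1 h2" unfolding h1_def h2_def by (rule compat_half[OF g pl g pl]) simp
  have ok: "half_ok h1" "half_ok h2" using c by (auto simp: compat_def)
  note T = half_ok_periodic[OF ok(1)] half_ok_periodic[OF ok(2)]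
  have v1: "x \<in> thru h1 \<longleftrightarrow> \<not> snd (fst D (x, True))" for x
    using half_vertical_iff[OF g, of True] by (simp add: thru_def h1_def)
  have v2: "x \<in> thru h2 \<longleftrightarrow> snd (fst D (x, False))" for x
    using half_vertical_iff[OF g, of False] by (simp add: thru_def h2_def)
  define f where "f x = fst (fst D (x, True))" for x
  have f: "fst D (x, True) = (f x, False)" "f x \<in> thru h2" if "x \<in> thru h1" for x
  proof -
    show 1: "fst D (x, True) = (f x, False)" using that v1 by (simp add: f_def prod_eq_iff)
    show "f x \<in> thru h2" using good_eqD[OF g 1] v2 by simp
  qed
  define gg where "gg k = cnt (thru h2) (f (idx (thru h1) k))" for k
  have gk: "gg k = k + gg 0" for k
  proof (rule strict_mono_surj_int)
    fix a b :: int assume ab: "a < b"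
    have "f (idx (thru h1) a) < f (idx (thru h1) b)"
      using planar_mono[OF pl g, of "idx (thru h1) a" True _ "idx (thru h1) b"] f idx_in[OF T(1)] ab idx_less_iff[OF T(1)]
      by simp
    then show "gg a < gg b" unfolding gg_def using cnt_strict f(2)[OF idx_in[OF T(1)]] by blast
  next
    fix k
    have "idx (thru h2) k \<in> thru h2" by (rule idx_in[OF T(2)])
    then obtain x where x: "fst D (idx (thru h2) k, False) = (x, True)" using v2 by (metis prod.collapse)
    then have xx: "fst D (x, True) = (idx (thru h2) k, False)" by (rule good_eqD[OF g])
    then have "x \<in> thru h1" using v1 by simp
    then have "gg (cnt (thru h1) x) = k" unfolding gg_def by (simp add: idx_cnt[OF T(1)] f_def xx cnt_idx[OF T(2)])
    then show "\<exists>x. gg x = k" by blast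
  qed
  have w: "gg 0 = - woff D" by (simp add: gg_def woff_def f_def h1_def h2_def)
  have vert: "fst D (idx (thru h1) k, True) = (idx (thru h2) (k - woff D), False)" for k
  proof -
    have "idx (thru h2) (gg k) = f (idx (thru h1) k)" unfolding gg_def by (rule idx_cnt[OF T(2) f(2)[OF idx_in[OF T(1)]]])
    then show ?thesis using f(1)[OF idx_in[OF T(1)]] gk[of k] w by simp
  qed
  have "fst D p = fst (mk h1 h2 (woff D)) p" for p
  proof (cases p rule: mk_node_cases[OF c])
    case (1 x)
    then show ?thesis using half_horizontal[OF g, of True x] by (simp add: mk_horizontal h1_def)
  next
    case (2 x)
    then show ?thesis using half_horizontal[OF g, of False x] by (simp add: mk_horizontal h2_def)
  next
    case (3 k)
    then show ?thesis using vert by (simp add: mk_vertical[OF c])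
  next
    case (4 k)
    have "fst D (idx (thru h2) k, False) = (idx (thru h1) (k + woff D), True)"
      by (rule good_eqD[OF g]) (simp add: vert)
    then show ?thesis using 4 by (simp add: mk_vertical[OF c])
  qed
  then show ?thesis using k by (simp add: prod_eq_iff fun_eq_iff h1_def h2_def)
qed

lemma woff_mk:
  assumes c: "compat h1 h2"
  shows "woff (mk h1 h2 w) = w"
proof -
  have "half_ok h2" using c by (simp add: compat_def)
  from cnt_idx[OF half_ok_periodic[OF this]] show ?thesis
    by (simp add: woff_def half_mk[OF c] mk_vertical[OF c])
qed

text \<open>A node lies to the right of x = 1/2 iff its index is positive. The edge from top index k
  to bottom index k - w is therefore counted by \<open>w1\<close> iff 1 \<le> k \<le> w, and by
  \<open>w2\<close> iff w < k \<le> 0.\<close>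

lemma wnum_mk:
  assumes c: "compat h1 h2"
  shows "wnum (mk h1 h2 w) = w"
proof -
  let ?T = "thru h1" and ?B = "thru h2"
  have ok: "half_ok h1" "half_ok h2" using c by (auto simp: compat_def)
  note T = half_ok_periodic[OF ok(1)] half_ok_periodic[OF ok(2)]
  have e: "fst (mk h1 h2 w) (j, False) = (i, True) \<longleftrightarrow> (\<exists>k. i = idx ?T k \<and> j = idx ?B (k - w))" for i j
  proof
    assume a: "fst (mk h1 h2 w) (j, False) = (i, True)"
    then have "h2 j = j" by (auto simp: mk_def split: if_splits)
    then have "j = idx ?B (cnt ?B j)" using idx_cnt[OF T(2)] by (simp add: thru_def)
    then obtain l where l: "j = idx ?B l" by blast
    then have "i = idx ?T (l + w)" using a mk_vertical(2)[OF c] by simp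
    then show "\<exists>k. i = idx ?T k \<and> j = idx ?B (k - w)" using l by (intro exI[of _ "l + w"]) simp
  qed (auto simp: mk_vertical[OF c])
  have lz: "idx ?B k \<le> 0 \<longleftrightarrow> k \<le> 0" "idx ?T k \<le> 0 \<longleftrightarrow> k \<le> 0" for k
    using idx_pos_iff[OF T(2), of k] idx_pos_iff[OF T(1), of k] by linarith+
  let ?F = "\<lambda>k. (idx ?T k, idx ?B (k - w))"
  have inj: "inj_on ?F S" for S
    by (rule inj_onI) (simp add: idx_inj[OF T(1)])
  have "{(i, j). i > j \<and> fst (mk h1 h2 w) (j, False) = (i, True) \<and> j \<le> 0 \<and> 1 \<le> i} = ?F ` {1..w}"
    (is "?L = _")
  proof (intro equalityI subsetI)
    fix q assume "q \<in> ?L"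
    then obtain i j k where q: "q = (i, j)" "i = idx ?T k" "j = idx ?B (k - w)" "j \<le> 0" "1 \<le> i" unfolding e by blast
    then have "k \<in> {1..w}" using idx_pos_iff[OF T(1), of k] lz(1)[of "k - w"] by simp
    then show "q \<in> ?F ` {1..w}" using q by blast
  next
    fix q assume "q \<in> ?F ` {1..w}"
    then obtain k where k: "q = ?F k" "1 \<le> k" "k \<le> w" by auto
    then have "1 \<le> idx ?T k" "idx ?B (k - w) \<le> 0" using idx_pos_iff[OF T(1), of k] lz(1)[of "k - w"] by simp_all
    then show "q \<in> ?L" unfolding e k(1) by auto
  qed
  then have w1: "w1 (mk h1 h2 w) = nat w" unfolding w1_def using inj by (simp add: card_image)
  have "{(i, j). i < j \<and> fst (mk h1 h2 w) (j, False) = (i, True) \<and> i \<le> 0 \<and> 1 \<le> j} = ?F ` {w + 1..0}"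
    (is "?L = _")
  proof (intro equalityI subsetI)
    fix q assume "q \<in> ?L"
    then obtain i j k where q: "q = (i, j)" "i = idx ?T k" "j = idx ?B (k - w)" "i \<le> 0" "1 \<le> j" unfolding e by blast
    then have "k \<in> {w + 1..0}" using idx_pos_iff[OF T(2), of "k - w"] lz(2)[of k] by simp
    then show "q \<in> ?F ` {w + 1..0}" using q by blast
  next
    fix q assume "q \<in> ?F ` {w + 1..0}"
    then obtain k where k: "q = ?F k" "w + 1 \<le> k" "k \<le> 0" by auto
    then have "1 \<le> idx ?B (k - w)" "idx ?T k \<le> 0" using idx_pos_iff[OF T(2), of "k - w"] lz(2)[of k] by simp_all
    then show "q \<in> ?L" unfolding e k(1) by auto
  qed
  then have w2: "w2 (mk h1 h2 w) = nat (- w)" unfolding w2_def using inj by (simp add: card_image)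
  show ?thesis unfolding wnum_def w1 w2 by simp
qed

lemma PD_eqI:
  assumes "D \<in> PD" "D' \<in> PD" "half True D = half True D'" "half False D = half False D'" "woff D = woff D'"
  shows "D = D'"
  using mk_eq[OF assms(1)] mk_eq[OF assms(2)] assms(3-5) by simp

lemma compat_PD: "D \<in> PD \<Longrightarrow> compat (half True D) (half False D)"
  using compat_half[of D D True False] by (simp add: PD_def)

definition rot :: "int \<Rightarrow> diagram \<Rightarrow> diagram" where
  "rot s D = mk (half True D) (half False D) (woff D + s)"

lemma rot_PD [simp]: "D \<in> PD \<Longrightarrow> rot s D \<in> PD"
  by (simp add: rot_def PD_mk compat_PD)

lemma rot_simps:
  assumes "D \<in> PD"
  shows "half r (rot s D) = half r D" "woff (rot s D) = woff D + s" "rot s' (rot s D) = rot (s + s') D"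
    "rot 0 D = D" "num_vertical n (rot s D) = num_vertical n D"
proof -
  note c = compat_PD[OF assms]
  show h: "half r (rot s D) = half r D" for r by (cases r) (simp_all add: rot_def half_mk[OF c])
  show w: "woff (rot s D) = woff D + s" by (simp add: rot_def woff_mk[OF c])
  show "rot s' (rot s D) = rot (s + s') D" unfolding rot_def[of s'] h w by (simp add: rot_def algebra_simps)
  show "rot 0 D = D" using mk_eq[OF assms] by (simp add: rot_def)
  have "good n D" "good n (rot s D)" using assms rot_PD[OF assms, of s] by (auto simp: PD_def)
  then show "num_vertical n (rot s D) = num_vertical n D"
    using num_vertical_size1[of D True] num_vertical_size1[of "rot s D" True] h by simp
qed

lemma same_halves_rot:
  assumes "D \<in> PD" "D' \<in> PD" "half True D = half True D'" "half False D = half False D'"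
  shows "D' = rot (woff D' - woff D) D"
  by (rule PD_eqI) (use assms rot_simps[OF assms(1)] in auto)

lemma half_flip: "half r (flipd D) = half (\<not> r) D"
  by (auto simp: half_def fun_eq_iff)

lemma PD_flip: "D \<in> PD \<Longrightarrow> flipd D \<in> PD \<and> woff (flipd D) = - woff D"
proof -
  assume D: "D \<in> PD"
  let ?h1 = "half True D" and ?h2 = "half False D"
  note c = compat_PD[OF D]
  then have c': "compat ?h2 ?h1" by (auto simp: compat_def)
  have "fst (flipd (mk ?h1 ?h2 w)) p = fst (mk ?h2 ?h1 (- w)) p" for w p
    by (cases p) (auto simp: mk_def)
  then have "flipd (mk ?h1 ?h2 (woff D)) = mk ?h2 ?h1 (- woff D)" by (auto simp: prod_eq_iff fun_eq_iff)
  then have "flipd D = mk ?h2 ?h1 (- woff D)" using mk_eq[OF D] by simp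
  then show ?thesis using PD_mk[OF c'] woff_mk[OF c'] by simp
qed

lemma rot_flip: "D \<in> PD \<Longrightarrow> flipd (rot s D) = rot (- s) (flipd D)"
  by (rule PD_eqI) (use PD_flip[of D] PD_flip[of "rot s D"] rot_simps[of D] rot_simps[of "flipd D"] in \<open>auto simp: half_flip\<close>)

section \<open>Parity of the offset\<close>

text \<open>Nodes strictly between two consecutive ends of vertical edges are joined among
  themselves, so their number is even and each gap is odd.\<close>

lemma idx_parity:
  assumes D: "good n D" "planar (fst D)" "even_diag D"
  shows "even (idx (thru (half r D)) k - idx (thru (half r D)) 0 - k)"
proof -
  let ?T = "thru (half r D)"
  have T: "periodic ?T" by (rule half_ok_periodic[OF half_ok_half[OF D(1,2)]])
  have v: "x \<in> ?T \<longleftrightarrow> snd (fst D (x, r)) \<noteq> r" for x using half_vertical_iff[OF D(1)] by (simp add: thru_def)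
  have step: "odd (idx ?T (k + 1) - idx ?T k)" for k
  proof -
    let ?a = "idx ?T k" and ?b = "idx ?T (k + 1)"
    have ab: "?a < ?b" using idx_less_iff[OF T] by simp
    have nT: "x \<notin> ?T" if "?a < x" "x < ?b" for x
    proof
      assume x: "x \<in> ?T"
      have "cnt ?T ?a < cnt ?T x" "cnt ?T x < cnt ?T ?b" using cnt_strict that x idx_in[OF T] by blast+
      then show False by (simp add: cnt_idx[OF T])
    qed
    have "even (card {?a<..<?b})"
    proof (rule even_card_involution[where f = "half r D"])
      fix x assume "x \<in> {?a<..<?b}"
      then have x: "?a < x" "x < ?b" by auto
      have hx: "fst D (x, r) = (half r D x, r)" using half_horizontal[OF D(1)] nT[OF x] by (simp add: thru_def)
      have hx': "fst D (half r D x, r) = (x, r)" using good_eqD[OF D(1) hx] .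
      have ne: "half r D x \<noteq> ?a" "half r D x \<noteq> ?b" using hx' v idx_in[OF T] by (metis snd_conv)+
      have "\<not> half r D x < ?a" using planar_nest(1)[OF D(2,1) hx', of ?a] x v idx_in[OF T] by blast
      moreover have "\<not> ?b < half r D x" using planar_nest(1)[OF D(2,1) hx, of ?b] x v idx_in[OF T] by blast
      ultimately show "half r D x \<in> {?a<..<?b} \<and> half r D (half r D x) = x \<and> half r D x \<noteq> x"
        using ne half_eqI[OF hx'] nT[OF x] by (auto simp: thru_def)
    qed simp
    moreover have "int (card {?a<..<?b}) = ?b - ?a - 1" using ab by simp
    ultimately have "even (?b - ?a - 1)" by (metis even_of_nat)
    then show ?thesis by presburger
  qed
  show ?thesis
  proof (induction k rule: int_induct[where k = 0])
    case (step1 i)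
    then show ?case using step[of i] by presburger
  next
    case (step2 i)
    then show ?case using step[of "i - 1"] by simp presburger
  qed simp
qed

text \<open>Horizontal edges inherit the right parity from D and D'. For vertical edges
  \<open>idx_parity\<close> reduces the condition at every index k to the one at k = 0, and this is
  a condition on the parity of w.\<close>

lemma mk_even_iff:
  assumes D: "D \<in> Dg" and D': "D' \<in> Dg" and nv: "num_vertical n D = num_vertical n D'"
  shows "mk (half True D) (half False D') w \<in> Dg \<longleftrightarrow>
     even (idx (thru (half True D)) 0 + idx (thru (half False D')) 0 + w)"
proof -
  have g: "good n D" "planar (fst D)" "even_diag D" "good n D'" "planar (fst D')" "even_diag D'"
    using D D' by (auto simp: Dg_def)
  let ?h1 = "half True D" and ?h2 = "half False D'"
  have c: "compat ?h1 ?h2" by (rule compat_half[OF g(1,2,4,5) nv])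
  let ?M = "mk ?h1 ?h2 w"
  have M: "good n ?M" "planar (fst ?M)" using PD_mk[OF c] by (auto simp: PD_def)
  have P: "even (idx (thru ?h1) k - idx (thru ?h1) 0 - k)" "even (idx (thru ?h2) k - idx (thru ?h2) 0 - k)" for k
    using idx_parity[OF g(1-3)] idx_parity[OF g(4-6)] by auto
  have "even_diag ?M \<longleftrightarrow> even (idx (thru ?h1) 0 + idx (thru ?h2) 0 + w)"
  proof
    assume ev: "even_diag ?M"
    have "fst ?M (idx (thru ?h1) 0, True) = (idx (thru ?h2) (0 - w), \<not> True)" using mk_vertical(1)[OF c] by simp
    from even_diag_diff[OF ev this] show "even (idx (thru ?h1) 0 + idx (thru ?h2) 0 + w)"
      using P(2)[of "0 - w"] by simp
  next
    assume ev: "even (idx (thru ?h1) 0 + idx (thru ?h2) 0 + w)"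
    have hor: "odd (x + y)" if "half r E x = y" "x \<noteq> y" "good n E" "even_diag E" for r E x y
      using even_diag_same[OF that(4), of x r y] half_horizontal[OF that(3)] that by auto
    show "even_diag ?M"
    proof (rule even_diagI)
      fix x y r assume e: "fst ?M (x, r) = (y, r)"
      then have "half r ?M x = y" by (rule half_eqI)
      moreover have "x \<noteq> y" using e good_nofix[OF M(1)] by metis
      ultimately show "odd (x + y)" using hor[of True D x y] hor[of False D' x y] g half_mk[OF c, of w] by (cases r) auto
    next
      fix x y r assume e: "fst ?M (x, r) = (y, \<not> r)"
      show "even (x + y)"
      proof (cases "(x, r)" rule: mk_node_cases[OF c])
        case (3 k)
        then have "y = idx (thru ?h2) (k - w)" "x = idx (thru ?h1) k" using e mk_vertical(1)[OF c, of w k] by auto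
        then show ?thesis using P(1)[of k] P(2)[of "k - w"] ev by simp presburger
      next
        case (4 k)
        then have "y = idx (thru ?h1) (k + w)" "x = idx (thru ?h2) k" using e mk_vertical(2)[OF c, of w k] by auto
        then show ?thesis using P(1)[of "k + w"] P(2)[of k] ev by simp presburger
      qed (use e mk_horizontal(1)[of ?h1 x ?h2 w] mk_horizontal(2)[of ?h2 x ?h1 w] in auto)
    qed
  qed
  then show ?thesis using M by (simp add: Dg_def)
qed

lemma rot_Dg_iff:
  assumes D: "D \<in> Dg"
  shows "rot s D \<in> Dg \<longleftrightarrow> even s"
proof -
  have "mk (half True D) (half False D) (woff D) \<in> Dg" using D mk_eq[OF Dg_PD[OF D]] by simp
  then show ?thesis unfolding rot_def mk_even_iff[OF D D refl] by presburger
qed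

lemma rot_TL:
  assumes D: "D \<in> TL_diagrams n" and nv: "num_vertical n D < n" and s: "even s"
  shows "rot s D \<in> TL_diagrams n"
  by (rule TL_characterization)
    (use TL_Dg[OF D] rot_Dg_iff s nv rot_simps(5)[OF Dg_PD[OF TL_Dg[OF D]]] in auto)

lemma TL_same_halves:
  assumes "D \<in> TL_diagrams n" "D' \<in> TL_diagrams n" "half True D = half True D'" "half False D = half False D'"
  shows "\<exists>m. D' = rot (2 * m) D"
proof -
  have D: "D \<in> Dg" "D' \<in> Dg" using assms TL_Dg by auto
  have e: "D' = rot (woff D' - woff D) D" using same_halves_rot Dg_PD D assms by blast
  then have "even (woff D' - woff D)" using rot_Dg_iff[OF D(1)] D(2) by metis
  then obtain m where "woff D' - woff D = 2 * m" by (rule evenE)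
  then show ?thesis using e by metis
qed

end

context odd_size
begin

section \<open>Products and halves\<close>

lemma comp_bottom: "good n A \<Longrightarrow> good n B \<Longrightarrow> fst B (a, False) = (b, False) \<Longrightarrow> comp_match A B (a, False) = (b, False)"
proof (rule comp_match_eqI[OF n_pos])
  assume g: "good n A" "good n B" and e: "fst B (a, False) = (b, False)"
  show "(onode (a, False), onode (b, False)) \<in> stack_conn A B"
    using conn_actB[of "liftB (a, False)" B A] unfolding actB_lift e by (simp add: liftB_def onode_def)
  show "(b, False) \<noteq> (a, False)" using good_nofix[OF g(2), of "(a, False)"] e by auto
qed

lemma comp_top: "good n A \<Longrightarrow> good n B \<Longrightarrow> fst A (a, True) = (b, True) \<Longrightarrow> comp_match A B (a, True) = (b, True)"
proof (rule comp_match_eqI[OF n_pos])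
  assume g: "good n A" "good n B" and e: "fst A (a, True) = (b, True)"
  show "(onode (a, True), onode (b, True)) \<in> stack_conn A B"
    using conn_actA[of "liftA (a, True)" A B] unfolding actA_lift e by (simp add: liftA_def onode_def)
  show "(b, True) \<noteq> (a, True)" using good_nofix[OF g(1), of "(a, True)"] e by auto
qed

lemma half_comp:
  assumes "good n A" "good n B"
  shows "half True A x \<noteq> x \<Longrightarrow> half True (diag_comp n A B) x = half True A x"
    "half False B x \<noteq> x \<Longrightarrow> half False (diag_comp n A B) x = half False B x"
proof -
  show "half True (diag_comp n A B) x = half True A x" if "half True A x \<noteq> x"
    by (rule half_eqI) (simp add: diag_comp_def comp_top[OF assms half_horizontal[OF assms(1) that]])
  show "half False (diag_comp n A B) x = half False B x" if "half False B x \<noteq> x"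
    by (rule half_eqI) (simp add: diag_comp_def comp_bottom[OF assms half_horizontal[OF assms(2) that]])
qed

lemma thru_comp:
  assumes "good n A" "good n B"
  shows "thru (half True (diag_comp n A B)) \<subseteq> thru (half True A)"
    "thru (half False (diag_comp n A B)) \<subseteq> thru (half False B)"
proof -
  show "thru (half True (diag_comp n A B)) \<subseteq> thru (half True A)"
  proof
    fix x assume "x \<in> thru (half True (diag_comp n A B))"
    then show "x \<in> thru (half True A)" using half_comp(1)[OF assms, of x] by (cases "half True A x = x") (auto simp: thru_def)
  qed
  show "thru (half False (diag_comp n A B)) \<subseteq> thru (half False B)"
  proof
    fix x assume "x \<in> thru (half False (diag_comp n A B))"
    then show "x \<in> thru (half False B)" using half_comp(2)[OF assms, of x] by (cases "half False B x = x") (auto simp: thru_def)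
  qed
qed

lemma size1_mono: "T \<subseteq> T' \<Longrightarrow> size1 T \<le> size1 T'"
  unfolding size1_def by (rule card_mono) auto

lemma num_vertical_comp:
  assumes "good n A" "good n B"
  shows "num_vertical n (diag_comp n A B) \<le> num_vertical n A" "num_vertical n (diag_comp n A B) \<le> num_vertical n B"
proof -
  have g: "good n (diag_comp n A B)" by (rule good_comp[OF n_pos assms])
  show "num_vertical n (diag_comp n A B) \<le> num_vertical n A"
    using size1_mono[OF thru_comp(1)[OF assms]] num_vertical_size1[OF g, of True] num_vertical_size1[OF assms(1), of True] by simp
  show "num_vertical n (diag_comp n A B) \<le> num_vertical n B"
    using size1_mono[OF thru_comp(2)[OF assms]] num_vertical_size1[OF g, of False] num_vertical_size1[OF assms(2), of False] by simp
qed

lemma periodic_subset_eq: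
  assumes "periodic T" "periodic T'" "T \<subseteq> T'" "size1 T = size1 T'"
  shows "T = T'"
proof -
  have "T \<inter> {1..int n} = T' \<inter> {1..int n}"
    by (rule card_subset_eq) (use assms in \<open>auto simp: size1_def\<close>)
  then have "x \<in> T" if "x \<in> T'" for x
  proof -
    obtain z where z: "canon x = x + z * int n" using canon_translate by blast
    then have "canon x \<in> T' \<inter> {1..int n}" using that periodic_iff[OF assms(2)] canon_bounds[of x] by auto
    then have "canon x \<in> T" using \<open>T \<inter> {1..int n} = T' \<inter> {1..int n}\<close> by blast
    then show ?thesis using periodic_iff[OF assms(1)] z by simp
  qed
  then show ?thesis using assms(3) by blast
qed

lemma TL_PD: "D \<in> TL_diagrams n \<Longrightarrow> D \<in> PD"
  using TL_Dg Dg_PD by blast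

lemma periodic_PD: "D \<in> PD \<Longrightarrow> periodic (thru (half r D))"
  using half_ok_periodic[OF half_ok_half] by (simp add: PD_def)

lemma thru_eq_imp_eq:
  assumes "thru f = thru h" "\<And>x. h x \<noteq> x \<Longrightarrow> f x = h x"
  shows "f = h"
proof
  fix x
  show "f x = h x"
  proof (cases "h x = x")
    case True
    then have "x \<in> thru f" using assms(1) by (simp add: thru_def)
    then show ?thesis using True by (simp add: thru_def)
  qed (rule assms(2))
qed

text \<open>Horizontal edges in an outer row survive a product, so ends of vertical edges can only
  be lost; equal numbers mean that none is lost and the row is unchanged.\<close>

lemma half_comp_eq:
  assumes A: "A \<in> TL_diagrams n" and B: "B \<in> TL_diagrams n"
  shows "num_vertical n (diag_comp n A B) = num_vertical n A \<Longrightarrow> half True (diag_comp n A B) = half True A"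
    "num_vertical n (diag_comp n A B) = num_vertical n B \<Longrightarrow> half False (diag_comp n A B) = half False B"
proof -
  note g = TL_good[OF A] TL_good[OF B] TL_good[OF TL_mult[OF A B]]
  note P = periodic_PD[OF TL_PD[OF A]] periodic_PD[OF TL_PD[OF B]] periodic_PD[OF TL_PD[OF TL_mult[OF A B]]]
  show "half True (diag_comp n A B) = half True A" if "num_vertical n (diag_comp n A B) = num_vertical n A"
  proof -
    have "thru (half True (diag_comp n A B)) = thru (half True A)"
      by (rule periodic_subset_eq[OF P(3,1) thru_comp(1)[OF g(1,2)]])
        (use that num_vertical_size1 g in metis)
    then show ?thesis using half_comp(1)[OF g(1,2)] by (rule thru_eq_imp_eq)
  qed
  show "half False (diag_comp n A B) = half False B" if "num_vertical n (diag_comp n A B) = num_vertical n B"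
  proof -
    have "thru (half False (diag_comp n A B)) = thru (half False B)"
      by (rule periodic_subset_eq[OF P(3,2) thru_comp(2)[OF g(1,2)]])
        (use that num_vertical_size1 g in metis)
    then show ?thesis using half_comp(2)[OF g(1,2)] by (rule thru_eq_imp_eq)
  qed
qed

section \<open>Rotation commutes with products\<close>

text \<open>Relabels the ends of vertical edges in the bottom row by s places. Rotating a diagram
  amounts to this relabelling, see \<open>turn_rot\<close>.\<close>

definition turn :: "int \<Rightarrow> (int \<Rightarrow> int) \<Rightarrow> node \<Rightarrow> node" where
  "turn s h p = (if \<not> snd p \<and> fst p \<in> thru h then (idx (thru h) (cnt (thru h) (fst p) - s), False) else p)"

lemma turn_simps [simp]: "snd (turn s h p) = snd p" "turn s h (x, True) = (x, True)"
  by (auto simp: turn_def)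

lemma turn_turn: "periodic (thru h) \<Longrightarrow> turn (- s) h (turn s h p) = p"
proof (cases "\<not> snd p \<and> fst p \<in> thru h")
  case True
  moreover assume "periodic (thru h)"
  ultimately show ?thesis by (simp add: turn_def idx_in cnt_idx idx_cnt prod_eq_iff)
next
  case False
  then have "turn s h p = p" for s unfolding turn_def by (rule if_not_P)
  then show ?thesis by simp
qed

lemma turn_rot:
  assumes D: "D \<in> PD"
  shows "fst (rot s D) (turn s (half False D) p) = turn s (half False D) (fst D p)"
proof -
  let ?h1 = "half True D" and ?h2 = "half False D"
  note c = compat_PD[OF D]
  have ok: "half_ok ?h1" "half_ok ?h2" using c by (auto simp: compat_def)
  note T = half_ok_periodic[OF ok(1)] half_ok_periodic[OF ok(2)]
  have t: "turn s ?h2 (idx (thru ?h2) k, False) = (idx (thru ?h2) (k - s), False)" for k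
    by (simp add: turn_def idx_in[OF T(2)] cnt_idx[OF T(2)])
  have main: "fst (mk ?h1 ?h2 (w + s)) (turn s ?h2 p) = turn s ?h2 (fst (mk ?h1 ?h2 w) p)" for w
  proof (cases p rule: mk_node_cases[OF c])
    case (1 x)
    then show ?thesis by (simp add: mk_horizontal)
  next
    case (2 x)
    have "?h2 (?h2 x) = x" using ok(2) by (simp add: half_ok_def)
    then have "x \<notin> thru ?h2" "?h2 x \<notin> thru ?h2" using 2 by (auto simp: thru_def)
    then show ?thesis using 2 by (simp add: mk_horizontal turn_def)
  next
    case (3 k)
    then show ?thesis by (simp add: mk_vertical[OF c] t algebra_simps)
  next
    case (4 k)
    then show ?thesis by (simp add: t mk_vertical[OF c])
  qed
  have "fst D p = fst (mk ?h1 ?h2 (woff D)) p" using mk_eq[OF D] by simp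
  then show ?thesis using main[of "woff D"] by (simp add: rot_def)
qed

text \<open>Relabelling touches only the bottom row of the stack, so it carries walks in X over D to
  walks in X over the rotated D.\<close>

lemma conn_rot:
  assumes D: "D \<in> PD" and c: "(onode p, onode q) \<in> stack_conn X D"
  shows "(onode (turn s (half False D) p), onode (turn s (half False D) q)) \<in> stack_conn X (rot s D)"
proof -
  define th where "th u = (if snd u = 0 then (fst (turn s (half False D) (fst u, False)), 0) else u)" for u :: "int \<times> nat"
  have tA: "th (liftA x) = liftA x" for x by (simp add: th_def liftA_def)
  have tB: "th (liftB x) = liftB (turn s (half False D) x)" for x
  proof (cases "snd x")
    case True
    then have "x = (fst x, True)" by (auto simp: prod_eq_iff)
    then have "turn s (half False D) x = x" by (metis turn_simps(2))
    then show ?thesis using True by (simp add: th_def liftB_def)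
  next
    case False
    then have "(fst x, False) = x" by (auto simp: prod_eq_iff)
    then show ?thesis using False by (simp add: th_def liftB_def)
  qed
  have tO: "th (onode x) = onode (turn s (half False D) x)" for x
  proof (cases "snd x")
    case True
    then have "x = (fst x, True)" by (auto simp: prod_eq_iff)
    then have "turn s (half False D) x = x" by (metis turn_simps(2))
    then show ?thesis using True by (simp add: th_def onode_def)
  next
    case False
    then have "onode x = liftB x" "onode (turn s (half False D) x) = liftB (turn s (half False D) x)"
      by (simp_all add: onode_def liftB_def)
    then show ?thesis using tB by simp
  qed
  have "onode q \<in> {w. (th (onode p), th w) \<in> stack_conn X (rot s D)}"
  proof (rule conn_least[OF c])
    fix x assume x: "x \<in> {w. (th (onode p), th w) \<in> stack_conn X (rot s D)}"
    show "actA X x \<in> {w. (th (onode p), th w) \<in> stack_conn X (rot s D)}" if "snd x = 2 \<or> snd x = 1"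
    proof -
      obtain y where "x = liftA y" using ex_liftA \<open>snd x = 2 \<or> snd x = 1\<close> by blast
      then have "th x = x" "th (actA X x) = actA X (th x)" by (simp_all add: tA)
      then show ?thesis using x conn_trans[OF _ conn_actA] by simp
    qed
    show "actB D x \<in> {w. (th (onode p), th w) \<in> stack_conn X (rot s D)}" if "snd x = 1 \<or> snd x = 0"
    proof -
      obtain y where "x = liftB y" using ex_liftB \<open>snd x = 1 \<or> snd x = 0\<close> by blast
      then have "th (actB D x) = actB (rot s D) (th x)" by (simp add: tB turn_rot[OF D])
      then show ?thesis using x conn_trans[OF _ conn_actB] by simp
    qed
  qed simp
  then show ?thesis by (simp add: tO)
qed

lemma comp_match_rot:
  assumes X: "good n X" and D: "D \<in> PD"
  shows "comp_match X (rot s D) (turn s (half False D) p) = turn s (half False D) (comp_match X D p)"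
proof -
  have g: "good n D" "good n (rot s D)" using D rot_PD[OF D, of s] by (auto simp: PD_def)
  note C = comp_match_conn[OF n_pos X g(1), of p]
  show ?thesis
  proof (rule comp_match_eqI[OF n_pos X g(2) conn_rot[OF D C(1)]])
    show "turn s (half False D) (comp_match X D p) \<noteq> turn s (half False D) p"
      using C(2) turn_turn[OF periodic_PD[OF D]] by metis
  qed
qed

lemma num_vertical_comp_rot:
  assumes X: "good n X" and D: "D \<in> PD"
  shows "num_vertical n (diag_comp n X (rot s D)) = num_vertical n (diag_comp n X D)"
proof -
  have "snd (comp_match X (rot s D) (a, True)) = snd (comp_match X D (a, True))" for a
    using comp_match_rot[OF X D, of s "(a, True)"] by simp
  then show ?thesis by (simp add: num_vertical_def diag_comp_def)
qed

lemma num_loops_rot: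
  assumes "good n X" "D \<in> PD"
  shows "num_loops n X (rot s D) = num_loops n X D" "num_loops n (rot s D) X = num_loops n D X"
  unfolding num_loops_conv using assms rot_PD[OF assms(2), of s] rot_simps(1)[OF assms(2)]
  by (auto intro!: num_comps_halves simp: PD_def)

text \<open>By \<open>comp_match_rot\<close> the product is relabelled along the ends belonging to
  D. Because no vertical edge is lost, these are also the ends belonging to the product, and the
  relabelling is a rotation of the product.\<close>

lemma comp_rot_right:
  assumes X: "X \<in> TL_diagrams n" and D: "D \<in> TL_diagrams n" and R: "rot s D \<in> TL_diagrams n"
    and nv: "num_vertical n (diag_comp n X D) = num_vertical n D"
  shows "diag_comp n X (rot s D) = rot s (diag_comp n X D)"
proof -
  have PD: "D \<in> PD" "diag_comp n X D \<in> PD" "diag_comp n X (rot s D) \<in> PD"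
    using TL_PD X D R TL_diagrams.TL_mult by blast+
  have h: "half False (diag_comp n X D) = half False D" by (rule half_comp_eq(2)[OF X D nv])
  have "fst (diag_comp n X (rot s D)) p = fst (rot s (diag_comp n X D)) p" for p
  proof -
    let ?q = "turn (- s) (half False D) p"
    have p: "p = turn s (half False D) ?q" using turn_turn[OF periodic_PD[OF PD(1)], of "- s"] by simp
    have "fst (diag_comp n X (rot s D)) p = turn s (half False D) (comp_match X D ?q)"
      using comp_match_rot[OF TL_good[OF X] PD(1), of s ?q] p by (simp add: diag_comp_def)
    moreover have "fst (rot s (diag_comp n X D)) p = turn s (half False D) (comp_match X D ?q)"
      using turn_rot[OF PD(2), of s ?q] p h by (simp add: diag_comp_def)
    ultimately show ?thesis by simp
  qed
  moreover have "snd (diag_comp n X (rot s D)) = 0" "snd (rot s (diag_comp n X D)) = 0"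
    using PD(3) by (auto simp: PD_def rot_def)
  ultimately show ?thesis by (simp add: prod_eq_iff fun_eq_iff)
qed

lemma num_vertical_rot_comp:
  assumes Y: "good n Y" and D: "D \<in> PD"
  shows "num_vertical n (diag_comp n (rot s D) Y) = num_vertical n (diag_comp n D Y)"
proof -
  have g: "good n D" "good n (rot s D)" using D rot_PD[OF D, of s] by (auto simp: PD_def)
  have "num_vertical n (diag_comp n (rot s D) Y) = num_vertical n (flipd (diag_comp n (rot s D) Y))"
    by (rule num_vertical_flip[symmetric, OF good_comp[OF n_pos g(2) Y]])
  also have "\<dots> = num_vertical n (diag_comp n (flipd Y) (rot (- s) (flipd D)))"
    by (simp add: flipd_comp[OF n_pos g(2) Y] rot_flip[OF D])
  also have "\<dots> = num_vertical n (diag_comp n (flipd Y) (flipd D))"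
    by (rule num_vertical_comp_rot) (use Y PD_flip[OF D] in auto)
  also have "\<dots> = num_vertical n (diag_comp n D Y)"
    by (simp add: flipd_comp[OF n_pos g(1) Y, symmetric] num_vertical_flip[OF good_comp[OF n_pos g(1) Y]])
  finally show ?thesis .
qed

text \<open>The reflection of \<open>comp_rot_right\<close>. Reflecting negates offsets, so the
  rotation is by -s in between.\<close>

lemma comp_rot_left:
  assumes Y: "Y \<in> TL_diagrams n" and D: "D \<in> TL_diagrams n" and R: "rot s D \<in> TL_diagrams n"
    and nv: "num_vertical n (diag_comp n D Y) = num_vertical n D"
  shows "diag_comp n (rot s D) Y = rot s (diag_comp n D Y)"
proof -
  note g = TL_good[OF D] TL_good[OF R] TL_good[OF Y]
  note PD = TL_PD[OF D] TL_PD[OF TL_diagrams.TL_mult[OF D Y]]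
  have f: "flipd (rot s D) = rot (- s) (flipd D)" by (rule rot_flip[OF PD(1)])
  have "flipd (diag_comp n (rot s D) Y) = diag_comp n (flipd Y) (rot (- s) (flipd D))"
    by (simp add: flipd_comp[OF n_pos g(2,3)] f)
  also have "\<dots> = rot (- s) (diag_comp n (flipd Y) (flipd D))"
  proof (rule comp_rot_right)
    show "rot (- s) (flipd D) \<in> TL_diagrams n" using TL_flip[OF R] f by simp
    show "num_vertical n (diag_comp n (flipd Y) (flipd D)) = num_vertical n (flipd D)"
      using nv by (simp add: flipd_comp[OF n_pos g(1,3), symmetric] num_vertical_flip good_comp[OF n_pos] g)
  qed (use TL_flip Y D in auto)
  also have "\<dots> = flipd (rot s (diag_comp n D Y))"
    by (simp add: flipd_comp[OF n_pos g(1,3), symmetric] rot_flip[OF PD(2)])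
  finally show ?thesis by (metis flipd_simps(1))
qed

text \<open>Each vertical edge of A meets one of B directly, with equal index in the middle row, so
  the two index shifts add up.\<close>

lemma comp_matching_halves:
  assumes A: "A \<in> TL_diagrams n" and B: "B \<in> TL_diagrams n" and h: "half False A = half True B"
  shows "diag_comp n A B = mk (half True A) (half False B) (woff A + woff B)"
proof -
  note g = TL_good[OF A] TL_good[OF B]
  note PD = TL_PD[OF A] TL_PD[OF B]
  let ?h1 = "half True A" and ?h2 = "half True B" and ?h3 = "half False B"
  have cA: "compat ?h1 ?h2" using compat_PD[OF PD(1)] h by simp
  have cB: "compat ?h2 ?h3" by (rule compat_PD[OF PD(2)])
  have c: "compat ?h1 ?h3" using cA cB by (simp add: compat_def)
  have eA: "fst A (idx (thru ?h1) k, True) = (idx (thru ?h2) (k - woff A), False)" for k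
    using mk_eq[OF PD(1)] mk_vertical(1)[OF cA, of "woff A" k] h by simp
  have eB: "fst B (idx (thru ?h2) k, True) = (idx (thru ?h3) (k - woff B), False)" for k
    using mk_eq[OF PD(2)] mk_vertical(1)[OF cB, of "woff B" k] by simp
  have v: "comp_match A B (idx (thru ?h1) k, True) = (idx (thru ?h3) (k - (woff A + woff B)), False)" for k
  proof (rule comp_match_eqI[OF n_pos g])
    have "(liftA (idx (thru ?h1) k, True), liftA (idx (thru ?h2) (k - woff A), False)) \<in> stack_conn A B"
      using conn_actA[of "liftA (idx (thru ?h1) k, True)" A B] by (simp add: eA)
    moreover have "(liftB (idx (thru ?h2) (k - woff A), True), liftB (idx (thru ?h3) (k - woff A - woff B), False)) \<in> stack_conn A B"
      using conn_actB[of "liftB (idx (thru ?h2) (k - woff A), True)" B A] by (simp add: eB)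
    ultimately show "(onode (idx (thru ?h1) k, True), onode (idx (thru ?h3) (k - (woff A + woff B)), False)) \<in> stack_conn A B"
      by (simp add: liftA_def liftB_def onode_def algebra_simps) (rule conn_trans)
  qed simp
  have "comp_match A B p = fst (mk ?h1 ?h3 (woff A + woff B)) p" for p
  proof (cases p rule: mk_node_cases[OF c])
    case (1 x)
    then show ?thesis using comp_top[OF g half_horizontal[OF g(1)]] by (simp add: mk_horizontal)
  next
    case (2 x)
    then show ?thesis using comp_bottom[OF g half_horizontal[OF g(2)]] by (simp add: mk_horizontal)
  next
    case (3 k)
    then show ?thesis using v by (simp add: mk_vertical[OF c])
  next
    case (4 k)
    have "fst (diag_comp n A B) (idx (thru ?h1) (k + (woff A + woff B)), True) = (idx (thru ?h3) k, False)"
      using v by (simp add: diag_comp_def)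
    from good_eqD[OF good_comp[OF n_pos g] this] show ?thesis using 4 by (simp add: mk_vertical[OF c] diag_comp_def)
  qed
  moreover have "snd (diag_comp n A B) = 0" using TL_Dg[OF TL_diagrams.TL_mult[OF A B]] by (simp add: Dg_def)
  ultimately show ?thesis by (simp add: prod_eq_iff fun_eq_iff) (simp add: diag_comp_def)
qed

section \<open>An idempotent for each number of vertical edges\<close>

text \<open>Residues 0 to n - t - 1 are joined in consecutive pairs, which works out because n - t
  is even; the last t residues stay free. The diagram built on it is flat, hence even.\<close>

definition cups :: "nat \<Rightarrow> int \<Rightarrow> int" where
  "cups t x = (if x mod int n < int n - int t then if even (x mod int n) then x + 1 else x - 1 else x)"

definition idem :: "nat \<Rightarrow> diagram" where
  "idem t = mk (cups t) (cups t) 0"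

context
  fixes t :: nat
  assumes t: "odd t" "t \<le> n - 2"
begin

lemma t_bounds: "1 \<le> t" "int t \<le> int n - 2" "even (int n - int t)"
  using t odd_n n3 by (auto elim: oddE)

lemma cups_invol: "cups t (cups t x) = x"
proof (cases "x mod int n < int n - int t")
  case True
  have m: "0 \<le> x mod int n" "x mod int n < int n" using n_pos by auto
  show ?thesis
  proof (cases "even (x mod int n)")
    case ev: True
    define r where "r = x mod int n"
    have "r < int n - int t" "even r" using True ev by (auto simp: r_def)
    then have lt: "x mod int n + 1 < int n - int t" using t_bounds(3) unfolding r_def[symmetric] by presburger
    have "(x + 1) mod int n = (x mod int n + 1) mod int n" by (simp add: mod_simps)
    also have "\<dots> = x mod int n + 1" by (rule mod_pos_pos_trivial) (use m lt in auto)
    finally show ?thesis using True ev lt by (simp add: cups_def)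
  next
    case od: False
    then have "x mod int n \<noteq> 0" by (metis even_zero)
    then have ge: "x mod int n \<ge> 1" using m by linarith
    have "(x - 1) mod int n = (x mod int n - 1) mod int n" by (simp add: mod_simps)
    also have "\<dots> = x mod int n - 1" by (rule mod_pos_pos_trivial) (use m ge in auto)
    finally show ?thesis using True od by (simp add: cups_def)
  qed
qed (simp add: cups_def)

lemma half_ok_cups: "half_ok (cups t)"
  unfolding half_ok_def
proof (intro conjI allI impI)
  fix x z
  show "cups t (cups t x) = x" by (rule cups_invol)
  show "cups t (x + z * int n) = cups t x + z * int n" by (simp add: cups_def)
  have "(int n - 1) mod int n = int n - 1" by (rule mod_pos_pos_trivial) (use n_pos in auto)
  then have "cups t (int n - 1) = int n - 1" using t_bounds by (simp add: cups_def)
  then show "thru (cups t) \<noteq> {}" by (auto simp: thru_def)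
next
  fix a c assume ac: "a < c \<and> c < cups t a"
  have "cups t a \<le> a + 1" by (simp add: cups_def)
  then show "cups t c \<noteq> c" "a < cups t c" "cups t c < cups t a" using ac by linarith+
qed

lemma size1_cups: "size1 (thru (cups t)) = t"
proof -
  have "thru (cups t) \<inter> {1..int n} = {int n - int t..int n - 1}"
  proof (intro equalityI subsetI)
    fix x assume x: "x \<in> thru (cups t) \<inter> {1..int n}"
    then have "\<not> x mod int n < int n - int t" by (auto simp: thru_def cups_def split: if_splits)
    \<comment> \<open>In the window 1 to n the residue 0 is represented by n, and it belongs to a
      pair.\<close>
    moreover from this have "x \<noteq> int n" using t_bounds by auto
    then have "x mod int n = x" using x by (intro mod_pos_pos_trivial) auto
    ultimately show "x \<in> {int n - int t..int n - 1}" using x \<open>x \<noteq> int n\<close> by auto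
  next
    fix x assume x: "x \<in> {int n - int t..int n - 1}"
    then have "x mod int n = x" using t_bounds by (intro mod_pos_pos_trivial) auto
    then show "x \<in> thru (cups t) \<inter> {1..int n}" using x t_bounds by (auto simp: thru_def cups_def)
  qed
  then show ?thesis using t_bounds by (simp add: size1_def)
qed

lemma compat_cups: "compat (cups t) (cups t)"
  by (simp add: compat_def half_ok_cups)

lemma half_idem: "half r (idem t) = cups t"
  using half_mk[OF compat_cups] by (cases r) (auto simp: idem_def)

lemma num_vertical_idem: "num_vertical n (idem t) = t"
  using num_vertical_size1[OF good_mk[OF compat_cups, of 0], of True] half_mk(1)[OF compat_cups, of 0] size1_cups
  by (simp add: idem_def)

lemma idem_Dg: "idem t \<in> Dg"
proof (rule flat_Dg)
  show "good n (idem t)" unfolding idem_def by (rule good_mk[OF compat_cups])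
  have "x \<in> thru (cups t) \<Longrightarrow> idx (thru (cups t)) (cnt (thru (cups t)) x) = x" for x
    by (rule idx_cnt[OF half_ok_periodic[OF half_ok_cups]])
  moreover have "cups t x = x + 1 \<or> cups t x = x - 1 \<or> cups t x = x" for x by (simp add: cups_def)
  ultimately show "flat (idem t)" unfolding flat_def idem_def mk_def by (auto simp: thru_def)
qed (simp add: idem_def)

lemma idem_TL: "idem t \<in> TL_diagrams n"
proof (rule TL_characterization[OF idem_Dg])
  show "num_vertical n (idem t) < n" using t_bounds num_vertical_idem by simp
qed

lemma woff_idem: "woff (idem t) = 0"
  by (simp add: idem_def woff_mk[OF compat_cups])

lemma idem_idem: "diag_comp n (idem t) (idem t) = idem t"
proof -
  have "half False (idem t) = half True (idem t)" by (simp add: half_idem)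
  from comp_matching_halves[OF idem_TL idem_TL this] show ?thesis
    by (simp add: half_idem woff_idem) (simp add: idem_def)
qed

text \<open>A leads from the top half of D to \<open>cups t\<close>, and B from there to the bottom
  half. The offset of D may be split between them at will; w is chosen to make A even, and evenness
  of D then makes B even.\<close>

lemma TL_factor:
  assumes D: "D \<in> TL_diagrams n" and nv: "num_vertical n D = t"
  shows "\<exists>A\<in>TL_diagrams n. \<exists>B\<in>TL_diagrams n. diag_comp n A B = D \<and> diag_comp n A (idem t) = A"
proof -
  note DD = TL_Dg[OF D]
  let ?p = "idx (thru (half True D)) 0" and ?q = "idx (thru (half False D)) 0" and ?e = "idx (thru (cups t)) 0"
  have g: "good n D" "planar (fst D)" "good n (idem t)" "planar (fst (idem t))"
    using DD idem_Dg by (auto simp: Dg_def)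
  have nve: "num_vertical n D = num_vertical n (idem t)" using nv num_vertical_idem by simp
  have cA: "compat (half True D) (cups t)"
    using compat_half[OF g nve, of True True] by (simp add: half_idem)
  have cB: "compat (cups t) (half False D)"
    using compat_half[OF g(3,4,1,2) nve[symmetric], of True False] by (simp add: half_idem)
  define w where "w = ?p + ?e"
  define A where "A = mk (half True D) (cups t) w"
  define B where "B = mk (cups t) (half False D) (woff D - w)"
  have "mk (half True D) (half False D) (woff D) \<in> Dg" using DD mk_eq[OF Dg_PD[OF DD]] by simp
  then have ev: "even (?p + ?q + woff D)" unfolding mk_even_iff[OF DD DD refl] .
  have A_Dg: "A \<in> Dg" using mk_even_iff[OF DD idem_Dg nve, of w] by (simp add: half_idem A_def w_def)
  have "even (?e + ?q + (woff D - w))" using ev unfolding w_def by presburger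
  then have B_Dg: "B \<in> Dg" using mk_even_iff[OF idem_Dg DD nve[symmetric], of "woff D - w"] by (simp add: half_idem B_def)
  have hA: "half True A = half True D" "half False A = cups t" "woff A = w"
    unfolding A_def by (simp_all add: half_mk[OF cA] woff_mk[OF cA])
  have hB: "half True B = cups t" "half False B = half False D" "woff B = woff D - w"
    unfolding B_def by (simp_all add: half_mk[OF cB] woff_mk[OF cB])
  have "num_vertical n A = num_vertical n D"
    using num_vertical_size1[OF Dg_good[OF A_Dg], of True] num_vertical_size1[OF g(1), of True] hA by simp
  then have A: "A \<in> TL_diagrams n" using TL_characterization[OF A_Dg] nv t_bounds by simp
  have "num_vertical n B = num_vertical n D"
    using num_vertical_size1[OF Dg_good[OF B_Dg], of False] num_vertical_size1[OF g(1), of False] hB by simp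
  then have B: "B \<in> TL_diagrams n" using TL_characterization[OF B_Dg] nv t_bounds by simp
  have "diag_comp n A B = D"
    using comp_matching_halves[OF A B] hA hB mk_eq[OF Dg_PD[OF DD]] by simp
  moreover have "diag_comp n A (idem t) = A"
    using comp_matching_halves[OF A idem_TL] hA by (simp add: half_idem woff_idem A_def)
  ultimately show ?thesis using A B by blast
qed

end

section \<open>Annular involutions and halves\<close>

definition inv_of :: "(int \<Rightarrow> int) \<Rightarrow> nat \<Rightarrow> nat" where
  "inv_of h i = (if 1 \<le> i \<and> i \<le> n then nat (canon (h (int i))) else i)"

definition encl :: "(nat \<Rightarrow> nat) \<Rightarrow> nat \<Rightarrow> nat \<Rightarrow> bool" where
  "encl S i j \<longleftrightarrow> (\<exists>c\<in>fixed_points n S. min i j \<le> c \<and> c \<le> max i j)"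

text \<open>In an annular involution an arc containing fixed points between its ends must run the other
  way around the cylinder, so in the universal cover it joins a node to a translate of its partner.\<close>

definition half_of :: "(nat \<Rightarrow> nat) \<Rightarrow> int \<Rightarrow> int" where
  "half_of S x = (let i = nat (canon x); j = S i in if j = i then x
     else x - int i + int j + (if encl S i j then if i < j then - int n else int n else 0))"

lemma row_inv_inv_of: "good n D \<Longrightarrow> row_inv n r D = inv_of (half r D)"
proof
  fix i assume g: "good n D"
  have "lab n j = nat (canon j)" for j
  proof -
    have "0 \<le> (j - 1) mod int n" using n_pos by simp
    then show ?thesis by (simp add: lab_def canon_def nat_add_distrib)
  qed
  moreover have "nat (canon (int i)) = i" if "1 \<le> i" "i \<le> n" using canon_id[of "int i"] that by simp
  ultimately show "row_inv n r D i = inv_of (half r D) i"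
    by (auto simp: row_inv_def inv_of_def half_def)
qed

lemma arc_short:
  assumes h: "half_ok h" and a: "a < h a"
  shows "h a < a + int n"
proof (rule ccontr)
  assume "\<not> ?thesis"
  then have long: "a + int n \<le> h a" by simp
  obtain x where x: "x \<in> thru h" using h by (auto simp: half_ok_def)
  define y where "y = a + (x - a) mod int n"
  have "y mod int n = x mod int n" by (simp add: y_def mod_simps)
  then obtain z where "x = y + z * int n" using mod_translate by blast
  then have y: "y \<in> thru h" using x periodic_iff[OF half_ok_periodic[OF h]] by simp
  have "0 \<le> (x - a) mod int n" "(x - a) mod int n < int n" using n_pos by auto
  then have "a \<le> y" "y < a + int n" by (auto simp: y_def)
  moreover have "y \<noteq> a" using y a by (auto simp: thru_def)
  ultimately have "h y \<noteq> y" using h long unfolding half_ok_def by (metis less_le order_less_le_trans)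
  then show False using y by (simp add: thru_def)
qed

context
  fixes h :: "int \<Rightarrow> int"
  assumes h: "half_ok h"
begin

lemma h_invol: "h (h x) = x" and h_shift: "h (x + z * int n) = h x + z * int n"
  and h_nest: "a < c \<Longrightarrow> c < h a \<Longrightarrow> h c \<noteq> c \<and> a < h c \<and> h c < h a"
  using h unfolding half_ok_def by blast+

lemma S_int: "i \<in> {1..n} \<Longrightarrow> int ((inv_of h) i) = canon (h (int i))"
  using canon_bounds[of "h (int i)"] by (simp add: inv_of_def)

lemma S_ex: "i \<in> {1..n} \<Longrightarrow> \<exists>z. int ((inv_of h) i) = h (int i) + z * int n"
  using S_int canon_translate by metis

lemma S_in: "i \<in> {1..n} \<Longrightarrow> (inv_of h) i \<in> {1..n}"
  using canon_bounds[of "h (int i)"] S_int[of i] by auto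

lemma S_eqI: "i \<in> {1..n} \<Longrightarrow> j \<in> {1..n} \<Longrightarrow> h (int i) = int j + z * int n \<Longrightarrow> (inv_of h) i = j"
  using S_int[of i] canon_add[of "int j" z] canon_id[of "int j"] by simp

lemma S_invol: "i \<in> {1..n} \<Longrightarrow> (inv_of h) ((inv_of h) i) = i"
proof -
  assume i: "i \<in> {1..n}"
  obtain z where z: "int ((inv_of h) i) = h (int i) + z * int n" using S_ex[OF i] by blast
  have "h (int ((inv_of h) i)) = int i + z * int n" unfolding z h_shift h_invol ..
  then show ?thesis by (rule S_eqI[OF S_in[OF i] i])
qed

lemma is_involution_S: "is_involution n (inv_of h)"
  unfolding is_involution_def using S_in S_invol by (auto simp: inv_of_def)

lemma S_fix_iff: "i \<in> {1..n} \<Longrightarrow> (inv_of h) i = i \<longleftrightarrow> h (int i) = int i"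
proof
  assume i: "i \<in> {1..n}" and "(inv_of h) i = i"
  then obtain z where z: "int i = h (int i) + z * int n" using S_ex[OF i] by metis
  then have "h (int i) = h (h (int i)) + z * int n" by (metis h_shift)
  then have "z = 0" using z h_invol n_pos by simp
  then show "h (int i) = int i" using z by simp
next
  assume i: "i \<in> {1..n}" and "h (int i) = int i"
  then show "(inv_of h) i = i" using S_eqI[OF i i, of 0] by simp
qed

lemma fixed_points_S: "fixed_points n (inv_of h) = {i \<in> {1..n}. h (int i) = int i}"
  using S_fix_iff by (auto simp: fixed_points_def)

lemma card_fixed_points: "card (fixed_points n (inv_of h)) = size1 (thru h)"
proof -
  have "thru h \<inter> {1..int n} = int ` fixed_points n (inv_of h)"
  proof (intro equalityI subsetI)
    fix x assume "x \<in> thru h \<inter> {1..int n}"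
    then have "x = int (nat x)" "nat x \<in> fixed_points n (inv_of h)" by (auto simp: thru_def fixed_points_S)
    then show "x \<in> int ` fixed_points n (inv_of h)" by (rule image_eqI)
  qed (auto simp: fixed_points_S thru_def)
  then show ?thesis by (simp add: size1_def card_image)
qed

lemma fixed_nonempty: "fixed_points n (inv_of h) \<noteq> {}"
  using card_fixed_points size1_pos[OF half_ok_periodic[OF h]] by force

text \<open>The lift of i is joined to j - z * n, and the bound on arc lengths leaves z = 0 or z =
  1. For z = 0 nesting keeps fixed points out from under the arc. For z = 1 the arc runs from j to i
  + n, and nesting confines the fixed points to {i..j}.\<close>

lemma S_cases:
  assumes ij: "i \<in> {1..n}" "j \<in> {1..n}" "i < j" "(inv_of h) i = j"
  shows "h (int i) = int j \<and> {i..j} \<inter> fixed_points n (inv_of h) = {} \<or>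
     h (int i) = int j - int n \<and> fixed_points n (inv_of h) \<subseteq> {i..j}"
proof -
  obtain z where z: "int j = h (int i) + z * int n" using S_ex[OF ij(1)] ij(4) by auto
  have ne: "h (int i) \<noteq> int i" using S_fix_iff[OF ij(1)] ij by simp
  have bd: "\<bar>h (int i) - int i\<bar> < int n"
  proof (cases "int i < h (int i)")
    case True then show ?thesis using arc_short[OF h True] by simp
  next
    case False
    then have lt: "h (int i) < h (h (int i))" using ne h_invol by simp
    show ?thesis using arc_short[OF h lt] h_invol False by simp
  qed
  have "int j \<le> int n" "1 \<le> int i" "int i < int j" using ij by auto
  then have lo: "- 1 * int n < z * int n" and hi: "z * int n < 2 * int n" using z bd by linarith+
  have "z = 0 \<or> z = 1"
  proof -
    have "- 1 < z" using mult_right_less_imp_less[OF lo] by simp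
    moreover have "z < 2" using mult_right_less_imp_less[OF hi] by simp
    ultimately show ?thesis by linarith
  qed
  then show ?thesis
  proof
    assume "z = 0"
    then have e: "h (int i) = int j" using z by simp
    have "{i..j} \<inter> fixed_points n (inv_of h) = {}"
    proof -
      have False if c: "c \<in> {i..j}" "c \<in> fixed_points n (inv_of h)" for c
      proof -
        have hc: "h (int c) = int c" using c by (simp add: fixed_points_S)
        have "c \<noteq> i" "c \<noteq> j" using hc e ne h_invol by metis+
        then show False using h_nest[of "int i" "int c"] hc e c by auto
      qed
      then show ?thesis by blast
    qed
    then show ?thesis using e by blast
  next
    assume "z = 1"
    then have e: "h (int i) = int j - int n" using z by simp
    have hj: "h (int j) = int i + int n"
    proof -
      have "int j = h (int i) + 1 * int n" using e by simp
      then have "h (int j) = h (h (int i)) + 1 * int n" by (metis h_shift)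
      then show ?thesis by (simp add: h_invol)
    qed
    have "fixed_points n (inv_of h) \<subseteq> {i..j}"
    proof
      fix c assume c: "c \<in> fixed_points n (inv_of h)"
      then have hc: "h (int c) = int c" "1 \<le> c" "c \<le> n" by (auto simp: fixed_points_S)
      have "\<not> j < c" using h_nest[of "int j" "int c"] hj hc ij by auto
      moreover have "\<not> c < i"
      proof
        assume "c < i"
        moreover have "h (int c + 1 * int n) = int c + 1 * int n" unfolding h_shift hc ..
        ultimately show False using h_nest[of "int j" "int c + int n"] hj hc ij by auto
      qed
      ultimately show "c \<in> {i..j}" by simp
    qed
    then show ?thesis using e by blast
  qed
qed

lemma annular_S: "annular n (inv_of h)"
  unfolding annular_def
proof (intro conjI allI impI is_involution_S)
  fix i j assume a: "1 \<le> i \<and> i < j \<and> j \<le> n \<and> (inv_of h) i = j"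
  then have ij: "i \<in> {1..n}" "j \<in> {1..n}" "i < j" "(inv_of h) i = j" by auto
  have Sj: "(inv_of h) j = i" using S_invol[OF ij(1)] ij(4) by simp
  have sub: "(inv_of h) c \<in> {i..j}" if c: "c \<in> {i..j}" for c
  proof -
    have cn: "c \<in> {1..n}" using c ij by auto
    consider "c = i" | "c = j" | "i < c" "c < j" using c by fastforce
    then show ?thesis
    proof cases
      case 3
      obtain y where y: "int ((inv_of h) c) = h (int c) + y * int n" using S_ex[OF cn] by blast
      then have hs: "h (int ((inv_of h) c)) = int c + y * int n" by (simp add: h_shift h_invol)
      note Sc = S_in[OF cn]
      have ne: "(inv_of h) c \<noteq> i" "(inv_of h) c \<noteq> j" using S_invol[OF cn] ij Sj 3 by auto
      from S_cases[OF ij] show ?thesis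
      proof
        assume "h (int i) = int j \<and> {i..j} \<inter> fixed_points n (inv_of h) = {}"
        then have "int i < h (int c)" "h (int c) < int j" using h_nest[of "int i" "int c"] 3 by auto
        then have "(inv_of h) c = nat (h (int c))" using S_eqI[OF cn, of "nat (h (int c))" 0] ij by auto
        then show ?thesis using \<open>int i < h (int c)\<close> \<open>h (int c) < int j\<close> by auto
      next
        assume z1: "h (int i) = int j - int n \<and> fixed_points n (inv_of h) \<subseteq> {i..j}"
        have hj: "h (int j) = int i + int n"
        proof -
          have "int j = h (int i) + 1 * int n" using z1 by simp
          then have "h (int j) = h (h (int i)) + 1 * int n" by (metis h_shift)
          then show ?thesis by (simp add: h_invol)
        qed
        \<comment> \<open>The window from j to i + n contains no translate of a c with i < c < j:
          shifting left or not at all keeps it below j, shifting right takes it beyond i +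
          n.\<close>
        have no: False if "int j < int c + y' * int n" "int c + y' * int n < int i + int n" for y'
        proof -
          have "y' > 0" using that(1) 3 by (cases "y' \<le> 0") (auto simp: mult_nonpos_nonneg dest: order_trans,
              smt (verit) mult_nonpos_nonneg of_nat_0_le_iff of_nat_less_iff)
          then have "1 * int n \<le> y' * int n" by (intro mult_right_mono) auto
          then show False using that(2) 3 by simp
        qed
        have "\<not> j < (inv_of h) c"
        proof
          assume "j < (inv_of h) c"
          then have "int j < h (int ((inv_of h) c)) \<and> h (int ((inv_of h) c)) < int i + int n"
            using h_nest[of "int j" "int ((inv_of h) c)"] hj Sc ij by auto
          then show False using no[of y] hs by simp
        qed
        moreover have "\<not> (inv_of h) c < i"
        proof
          assume "(inv_of h) c < i"
          then have "int j < h (int ((inv_of h) c) + 1 * int n) \<and> h (int ((inv_of h) c) + 1 * int n) < int i + int n"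
            using h_nest[of "int j" "int ((inv_of h) c) + 1 * int n"] hj Sc ij by auto
          then show False using no[of "y + 1"] unfolding h_shift hs by (simp add: algebra_simps)
        qed
        ultimately show ?thesis by simp
      qed
    qed (use ij Sj in auto)
  qed
  show "(inv_of h) ` {i..j} = {i..j}"
  proof (intro equalityI subsetI)
    fix c assume "c \<in> {i..j}"
    moreover from this have "c = (inv_of h) ((inv_of h) c)" using S_invol ij by auto
    ultimately show "c \<in> (inv_of h) ` {i..j}" using sub by blast
  qed (use sub in auto)
  show "{i..j} \<inter> fixed_points n (inv_of h) = {} \<or> fixed_points n (inv_of h) \<subseteq> {i..j}" using S_cases[OF ij] by blast
qed

lemma half_of_S: "half_of (inv_of h) = h"
proof
  fix x
  define i where "i = nat (canon x)"
  have i: "int i = canon x" "i \<in> {1..n}" using canon_bounds[of x] by (auto simp: i_def)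
  obtain z where z: "canon x = x + z * int n" using canon_translate by blast
  have hx: "h x = h (int i) - z * int n" using h_shift[of x z] i z by simp
  have "half_of (inv_of h) x = h (int i) - z * int n"
  proof (cases "(inv_of h) i = i")
    case True
    then have "h (int i) = int i" using S_fix_iff i by simp
    then show ?thesis using True i z unfolding half_of_def Let_def i_def[symmetric] by simp
  next
    case ne: False
    define j where "j = (inv_of h) i"
    have j: "j \<in> {1..n}" "(inv_of h) j = i" using S_in[OF i(2)] S_invol[OF i(2)] by (auto simp: j_def)
    obtain f where f: "f \<in> fixed_points n (inv_of h)" using fixed_nonempty by blast
    have "h (int i) = int j + (if encl (inv_of h) i j then if i < j then - int n else int n else 0)"
    proof (cases "i < j")
      case True
      from S_cases[OF i(2) j(1) True j_def[symmetric]] show ?thesis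
        using True f by (fastforce simp: encl_def)
    next
      case False
      then have lt: "j < i" using ne j_def by simp
      from S_cases[OF j(1) i(2) lt j(2)] show ?thesis
      proof
        assume a: "h (int j) = int i \<and> {j..i} \<inter> fixed_points n (inv_of h) = {}"
        then have "h (int i) = int j" using h_invol by metis
        moreover have "\<not> encl (inv_of h) i j" using a lt by (fastforce simp: encl_def)
        ultimately show ?thesis by simp
      next
        assume a: "h (int j) = int i - int n \<and> fixed_points n (inv_of h) \<subseteq> {j..i}"
        then have "int i = h (int j) + 1 * int n" by simp
        then have "h (int i) = h (h (int j)) + 1 * int n" by (metis h_shift)
        moreover have "encl (inv_of h) i j" using a f lt by (fastforce simp: encl_def)
        ultimately show ?thesis using lt by (simp add: h_invol)
      qed
    qed
    then show ?thesis using ne i z unfolding half_of_def Let_def i_def[symmetric] j_def[symmetric] by (simp add: j_def)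
  qed
  then show "half_of (inv_of h) x = h x" using hx by simp
qed

end

context
  fixes S :: "nat \<Rightarrow> nat"
  assumes S: "annular n S" and fne: "fixed_points n S \<noteq> {}"
begin

lemma ann_invol: "i \<in> {1..n} \<Longrightarrow> S i \<in> {1..n}" "i \<in> {1..n} \<Longrightarrow> S (S i) = i"
  using S by (auto simp: annular_def is_involution_def)

lemma half_of_shift: "half_of S (x + z * int n) = half_of S x + z * int n"
  by (simp add: half_of_def Let_def)

lemma half_of_int: "i \<in> {1..n} \<Longrightarrow> half_of S (int i) = (if S i = i then int i
    else int (S i) + (if encl S i (S i) then if i < S i then - int n else int n else 0))"
  using canon_id[of "int i"] by (simp add: half_of_def Let_def)

lemma encl_sym: "encl S i j \<longleftrightarrow> encl S j i"
  by (simp add: encl_def min.commute max.commute)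

lemma half_of_invol_int: "i \<in> {1..n} \<Longrightarrow> half_of S (half_of S (int i)) = int i"
proof -
  assume i: "i \<in> {1..n}"
  show ?thesis
  proof (cases "S i = i")
    case True then show ?thesis using half_of_int[OF i] by simp
  next
    case False
    note Si = ann_invol[OF i]
    have e: "half_of S (int (S i)) = int i + (if encl S i (S i) then if S i < i then - int n else int n else 0)"
      using half_of_int[OF Si(1)] Si False encl_sym[of i] by auto
    consider "\<not> encl S i (S i)" | "encl S i (S i)" "i < S i" | "encl S i (S i)" "S i < i" using False by linarith
    then show ?thesis
    proof cases
      case 1
      then show ?thesis using half_of_int[OF i] e False by simp
    next
      case 2
      then show ?thesis using half_of_int[OF i] e False half_of_shift[of "int (S i)" "-1"] by simp
    next
      case 3
      then show ?thesis using half_of_int[OF i] e False half_of_shift[of "int (S i)" 1] by simp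
    qed
  qed
qed

lemma int_rep: obtains i z where "i \<in> {1..n}" "x = int i + z * int n"
proof -
  obtain z where z: "canon x = x + z * int n" using canon_translate by blast
  have "nat (canon x) \<in> {1..n}" "x = int (nat (canon x)) + (- z) * int n" using canon_bounds[of x] z by auto
  then show ?thesis using that by blast
qed

text \<open>A lifted arc going right is either direct, with no fixed point below it, or it wraps
  around from i to j + n with j < i. In the second case the nodes below it lift the residues outside
  {j..i}, which S preserves since it preserves {j..i}.\<close>

lemma half_of_nest_int:
  assumes i: "i \<in> {1..n}" and c: "int i < c" "c < half_of S (int i)"
  shows "half_of S c \<noteq> c \<and> int i < half_of S c \<and> half_of S c < half_of S (int i)"
proof -
  define j where "j = S i"
  have j: "j \<in> {1..n}" "S j = i" using ann_invol[OF i] by (auto simp: j_def)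
  have ne: "j \<noteq> i" using c half_of_int[OF i] by (auto simp: j_def)
  have hi: "half_of S (int i) = int j + (if encl S i j then if i < j then - int n else int n else 0)"
    using half_of_int[OF i] ne by (simp add: j_def)
  have ann: "S ` {a..b} = {a..b}" "{a..b} \<inter> fixed_points n S = {} \<or> fixed_points n S \<subseteq> {a..b}"
    if "a \<in> {1..n}" "b \<in> {1..n}" "a < b" "S a = b" for a b
    using S that unfolding annular_def by auto
  consider "i < j" "\<not> encl S i j" | "j < i" "encl S i j"
    using c hi ne i j by (auto split: if_splits)
  then show ?thesis
  proof cases
    case 1
    have ci: "c = int (nat c)" "i < nat c" "nat c < j" using c hi 1 by auto
    define c' where "c' = nat c"
    have c': "c = int c'" "i < c'" "c' < j" "c' \<in> {1..n}" using ci i j by (auto simp: c'_def)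
    have im: "S c' \<in> {i..j}" using ann(1)[OF i j(1) 1(1) j_def[symmetric]] c' by (metis atLeastAtMost_iff image_eqI less_imp_le)
    have ncf: "f \<notin> {i..j}" if "f \<in> fixed_points n S" for f using 1 that by (auto simp: encl_def)
    have nf: "S c' \<noteq> c'" using ncf[of c'] c' by (auto simp: fixed_points_def)
    have "\<not> encl S c' (S c')" using ncf im c' by (fastforce simp: encl_def)
    then have "half_of S c = int (S c')" using half_of_int[OF c'(4)] nf c' by simp
    moreover have "S c' \<noteq> i" "S c' \<noteq> j" using ann_invol(2)[OF c'(4)] c' j j_def by auto
    ultimately show ?thesis using im nf c' hi 1 by auto
  next
    case 2
    have hi': "half_of S (int i) = int j + int n" using hi 2 by simp
    note an = ann[OF j(1) i 2(1) j(2)]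
    have F: "fixed_points n S \<subseteq> {j..i}" using an(2) 2 by (fastforce simp: encl_def)
    obtain f where f: "f \<in> fixed_points n S" "j \<le> f" "f \<le> i" using fne F by fastforce
    \<comment> \<open>\<open>c'\<close> is the representative of c in 1 to n, and y tells whether c
      has passed n.\<close>
    define c' where "c' = (if c \<le> int n then nat c else nat (c - int n))"
    define y where "y = (if c \<le> int n then 0 else 1 :: int)"
    have c': "c = int c' + y * int n" "c' \<in> {1..n}" "(y = 0 \<and> i < c') \<or> (y = 1 \<and> c' < j)"
      using c hi' i j by (auto simp: c'_def y_def)
    have nin: "S c' \<notin> {j..i}"
    proof
      assume "S c' \<in> {j..i}"
      then have "S (S c') \<in> {j..i}" using an(1) by blast
      then show False using ann_invol(2)[OF c'(2)] c' 2 by auto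
    qed
    have Sc: "S c' \<in> {1..n}" by (rule ann_invol(1)[OF c'(2)])
    have nf: "S c' \<noteq> c'" using F c' 2 by (auto simp: fixed_points_def)
    have hc: "half_of S c = int (S c') + (if encl S c' (S c') then if c' < S c' then - int n else int n else 0) + y * int n"
      using half_of_int[OF c'(2)] nf half_of_shift[of "int c'" y] c' by simp
    \<comment> \<open>All fixed points lie in {j..i}, an interval avoiding c' and S c'. So the arc
      of c' encloses one of them iff its ends lie on opposite sides of this interval.\<close>
    have enc: "encl S c' (S c') \<longleftrightarrow> (c' < j) \<noteq> (S c' < j)"
    proof
      assume "encl S c' (S c')"
      then obtain g where g: "g \<in> fixed_points n S" "min c' (S c') \<le> g" "g \<le> max c' (S c')" by (auto simp: encl_def)
      then have "j \<le> g" "g \<le> i" using F by auto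
      then show "(c' < j) \<noteq> (S c' < j)" using g nin c' 2 by (auto simp: min_def max_def split: if_splits)
    next
      assume "(c' < j) \<noteq> (S c' < j)"
      then show "encl S c' (S c')" unfolding encl_def using f nin c' by (intro bexI[OF _ f(1)]) auto
    qed
    show ?thesis
    proof (cases "c' < j")
      case True
      then have y: "y = 1" using c' 2 by auto
      show ?thesis
      proof (cases "S c' < j")
        case True
        then show ?thesis using hc enc \<open>c' < j\<close> y hi' c' nf i Sc by auto
      next
        case False
        then have "i < S c'" using nin by auto
        then show ?thesis using hc enc \<open>c' < j\<close> y hi' c' nf i Sc False 2 by auto
      qed
    next
      case False
      then have y: "y = 0" "i < c'" using c' by auto
      show ?thesis
      proof (cases "S c' < j")
        case True
        then show ?thesis using hc enc \<open>\<not> c' < j\<close> y hi' c' nf i Sc 2 by auto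
      next
        case f2: False
        then have "i < S c'" using nin by auto
        then show ?thesis using hc enc \<open>\<not> c' < j\<close> y hi' c' nf i Sc f2 j by auto
      qed
    qed
  qed
qed

lemma half_ok_half_of: "half_ok (half_of S)"
  unfolding half_ok_def
proof (intro conjI allI impI half_of_shift)
  fix x
  obtain i z where i: "i \<in> {1..n}" "x = int i + z * int n" by (rule int_rep)
  show "half_of S (half_of S x) = x" unfolding i(2) half_of_shift half_of_invol_int[OF i(1)] ..
next
  obtain f where "f \<in> fixed_points n S" using fne by blast
  then have "f \<in> {1..n}" "S f = f" by (auto simp: fixed_points_def)
  then have "int f \<in> thru (half_of S)" using half_of_int by (simp add: thru_def)
  then show "thru (half_of S) \<noteq> {}" by blast
next
  fix a c assume ac: "a < c \<and> c < half_of S a"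
  obtain i z where i: "i \<in> {1..n}" "a = int i + z * int n" by (rule int_rep)
  have "int i < c - z * int n" "c - z * int n < half_of S (int i)" using ac unfolding i(2) half_of_shift by auto
  note N = half_of_nest_int[OF i(1) this]
  have "half_of S (c - z * int n) = half_of S c - z * int n" using half_of_shift[of c "- z"] by simp
  then have "half_of S c \<noteq> c \<and> a < half_of S c \<and> half_of S c < half_of S a" using N unfolding i(2) half_of_shift by auto
  then show "half_of S c \<noteq> c" "a < half_of S c" "half_of S c < half_of S a" by auto
qed

lemma inv_of_half_of: "inv_of (half_of S) = S"
proof
  fix i
  show "inv_of (half_of S) i = S i"
  proof (cases "i \<in> {1..n}")
    case True
    note Si = ann_invol(1)[OF True]
    have "\<exists>z. half_of S (int i) = int (S i) + z * int n"
    proof (cases "S i = i")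
      case True
      then show ?thesis using half_of_int[OF \<open>i \<in> {1..n}\<close>] by (intro exI[of _ 0]) simp
    next
      case False
      then show ?thesis using half_of_int[OF \<open>i \<in> {1..n}\<close>]
        by (intro exI[of _ "if encl S i (S i) then if i < S i then - 1 else 1 else 0"]) simp
    qed
    then obtain z where "half_of S (int i) = int (S i) + z * int n" by blast
    then have "canon (half_of S (int i)) = int (S i)" using canon_id[of "int (S i)"] Si by simp
    then show ?thesis using True by (simp add: inv_of_def)
  next
    case False
    then have "i < 1 \<or> n < i" by auto
    moreover have "\<forall>i. (i < 1 \<or> n < i) \<longrightarrow> S i = i"
      using S unfolding annular_def is_involution_def by (elim conjE)
    ultimately have e: "S i = i" by (elim allE impE)
    have "inv_of (half_of S) i = i" using False unfolding inv_of_def by (metis atLeastAtMost_iff)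
    then show ?thesis using e by (rule trans[OF _ sym])
  qed
qed

end

text \<open>Replaces the definite description by an explicit diagram. Existence comes from
  \<open>half_ok_half_of\<close>, uniqueness from the facts that halves are recovered from their
  involutions and that \<open>wnum\<close> is the offset.\<close>

lemma bracket_mk:
  assumes S1: "annular n S1" "in_I n t S1" and S2: "annular n S2" "in_I n t S2" and t: "t > 0"
  shows "bracket n S1 S2 w = mk (half_of S1) (half_of S2) w" "compat (half_of S1) (half_of S2)"
    "num_vertical n (bracket n S1 S2 w) = t"
proof -
  have f: "fixed_points n S1 \<noteq> {}" "fixed_points n S2 \<noteq> {}" using S1 S2 t by (auto simp: in_I_def)
  note ok = half_ok_half_of[OF S1(1) f(1)] half_ok_half_of[OF S2(1) f(2)]
  note inv = inv_of_half_of[OF S1(1) f(1)] inv_of_half_of[OF S2(1) f(2)]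
  have sz: "size1 (thru (half_of S1)) = t" "size1 (thru (half_of S2)) = t"
    using card_fixed_points[OF ok(1)] card_fixed_points[OF ok(2)] S1 S2 inv by (auto simp: in_I_def)
  show c: "compat (half_of S1) (half_of S2)" using ok sz by (simp add: compat_def)
  note g = good_mk[OF c, of w]
  have nv: "num_vertical n (mk (half_of S1) (half_of S2) w) = t"
    using num_vertical_size1[OF g, of True] half_mk(1)[OF c] sz by simp
  show "bracket n S1 S2 w = mk (half_of S1) (half_of S2) w"
    unfolding bracket_def
  proof (rule the_equality)
    show "is_diagram n (mk (half_of S1) (half_of S2) w) \<and> num_vertical n (mk (half_of S1) (half_of S2) w) > 0 \<and>
        row_inv n True (mk (half_of S1) (half_of S2) w) = S1 \<and> row_inv n False (mk (half_of S1) (half_of S2) w) = S2 \<and>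
        wnum (mk (half_of S1) (half_of S2) w) = w"
      using is_diagram_mk[OF c] nv t row_inv_inv_of[OF g] half_mk[OF c] inv wnum_mk[OF c] by simp
  next
    fix D assume D: "is_diagram n D \<and> num_vertical n D > 0 \<and> row_inv n True D = S1 \<and> row_inv n False D = S2 \<and> wnum D = w"
    note gp = is_diagram_planar[of n D]
    have gD: "good n D" "planar (fst D)" using D gp by auto
    have "snd D = 0"
    proof (rule ccontr)
      assume "snd D \<noteq> 0"
      then have "\<forall>a. snd (fst D (a, True)) = True" using D unfolding is_diagram_def Let_def by blast
      then show False using D by (simp add: num_vertical_def)
    qed
    then have P: "D \<in> PD" using gD by (simp add: PD_def)
    have "half True D = half_of S1" "half False D = half_of S2"
      using half_of_S[OF half_ok_half[OF gD]] row_inv_inv_of[OF gD(1)] D by metis+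
    moreover have "woff D = w" using wnum_mk[OF compat_PD[OF P], of "woff D"] mk_eq[OF P] D by simp
    ultimately show "D = mk (half_of S1) (half_of S2) w" using mk_eq[OF P] by simp
  qed
  then show "num_vertical n (bracket n S1 S2 w) = t" using nv by simp
qed

lemma bracket_rot:
  assumes "annular n S1" "in_I n t S1" "annular n S2" "in_I n t S2" "t > 0"
  shows "bracket n S1 S2 (w + s) = rot s (bracket n S1 S2 w)"
  using bracket_mk[OF assms] by (simp add: rot_def half_mk woff_mk)

lemma bracket_row_inv:
  assumes D: "D \<in> PD"
  shows "annular n (row_inv n r D)" "in_I n (num_vertical n D) (row_inv n r D)"
    "bracket n (row_inv n True D) (row_inv n False D) (woff D) = D"
proof -
  have g: "good n D" "planar (fst D)" using D by (auto simp: PD_def)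
  note ok = half_ok_half[OF g] and ri = row_inv_inv_of[OF g(1)]
  show a: "annular n (row_inv n r D)" for r unfolding ri by (rule annular_S[OF ok])
  show i: "in_I n (num_vertical n D) (row_inv n r D)" for r
    unfolding ri in_I_def using is_involution_S[OF ok] card_fixed_points[OF ok] num_vertical_size1[OF g(1)] by simp
  have "num_vertical n D > 0"
    using num_vertical_size1[OF g(1), of True] size1_pos[OF periodic_PD[OF D]] by simp
  from bracket_mk(1)[OF a i a i this] show "bracket n (row_inv n True D) (row_inv n False D) (woff D) = D"
    unfolding ri half_of_S[OF ok] using mk_eq[OF D] by simp
qed

end

section \<open>Linear algebra\<close>

lemma mat_eq_by_vec:
  fixes A B :: "'k::field mat"
  assumes "A \<in> carrier_mat nr nc" "B \<in> carrier_mat nr nc" "\<And>x. x \<in> carrier_vec nc \<Longrightarrow> A *\<^sub>v x = B *\<^sub>v x"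
  shows "A = B"
proof (rule eq_matI)
  fix i j assume ij: "i < dim_row B" "j < dim_col B"
  have "(A *\<^sub>v unit_vec nc j) $ i = (B *\<^sub>v unit_vec nc j) $ i" using assms(3) by simp
  then show "A $$ (i, j) = B $$ (i, j)" using assms(1,2) ij by simp
qed (use assms in auto)

text \<open>The step is demanded only for coordinates in the support of z (or with coefficient 0).
  So a vector with restricted support is built from the corresponding unit vectors alone.\<close>

lemma vec_induct_units:
  fixes z :: "'k::field vec"
  assumes z: "z \<in> carrier_vec d" and "P (0\<^sub>v d)"
    and step: "\<And>x k c. P x \<Longrightarrow> x \<in> carrier_vec d \<Longrightarrow> k < d \<Longrightarrow> (c = 0 \<or> z $ k \<noteq> 0) \<Longrightarrow> P (x + c \<cdot>\<^sub>v unit_vec d k)"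
  shows "P z"
proof -
  define t where "t k = vec d (\<lambda>i. if i < k then z $ i else 0)" for k
  have "P (t k)" if "k \<le> d" for k
    using that
  proof (induction k)
    case 0
    have "t 0 = 0\<^sub>v d" by (intro eq_vecI) (auto simp: t_def)
    then show ?case using assms(2) by simp
  next
    case (Suc k)
    have "t (Suc k) = t k + z $ k \<cdot>\<^sub>v unit_vec d k" using Suc(2) by (intro eq_vecI) (auto simp: t_def less_Suc_eq)
    moreover have "t k \<in> carrier_vec d" by (simp add: t_def)
    ultimately show ?case using step[of "t k" k "z $ k"] Suc by auto
  qed
  moreover have "t d = z" using z by (intro eq_vecI) (auto simp: t_def)
  ultimately show ?thesis by (metis order_refl)
qed

lemma linear_map_matrix:
  fixes f :: "'k::field vec \<Rightarrow> 'k vec"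
  assumes c: "\<And>x. x \<in> carrier_vec d1 \<Longrightarrow> f x \<in> carrier_vec d2"
    and add: "\<And>x y. x \<in> carrier_vec d1 \<Longrightarrow> y \<in> carrier_vec d1 \<Longrightarrow> f (x + y) = f x + f y"
    and scale: "\<And>x k. x \<in> carrier_vec d1 \<Longrightarrow> f (k \<cdot>\<^sub>v x) = k \<cdot>\<^sub>v f x"
  shows "\<exists>P\<in>carrier_mat d2 d1. \<forall>x\<in>carrier_vec d1. f x = P *\<^sub>v x"
proof -
  define P where "P = mat d2 d1 (\<lambda>(i, j). f (unit_vec d1 j) $ i)"
  have P: "P \<in> carrier_mat d2 d1" by (simp add: P_def)
  have u: "P *\<^sub>v unit_vec d1 k = f (unit_vec d1 k)" if "k < d1" for k
    using that c[of "unit_vec d1 k"] by (intro eq_vecI) (auto simp: P_def)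
  have z: "f (0\<^sub>v d1) = 0\<^sub>v d2"
  proof -
    have "f (0 \<cdot>\<^sub>v 0\<^sub>v d1) = 0 \<cdot>\<^sub>v f (0\<^sub>v d1)" by (rule scale) simp
    moreover have "(0::'k) \<cdot>\<^sub>v 0\<^sub>v d1 = 0\<^sub>v d1" by auto
    moreover have "0 \<cdot>\<^sub>v f (0\<^sub>v d1) = 0\<^sub>v d2" using c[of "0\<^sub>v d1"] by (intro eq_vecI) auto
    ultimately show ?thesis by simp
  qed
  have "f x = P *\<^sub>v x" if x: "x \<in> carrier_vec d1" for x
    using x
  proof (rule vec_induct_units[where P = "\<lambda>x. f x = P *\<^sub>v x"])
    show "f (0\<^sub>v d1) = P *\<^sub>v 0\<^sub>v d1" using z P by (intro eq_vecI) auto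
  next
    fix y k and a :: 'k assume y: "f y = P *\<^sub>v y" "y \<in> carrier_vec d1" "k < d1"
    have "f (y + a \<cdot>\<^sub>v unit_vec d1 k) = P *\<^sub>v y + a \<cdot>\<^sub>v (P *\<^sub>v unit_vec d1 k)"
      using y u by (simp add: add scale)
    also have "\<dots> = P *\<^sub>v (y + a \<cdot>\<^sub>v unit_vec d1 k)"
      using y P by (simp add: mult_add_distrib_mat_vec[OF P] mult_mat_vec[OF P])
    finally show "f (y + a \<cdot>\<^sub>v unit_vec d1 k) = P *\<^sub>v (y + a \<cdot>\<^sub>v unit_vec d1 k)" .
  qed
  then show ?thesis using P by blast
qed

lemma mult_zero_vec_mat: "A \<in> carrier_mat nr nc \<Longrightarrow> A *\<^sub>v 0\<^sub>v nc = (0\<^sub>v nr :: 'k::field vec)"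
  by (intro eq_vecI) auto

text \<open>If d1 < d2, padding Q with zero rows gives a singular square matrix; a vector in its
  kernel is killed by Q and hence by P * Q.\<close>

lemma right_inverse_dim_le:
  fixes P Q :: "'k::field mat"
  assumes P: "P \<in> carrier_mat d2 d1" and Q: "Q \<in> carrier_mat d1 d2" and PQ: "P * Q = 1\<^sub>m d2"
  shows "d2 \<le> d1"
proof (rule ccontr)
  assume "\<not> ?thesis"
  then have lt: "d1 < d2" by simp
  define Q' where "Q' = mat d2 d2 (\<lambda>(i, j). if i < d1 then Q $$ (i, j) else 0)"
  have Q': "Q' \<in> carrier_mat d2 d2" by (simp add: Q'_def)
  have "Q'\<^sup>T *\<^sub>v unit_vec d2 d1 = 0\<^sub>v d2" using lt by (intro eq_vecI) (auto simp: Q'_def)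
  moreover have "unit_vec d2 d1 \<noteq> (0\<^sub>v d2 :: 'k vec)" using lt by simp
  moreover have "Q'\<^sup>T \<in> carrier_mat d2 d2" using Q' by simp
  ultimately have "det Q'\<^sup>T = 0" using det_0_iff_vec_prod_zero_field unit_vec_carrier by blast
  then have "det Q' = 0" using det_transpose[OF Q'] by simp
  then obtain v where v: "v \<in> carrier_vec d2" "v \<noteq> 0\<^sub>v d2" "Q' *\<^sub>v v = 0\<^sub>v d2"
    using det_0_iff_vec_prod_zero_field[OF Q'] by blast
  have "Q *\<^sub>v v = 0\<^sub>v d1"
  proof (rule eq_vecI)
    fix i assume i: "i < dim_vec (0\<^sub>v d1 :: 'k vec)"
    then have "(Q' *\<^sub>v v) $ i = (Q *\<^sub>v v) $ i"
      using Q v(1) lt by (auto simp: Q'_def scalar_prod_def intro!: sum.cong)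
    then show "(Q *\<^sub>v v) $ i = 0\<^sub>v d1 $ i" using v(3) i lt by simp
  qed (use Q in auto)
  then have "(P * Q) *\<^sub>v v = 0\<^sub>v d2" using P Q v by (simp add: mult_zero_vec_mat)
  then show False using PQ v by simp
qed

lemma exists_eigenvector:
  fixes M :: "'k::alg_closed_field mat"
  assumes M: "M \<in> carrier_mat r r" and r: "r > 0"
  shows "\<exists>l v. v \<in> carrier_vec r \<and> v \<noteq> 0\<^sub>v r \<and> M *\<^sub>v v = l \<cdot>\<^sub>v v"
proof -
  have "degree (char_poly M) > 0" using degree_monic_char_poly[OF M] r by simp
  then obtain l where "poly (char_poly M) l = 0" using alg_closed_imp_poly_has_root by blast
  then have "eigenvalue M l" using eigenvalue_root_char_poly[OF M] by blast
  then show ?thesis using M by (auto simp: eigenvalue_def eigenvector_def)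
qed

lemma det_nonzero_inverse:
  fixes B :: "'k::field mat"
  assumes B: "B \<in> carrier_mat d d" and inj: "\<And>v. v \<in> carrier_vec d \<Longrightarrow> B *\<^sub>v v = 0\<^sub>v d \<Longrightarrow> v = 0\<^sub>v d"
  shows "\<exists>C\<in>carrier_mat d d. B * C = 1\<^sub>m d \<and> C * B = 1\<^sub>m d"
proof -
  have "det B \<noteq> 0" using det_0_iff_vec_prod_zero_field[OF B] inj by blast
  from det_non_zero_imp_unit[OF B this, of undefined] show ?thesis
    by (auto simp: Units_def ring_mat_def)
qed

text \<open>The exchange step for bases, with a basis kept as the columns of an invertible
  matrix.\<close>

lemma replace_column:
  fixes B z :: "_"
  assumes B: "(B :: 'k::field mat) \<in> carrier_mat d d" and inj: "\<And>v. v \<in> carrier_vec d \<Longrightarrow> B *\<^sub>v v = 0\<^sub>v d \<Longrightarrow> v = 0\<^sub>v d"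
    and z: "z \<in> carrier_vec d" and j: "j < d" "z $ j \<noteq> 0" "r \<le> j"
  shows "\<exists>B'\<in>carrier_mat d d. (\<forall>v\<in>carrier_vec d. B' *\<^sub>v v = 0\<^sub>v d \<longrightarrow> v = 0\<^sub>v d) \<and>
     (\<forall>i<r. B' *\<^sub>v unit_vec d i = B *\<^sub>v unit_vec d i) \<and> B' *\<^sub>v unit_vec d r = B *\<^sub>v z"
proof -
  have rd: "r < d" using j by simp
  define \<pi> where "\<pi> i = (if i = r then j else i)" for i
  \<comment> \<open>C sends the r-th unit vector to z and, for j \<noteq> r, the j-th one to the
    r-th; the others stay. It is injective because the j-th entry of z is nonzero.\<close>
  define C where "C = mat d d (\<lambda>(i, k). if k = r then z $ i else if k = j then (if i = r then 1 else 0)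
     else if i = k then 1 else 0 :: 'k)"
  have C: "C \<in> carrier_mat d d" by (simp add: C_def)
  have Cv: "(C *\<^sub>v v) $ i = z $ i * v $ r + (if i \<noteq> j then v $ (\<pi> i) else 0)"
    if v: "v \<in> carrier_vec d" and i: "i < d" for v i
  proof -
    have "(C *\<^sub>v v) $ i = (\<Sum>k = 0..<d. (if k = r then z $ i * v $ r else 0) + (if k = \<pi> i then if i \<noteq> j then v $ (\<pi> i) else 0 else 0))"
    proof -
      have "(C *\<^sub>v v) $ i = (\<Sum>k = 0..<d. C $$ (i, k) * v $ k)" using v i C by (auto simp: scalar_prod_def)
      also have "\<dots> = (\<Sum>k = 0..<d. (if k = r then z $ i * v $ r else 0) + (if k = \<pi> i then if i \<noteq> j then v $ (\<pi> i) else 0 else 0))"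
        by (rule sum.cong) (use i j in \<open>auto simp: C_def \<pi>_def\<close>)
      finally show ?thesis .
    qed
    also have "\<dots> = z $ i * v $ r + (if i \<noteq> j then v $ (\<pi> i) else 0)"
      using i rd j by (simp add: sum.distrib \<pi>_def)
    finally show ?thesis .
  qed
  have Cinj: "v = 0\<^sub>v d" if v: "v \<in> carrier_vec d" and 0: "C *\<^sub>v v = 0\<^sub>v d" for v
  proof -
    have e: "z $ i * v $ r + (if i \<noteq> j then v $ (\<pi> i) else 0) = 0" if "i < d" for i
      using Cv[OF v that] 0 that by simp
    have vr: "v $ r = 0" using e[OF j(1)] j by simp
    have "v $ k = 0" if "k < d" for k
    proof (cases "k = r")
      case False
      define i where "i = (if k = j then r else k)"
      have "i < d" "i \<noteq> j" "\<pi> i = k" using False that rd by (auto simp: i_def \<pi>_def)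
      then show ?thesis using e[of i] vr by simp
    qed (use vr in simp)
    then show ?thesis using v by (intro eq_vecI) auto
  qed
  have Cu: "C *\<^sub>v unit_vec d i = unit_vec d i" if "i < r" for i
    by (rule eq_vecI) (use Cv[of "unit_vec d i"] C that rd j in \<open>auto simp: \<pi>_def\<close>)
  have Cr: "C *\<^sub>v unit_vec d r = z"
    by (rule eq_vecI) (use Cv[of "unit_vec d r"] C rd j z in \<open>auto simp: \<pi>_def\<close>)
  show ?thesis
  proof (intro bexI[of _ "B * C"] conjI ballI allI impI)
    show "B * C \<in> carrier_mat d d" using B C by simp
    fix v assume v: "v \<in> carrier_vec d" "B * C *\<^sub>v v = 0\<^sub>v d"
    then have "B *\<^sub>v (C *\<^sub>v v) = 0\<^sub>v d" using assoc_mult_mat_vec[OF B C v(1)] by simp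
    then have "C *\<^sub>v v = 0\<^sub>v d" using inj C v by simp
    then show "v = 0\<^sub>v d" using Cinj v by simp
  next
    fix i assume "i < r"
    then show "B * C *\<^sub>v unit_vec d i = B *\<^sub>v unit_vec d i" using assoc_mult_mat_vec[OF B C, of "unit_vec d i"] Cu by simp
  next
    show "B * C *\<^sub>v unit_vec d r = B *\<^sub>v z" using assoc_mult_mat_vec[OF B C, of "unit_vec d r"] Cr by simp
  qed
qed

text \<open>Choose an invertible B with as many leading columns in W as possible, say r. A vector of
  W with a nonzero coordinate beyond the first r could be exchanged for a column, contradicting
  maximality.\<close>

lemma subspace_basis:
  fixes W :: "'k::field vec set"
  assumes W: "is_subspace d W"
  shows "\<exists>r B C. r \<le> d \<and> B \<in> carrier_mat d d \<and> C \<in> carrier_mat d d \<and> B * C = 1\<^sub>m d \<and> C * B = 1\<^sub>m d \<and>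
    W = {B *\<^sub>v z | z. z \<in> carrier_vec d \<and> (\<forall>i. r \<le> i \<and> i < d \<longrightarrow> z $ i = 0)}"
proof -
  define good where "good r B \<longleftrightarrow> r \<le> d \<and> B \<in> carrier_mat d d \<and>
     (\<forall>v\<in>carrier_vec d. B *\<^sub>v v = 0\<^sub>v d \<longrightarrow> v = 0\<^sub>v d) \<and> (\<forall>i<r. B *\<^sub>v unit_vec d i \<in> W)" for r and B :: "'k mat"
  have g0: "good 0 (1\<^sub>m d)" by (auto simp: good_def)
  define r where "r = Max {r. \<exists>B. good r B}"
  have fin: "finite {r. \<exists>B. good r B}" by (rule finite_subset[of _ "{..d}"]) (auto simp: good_def)
  have "r \<in> {r. \<exists>B. good r B}" unfolding r_def by (rule Max_in[OF fin]) (use g0 in blast)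
  then obtain B where gB: "good r B" by blast
  have max: "\<not> good (Suc r) B'" for B'
    using Max_ge[OF fin, of "Suc r"] unfolding r_def[symmetric] by auto
  have B: "B \<in> carrier_mat d d" "\<And>v. v \<in> carrier_vec d \<Longrightarrow> B *\<^sub>v v = 0\<^sub>v d \<Longrightarrow> v = 0\<^sub>v d"
    "\<And>i. i < r \<Longrightarrow> B *\<^sub>v unit_vec d i \<in> W" "r \<le> d" using gB by (auto simp: good_def)
  obtain C where C: "C \<in> carrier_mat d d" "B * C = 1\<^sub>m d" "C * B = 1\<^sub>m d" using det_nonzero_inverse[OF B(1,2)] by blast
  have Wp: "W \<subseteq> carrier_vec d" "0\<^sub>v d \<in> W" "\<And>x y. x \<in> W \<Longrightarrow> y \<in> W \<Longrightarrow> x + y \<in> W" "\<And>c x. x \<in> W \<Longrightarrow> c \<cdot>\<^sub>v x \<in> W"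
    using W by (auto simp: is_subspace_def)
  have "W = {B *\<^sub>v z | z. z \<in> carrier_vec d \<and> (\<forall>i. r \<le> i \<and> i < d \<longrightarrow> z $ i = 0)}"
  proof (intro equalityI subsetI)
    fix w assume w: "w \<in> W"
    define z where "z = C *\<^sub>v w"
    have z: "z \<in> carrier_vec d" using C w Wp by (auto simp: z_def)
    have "B *\<^sub>v z = (B * C) *\<^sub>v w" unfolding z_def using assoc_mult_mat_vec[OF B(1) C(1)] w Wp(1) by auto
    then have Bz: "B *\<^sub>v z = w" using C w Wp by auto
    have "z $ i = 0" if i: "r \<le> i" "i < d" for i
    proof (rule ccontr)
      assume "z $ i \<noteq> 0"
      from replace_column[OF B(1,2) z i(2) this i(1)] obtain B' where B': "B' \<in> carrier_mat d d"
        "\<forall>v\<in>carrier_vec d. B' *\<^sub>v v = 0\<^sub>v d \<longrightarrow> v = 0\<^sub>v d"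
        "\<forall>i<r. B' *\<^sub>v unit_vec d i = B *\<^sub>v unit_vec d i" "B' *\<^sub>v unit_vec d r = B *\<^sub>v z" by blast
      have "good (Suc r) B'" using B' B(3) Bz w i by (auto simp: good_def less_Suc_eq)
      then show False using max by blast
    qed
    then show "w \<in> {B *\<^sub>v z | z. z \<in> carrier_vec d \<and> (\<forall>i. r \<le> i \<and> i < d \<longrightarrow> z $ i = 0)}" using z Bz by blast
  next
    fix w assume "w \<in> {B *\<^sub>v z | z. z \<in> carrier_vec d \<and> (\<forall>i. r \<le> i \<and> i < d \<longrightarrow> z $ i = 0)}"
    then obtain z where z: "w = B *\<^sub>v z" "z \<in> carrier_vec d" "\<And>i. r \<le> i \<Longrightarrow> i < d \<Longrightarrow> z $ i = 0" by blast
    have "B *\<^sub>v z \<in> W"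
      using z(2)
    proof (rule vec_induct_units[where P = "\<lambda>x. B *\<^sub>v x \<in> W"])
      show "B *\<^sub>v 0\<^sub>v d \<in> W" using Wp(2) mult_zero_vec_mat[OF B(1)] by simp
    next
      fix x k and c :: 'k assume x: "B *\<^sub>v x \<in> W" "x \<in> carrier_vec d" "k < d" "c = 0 \<or> z $ k \<noteq> 0"
      have e: "B *\<^sub>v (x + c \<cdot>\<^sub>v unit_vec d k) = B *\<^sub>v x + c \<cdot>\<^sub>v (B *\<^sub>v unit_vec d k)"
        using x by (simp add: mult_add_distrib_mat_vec[OF B(1)] mult_mat_vec[OF B(1)])
      show "B *\<^sub>v (x + c \<cdot>\<^sub>v unit_vec d k) \<in> W"
      proof (cases "c = 0")
        case True
        then have "x + c \<cdot>\<^sub>v unit_vec d k = x" using x by (intro eq_vecI) auto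
        then show ?thesis using x by simp
      next
        case False
        then have "k < r" using x z(3)[of k] by (cases "r \<le> k") auto
        then show ?thesis unfolding e using B(3) Wp x by blast
      qed
    qed
    then show "w \<in> W" using z by simp
  qed
  then show ?thesis using B C by blast
qed

text \<open>P is the inclusion of W and Q' the projection onto the quotient; Q and P' split them.
  Restrictions and quotients of an action thus become products of matrices.\<close>

lemma subspace_split:
  fixes W :: "'k::field vec set"
  assumes W: "is_subspace d W"
  shows "\<exists>r P Q P' Q'. r \<le> d \<and> P \<in> carrier_mat d r \<and> Q \<in> carrier_mat r d \<and>
    P' \<in> carrier_mat d (d - r) \<and> Q' \<in> carrier_mat (d - r) d \<and>
    Q * P = 1\<^sub>m r \<and> Q' * P' = 1\<^sub>m (d - r) \<and> Q' * P = 0\<^sub>m (d - r) r \<and>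
    P * Q + P' * Q' = 1\<^sub>m d \<and> W = {P *\<^sub>v z | z. z \<in> carrier_vec r}"
proof -
  obtain r B C where r: "r \<le> d" and B: "B \<in> carrier_mat d d" and C: "C \<in> carrier_mat d d"
    and BC: "B * C = 1\<^sub>m d" "C * B = 1\<^sub>m d"
    and Weq: "W = {B *\<^sub>v z | z. z \<in> carrier_vec d \<and> (\<forall>i. r \<le> i \<and> i < d \<longrightarrow> z $ i = 0)}"
    using subspace_basis[OF W] by blast
  define P where "P = mat d r (\<lambda>(i, j). B $$ (i, j))"
  define Q where "Q = mat r d (\<lambda>(i, j). C $$ (i, j))"
  define P' where "P' = mat d (d - r) (\<lambda>(i, j). B $$ (i, j + r))"
  define Q' where "Q' = mat (d - r) d (\<lambda>(i, j). C $$ (i + r, j))"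
  have CB: "(\<Sum>k = 0..<d. C $$ (i, k) * B $$ (k, j)) = (if i = j then 1 else 0)" if "i < d" "j < d" for i j
  proof -
    have "(C * B) $$ (i, j) = (\<Sum>k = 0..<d. C $$ (i, k) * B $$ (k, j))" using B C that by (auto simp: scalar_prod_def)
    then show ?thesis using BC that by simp
  qed
  have BCe: "(\<Sum>k = 0..<d. B $$ (i, k) * C $$ (k, j)) = (if i = j then 1 else 0)" if "i < d" "j < d" for i j
  proof -
    have "(B * C) $$ (i, j) = (\<Sum>k = 0..<d. B $$ (i, k) * C $$ (k, j))" using B C that by (auto simp: scalar_prod_def)
    then show ?thesis using BC that by simp
  qed
  have "Q * P = 1\<^sub>m r" using CB r by (intro eq_matI) (auto simp: P_def Q_def scalar_prod_def)
  moreover have "Q' * P' = 1\<^sub>m (d - r)" using CB r by (intro eq_matI) (auto simp: P'_def Q'_def scalar_prod_def)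
  moreover have "Q' * P = 0\<^sub>m (d - r) r" using CB r by (intro eq_matI) (auto simp: P_def Q'_def scalar_prod_def)
  moreover have "P * Q + P' * Q' = 1\<^sub>m d"
  proof (rule eq_matI)
    fix i j assume ij: "i < dim_row (1\<^sub>m d :: 'k mat)" "j < dim_col (1\<^sub>m d :: 'k mat)"
    have "(P * Q + P' * Q') $$ (i, j) = (\<Sum>k = 0..<r. B $$ (i, k) * C $$ (k, j)) + (\<Sum>k = 0..<d - r. B $$ (i, k + r) * C $$ (k + r, j))"
      using ij by (auto simp: P_def Q_def P'_def Q'_def scalar_prod_def)
    also have "(\<Sum>k = 0..<d - r. B $$ (i, k + r) * C $$ (k + r, j)) = (\<Sum>k = r..<d. B $$ (i, k) * C $$ (k, j))"
      using sum.shift_bounds_nat_ivl[of "\<lambda>k. B $$ (i, k) * C $$ (k, j)" 0 r "d - r"] r by simp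
    also have "(\<Sum>k = 0..<r. B $$ (i, k) * C $$ (k, j)) + (\<Sum>k = r..<d. B $$ (i, k) * C $$ (k, j)) = (\<Sum>k = 0..<d. B $$ (i, k) * C $$ (k, j))"
      using r by (simp add: sum.atLeastLessThan_concat)
    finally show "(P * Q + P' * Q') $$ (i, j) = 1\<^sub>m d $$ (i, j)" using BCe ij by simp
  qed (auto simp: P_def Q_def P'_def Q'_def)
  moreover have "W = {P *\<^sub>v z | z. z \<in> carrier_vec r}"
  proof -
    have e: "B *\<^sub>v z = P *\<^sub>v (vec r (\<lambda>i. z $ i))" if z: "z \<in> carrier_vec d" "\<And>i. r \<le> i \<Longrightarrow> i < d \<Longrightarrow> z $ i = 0" for z
    proof (rule eq_vecI)
      fix i assume "i < dim_vec (P *\<^sub>v vec r (\<lambda>i. z $ i))"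
      then have i: "i < d" by (simp add: P_def)
      have "(B *\<^sub>v z) $ i = (\<Sum>k = 0..<d. B $$ (i, k) * z $ k)" using B z i by (auto simp: scalar_prod_def)
      also have "\<dots> = (\<Sum>k = 0..<r. B $$ (i, k) * z $ k) + (\<Sum>k = r..<d. B $$ (i, k) * z $ k)"
        using r by (simp add: sum.atLeastLessThan_concat)
      also have "(\<Sum>k = r..<d. B $$ (i, k) * z $ k) = 0" using z(2) by (intro sum.neutral) auto
      finally show "(B *\<^sub>v z) $ i = (P *\<^sub>v vec r (\<lambda>i. z $ i)) $ i" using i by (simp add: P_def scalar_prod_def)
    qed (use B in \<open>auto simp: P_def\<close>)
    show ?thesis
    proof (intro equalityI subsetI)
      fix w assume "w \<in> W"
      then obtain z where "w = B *\<^sub>v z" "z \<in> carrier_vec d" "\<And>i. r \<le> i \<Longrightarrow> i < d \<Longrightarrow> z $ i = 0" unfolding Weq by blast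
      then show "w \<in> {P *\<^sub>v z | z. z \<in> carrier_vec r}" using e by (auto intro!: exI[of _ "vec r (\<lambda>i. z $ i)"])
    next
      fix w assume "w \<in> {P *\<^sub>v z | z. z \<in> carrier_vec r}"
      then obtain z where z: "w = P *\<^sub>v z" "z \<in> carrier_vec r" by blast
      define z' where "z' = vec d (\<lambda>i. if i < r then z $ i else 0)"
      have "vec r (\<lambda>i. z' $ i) = z" using z r by (intro eq_vecI) (auto simp: z'_def)
      then have "B *\<^sub>v z' = w" using e[of z'] z by (simp add: z'_def)
      moreover have "z' \<in> carrier_vec d" "\<forall>i. r \<le> i \<and> i < d \<longrightarrow> z' $ i = 0" by (auto simp: z'_def)
      ultimately show "w \<in> W" unfolding Weq by blast
    qed
  qed
  moreover have "P \<in> carrier_mat d r" "Q \<in> carrier_mat r d" "P' \<in> carrier_mat d (d - r)" "Q' \<in> carrier_mat (d - r) d"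
    by (auto simp: P_def Q_def P'_def Q'_def)
  ultimately show ?thesis using r by blast
qed

text \<open>An eigenvector of the compression Q * (X * P) becomes one of X after applying P, since X
  preserves the image of P.\<close>

lemma eigenvector_in_subspace:
  fixes X :: "'k::alg_closed_field mat"
  assumes X: "X \<in> carrier_mat d d" and W: "is_subspace d W" and inv: "\<And>x. x \<in> W \<Longrightarrow> X *\<^sub>v x \<in> W"
    and ne: "W \<noteq> {0\<^sub>v d}"
  shows "\<exists>l u. u \<in> W \<and> u \<noteq> 0\<^sub>v d \<and> X *\<^sub>v u = l \<cdot>\<^sub>v u"
proof -
  obtain r P Q where P: "P \<in> carrier_mat d r" and Q: "Q \<in> carrier_mat r d" and QP: "Q * P = 1\<^sub>m r"
    and Weq: "W = {P *\<^sub>v z | z. z \<in> carrier_vec r}" using subspace_split[OF W] by blast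
  have r: "r > 0"
  proof (rule ccontr)
    assume "\<not> ?thesis"
    then have r0: "r = 0" by simp
    have "P *\<^sub>v z = 0\<^sub>v d" if "z \<in> carrier_vec r" for z
      using P that r0 by (intro eq_vecI) (auto simp: scalar_prod_def)
    then have "W \<subseteq> {0\<^sub>v d}" unfolding Weq by auto
    moreover have "0\<^sub>v d \<in> W" using W by (simp add: is_subspace_def)
    ultimately have "W = {0\<^sub>v d}" by (intro subset_antisym) auto
    then show False using ne by simp
  qed
  have QPz: "Q *\<^sub>v (P *\<^sub>v z) = z" if "z \<in> carrier_vec r" for z
    using assoc_mult_mat_vec[OF Q P that] QP that by simp
  have M: "Q * (X * P) \<in> carrier_mat r r" using P Q X by simp
  obtain l z where z: "z \<in> carrier_vec r" "z \<noteq> 0\<^sub>v r" "Q * (X * P) *\<^sub>v z = l \<cdot>\<^sub>v z"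
    using exists_eigenvector[OF M r] by blast
  have XP: "X * P \<in> carrier_mat d r" using X P by simp
  have "X *\<^sub>v (P *\<^sub>v z) \<in> W" using inv z(1) unfolding Weq by blast
  then obtain y where y: "X *\<^sub>v (P *\<^sub>v z) = P *\<^sub>v y" "y \<in> carrier_vec r" unfolding Weq by blast
  have "Q * (X * P) *\<^sub>v z = Q *\<^sub>v (X *\<^sub>v (P *\<^sub>v z))"
    using assoc_mult_mat_vec[OF Q XP z(1)] assoc_mult_mat_vec[OF X P z(1)] by simp
  then have "y = l \<cdot>\<^sub>v z" using y QPz z by simp
  then have "X *\<^sub>v (P *\<^sub>v z) = l \<cdot>\<^sub>v (P *\<^sub>v z)" using y mult_mat_vec[OF P z(1)] by simp
  moreover have "P *\<^sub>v z \<noteq> 0\<^sub>v d" using QPz[OF z(1)] z(2) mult_zero_vec_mat[OF Q] by metis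
  moreover have "P *\<^sub>v z \<in> W" using z unfolding Weq by blast
  ultimately show ?thesis by blast
qed

text \<open>The polynomial x excludes v = 0, where \<open>inverse v\<close> would be 0 as well;
  otherwise v + v^{-1} = 0 makes v a root of 1 + x^2. Both polynomials have coefficients in
  F.\<close>

lemma qtwo_nonzero:
  fixes v :: "'k::field"
  assumes F: "is_subfield F" and tr: "transcendental_over F v"
  shows "qtwo v \<noteq> 0"
proof
  assume q: "qtwo v = 0"
  have F01: "0 \<in> F" "1 \<in> F" using F by (auto simp: is_subfield_def)
  have "\<forall>i. coeff [:0, 1:] i \<in> F" "\<forall>i. coeff [:1, 0, 1:] i \<in> F"
    using F01 by (auto simp: coeff_pCons split: nat.splits)
  moreover have "[:0, 1:] \<noteq> (0 :: 'k poly)" "[:1, 0, 1:] \<noteq> (0 :: 'k poly)" by auto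
  ultimately have "poly [:0, 1:] v \<noteq> 0" "poly [:1, 0, 1:] v \<noteq> 0"
    using tr unfolding transcendental_over_def by blast+
  moreover from this have "v * qtwo v = 1 + v * v" by (simp add: qtwo_def algebra_simps)
  ultimately show False using q by simp
qed

lemma smult_mat_vec: "A \<in> carrier_mat nr nc \<Longrightarrow> x \<in> carrier_vec nc \<Longrightarrow> (c \<cdot>\<^sub>m A) *\<^sub>v x = c \<cdot>\<^sub>v (A *\<^sub>v (x :: 'k::field vec))"
  by (intro eq_vecI) auto

lemma smult_vec_cancel: "c \<noteq> 0 \<Longrightarrow> c \<cdot>\<^sub>v x = c \<cdot>\<^sub>v (y :: 'k::field vec) \<Longrightarrow> x = y"
proof -
  assume c: "c \<noteq> 0" "c \<cdot>\<^sub>v x = c \<cdot>\<^sub>v y"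
  have "inverse c \<cdot>\<^sub>v (c \<cdot>\<^sub>v x) = inverse c \<cdot>\<^sub>v (c \<cdot>\<^sub>v y)" using c(2) by simp
  then show "x = y" using c(1) by (simp add: smult_smult_assoc)
qed

lemma smult_vec_eq_iff:
  assumes "u \<in> carrier_vec d" "u \<noteq> 0\<^sub>v d"
  shows "a \<cdot>\<^sub>v u = b \<cdot>\<^sub>v (u :: 'k::field vec) \<longleftrightarrow> a = b"
proof
  assume e: "a \<cdot>\<^sub>v u = b \<cdot>\<^sub>v u"
  obtain i where i: "i < d" "u $ i \<noteq> 0" using assms by (metis carrier_vecD eq_vecI index_zero_vec)
  have "(a \<cdot>\<^sub>v u) $ i = (b \<cdot>\<^sub>v u) $ i" using e by simp
  then show "a = b" using i assms by simp
qed simp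

lemma smult_zero_vec0 [simp]: "c \<cdot>\<^sub>v 0\<^sub>v d = (0\<^sub>v d :: 'k::field vec)"
  by (intro eq_vecI) auto

lemma zero_smult_vec0: "x \<in> carrier_vec d \<Longrightarrow> 0 \<cdot>\<^sub>v x = (0\<^sub>v d :: 'k::field vec)"
  by (intro eq_vecI) auto

lemma zero_mat_vec: "x \<in> carrier_vec d \<Longrightarrow> 0\<^sub>m d' d *\<^sub>v x = (0\<^sub>v d' :: 'k::field vec)"
  by (intro eq_vecI) auto

lemma smult_vec_comm: "a \<cdot>\<^sub>v (b \<cdot>\<^sub>v x) = b \<cdot>\<^sub>v (a \<cdot>\<^sub>v (x :: 'k::field vec))"
  by (simp add: smult_smult_assoc mult.commute)

locale tl = odd_size n for n +
  fixes v :: "'k::alg_closed_field"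
  assumes q_ne: "qtwo v \<noteq> 0"
begin

abbreviation "TL \<equiv> TL_diagrams n"
abbreviation "nv \<equiv> num_vertical n"
abbreviation "lp A B \<equiv> qtwo v ^ num_loops n A B"

lemma lp_ne [simp]: "lp A B \<noteq> 0"
  using q_ne by simp

lemma TL_comp: "A \<in> TL \<Longrightarrow> B \<in> TL \<Longrightarrow> diag_comp n A B \<in> TL"
  by (rule TL_diagrams.TL_mult)

section \<open>The action of a representation\<close>

context
  fixes d :: nat and \<rho> :: "diagram \<Rightarrow> 'k mat"
  assumes rep: "is_rep n v d \<rho>"
begin

lemma rep_car: "D \<in> TL \<Longrightarrow> \<rho> D \<in> carrier_mat d d"
  using rep by (simp add: is_rep_def)

lemma rep_vec: "D \<in> TL \<Longrightarrow> x \<in> carrier_vec d \<Longrightarrow> \<rho> D *\<^sub>v x \<in> carrier_vec d"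
  using mult_mat_vec_carrier[OF rep_car] .

lemma rep_id: "x \<in> carrier_vec d \<Longrightarrow> \<rho> id_diagram *\<^sub>v x = x"
  using rep by (simp add: is_rep_def)

lemma rep_act: "A \<in> TL \<Longrightarrow> B \<in> TL \<Longrightarrow> x \<in> carrier_vec d \<Longrightarrow>
    \<rho> A *\<^sub>v (\<rho> B *\<^sub>v x) = lp A B \<cdot>\<^sub>v (\<rho> (diag_comp n A B) *\<^sub>v x)"
proof -
  assume A: "A \<in> TL" and B: "B \<in> TL" and x: "x \<in> carrier_vec d"
  have "\<rho> A *\<^sub>v (\<rho> B *\<^sub>v x) = (\<rho> A * \<rho> B) *\<^sub>v x"
    using assoc_mult_mat_vec[OF rep_car[OF A] rep_car[OF B] x] by simp
  also have "\<rho> A * \<rho> B = lp A B \<cdot>\<^sub>m \<rho> (diag_comp n A B)" using rep A B by (simp add: is_rep_def)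
  finally show ?thesis using smult_mat_vec[OF rep_car[OF TL_comp[OF A B]] x] by simp
qed

lemma rep_add: "D \<in> TL \<Longrightarrow> x \<in> carrier_vec d \<Longrightarrow> y \<in> carrier_vec d \<Longrightarrow> \<rho> D *\<^sub>v (x + y) = \<rho> D *\<^sub>v x + \<rho> D *\<^sub>v y"
  by (rule mult_add_distrib_mat_vec[OF rep_car])

lemma rep_smult: "D \<in> TL \<Longrightarrow> x \<in> carrier_vec d \<Longrightarrow> \<rho> D *\<^sub>v (c \<cdot>\<^sub>v x) = c \<cdot>\<^sub>v (\<rho> D *\<^sub>v x)"
  by (rule mult_mat_vec[OF rep_car])

lemma rep_zero: "D \<in> TL \<Longrightarrow> \<rho> D *\<^sub>v 0\<^sub>v d = 0\<^sub>v d"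
  by (rule mult_zero_vec_mat[OF rep_car])

text \<open>Irreducibility as an induction rule: a property that is stable under linear operations
  and the action, and holds at one nonzero vector, holds everywhere.\<close>

lemma irrep_full:
  assumes irr: "is_irrep n v d \<rho>" and u: "u \<in> carrier_vec d" "u \<noteq> 0\<^sub>v d" "Pr u"
    and zero: "Pr (0\<^sub>v d)"
    and add: "\<And>x y. x \<in> carrier_vec d \<Longrightarrow> y \<in> carrier_vec d \<Longrightarrow> Pr x \<Longrightarrow> Pr y \<Longrightarrow> Pr (x + y)"
    and smult: "\<And>x c. x \<in> carrier_vec d \<Longrightarrow> Pr x \<Longrightarrow> Pr (c \<cdot>\<^sub>v x)"
    and inv: "\<And>x D. x \<in> carrier_vec d \<Longrightarrow> D \<in> TL \<Longrightarrow> Pr x \<Longrightarrow> Pr (\<rho> D *\<^sub>v x)"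
    and x: "x \<in> carrier_vec d"
  shows "Pr x"
proof -
  let ?W = "{x \<in> carrier_vec d. Pr x}"
  have "is_subspace d ?W" using zero add smult by (auto simp: is_subspace_def)
  moreover have "\<forall>D\<in>TL. \<forall>x\<in>?W. \<rho> D *\<^sub>v x \<in> ?W" using inv rep_vec by auto
  ultimately have "?W = {0\<^sub>v d} \<or> ?W = carrier_vec d" using irr unfolding is_irrep_def by blast
  then show ?thesis using u x by auto
qed

end

section \<open>The commutative corner algebra\<close>

text \<open>The scalar by which e C sends the vector u of \<open>tvec\<close> to a multiple of
  itself, see \<open>u_weight\<close>. It is computed from t, \<open>\<alpha>\<close> and C without
  the representation, which makes different representations comparable.\<close>

definition weight :: "nat \<Rightarrow> 'k \<Rightarrow> diagram \<Rightarrow> 'k" where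
  "weight t \<alpha> C = (let F = diag_comp n (idem t) C; G = diag_comp n F (idem t) in
     if nv G < t then 0 else lp (idem t) C * lp F (idem t) * \<alpha> powi (woff G div 2))"

definition tvec :: "nat \<Rightarrow> nat \<Rightarrow> (diagram \<Rightarrow> 'k mat) \<Rightarrow> 'k \<Rightarrow> 'k vec \<Rightarrow> bool" where
  "tvec t d \<rho> \<alpha> u \<longleftrightarrow> u \<in> carrier_vec d \<and> u \<noteq> 0\<^sub>v d \<and>
     (\<forall>m. \<rho> (rot (2 * m) (idem t)) *\<^sub>v u = (lp (idem t) (idem t) * \<alpha> powi m) \<cdot>\<^sub>v u)"

context
  fixes t :: nat
  assumes t: "odd t" "t \<le> n - 2"
begin

abbreviation (input) "e \<equiv> idem t"
abbreviation (input) "R m \<equiv> rot (2 * m) (idem t)"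

lemma e_TL: "e \<in> TL" and e_PD: "e \<in> PD" and e_nv: "nv e = t" and e_e: "diag_comp n e e = e"
  and t_less: "t < n"
  using idem_TL[OF t] TL_PD[OF idem_TL[OF t]] num_vertical_idem[OF t] idem_idem[OF t] t n3 by auto

lemma R_TL: "R m \<in> TL"
  by (rule rot_TL[OF e_TL]) (use e_nv t_less in auto)

lemma R_0: "rot 0 e = e"
  using rot_simps(4)[OF e_PD] by simp

lemma R_R: "diag_comp n (R a) (R b) = R (a + b)"
proof -
  have 1: "diag_comp n e (R b) = R b"
    using comp_rot_right[OF e_TL e_TL R_TL[of b]] e_e by simp
  have "nv (R b) = t" using rot_simps(5)[OF e_PD] e_nv by simp
  then have "diag_comp n (R a) (R b) = rot (2 * a) (R b)"
    using comp_rot_left[OF R_TL[of b] e_TL R_TL[of a]] 1 e_nv by simp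
  then show ?thesis using rot_simps(3)[OF e_PD] by (simp add: algebra_simps)
qed

lemma lp_R_R: "lp (R a) (R b) = lp e e"
  using num_loops_rot(2)[OF TL_good[OF R_TL[of b]] e_PD, of "2 * a"]
    num_loops_rot(1)[OF TL_good[OF e_TL] e_PD, of "2 * b"] by simp

text \<open>If e C e keeps t vertical edges, both of its halves are those of e, and diagrams of the
  algebra with equal halves differ by an even rotation.\<close>

lemma corner_shape:
  assumes C: "C \<in> TL" and nv: "\<not> nv (diag_comp n (diag_comp n e C) e) < t"
  shows "diag_comp n (diag_comp n e C) e = R (woff (diag_comp n (diag_comp n e C) e) div 2)"
proof -
  let ?F = "diag_comp n e C" and ?G = "diag_comp n (diag_comp n e C) e"
  have F: "?F \<in> TL" and G: "?G \<in> TL" using TL_comp e_TL C by auto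
  have "nv ?G \<le> nv ?F" "nv ?G \<le> nv e" "nv ?F \<le> nv e"
    using num_vertical_comp TL_good F e_TL C by auto
  then have nvs: "nv ?G = t" "nv ?F = t" using nv e_nv by auto
  have "half True ?G = half True e" using half_comp_eq(1)[OF F e_TL] half_comp_eq(1)[OF e_TL C] nvs e_nv by simp
  moreover have "half False ?G = half False e" using half_comp_eq(2)[OF F e_TL] nvs e_nv by simp
  ultimately obtain m where m: "?G = rot (2 * m) e" using TL_same_halves[OF e_TL G] by auto
  then have "woff ?G = 2 * m" using rot_simps(2)[OF e_PD] woff_idem[OF t] by simp
  then show ?thesis using m by simp
qed

lemma weight_rot:
  assumes H: "H \<in> TL" "nv H = t" and \<alpha>: "\<alpha> \<noteq> 0"
  shows "weight t \<alpha> (rot 2 H) = \<alpha> * weight t \<alpha> H"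
proof -
  have rH: "rot 2 H \<in> TL" by (rule rot_TL[OF H(1)]) (use H t_less in auto)
  let ?F = "diag_comp n e H" and ?F' = "diag_comp n e (rot 2 H)"
  let ?G = "diag_comp n ?F e" and ?G' = "diag_comp n ?F' e"
  have F: "?F \<in> TL" "?F' \<in> TL" "?G \<in> TL" "?G' \<in> TL" using TL_comp e_TL H rH by auto
  have nvF: "nv ?F' = nv ?F" by (rule num_vertical_comp_rot[OF TL_good[OF e_TL] TL_PD[OF H(1)]])
  have nGF: "nv ?G \<le> nv ?F" "nv ?G' \<le> nv ?F'" using num_vertical_comp(1) TL_good F e_TL by auto
  show ?thesis
  proof (cases "nv ?F < t")
    case True
    then have "nv ?G < t" "nv ?G' < t" using nGF nvF by auto
    then show ?thesis by (simp add: weight_def Let_def)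
  next
    case False
    moreover have "nv ?F \<le> nv e" using num_vertical_comp(1) TL_good e_TL H by auto
    ultimately have nF: "nv ?F = t" using e_nv by simp
    have F': "?F' = rot 2 ?F" by (rule comp_rot_right[OF e_TL H(1) rH]) (use nF H in simp)
    have nG: "nv ?G' = nv ?G" unfolding F' by (rule num_vertical_rot_comp[OF TL_good[OF e_TL] TL_PD[OF F(1)]])
    have l: "lp e (rot 2 H) = lp e H" "lp ?F' e = lp ?F e"
      using num_loops_rot(1)[OF TL_good[OF e_TL] TL_PD[OF H(1)]] num_loops_rot(2)[OF TL_good[OF e_TL] TL_PD[OF F(1)]]
      unfolding F' by simp_all
    show ?thesis
    proof (cases "nv ?G < t")
      case True
      then show ?thesis using nG by (simp add: weight_def Let_def)
    next
      case gt: False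
      then have "nv ?G = nv ?F" using nF nGF by simp
      then have "?G' = rot 2 ?G" unfolding F' using comp_rot_left[OF e_TL F(1), of 2] F(2) F' by simp
      then have "woff ?G' = woff ?G + 2" using rot_simps(2)[OF TL_PD[OF F(3)]] by simp
      then have "\<alpha> powi (woff ?G' div 2) = \<alpha> * \<alpha> powi (woff ?G div 2)"
        using \<alpha> by (simp add: power_int_add_1')
      then show ?thesis using gt nG l by (simp add: weight_def Let_def)
    qed
  qed
qed

text \<open>With c = \<open>lp e e\<close>, the c-eigenspace E of e is nonzero and stable under the
  rotation \<open>R 1\<close>, so it contains an eigenvector u with eigenvalue l. Since
  \<open>R (- 1)\<close> undoes \<open>R 1\<close> up to c * c, l is nonzero; dividing by c
  normalises it to \<open>\<alpha>\<close>.\<close>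

lemma exists_tvec:
  assumes rep: "is_rep n v d \<rho>" and ne: "\<rho> e \<noteq> 0\<^sub>m d d"
  shows "\<exists>\<alpha> u. \<alpha> \<noteq> 0 \<and> tvec t d \<rho> \<alpha> u"
proof -
  define c where "c = lp e e"
  have c0: "c \<noteq> 0" unfolding c_def by (rule lp_ne)
  note car = rep_car[OF rep] and vec = rep_vec[OF rep] and act = rep_act[OF rep]
  define E where "E = {x \<in> carrier_vec d. \<rho> e *\<^sub>v x = c \<cdot>\<^sub>v x}"
  have E: "is_subspace d E"
    using rep_zero[OF rep e_TL] rep_add[OF rep e_TL] rep_smult[OF rep e_TL]
    by (auto simp: is_subspace_def E_def smult_add_distrib_vec smult_vec_comm)
  have RE: "\<rho> (R m) *\<^sub>v x \<in> E" if "x \<in> carrier_vec d" for m x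
    using that vec[OF R_TL] act[OF e_TL R_TL[of m] that] R_R[of 0 m] lp_R_R[of 0 m] by (simp add: E_def c_def R_0)
  have RR: "\<rho> (R a) *\<^sub>v (\<rho> (R b) *\<^sub>v x) = c \<cdot>\<^sub>v (\<rho> (R (a + b)) *\<^sub>v x)" if "x \<in> carrier_vec d" for a b x
    using act[OF R_TL[of a] R_TL[of b] that] R_R[of a b] lp_R_R[of a b] by (simp add: c_def)
  obtain y where y: "y \<in> carrier_vec d" "\<rho> e *\<^sub>v y \<noteq> 0\<^sub>v d"
    using mat_eq_by_vec[OF car[OF e_TL] zero_carrier_mat[of d d]] ne zero_mat_vec by metis
  have "E \<noteq> {0\<^sub>v d}" using RE[OF y(1), of 0] y(2) R_0 by auto
  moreover have inv: "\<rho> (R 1) *\<^sub>v x \<in> E" if "x \<in> E" for x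
    by (rule RE) (use that in \<open>simp add: E_def\<close>)
  ultimately obtain l u where u: "u \<in> E" "u \<noteq> 0\<^sub>v d" "\<rho> (R 1) *\<^sub>v u = l \<cdot>\<^sub>v u"
    using eigenvector_in_subspace[OF car[OF R_TL[of 1]] E] by blast
  have uc: "u \<in> carrier_vec d" and ue: "\<rho> e *\<^sub>v u = c \<cdot>\<^sub>v u" using u by (auto simp: E_def)
  have uR: "\<rho> (R (a + b)) *\<^sub>v u = (k * k' / c) \<cdot>\<^sub>v u" if "\<rho> (R a) *\<^sub>v u = k \<cdot>\<^sub>v u" "\<rho> (R b) *\<^sub>v u = k' \<cdot>\<^sub>v u" for a b k k'
  proof -
    have "c \<cdot>\<^sub>v (\<rho> (R (a + b)) *\<^sub>v u) = \<rho> (R a) *\<^sub>v (k' \<cdot>\<^sub>v u)" using RR[OF uc, of a b] that by simp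
    also have "\<dots> = (k * k') \<cdot>\<^sub>v u" using rep_smult[OF rep R_TL uc] that by (simp add: smult_smult_assoc mult.commute)
    also have "\<dots> = c \<cdot>\<^sub>v ((k * k' / c) \<cdot>\<^sub>v u)" using c0 by (simp add: smult_smult_assoc)
    finally show ?thesis using smult_vec_cancel[OF c0] by blast
  qed
  have inv1: "l \<cdot>\<^sub>v (\<rho> (R (- 1)) *\<^sub>v u) = (c * c) \<cdot>\<^sub>v u"
  proof -
    have "l \<cdot>\<^sub>v (\<rho> (R (- 1)) *\<^sub>v u) = \<rho> (R (- 1)) *\<^sub>v (l \<cdot>\<^sub>v u)" using rep_smult[OF rep R_TL[of "- 1"] uc] by simp
    also have "\<dots> = \<rho> (R (- 1)) *\<^sub>v (\<rho> (R 1) *\<^sub>v u)" using u(3) by simp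
    also have "\<dots> = c \<cdot>\<^sub>v (c \<cdot>\<^sub>v u)" using RR[OF uc, of "-1" 1] R_0 ue by simp
    finally show ?thesis by (simp add: smult_smult_assoc)
  qed
  have l0: "l \<noteq> 0"
  proof
    assume "l = 0"
    then have "(c * c) \<cdot>\<^sub>v u = 0\<^sub>v d" using inv1 zero_smult_vec0[OF vec[OF R_TL[of "- 1"] uc]] by simp
    then have "(c * c) \<cdot>\<^sub>v u = 0 \<cdot>\<^sub>v u" using zero_smult_vec0[OF uc] by simp
    then have "c * c = 0" using smult_vec_eq_iff[OF uc u(2)] by blast
    then show False using c0 by simp
  qed
  have um1: "\<rho> (R (- 1)) *\<^sub>v u = (c * c / l) \<cdot>\<^sub>v u"
  proof (rule smult_vec_cancel[OF l0])
    show "l \<cdot>\<^sub>v (\<rho> (R (- 1)) *\<^sub>v u) = l \<cdot>\<^sub>v ((c * c / l) \<cdot>\<^sub>v u)" using inv1 l0 by (simp add: smult_smult_assoc)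
  qed
  define \<alpha> where "\<alpha> = l / c"
  have a0: "\<alpha> \<noteq> 0" using l0 c0 by (simp add: \<alpha>_def)
  have "\<rho> (R m) *\<^sub>v u = (c * \<alpha> powi m) \<cdot>\<^sub>v u" for m
  proof (induction m rule: int_induct[where k = 0])
    case base
    then show ?case using R_0 ue by simp
  next
    case (step1 i)
    have "c * \<alpha> powi i * l / c = c * \<alpha> powi (i + 1)" using c0 a0 by (simp add: power_int_add_1 \<alpha>_def)
    then show ?case using uR[OF step1(2) u(3)] by simp
  next
    case (step2 i)
    have "c * \<alpha> powi i * (c * c / l) / c = c * \<alpha> powi (i - 1)"
      using c0 l0 a0 by (simp add: power_int_diff \<alpha>_def)
    then show ?case using uR[OF step2(2) um1] by simp
  qed
  then show ?thesis using a0 u uc by (auto simp: tvec_def c_def)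
qed

context
  fixes d :: nat and \<rho> :: "diagram \<Rightarrow> 'k mat" and \<alpha> :: 'k and u :: "'k vec"
  assumes rep: "is_rep n v d \<rho>"
    and kill: "\<And>D. D \<in> TL \<Longrightarrow> nv D < t \<Longrightarrow> \<rho> D = 0\<^sub>m d d"
    and \<alpha>: "\<alpha> \<noteq> 0" and u: "tvec t d \<rho> \<alpha> u"
begin

lemma u_car: "u \<in> carrier_vec d" and u_ne: "u \<noteq> 0\<^sub>v d" and u_R: "\<rho> (R m) *\<^sub>v u = (lp e e * \<alpha> powi m) \<cdot>\<^sub>v u"
  using u by (auto simp: tvec_def)

lemma u_e: "\<rho> e *\<^sub>v u = lp e e \<cdot>\<^sub>v u"
  using u_R[of 0] R_0 by simp

text \<open>As e u = c u with c = \<open>lp e e\<close>, c times the left side is e C e u. By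
  \<open>corner_shape\<close> the corner element is zero on u or a rotation, whose eigenvalue on u
  contains the same factor c.\<close>

lemma u_weight: "C \<in> TL \<Longrightarrow> \<rho> e *\<^sub>v (\<rho> C *\<^sub>v u) = weight t \<alpha> C \<cdot>\<^sub>v u"
proof -
  assume C: "C \<in> TL"
  let ?c = "lp e e" and ?F = "diag_comp n e C" and ?G = "diag_comp n (diag_comp n e C) e"
  have F: "?F \<in> TL" and G: "?G \<in> TL" using TL_comp e_TL C by auto
  note vec = rep_vec[OF rep] and act = rep_act[OF rep]
  note eu = vec[OF e_TL u_car]
  have "?c \<cdot>\<^sub>v (\<rho> e *\<^sub>v (\<rho> C *\<^sub>v u)) = \<rho> e *\<^sub>v (\<rho> C *\<^sub>v (\<rho> e *\<^sub>v u))"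
    using rep_smult[OF rep C u_car] rep_smult[OF rep e_TL vec[OF C u_car]] by (simp add: u_e)
  also have "\<dots> = lp e C \<cdot>\<^sub>v (lp ?F e \<cdot>\<^sub>v (\<rho> ?G *\<^sub>v u))"
    using act[OF e_TL C eu] act[OF F e_TL u_car] by simp
  also have "\<dots> = ?c \<cdot>\<^sub>v (weight t \<alpha> C \<cdot>\<^sub>v u)"
  proof (cases "nv ?G < t")
    case True
    then have "\<rho> ?G *\<^sub>v u = 0\<^sub>v d" using kill[OF G] zero_mat_vec[OF u_car] by simp
    then show ?thesis using True zero_smult_vec0[OF u_car] by (simp add: weight_def Let_def)
  next
    case False
    have "\<rho> ?G *\<^sub>v u = (?c * \<alpha> powi (woff ?G div 2)) \<cdot>\<^sub>v u"
      using u_R[of "woff ?G div 2"] corner_shape[OF C False] by simp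
    then show ?thesis using False by (simp add: weight_def Let_def smult_smult_assoc mult_ac)
  qed
  finally show ?thesis using smult_vec_cancel[OF lp_ne] by blast
qed

context
  assumes irr: "is_irrep n v d \<rho>"
begin

text \<open>The vectors y annihilated by all e C form a subspace stable under the action. Were it
  nonzero, it would contain u, but e u is a nonzero multiple of u.\<close>

lemma corner_separates:
  assumes y: "y \<in> carrier_vec d" and 0: "\<And>C. C \<in> TL \<Longrightarrow> \<rho> e *\<^sub>v (\<rho> C *\<^sub>v y) = 0\<^sub>v d"
  shows "y = 0\<^sub>v d"
proof (rule ccontr)
  note vec = rep_vec[OF rep]
  assume "y \<noteq> 0\<^sub>v d"
  have "\<forall>C\<in>TL. \<rho> e *\<^sub>v (\<rho> C *\<^sub>v u) = 0\<^sub>v d"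
  proof (rule irrep_full[OF rep irr y \<open>y \<noteq> 0\<^sub>v d\<close> _ _ _ _ _ u_car])
    show "\<forall>C\<in>TL. \<rho> e *\<^sub>v (\<rho> C *\<^sub>v y) = 0\<^sub>v d" using 0 by blast
    show "\<forall>C\<in>TL. \<rho> e *\<^sub>v (\<rho> C *\<^sub>v 0\<^sub>v d) = 0\<^sub>v d" using rep_zero[OF rep] e_TL by simp
  next
    fix x y assume *: "x \<in> carrier_vec d" "y \<in> carrier_vec d"
      "\<forall>C\<in>TL. \<rho> e *\<^sub>v (\<rho> C *\<^sub>v x) = 0\<^sub>v d" "\<forall>C\<in>TL. \<rho> e *\<^sub>v (\<rho> C *\<^sub>v y) = 0\<^sub>v d"
    then show "\<forall>C\<in>TL. \<rho> e *\<^sub>v (\<rho> C *\<^sub>v (x + y)) = 0\<^sub>v d"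
      using rep_add[OF rep _ *(1,2)] rep_add[OF rep e_TL vec[OF _ *(1)] vec[OF _ *(2)]] by simp
  next
    fix x c assume *: "x \<in> carrier_vec d" "\<forall>C\<in>TL. \<rho> e *\<^sub>v (\<rho> C *\<^sub>v x) = 0\<^sub>v d"
    then show "\<forall>C\<in>TL. \<rho> e *\<^sub>v (\<rho> C *\<^sub>v (c \<cdot>\<^sub>v x)) = 0\<^sub>v d"
      using rep_smult[OF rep _ *(1)] rep_smult[OF rep e_TL vec[OF _ *(1)]] by simp
  next
    fix x D assume *: "x \<in> carrier_vec d" "D \<in> TL" "\<forall>C\<in>TL. \<rho> e *\<^sub>v (\<rho> C *\<^sub>v x) = 0\<^sub>v d"
    then show "\<forall>C\<in>TL. \<rho> e *\<^sub>v (\<rho> C *\<^sub>v (\<rho> D *\<^sub>v x)) = 0\<^sub>v d"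
      using rep_act[OF rep _ *(2,1)] rep_smult[OF rep e_TL vec[OF TL_comp[OF _ *(2)] *(1)]] TL_comp[OF _ *(2)] by simp
  qed
  then have "\<rho> e *\<^sub>v u = 0\<^sub>v d" using TL_diagrams.TL_id rep_id[OF rep u_car] by metis
  then have "lp e e \<cdot>\<^sub>v u = 0 \<cdot>\<^sub>v u" using u_e zero_smult_vec0[OF u_car] by simp
  then show False using smult_vec_eq_iff[OF u_car u_ne] lp_ne by blast
qed

text \<open>Compare e C1 X C2 y for X = D and X its rotation. At y = u the two differ by the factor
  \<open>\<alpha>\<close>, through \<open>weight_rot\<close>; then all y are reached from u, and
  \<open>corner_separates\<close> removes e C1.\<close>

lemma rep_rot:
  assumes D: "D \<in> TL" "nv D = t"
  shows "\<rho> (rot 2 D) = \<alpha> \<cdot>\<^sub>m \<rho> D"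
proof -
  note vec = rep_vec[OF rep] and act = rep_act[OF rep] and sm = rep_smult[OF rep]
  have rD: "rot 2 D \<in> TL" by (rule rot_TL[OF D(1)]) (use D t_less in auto)
  text \<open>Both factors of a product around \<open>D\<close> only see its halves, so the rotation passes through.\<close>
  have wt: "\<rho> e *\<^sub>v (\<rho> C1 *\<^sub>v (\<rho> (rot 2 D) *\<^sub>v (\<rho> C2 *\<^sub>v u))) = \<alpha> \<cdot>\<^sub>v (\<rho> e *\<^sub>v (\<rho> C1 *\<^sub>v (\<rho> D *\<^sub>v (\<rho> C2 *\<^sub>v u))))"
    if C: "C1 \<in> TL" "C2 \<in> TL" for C1 C2
  proof -
    let ?E = "diag_comp n D C2" and ?E' = "diag_comp n (rot 2 D) C2"
    have E: "?E \<in> TL" "?E' \<in> TL" using TL_comp D rD C by auto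
    have nE: "nv ?E' = nv ?E" by (rule num_vertical_rot_comp[OF TL_good[OF C(2)] TL_PD[OF D(1)]])
    have lE: "lp (rot 2 D) C2 = lp D C2" using num_loops_rot(2)[OF TL_good[OF C(2)] TL_PD[OF D(1)]] by simp
    have leE: "nv ?E \<le> t" using num_vertical_comp(1)[OF TL_good[OF D(1)] TL_good[OF C(2)]] D by simp
    have L: "\<rho> D *\<^sub>v (\<rho> C2 *\<^sub>v u) = lp D C2 \<cdot>\<^sub>v (\<rho> ?E *\<^sub>v u)"
      "\<rho> (rot 2 D) *\<^sub>v (\<rho> C2 *\<^sub>v u) = lp D C2 \<cdot>\<^sub>v (\<rho> ?E' *\<^sub>v u)"
      using act[OF D(1) C(2) u_car] act[OF rD C(2) u_car] lE by simp_all
    have main: "\<rho> e *\<^sub>v (\<rho> C1 *\<^sub>v (\<rho> ?E' *\<^sub>v u)) = \<alpha> \<cdot>\<^sub>v (\<rho> e *\<^sub>v (\<rho> C1 *\<^sub>v (\<rho> ?E *\<^sub>v u)))"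
    proof (cases "nv ?E < t")
      case True
      then have "\<rho> ?E *\<^sub>v u = 0\<^sub>v d" "\<rho> ?E' *\<^sub>v u = 0\<^sub>v d" using kill E nE zero_mat_vec[OF u_car] by simp_all
      then show ?thesis using rep_zero[OF rep] C e_TL by simp
    next
      case False
      then have nt: "nv ?E = t" using leE by simp
      have rE: "?E' = rot 2 ?E" by (rule comp_rot_left[OF C(2) D(1) rD]) (use nt D in simp)
      let ?H = "diag_comp n C1 ?E" and ?H' = "diag_comp n C1 (rot 2 ?E)"
      have H: "?H \<in> TL" "?H' \<in> TL" using TL_comp C E rE by auto
      have nH: "nv ?H' = nv ?H" by (rule num_vertical_comp_rot[OF TL_good[OF C(1)] TL_PD[OF E(1)]])
      have lH: "lp C1 (rot 2 ?E) = lp C1 ?E" using num_loops_rot(1)[OF TL_good[OF C(1)] TL_PD[OF E(1)]] by simp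
      have leH: "nv ?H \<le> t" using num_vertical_comp(2)[OF TL_good[OF C(1)] TL_good[OF E(1)]] nt by simp
      have K: "\<rho> C1 *\<^sub>v (\<rho> ?E *\<^sub>v u) = lp C1 ?E \<cdot>\<^sub>v (\<rho> ?H *\<^sub>v u)"
        "\<rho> C1 *\<^sub>v (\<rho> ?E' *\<^sub>v u) = lp C1 ?E \<cdot>\<^sub>v (\<rho> ?H' *\<^sub>v u)"
        using act[OF C(1) E(1) u_car] act[OF C(1) E(2) u_car] lH rE by simp_all
      have "\<rho> e *\<^sub>v (\<rho> ?H' *\<^sub>v u) = \<alpha> \<cdot>\<^sub>v (\<rho> e *\<^sub>v (\<rho> ?H *\<^sub>v u))"
      proof (cases "nv ?H < t")
        case True
        then have "\<rho> ?H *\<^sub>v u = 0\<^sub>v d" "\<rho> ?H' *\<^sub>v u = 0\<^sub>v d" using kill H nH zero_mat_vec[OF u_car] by simp_all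
        then show ?thesis using rep_zero[OF rep] e_TL by simp
      next
        case False
        then have nHt: "nv ?H = t" using leH by simp
        have "?H' = rot 2 ?H" by (rule comp_rot_right[OF C(1) E(1)]) (use E rE nt nHt in simp_all)
        then show ?thesis using u_weight[OF H(1)] u_weight[OF H(2)] weight_rot[OF H(1) nHt \<alpha>] by (simp add: smult_smult_assoc)
      qed
      then show ?thesis using K sm[OF e_TL vec[OF H(1) u_car]] sm[OF e_TL vec[OF H(2) u_car]] by (simp add: smult_smult_assoc mult.commute)
    qed
    show ?thesis unfolding L
      using main sm[OF C(1) vec[OF E(1) u_car]] sm[OF C(1) vec[OF E(2) u_car]]
        sm[OF e_TL vec[OF C(1) vec[OF E(1) u_car]]] sm[OF e_TL vec[OF C(1) vec[OF E(2) u_car]]]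
      by (simp add: smult_smult_assoc mult.commute)
  qed
  \<comment> \<open>Both sides are linear in y, and acting on y by B only replaces C2 by C2 B and a
    common loop factor. Hence the claim spreads from u to every vector.\<close>
  have all: "\<forall>C1\<in>TL. \<forall>C2\<in>TL. \<rho> e *\<^sub>v (\<rho> C1 *\<^sub>v (\<rho> (rot 2 D) *\<^sub>v (\<rho> C2 *\<^sub>v y))) =
      \<alpha> \<cdot>\<^sub>v (\<rho> e *\<^sub>v (\<rho> C1 *\<^sub>v (\<rho> D *\<^sub>v (\<rho> C2 *\<^sub>v y))))" if y: "y \<in> carrier_vec d" for y
  proof (rule irrep_full[OF rep irr u_car u_ne _ _ _ _ _ y])
    show "\<forall>C1\<in>TL. \<forall>C2\<in>TL. \<rho> e *\<^sub>v (\<rho> C1 *\<^sub>v (\<rho> (rot 2 D) *\<^sub>v (\<rho> C2 *\<^sub>v u))) =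
      \<alpha> \<cdot>\<^sub>v (\<rho> e *\<^sub>v (\<rho> C1 *\<^sub>v (\<rho> D *\<^sub>v (\<rho> C2 *\<^sub>v u))))" using wt by blast
    show "\<forall>C1\<in>TL. \<forall>C2\<in>TL. \<rho> e *\<^sub>v (\<rho> C1 *\<^sub>v (\<rho> (rot 2 D) *\<^sub>v (\<rho> C2 *\<^sub>v 0\<^sub>v d))) =
      \<alpha> \<cdot>\<^sub>v (\<rho> e *\<^sub>v (\<rho> C1 *\<^sub>v (\<rho> D *\<^sub>v (\<rho> C2 *\<^sub>v 0\<^sub>v d))))" using rep_zero[OF rep] e_TL D rD by simp
  next
    fix x y assume x: "x \<in> carrier_vec d" and y: "y \<in> carrier_vec d"
      and *: "\<forall>C1\<in>TL. \<forall>C2\<in>TL. \<rho> e *\<^sub>v (\<rho> C1 *\<^sub>v (\<rho> (rot 2 D) *\<^sub>v (\<rho> C2 *\<^sub>v x))) = \<alpha> \<cdot>\<^sub>v (\<rho> e *\<^sub>v (\<rho> C1 *\<^sub>v (\<rho> D *\<^sub>v (\<rho> C2 *\<^sub>v x))))"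
      "\<forall>C1\<in>TL. \<forall>C2\<in>TL. \<rho> e *\<^sub>v (\<rho> C1 *\<^sub>v (\<rho> (rot 2 D) *\<^sub>v (\<rho> C2 *\<^sub>v y))) = \<alpha> \<cdot>\<^sub>v (\<rho> e *\<^sub>v (\<rho> C1 *\<^sub>v (\<rho> D *\<^sub>v (\<rho> C2 *\<^sub>v y))))"
    have lin: "\<rho> e *\<^sub>v (\<rho> C1 *\<^sub>v (\<rho> X *\<^sub>v (\<rho> C2 *\<^sub>v (x + y)))) =
        \<rho> e *\<^sub>v (\<rho> C1 *\<^sub>v (\<rho> X *\<^sub>v (\<rho> C2 *\<^sub>v x))) + \<rho> e *\<^sub>v (\<rho> C1 *\<^sub>v (\<rho> X *\<^sub>v (\<rho> C2 *\<^sub>v y)))"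
      if "C1 \<in> TL" "C2 \<in> TL" "X \<in> TL" for C1 C2 X
      using that x y e_TL by (simp add: rep_add[OF rep] vec)
    show "\<forall>C1\<in>TL. \<forall>C2\<in>TL. \<rho> e *\<^sub>v (\<rho> C1 *\<^sub>v (\<rho> (rot 2 D) *\<^sub>v (\<rho> C2 *\<^sub>v (x + y)))) =
      \<alpha> \<cdot>\<^sub>v (\<rho> e *\<^sub>v (\<rho> C1 *\<^sub>v (\<rho> D *\<^sub>v (\<rho> C2 *\<^sub>v (x + y)))))"
      using * x y D rD e_TL by (simp add: lin) (intro ballI smult_add_distrib_vec[symmetric], auto intro!: vec)
  next
    fix x c assume x: "x \<in> carrier_vec d"
      and *: "\<forall>C1\<in>TL. \<forall>C2\<in>TL. \<rho> e *\<^sub>v (\<rho> C1 *\<^sub>v (\<rho> (rot 2 D) *\<^sub>v (\<rho> C2 *\<^sub>v x))) = \<alpha> \<cdot>\<^sub>v (\<rho> e *\<^sub>v (\<rho> C1 *\<^sub>v (\<rho> D *\<^sub>v (\<rho> C2 *\<^sub>v x))))"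
    have lin: "\<rho> e *\<^sub>v (\<rho> C1 *\<^sub>v (\<rho> X *\<^sub>v (\<rho> C2 *\<^sub>v (c \<cdot>\<^sub>v x)))) = c \<cdot>\<^sub>v (\<rho> e *\<^sub>v (\<rho> C1 *\<^sub>v (\<rho> X *\<^sub>v (\<rho> C2 *\<^sub>v x))))"
      if "C1 \<in> TL" "C2 \<in> TL" "X \<in> TL" for C1 C2 X
      using that x e_TL by (simp add: sm vec)
    show "\<forall>C1\<in>TL. \<forall>C2\<in>TL. \<rho> e *\<^sub>v (\<rho> C1 *\<^sub>v (\<rho> (rot 2 D) *\<^sub>v (\<rho> C2 *\<^sub>v (c \<cdot>\<^sub>v x)))) =
      \<alpha> \<cdot>\<^sub>v (\<rho> e *\<^sub>v (\<rho> C1 *\<^sub>v (\<rho> D *\<^sub>v (\<rho> C2 *\<^sub>v (c \<cdot>\<^sub>v x)))))"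
      using * D rD by (simp add: lin smult_smult_assoc mult.commute)
  next
    fix x B assume x: "x \<in> carrier_vec d" and B: "B \<in> TL"
      and *: "\<forall>C1\<in>TL. \<forall>C2\<in>TL. \<rho> e *\<^sub>v (\<rho> C1 *\<^sub>v (\<rho> (rot 2 D) *\<^sub>v (\<rho> C2 *\<^sub>v x))) = \<alpha> \<cdot>\<^sub>v (\<rho> e *\<^sub>v (\<rho> C1 *\<^sub>v (\<rho> D *\<^sub>v (\<rho> C2 *\<^sub>v x))))"
    have lin: "\<rho> e *\<^sub>v (\<rho> C1 *\<^sub>v (\<rho> X *\<^sub>v (\<rho> C2 *\<^sub>v (\<rho> B *\<^sub>v x)))) =
        lp C2 B \<cdot>\<^sub>v (\<rho> e *\<^sub>v (\<rho> C1 *\<^sub>v (\<rho> X *\<^sub>v (\<rho> (diag_comp n C2 B) *\<^sub>v x))))"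
      if "C1 \<in> TL" "C2 \<in> TL" "X \<in> TL" for C1 C2 X
      using that x B e_TL by (simp add: sm vec act TL_comp)
    show "\<forall>C1\<in>TL. \<forall>C2\<in>TL. \<rho> e *\<^sub>v (\<rho> C1 *\<^sub>v (\<rho> (rot 2 D) *\<^sub>v (\<rho> C2 *\<^sub>v (\<rho> B *\<^sub>v x)))) =
      \<alpha> \<cdot>\<^sub>v (\<rho> e *\<^sub>v (\<rho> C1 *\<^sub>v (\<rho> D *\<^sub>v (\<rho> C2 *\<^sub>v (\<rho> B *\<^sub>v x)))))"
      using * D rD TL_comp B by (simp add: lin smult_smult_assoc mult.commute)
  qed
  show ?thesis
  proof (rule mat_eq_by_vec)
    show "\<rho> (rot 2 D) \<in> carrier_mat d d" "\<alpha> \<cdot>\<^sub>m \<rho> D \<in> carrier_mat d d" using rep_car[OF rep] D rD by auto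
    fix y :: "'k vec" assume y: "y \<in> carrier_vec d"
    define a where "a = \<rho> (rot 2 D) *\<^sub>v y"
    define b where "b = \<rho> D *\<^sub>v y"
    have ab: "a \<in> carrier_vec d" "b \<in> carrier_vec d" using vec D rD y by (auto simp: a_def b_def)
    have "a + (- \<alpha>) \<cdot>\<^sub>v b = 0\<^sub>v d"
    proof (rule corner_separates)
      show "a + (- \<alpha>) \<cdot>\<^sub>v b \<in> carrier_vec d" using ab by simp
      fix C assume C: "C \<in> TL"
      have "\<rho> e *\<^sub>v (\<rho> C *\<^sub>v a) = \<alpha> \<cdot>\<^sub>v (\<rho> e *\<^sub>v (\<rho> C *\<^sub>v b))"
        using all[OF y] C TL_diagrams.TL_id rep_id[OF rep y] unfolding a_def b_def by metis
      moreover have "\<rho> e *\<^sub>v (\<rho> C *\<^sub>v (a + (- \<alpha>) \<cdot>\<^sub>v b)) = \<rho> e *\<^sub>v (\<rho> C *\<^sub>v a) + (- \<alpha>) \<cdot>\<^sub>v (\<rho> e *\<^sub>v (\<rho> C *\<^sub>v b))"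
        using ab C e_TL by (simp add: rep_add[OF rep] sm vec)
      moreover have "\<alpha> \<cdot>\<^sub>v z + (- \<alpha>) \<cdot>\<^sub>v z = 0\<^sub>v d" if "z \<in> carrier_vec d" for z
        using that by (intro eq_vecI) auto
      ultimately show "\<rho> e *\<^sub>v (\<rho> C *\<^sub>v (a + (- \<alpha>) \<cdot>\<^sub>v b)) = 0\<^sub>v d" using vec e_TL C ab by simp
    qed
    then have "a = \<alpha> \<cdot>\<^sub>v b"
    proof (intro eq_vecI)
      fix i assume i: "i < dim_vec (\<alpha> \<cdot>\<^sub>v b)"
      assume "a + (- \<alpha>) \<cdot>\<^sub>v b = 0\<^sub>v d"
      then have "(a + (- \<alpha>) \<cdot>\<^sub>v b) $ i = 0\<^sub>v d $ i" by simp
      then show "a $ i = (\<alpha> \<cdot>\<^sub>v b) $ i" using i ab by simp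
    qed (use ab in auto)
    then show "\<rho> (rot 2 D) *\<^sub>v y = \<alpha> \<cdot>\<^sub>m \<rho> D *\<^sub>v y" using smult_mat_vec[OF rep_car[OF rep D(1)] y] by (simp add: a_def b_def)
  qed
qed

end

end

end

end

context tl
begin

section \<open>The invariants determine the representation\<close>

text \<open>The graph of the isomorphism to be constructed.\<close>

definition linked :: "nat \<Rightarrow> nat \<Rightarrow> (diagram \<Rightarrow> 'k mat) \<Rightarrow> 'k vec \<Rightarrow> nat \<Rightarrow> (diagram \<Rightarrow> 'k mat) \<Rightarrow> 'k vec \<Rightarrow> 'k vec \<Rightarrow> 'k vec \<Rightarrow> bool" where
  "linked t d1 \<rho>1 u1 d2 \<rho>2 u2 y1 y2 \<longleftrightarrow> y1 \<in> carrier_vec d1 \<and> y2 \<in> carrier_vec d2 \<and>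
     (\<forall>C\<in>TL. \<exists>k. \<rho>1 (idem t) *\<^sub>v (\<rho>1 C *\<^sub>v y1) = k \<cdot>\<^sub>v u1 \<and> \<rho>2 (idem t) *\<^sub>v (\<rho>2 C *\<^sub>v y2) = k \<cdot>\<^sub>v u2)"

lemma linked_sym: "linked t d1 \<rho>1 u1 d2 \<rho>2 u2 y1 y2 \<longleftrightarrow> linked t d2 \<rho>2 u2 d1 \<rho>1 u1 y2 y1"
  by (auto simp: linked_def)

definition tirrep :: "nat \<Rightarrow> 'k \<Rightarrow> nat \<Rightarrow> (diagram \<Rightarrow> 'k mat) \<Rightarrow> 'k vec \<Rightarrow> bool" where
  "tirrep t \<alpha> d \<rho> u \<longleftrightarrow> is_irrep n v d \<rho> \<and> (\<forall>D\<in>TL. nv D < t \<longrightarrow> \<rho> D = 0\<^sub>m d d) \<and> \<alpha> \<noteq> 0 \<and> tvec t d \<rho> \<alpha> u"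

lemma tirrepD:
  assumes "tirrep t \<alpha> d \<rho> u"
  shows "is_rep n v d \<rho>" "\<And>D. D \<in> TL \<Longrightarrow> nv D < t \<Longrightarrow> \<rho> D = 0\<^sub>m d d" "\<alpha> \<noteq> 0" "tvec t d \<rho> \<alpha> u" "is_irrep n v d \<rho>"
  using assms by (auto simp: tirrep_def is_irrep_def)

context
  fixes t :: nat and \<alpha> :: 'k and d1 d2 \<rho>1 \<rho>2 u1 u2
  assumes t: "odd t" "t \<le> n - 2"
    and I1: "tirrep t \<alpha> d1 \<rho>1 u1" and I2: "tirrep t \<alpha> d2 \<rho>2 u2"
begin

lemma linked_zero: "linked t d1 \<rho>1 u1 d2 \<rho>2 u2 (0\<^sub>v d1) (0\<^sub>v d2)"
  using rep_zero[OF tirrepD(1)[OF I1]] rep_zero[OF tirrepD(1)[OF I2]] idem_TL[OF t]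
    zero_smult_vec0[OF u_car[OF t tirrepD(1-4)[OF I1]]] zero_smult_vec0[OF u_car[OF t tirrepD(1-4)[OF I2]]]
  unfolding linked_def by (auto intro!: exI[of _ 0])

lemma linked_u: "linked t d1 \<rho>1 u1 d2 \<rho>2 u2 u1 u2"
  using u_weight[OF t tirrepD(1-4)[OF I1]] u_weight[OF t tirrepD(1-4)[OF I2]]
    u_car[OF t tirrepD(1-4)[OF I1]] u_car[OF t tirrepD(1-4)[OF I2]]
  unfolding linked_def by blast

lemma linked_add:
  assumes "linked t d1 \<rho>1 u1 d2 \<rho>2 u2 x1 x2" "linked t d1 \<rho>1 u1 d2 \<rho>2 u2 y1 y2"
  shows "linked t d1 \<rho>1 u1 d2 \<rho>2 u2 (x1 + y1) (x2 + y2)"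
  unfolding linked_def
proof (intro conjI ballI)
  have c: "x1 \<in> carrier_vec d1" "x2 \<in> carrier_vec d2" "y1 \<in> carrier_vec d1" "y2 \<in> carrier_vec d2"
    using assms by (auto simp: linked_def)
  then show "x1 + y1 \<in> carrier_vec d1" "x2 + y2 \<in> carrier_vec d2" by auto
  fix C assume C: "C \<in> TL"
  obtain k where k: "\<rho>1 (idem t) *\<^sub>v (\<rho>1 C *\<^sub>v x1) = k \<cdot>\<^sub>v u1" "\<rho>2 (idem t) *\<^sub>v (\<rho>2 C *\<^sub>v x2) = k \<cdot>\<^sub>v u2"
    using assms(1) C unfolding linked_def by blast
  obtain l where l: "\<rho>1 (idem t) *\<^sub>v (\<rho>1 C *\<^sub>v y1) = l \<cdot>\<^sub>v u1" "\<rho>2 (idem t) *\<^sub>v (\<rho>2 C *\<^sub>v y2) = l \<cdot>\<^sub>v u2"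
    using assms(2) C unfolding linked_def by blast
  show "\<exists>k. \<rho>1 (idem t) *\<^sub>v (\<rho>1 C *\<^sub>v (x1 + y1)) = k \<cdot>\<^sub>v u1 \<and> \<rho>2 (idem t) *\<^sub>v (\<rho>2 C *\<^sub>v (x2 + y2)) = k \<cdot>\<^sub>v u2"
    by (rule exI[of _ "k + l"])
      (use c C idem_TL[OF t] k l tirrepD(1)[OF I1] tirrepD(1)[OF I2] in
        \<open>simp add: rep_add rep_vec add_smult_distrib_vec\<close>)
qed

lemma linked_smult:
  assumes "linked t d1 \<rho>1 u1 d2 \<rho>2 u2 x1 x2"
  shows "linked t d1 \<rho>1 u1 d2 \<rho>2 u2 (c \<cdot>\<^sub>v x1) (c \<cdot>\<^sub>v x2)"
  unfolding linked_def
proof (intro conjI ballI)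
  have x: "x1 \<in> carrier_vec d1" "x2 \<in> carrier_vec d2" using assms by (auto simp: linked_def)
  then show "c \<cdot>\<^sub>v x1 \<in> carrier_vec d1" "c \<cdot>\<^sub>v x2 \<in> carrier_vec d2" by auto
  fix C assume C: "C \<in> TL"
  obtain k where k: "\<rho>1 (idem t) *\<^sub>v (\<rho>1 C *\<^sub>v x1) = k \<cdot>\<^sub>v u1" "\<rho>2 (idem t) *\<^sub>v (\<rho>2 C *\<^sub>v x2) = k \<cdot>\<^sub>v u2"
    using assms(1) C unfolding linked_def by blast
  show "\<exists>k. \<rho>1 (idem t) *\<^sub>v (\<rho>1 C *\<^sub>v (c \<cdot>\<^sub>v x1)) = k \<cdot>\<^sub>v u1 \<and> \<rho>2 (idem t) *\<^sub>v (\<rho>2 C *\<^sub>v (c \<cdot>\<^sub>v x2)) = k \<cdot>\<^sub>v u2"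
    by (rule exI[of _ "c * k"])
      (use x C idem_TL[OF t] k tirrepD(1)[OF I1] tirrepD(1)[OF I2] in
        \<open>simp add: rep_smult rep_vec smult_smult_assoc\<close>)
qed

lemma linked_act:
  assumes "linked t d1 \<rho>1 u1 d2 \<rho>2 u2 x1 x2" and D: "D \<in> TL"
  shows "linked t d1 \<rho>1 u1 d2 \<rho>2 u2 (\<rho>1 D *\<^sub>v x1) (\<rho>2 D *\<^sub>v x2)"
  unfolding linked_def
proof (intro conjI ballI)
  have x: "x1 \<in> carrier_vec d1" "x2 \<in> carrier_vec d2" using assms by (auto simp: linked_def)
  then show "\<rho>1 D *\<^sub>v x1 \<in> carrier_vec d1" "\<rho>2 D *\<^sub>v x2 \<in> carrier_vec d2"
    using rep_vec[OF tirrepD(1)[OF I1] D] rep_vec[OF tirrepD(1)[OF I2] D] by auto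
  fix C assume C: "C \<in> TL"
  obtain k where k: "\<rho>1 (idem t) *\<^sub>v (\<rho>1 (diag_comp n C D) *\<^sub>v x1) = k \<cdot>\<^sub>v u1"
      "\<rho>2 (idem t) *\<^sub>v (\<rho>2 (diag_comp n C D) *\<^sub>v x2) = k \<cdot>\<^sub>v u2"
    using assms(1) TL_comp[OF C D] unfolding linked_def by blast
  show "\<exists>k. \<rho>1 (idem t) *\<^sub>v (\<rho>1 C *\<^sub>v (\<rho>1 D *\<^sub>v x1)) = k \<cdot>\<^sub>v u1 \<and> \<rho>2 (idem t) *\<^sub>v (\<rho>2 C *\<^sub>v (\<rho>2 D *\<^sub>v x2)) = k \<cdot>\<^sub>v u2"
    by (rule exI[of _ "lp C D * k"])
      (use x C D TL_comp[OF C D] idem_TL[OF t] k rep_act[OF tirrepD(1)[OF I1] C D] rep_act[OF tirrepD(1)[OF I2] C D]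
         tirrepD(1)[OF I1] tirrepD(1)[OF I2] in
        \<open>simp add: rep_smult rep_vec smult_smult_assoc\<close>)
qed

text \<open>On the left every coefficient k is 0, as u1 is not zero; so every e C annihilates y, and
  \<open>corner_separates\<close> applies.\<close>

lemma linked_zero_left:
  assumes L: "linked t d1 \<rho>1 u1 d2 \<rho>2 u2 (0\<^sub>v d1) y"
  shows "y = 0\<^sub>v d2"
proof (rule corner_separates[OF t tirrepD[OF I2]])
  note u1c = u_car[OF t tirrepD(1-4)[OF I1]] and u1n = u_ne[OF t tirrepD(1-4)[OF I1]]
  note u2c = u_car[OF t tirrepD(1-4)[OF I2]]
  show "y \<in> carrier_vec d2" using L by (simp add: linked_def)
  fix C assume C: "C \<in> TL"
  obtain k where k: "\<rho>1 (idem t) *\<^sub>v (\<rho>1 C *\<^sub>v 0\<^sub>v d1) = k \<cdot>\<^sub>v u1" "\<rho>2 (idem t) *\<^sub>v (\<rho>2 C *\<^sub>v y) = k \<cdot>\<^sub>v u2"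
    using L C unfolding linked_def by blast
  have "k \<cdot>\<^sub>v u1 = 0 \<cdot>\<^sub>v u1"
    using k(1) rep_zero[OF tirrepD(1)[OF I1]] C idem_TL[OF t] zero_smult_vec0[OF u1c] by simp
  then have "k = 0" using smult_vec_eq_iff[OF u1c u1n] by blast
  then show "\<rho>2 (idem t) *\<^sub>v (\<rho>2 C *\<^sub>v y) = 0\<^sub>v d2" using k(2) zero_smult_vec0[OF u2c] by simp
qed

lemma linked_fun:
  assumes "linked t d1 \<rho>1 u1 d2 \<rho>2 u2 x y" "linked t d1 \<rho>1 u1 d2 \<rho>2 u2 x z"
  shows "y = z"
proof -
  have c: "x \<in> carrier_vec d1" "y \<in> carrier_vec d2" "z \<in> carrier_vec d2" using assms by (auto simp: linked_def)
  have "linked t d1 \<rho>1 u1 d2 \<rho>2 u2 (x + (- 1) \<cdot>\<^sub>v x) (y + (- 1) \<cdot>\<^sub>v z)"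
    by (rule linked_add[OF assms(1) linked_smult[OF assms(2)]])
  moreover have "x + (- 1) \<cdot>\<^sub>v x = 0\<^sub>v d1" using c by (intro eq_vecI) auto
  ultimately have "y + (- 1) \<cdot>\<^sub>v z = 0\<^sub>v d2" using linked_zero_left by simp
  then have e: "(y + (- 1) \<cdot>\<^sub>v z) $ i = 0\<^sub>v d2 $ i" for i by simp
  show ?thesis
  proof (rule eq_vecI)
    fix i assume i: "i < dim_vec z"
    then show "y $ i = z $ i" using e[of i] c by simp
  qed (use c in simp)
qed

text \<open>u1 is linked to u2 because both obey the same \<open>weight\<close>; vectors that have a
  partner are stable under the action, and u1 generates.\<close>

lemma linked_total: "x \<in> carrier_vec d1 \<Longrightarrow> \<exists>y. linked t d1 \<rho>1 u1 d2 \<rho>2 u2 x y"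
proof (rule irrep_full[OF tirrepD(1,5)[OF I1] u_car[OF t tirrepD(1-4)[OF I1]] u_ne[OF t tirrepD(1-4)[OF I1]],
      where Pr = "\<lambda>x. \<exists>y. linked t d1 \<rho>1 u1 d2 \<rho>2 u2 x y"])
qed (use linked_u linked_zero linked_add linked_smult linked_act in blast)+

lemma linked_matrix: "\<exists>P\<in>carrier_mat d2 d1. \<forall>x\<in>carrier_vec d1. linked t d1 \<rho>1 u1 d2 \<rho>2 u2 x (P *\<^sub>v x)"
proof -
  define f where "f x = (SOME y. linked t d1 \<rho>1 u1 d2 \<rho>2 u2 x y)" for x
  have f: "linked t d1 \<rho>1 u1 d2 \<rho>2 u2 x (f x)" if "x \<in> carrier_vec d1" for x
    unfolding f_def by (rule someI_ex[OF linked_total[OF that]])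
  have "\<exists>P\<in>carrier_mat d2 d1. \<forall>x\<in>carrier_vec d1. f x = P *\<^sub>v x"
  proof (rule linear_map_matrix)
    fix x :: "'k vec" assume x: "x \<in> carrier_vec d1"
    show "f x \<in> carrier_vec d2" using f[OF x] by (simp add: linked_def)
    fix k show "f (k \<cdot>\<^sub>v x) = k \<cdot>\<^sub>v f x"
      by (rule linked_fun[OF f linked_smult[OF f[OF x]]]) (use x in simp)
  next
    fix x y :: "'k vec" assume xy: "x \<in> carrier_vec d1" "y \<in> carrier_vec d1"
    show "f (x + y) = f x + f y"
      by (rule linked_fun[OF f linked_add[OF f[OF xy(1)] f[OF xy(2)]]]) (use xy in simp)
  qed
  then show ?thesis using f by metis
qed

end

text \<open>The relation is the graph of a linear map in either direction, so the two matrices are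
  inverse to each other and commute with the action.\<close>

lemma tirrep_iso:
  assumes t: "odd t" "t \<le> n - 2" and I1: "tirrep t \<alpha> d1 \<rho>1 u1" and I2: "tirrep t \<alpha> d2 \<rho>2 u2"
  shows "rep_iso n d1 \<rho>1 d2 \<rho>2"
proof -
  obtain P where P: "P \<in> carrier_mat d2 d1" "\<And>x. x \<in> carrier_vec d1 \<Longrightarrow> linked t d1 \<rho>1 u1 d2 \<rho>2 u2 x (P *\<^sub>v x)"
    using linked_matrix[OF t I1 I2] by blast
  obtain Q where Q: "Q \<in> carrier_mat d1 d2" "\<And>x. x \<in> carrier_vec d2 \<Longrightarrow> linked t d2 \<rho>2 u2 d1 \<rho>1 u1 x (Q *\<^sub>v x)"
    using linked_matrix[OF t I2 I1] by blast
  note rep = tirrepD(1)[OF I1] tirrepD(1)[OF I2]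
  have PQ: "P * Q = 1\<^sub>m d2"
  proof (rule mat_eq_by_vec)
    fix x :: "'k vec" assume x: "x \<in> carrier_vec d2"
    have Qx: "Q *\<^sub>v x \<in> carrier_vec d1" using Q x by simp
    have "P *\<^sub>v (Q *\<^sub>v x) = x" using linked_fun[OF t I1 I2 P(2)[OF Qx]] Q(2)[OF x] linked_sym by blast
    then show "P * Q *\<^sub>v x = 1\<^sub>m d2 *\<^sub>v x" using assoc_mult_mat_vec[OF P(1) Q(1) x] x by simp
  qed (use P Q in auto)
  have QP: "Q * P = 1\<^sub>m d1"
  proof (rule mat_eq_by_vec)
    fix x :: "'k vec" assume x: "x \<in> carrier_vec d1"
    have Px: "P *\<^sub>v x \<in> carrier_vec d2" using P x by simp
    have "Q *\<^sub>v (P *\<^sub>v x) = x" using linked_fun[OF t I2 I1 Q(2)[OF Px]] P(2)[OF x] linked_sym by blast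
    then show "Q * P *\<^sub>v x = 1\<^sub>m d1 *\<^sub>v x" using assoc_mult_mat_vec[OF Q(1) P(1) x] x by simp
  qed (use P Q in auto)
  have d: "d1 = d2" using right_inverse_dim_le[OF P(1) Q(1) PQ] right_inverse_dim_le[OF Q(1) P(1) QP] by simp
  have "P * \<rho>1 D = \<rho>2 D * P" if D: "D \<in> TL" for D
  proof (rule mat_eq_by_vec)
    note c = rep_car[OF rep(1) D] rep_car[OF rep(2) D]
    show "P * \<rho>1 D \<in> carrier_mat d2 d1" "\<rho>2 D * P \<in> carrier_mat d2 d1" using P c by auto
    fix x :: "'k vec" assume x: "x \<in> carrier_vec d1"
    have "P *\<^sub>v (\<rho>1 D *\<^sub>v x) = \<rho>2 D *\<^sub>v (P *\<^sub>v x)"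
      by (rule linked_fun[OF t I1 I2 P(2)[OF rep_vec[OF rep(1) D x]] linked_act[OF t I1 I2 P(2)[OF x] D]])
    then show "P * \<rho>1 D *\<^sub>v x = \<rho>2 D * P *\<^sub>v x"
      using assoc_mult_mat_vec[OF P(1) c(1) x] assoc_mult_mat_vec[OF c(2) P(1) x] by simp
  qed
  moreover have "invertible_mat P"
    using P Q PQ QP d by (auto simp: invertible_mat_def inverts_mat_def square_mat.simps)
  ultimately show ?thesis using P(1) d by (auto simp: rep_iso_def)
qed

section \<open>The cell module\<close>

lemma not_closed_mid_id: "\<not> closed_mid id_diagram B u"
proof
  assume c: "closed_mid id_diagram B u"
  then have "actA id_diagram u = (fst u, 2)" by (simp add: closed_mid_def actA_def liftA_def)
  then have "(u, (fst u, 2)) \<in> stack_conn id_diagram B" using conn_actA[of u id_diagram B] by simp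
  then show False using c unfolding closed_mid_def outer_node_def by (metis snd_conv)
qed

lemma num_loops_id: "num_loops n id_diagram B = 0"
  using not_closed_mid_id by (simp add: num_loops_conv num_comps_def mid_nodes_def)

lemma is_rep_by_vec:
  assumes "\<And>D. D \<in> TL \<Longrightarrow> \<sigma> D \<in> carrier_mat d d"
    and "\<And>z. z \<in> carrier_vec d \<Longrightarrow> \<sigma> id_diagram *\<^sub>v z = z"
    and "\<And>A B z. A \<in> TL \<Longrightarrow> B \<in> TL \<Longrightarrow> z \<in> carrier_vec d \<Longrightarrow> \<sigma> A *\<^sub>v (\<sigma> B *\<^sub>v z) = lp A B \<cdot>\<^sub>v (\<sigma> (diag_comp n A B) *\<^sub>v z)"
  shows "is_rep n v d \<sigma>"
  unfolding is_rep_def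
proof (intro conjI ballI)
  show "\<sigma> id_diagram = 1\<^sub>m d"
    by (rule mat_eq_by_vec[OF assms(1)]) (use assms(2) TL_diagrams.TL_id in auto)
  fix A B assume AB: "A \<in> TL" "B \<in> TL"
  show "\<sigma> A * \<sigma> B = lp A B \<cdot>\<^sub>m \<sigma> (diag_comp n A B)"
  proof (rule mat_eq_by_vec)
    note c = assms(1)[OF AB(1)] assms(1)[OF AB(2)] assms(1)[OF TL_comp[OF AB]]
    show "\<sigma> A * \<sigma> B \<in> carrier_mat d d" "lp A B \<cdot>\<^sub>m \<sigma> (diag_comp n A B) \<in> carrier_mat d d" using c by auto
    fix z :: "'k vec" assume z: "z \<in> carrier_vec d"
    show "\<sigma> A * \<sigma> B *\<^sub>v z = lp A B \<cdot>\<^sub>m \<sigma> (diag_comp n A B) *\<^sub>v z"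
      using assoc_mult_mat_vec[OF c(1,2) z] assms(3)[OF AB z] smult_mat_vec[OF c(3) z] by simp
  qed
qed (use assms(1) in auto)

text \<open>Collects what must survive the passage to a subrepresentation or a quotient.
  Nonvanishing on \<open>idem t\<close> is the part that only one of the two need inherit.\<close>

definition cellular :: "nat \<Rightarrow> 'k \<Rightarrow> nat \<Rightarrow> (diagram \<Rightarrow> 'k mat) \<Rightarrow> bool" where
  "cellular t \<alpha> d \<rho> \<longleftrightarrow> is_rep n v d \<rho> \<and> (\<forall>D\<in>TL. nv D < t \<longrightarrow> \<rho> D = 0\<^sub>m d d) \<and> \<rho> (idem t) \<noteq> 0\<^sub>m d d \<and>
     (\<forall>D\<in>TL. nv D = t \<longrightarrow> \<rho> (rot 2 D) = \<alpha> \<cdot>\<^sub>m \<rho> D)"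

context
  fixes t :: nat and \<alpha> :: 'k
  assumes t: "odd t" "t \<le> n - 2" and \<alpha>: "\<alpha> \<noteq> 0"
begin

text \<open>An infinite set, since each top half occurs with infinitely many offsets. The module
  takes one \<open>base\<close> diagram per top half and lets a rotation by two act as
  multiplication by \<open>\<alpha>\<close>.\<close>

definition cell :: "diagram set" where
  "cell = {D \<in> TL. nv D = t \<and> half False D = cups t}"

lemma cell_iff: "D \<in> cell \<longleftrightarrow> D \<in> TL \<and> nv D = t \<and> half False D = cups t"
  unfolding cell_def by simp

lemma cell_TL: "D \<in> cell \<Longrightarrow> D \<in> TL" and cell_nv: "D \<in> cell \<Longrightarrow> nv D = t"
  by (auto simp: cell_iff)

text \<open>A half is determined by its involution of {1..n}, and there are finitely many of these;
  so the module has finite dimension.\<close>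

lemma finite_halves: "finite (half True ` cell)"
proof -
  let ?F = "{f :: nat \<Rightarrow> nat. f ` {1..n} \<subseteq> {1..n} \<and> (\<forall>i. i \<notin> {1..n} \<longrightarrow> f i = i)}"
  have "finite ((\<lambda>f i. if i \<in> {1..n} then f i else i) ` ({1..n} \<rightarrow>\<^sub>E {1..n}))"
    by (intro finite_imageI finite_PiE) auto
  moreover have "?F \<subseteq> (\<lambda>f i. if i \<in> {1..n} then f i else i) ` ({1..n} \<rightarrow>\<^sub>E {1..n})"
  proof
    fix f assume f: "f \<in> ?F"
    show "f \<in> (\<lambda>f i. if i \<in> {1..n} then f i else i) ` ({1..n} \<rightarrow>\<^sub>E {1..n})"
      by (rule image_eqI[of _ _ "restrict f {1..n}"]) (use f in \<open>auto simp: fun_eq_iff\<close>)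
  qed
  ultimately have "finite ?F" using finite_subset by blast
  moreover have "half True ` cell \<subseteq> half_of ` ?F"
  proof
    fix h assume "h \<in> half True ` cell"
    then obtain D where D: "D \<in> TL" "h = half True D" using cell_TL by blast
    then have ok: "half_ok h" using half_ok_half TL_PD[OF D(1)] by (auto simp: PD_def)
    have F: "inv_of h \<in> ?F" using is_involution_S[OF ok] unfolding is_involution_def mem_Collect_eq
      by (metis atLeastAtMost_iff image_subsetI not_le)
    show "h \<in> half_of ` ?F" using imageI[OF F, of half_of] unfolding half_of_S[OF ok] .
  qed
  ultimately show ?thesis using finite_subset by blast
qed

definition hs :: "(int \<Rightarrow> int) list" where
  "hs = (SOME l. set l = half True ` cell \<and> distinct l)"

definition base :: "nat \<Rightarrow> diagram" where
  "base i = (SOME D. D \<in> cell \<and> half True D = hs ! i)"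

lemma hs: "set hs = half True ` cell" "distinct hs"
  using someI_ex[OF finite_distinct_list[OF finite_halves]] unfolding hs_def by auto

lemma base: "i < length hs \<Longrightarrow> base i \<in> cell \<and> half True (base i) = hs ! i"
proof -
  assume "i < length hs"
  then have "hs ! i \<in> half True ` cell" using hs(1) nth_mem by blast
  then have "\<exists>D. D \<in> cell \<and> half True D = hs ! i" by (metis imageE)
  then show ?thesis unfolding base_def by (rule someI_ex)
qed

lemma base_ex: "D \<in> cell \<Longrightarrow> \<exists>i<length hs. hs ! i = half True D \<and> D = rot (2 * ((woff D - woff (base i)) div 2)) (base i)"
proof -
  assume D: "D \<in> cell"
  then obtain i where i: "i < length hs" "hs ! i = half True D" using hs(1) by (metis imageI in_set_conv_nth)
  have b: "base i \<in> cell" "half True (base i) = half True D" using base[OF i(1)] i(2) by auto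
  have "half False (base i) = half False D" using b D by (simp add: cell_iff)
  then obtain m where m: "D = rot (2 * m) (base i)"
    using TL_same_halves[OF cell_TL[OF b(1)] cell_TL[OF D] b(2)] by blast
  then have "woff D = woff (base i) + 2 * m" using rot_simps(2)[OF TL_PD[OF cell_TL[OF b(1)]]] by simp
  then show ?thesis using i m by auto
qed

lemma cell_comp:
  assumes X: "X \<in> TL" and D: "D \<in> cell" and nv: "\<not> nv (diag_comp n X D) < t"
  shows "diag_comp n X D \<in> cell"
proof -
  have "nv (diag_comp n X D) \<le> nv D" using num_vertical_comp(2) TL_good X cell_TL[OF D] by blast
  then have "nv (diag_comp n X D) = nv D" using nv cell_nv[OF D] by simp
  then show ?thesis using half_comp_eq(2)[OF X cell_TL[OF D]] D TL_comp[OF X cell_TL[OF D]] by (simp add: cell_iff)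
qed

text \<open>The coordinate of D at the i-th basis diagram. On \<open>cell\<close> the division by 2
  is exact, because offsets with equal halves differ by an even number. The value 0 for small
  diagrams expresses the passage to a quotient.\<close>

definition coef :: "diagram \<Rightarrow> nat \<Rightarrow> 'k" where
  "coef D i = (if nv D < t \<or> hs ! i \<noteq> half True D then 0 else \<alpha> powi ((woff D - woff (base i)) div 2))"

lemma coef_rot: "D \<in> PD \<Longrightarrow> coef (rot (2 * s) D) i = \<alpha> powi s * coef D i"
proof -
  assume D: "D \<in> PD"
  have "(woff D + 2 * s - woff (base i)) div 2 = s + (woff D - woff (base i)) div 2" by linarith
  then show ?thesis using \<alpha> by (simp add: coef_def rot_simps[OF D] power_int_add)
qed

definition cellrep :: "diagram \<Rightarrow> 'k mat" where
  "cellrep X = mat (length hs) (length hs) (\<lambda>(i, j). lp X (base j) * coef (diag_comp n X (base j)) i)"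

lemma cellrep_carrier: "cellrep X \<in> carrier_mat (length hs) (length hs)"
  and cellrep_index: "i < length hs \<Longrightarrow> j < length hs \<Longrightarrow> cellrep X $$ (i, j) = lp X (base j) * coef (diag_comp n X (base j)) i"
  unfolding cellrep_def by auto

lemma coef_base: "i < length hs \<Longrightarrow> j < length hs \<Longrightarrow> coef (base j) i = (if i = j then 1 else 0)"
  using base[of j] base[of i] cell_nv[of "base j"] nth_eq_iff_index_eq[OF hs(2), of i j] by (auto simp: coef_def)

lemma coef_small: "nv D < t \<Longrightarrow> coef D i = 0"
  by (simp add: coef_def)

lemma cellrep_rep: "is_rep n v (length hs) cellrep"
  unfolding is_rep_def
proof (intro conjI ballI cellrep_carrier)
  show "cellrep id_diagram = 1\<^sub>m (length hs)"
  proof (rule eq_matI)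
    fix i j assume "i < dim_row (1\<^sub>m (length hs) :: 'k mat)" "j < dim_col (1\<^sub>m (length hs) :: 'k mat)"
    then have ij: "i < length hs" "j < length hs" by auto
    have "diag_comp n id_diagram (base j) = base j" using comp_id_left TL_good cell_TL base[OF ij(2)] by blast
    then show "cellrep id_diagram $$ (i, j) = 1\<^sub>m (length hs) $$ (i, j)"
      using ij by (simp add: cellrep_index coef_base num_loops_id)
  qed (use cellrep_carrier[of id_diagram] in auto)
next
  fix A B assume A: "A \<in> TL" and B: "B \<in> TL"
  let ?N = "length hs" and ?AB = "diag_comp n A B"
  show "cellrep A * cellrep B = lp A B \<cdot>\<^sub>m cellrep ?AB"
  proof (rule eq_matI)
    fix i j assume "i < dim_row (lp A B \<cdot>\<^sub>m cellrep ?AB)" "j < dim_col (lp A B \<cdot>\<^sub>m cellrep ?AB)"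
    then have ij: "i < ?N" "j < ?N" using cellrep_carrier[of ?AB] by auto
    let ?b = "base j"
    let ?E = "diag_comp n B ?b"
    have b: "?b \<in> cell" "?b \<in> TL" using base[OF ij(2)] cell_TL by auto
    note g = TL_good[OF A] TL_good[OF B] TL_good[OF b(2)]
    have E: "?E \<in> TL" using TL_comp B b by blast
    have assoc: "diag_comp n ?AB ?b = diag_comp n A ?E" by (rule diag_comp_assoc[OF n_pos g])
    have "num_loops n A B + num_loops n ?AB ?b = num_loops n B ?b + num_loops n A ?E"
      unfolding num_loops_conv by (rule num_comps_cocycle[OF n_pos g])
    then have lps: "lp A B * lp ?AB ?b = lp B ?b * lp A ?E" by (simp flip: power_add)
    have "(cellrep A * cellrep B) $$ (i, j) = (\<Sum>k = 0..<?N. cellrep A $$ (i, k) * cellrep B $$ (k, j))"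
      using ij cellrep_carrier[of A] cellrep_carrier[of B] by (auto simp: scalar_prod_def)
    also have "\<dots> = lp B ?b * (\<Sum>k = 0..<?N. lp A (base k) * coef (diag_comp n A (base k)) i * coef ?E k)"
      using ij by (simp add: cellrep_index sum_distrib_left mult_ac)
    also have "(\<Sum>k = 0..<?N. lp A (base k) * coef (diag_comp n A (base k)) i * coef ?E k) =
        lp A ?E * coef (diag_comp n A ?E) i"
    proof (cases "nv ?E < t")
      case True
      moreover have "nv (diag_comp n A ?E) \<le> nv ?E" using num_vertical_comp(2)[OF g(1) TL_good[OF E]] .
      ultimately show ?thesis by (simp add: coef_small)
    next
      case False
      have Ec: "?E \<in> cell" by (rule cell_comp[OF B b(1) False])
      obtain l where l: "l < ?N" "hs ! l = half True ?E" "?E = rot (2 * ((woff ?E - woff (base l)) div 2)) (base l)"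
        using base_ex[OF Ec] by blast
      define s where "s = (woff ?E - woff (base l)) div 2"
      have Es: "?E = rot (2 * s) (base l)" using l(3) by (simp add: s_def)
      have bl: "base l \<in> cell" "base l \<in> TL" using base[OF l(1)] cell_TL by auto
      \<comment> \<open>The product has a single nonzero coordinate, at its own top half, so the sum
        over k collapses to one term with the factor \<open>\<alpha> powi s\<close>.\<close>
      have ck: "coef ?E k = (if k = l then \<alpha> powi s else 0)" if "k < ?N" for k
        unfolding Es coef_rot[OF TL_PD[OF bl(2)]] using coef_base[OF that l(1)] by simp
      have "(\<Sum>k = 0..<?N. lp A (base k) * coef (diag_comp n A (base k)) i * coef ?E k) =
          (\<Sum>k = 0..<?N. if k = l then lp A (base l) * coef (diag_comp n A (base l)) i * \<alpha> powi s else 0)"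
        by (rule sum.cong) (auto simp: ck)
      also have "\<dots> = lp A (base l) * coef (diag_comp n A (base l)) i * \<alpha> powi s" using l(1) by simp
      also have "\<dots> = lp A ?E * coef (diag_comp n A ?E) i"
      proof -
        have "lp A ?E = lp A (base l)" unfolding Es using num_loops_rot(1)[OF g(1) TL_PD[OF bl(2)]] by simp
        moreover have "coef (diag_comp n A ?E) i = \<alpha> powi s * coef (diag_comp n A (base l)) i"
        proof (cases "nv (diag_comp n A (base l)) < t")
          case True
          moreover have "nv (diag_comp n A ?E) = nv (diag_comp n A (base l))"
            unfolding Es by (rule num_vertical_comp_rot[OF g(1) TL_PD[OF bl(2)]])
          ultimately show ?thesis by (simp add: coef_small)
        next
          case nt: False
          have c: "diag_comp n A (base l) \<in> cell" by (rule cell_comp[OF A bl(1) nt])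
          have "diag_comp n A ?E = rot (2 * s) (diag_comp n A (base l))"
            using comp_rot_right[OF A bl(2), of "2 * s"] E cell_nv[OF c] cell_nv[OF bl(1)] Es by simp
          then show ?thesis using coef_rot[OF TL_PD[OF cell_TL[OF c]]] by simp
        qed
        ultimately show ?thesis by (simp add: mult_ac)
      qed
      finally show ?thesis .
    qed
    also have "lp B ?b * (lp A ?E * coef (diag_comp n A ?E) i) = lp A B * (lp ?AB ?b * coef (diag_comp n ?AB ?b) i)"
      unfolding assoc using lps by (metis mult.assoc)
    finally show "(cellrep A * cellrep B) $$ (i, j) = (lp A B \<cdot>\<^sub>m cellrep ?AB) $$ (i, j)"
      using ij cellrep_carrier[of ?AB] by (simp add: cellrep_index)
  qed (use cellrep_carrier[of A] cellrep_carrier[of B] cellrep_carrier[of ?AB] in auto)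
qed

lemma cellrep_cellular: "cellular t \<alpha> (length hs) cellrep"
  unfolding cellular_def
proof (intro conjI ballI impI cellrep_rep)
  fix D assume D: "D \<in> TL" "nv D < t"
  show "cellrep D = 0\<^sub>m (length hs) (length hs)"
  proof (rule eq_matI)
    fix i j assume "i < dim_row (0\<^sub>m (length hs) (length hs) :: 'k mat)" "j < dim_col (0\<^sub>m (length hs) (length hs) :: 'k mat)"
    then have ij: "i < length hs" "j < length hs" by auto
    have "nv (diag_comp n D (base j)) \<le> nv D"
      using num_vertical_comp(1) TL_good D base[OF ij(2)] cell_TL by blast
    then show "cellrep D $$ (i, j) = 0\<^sub>m (length hs) (length hs) $$ (i, j)"
      using ij D by (simp add: cellrep_index coef_small)
  qed (use cellrep_carrier[of D] in auto)
next
  have e: "idem t \<in> cell" using idem_TL[OF t] num_vertical_idem[OF t] half_idem[OF t] by (simp add: cell_iff)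
  obtain j where j: "j < length hs" "idem t = rot (2 * ((woff (idem t) - woff (base j)) div 2)) (base j)"
    using base_ex[OF e] by blast
  define m where "m = (woff (idem t) - woff (base j)) div 2"
  have b: "base j \<in> cell" "base j \<in> TL" using base[OF j(1)] cell_TL by auto
  have em: "idem t = rot (2 * m) (base j)" using j(2) by (simp add: m_def)
  then have bm: "base j = rot (2 * (- m)) (idem t)" using rot_simps(3,4)[OF TL_PD[OF b(2)]] by simp
  have "diag_comp n (idem t) (base j) = base j"
    using R_R[OF t, of 0 "- m"] R_0[OF t] bm by simp
  then have "cellrep (idem t) $$ (j, j) \<noteq> 0"
    using j(1) lp_ne by (simp add: cellrep_index coef_base)
  then show "cellrep (idem t) \<noteq> 0\<^sub>m (length hs) (length hs)" using j(1) by auto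
next
  fix D assume D: "D \<in> TL" "nv D = t"
  have rD: "rot 2 D \<in> TL" by (rule rot_TL[OF D(1)]) (use D t_less[OF t] in auto)
  show "cellrep (rot 2 D) = \<alpha> \<cdot>\<^sub>m cellrep D"
  proof (rule eq_matI)
    fix i j assume "i < dim_row (\<alpha> \<cdot>\<^sub>m cellrep D)" "j < dim_col (\<alpha> \<cdot>\<^sub>m cellrep D)"
    then have ij: "i < length hs" "j < length hs" using cellrep_carrier[of D] by auto
    have b: "base j \<in> cell" "base j \<in> TL" using base[OF ij(2)] cell_TL by auto
    have "lp (rot 2 D) (base j) = lp D (base j)" using num_loops_rot(2)[OF TL_good[OF b(2)] TL_PD[OF D(1)]] by simp
    moreover have "coef (diag_comp n (rot 2 D) (base j)) i = \<alpha> * coef (diag_comp n D (base j)) i"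
    proof (cases "nv (diag_comp n D (base j)) < t")
      case True
      moreover have "nv (diag_comp n (rot 2 D) (base j)) = nv (diag_comp n D (base j))"
        by (rule num_vertical_rot_comp[OF TL_good[OF b(2)] TL_PD[OF D(1)]])
      ultimately show ?thesis by (simp add: coef_small)
    next
      case False
      then have c: "diag_comp n D (base j) \<in> cell" by (rule cell_comp[OF D(1) b(1)])
      have "diag_comp n (rot 2 D) (base j) = rot (2 * 1) (diag_comp n D (base j))"
        using comp_rot_left[OF b(2) D(1) rD] cell_nv[OF c] D(2) by simp
      then show ?thesis using coef_rot[OF TL_PD[OF cell_TL[OF c]], of 1] by simp
    qed
    ultimately show "cellrep (rot 2 D) $$ (i, j) = (\<alpha> \<cdot>\<^sub>m cellrep D) $$ (i, j)"
      using ij cellrep_carrier[of D] by (simp add: cellrep_index)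
  qed (use cellrep_carrier[of D] cellrep_carrier[of "rot 2 D"] in auto)
qed

end

section \<open>Cellular representations of minimal dimension are irreducible\<close>

text \<open>Subrepresentation and quotient both have smaller dimension and inherit everything except
  possibly the nonvanishing of \<open>idem t\<close>, which passes to at least one of them.\<close>

lemma cellular_split:
  assumes t: "odd t" "t \<le> n - 2" and c: "cellular t \<alpha> d \<rho>"
    and W: "is_subspace d W" and inv: "\<forall>D\<in>TL. \<forall>x\<in>W. \<rho> D *\<^sub>v x \<in> W" and ne: "W \<noteq> {0\<^sub>v d}" "W \<noteq> carrier_vec d"
  shows "\<exists>d'<d. \<exists>\<sigma>. cellular t \<alpha> d' \<sigma>"
proof -
  have rep: "is_rep n v d \<rho>" and kill: "\<And>D. D \<in> TL \<Longrightarrow> nv D < t \<Longrightarrow> \<rho> D = 0\<^sub>m d d"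
    and e0: "\<rho> (idem t) \<noteq> 0\<^sub>m d d" and rt: "\<And>D. D \<in> TL \<Longrightarrow> nv D = t \<Longrightarrow> \<rho> (rot 2 D) = \<alpha> \<cdot>\<^sub>m \<rho> D"
    using c by (auto simp: cellular_def)
  note car = rep_car[OF rep] and vec = rep_vec[OF rep] and act = rep_act[OF rep]
  note e_TL = idem_TL[OF t]
  obtain r P Q P' Q' where r: "r \<le> d" and P: "P \<in> carrier_mat d r" and Q: "Q \<in> carrier_mat r d"
    and P': "P' \<in> carrier_mat d (d - r)" and Q': "Q' \<in> carrier_mat (d - r) d"
    and m: "Q * P = 1\<^sub>m r" "Q' * P' = 1\<^sub>m (d - r)" "Q' * P = 0\<^sub>m (d - r) r" "P * Q + P' * Q' = 1\<^sub>m d"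
    and Weq: "W = {P *\<^sub>v z | z. z \<in> carrier_vec r}"
    using subspace_split[OF W] by blast
  have QP: "Q *\<^sub>v (P *\<^sub>v z) = z" if "z \<in> carrier_vec r" for z
    using assoc_mult_mat_vec[OF Q P that] m(1) that by simp
  have QP': "Q' *\<^sub>v (P' *\<^sub>v z) = z" if "z \<in> carrier_vec (d - r)" for z
    using assoc_mult_mat_vec[OF Q' P' that] m(2) that by simp
  have QP0: "Q' *\<^sub>v (P *\<^sub>v z) = 0\<^sub>v (d - r)" if "z \<in> carrier_vec r" for z
    using assoc_mult_mat_vec[OF Q' P that] m(3) zero_mat_vec[OF that] by simp
  have split: "P *\<^sub>v (Q *\<^sub>v x) + P' *\<^sub>v (Q' *\<^sub>v x) = x" if x: "x \<in> carrier_vec d" for x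
  proof -
    have "(P * Q + P' * Q') *\<^sub>v x = P * Q *\<^sub>v x + P' * Q' *\<^sub>v x"
      using P Q P' Q' x by (intro add_mult_distrib_mat_vec) auto
    then show ?thesis using m(4) x assoc_mult_mat_vec[OF P Q x] assoc_mult_mat_vec[OF P' Q' x] by simp
  qed
  have PW: "\<exists>y\<in>carrier_vec r. \<rho> D *\<^sub>v (P *\<^sub>v z) = P *\<^sub>v y" if "D \<in> TL" "z \<in> carrier_vec r" for D z
  proof -
    have "P *\<^sub>v z \<in> W" using that Weq by blast
    then have "\<rho> D *\<^sub>v (P *\<^sub>v z) \<in> W" using inv that by blast
    then show ?thesis unfolding Weq by blast
  qed
  have Pc: "z \<in> carrier_vec r \<Longrightarrow> P *\<^sub>v z \<in> carrier_vec d" "z \<in> carrier_vec (d - r) \<Longrightarrow> P' *\<^sub>v z \<in> carrier_vec d"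
    "x \<in> carrier_vec d \<Longrightarrow> Q *\<^sub>v x \<in> carrier_vec r" "x \<in> carrier_vec d \<Longrightarrow> Q' *\<^sub>v x \<in> carrier_vec (d - r)" for z x
    using P Q P' Q' by auto
  have r0: "r \<noteq> 0"
  proof
    assume "r = 0"
    then have "P *\<^sub>v z = 0\<^sub>v d" if "z \<in> carrier_vec r" for z
      using P that by (intro eq_vecI) (auto simp: scalar_prod_def)
    then have "W \<subseteq> {0\<^sub>v d}" unfolding Weq by auto
    moreover have "0\<^sub>v d \<in> W" using W by (simp add: is_subspace_def)
    ultimately have "W = {0\<^sub>v d}" by (intro subset_antisym) auto
    then show False using ne by simp
  qed
  have rd: "r \<noteq> d"
  proof
    assume rd: "r = d"
    have PQ: "P * Q = 1\<^sub>m d" by (rule mat_mult_left_right_inverse[of Q]) (use P Q m(1) rd in auto)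
    have "x \<in> W" if x: "x \<in> carrier_vec d" for x
    proof -
      have "P *\<^sub>v (Q *\<^sub>v x) = x" using assoc_mult_mat_vec[OF P Q x] PQ x by simp
      then show ?thesis unfolding Weq using Pc(3)[OF x] by (metis (mono_tags, lifting) mem_Collect_eq)
    qed
    then have "W = carrier_vec d" using W by (auto simp: is_subspace_def)
    then show False using ne by simp
  qed
  define \<sigma> where "\<sigma> D = Q * (\<rho> D * P)" for D
  define \<sigma>' where "\<sigma>' D = Q' * (\<rho> D * P')" for D
  have sc: "\<sigma> D \<in> carrier_mat r r" "\<sigma>' D \<in> carrier_mat (d - r) (d - r)" if "D \<in> TL" for D
    using car[OF that] P Q P' Q' by (auto simp: \<sigma>_def \<sigma>'_def)
  have sv: "\<sigma> D *\<^sub>v z = Q *\<^sub>v (\<rho> D *\<^sub>v (P *\<^sub>v z))" if "D \<in> TL" "z \<in> carrier_vec r" for D z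
    unfolding \<sigma>_def using assoc_mult_mat_vec[OF Q _ that(2), of "\<rho> D * P"] assoc_mult_mat_vec[OF car[OF that(1)] P that(2)] car[OF that(1)] P by simp
  have sv': "\<sigma>' D *\<^sub>v z = Q' *\<^sub>v (\<rho> D *\<^sub>v (P' *\<^sub>v z))" if "D \<in> TL" "z \<in> carrier_vec (d - r)" for D z
    unfolding \<sigma>'_def using assoc_mult_mat_vec[OF Q' _ that(2), of "\<rho> D * P'"] assoc_mult_mat_vec[OF car[OF that(1)] P' that(2)] car[OF that(1)] P' by simp
  have rep1: "is_rep n v r \<sigma>"
  proof (rule is_rep_by_vec)
    fix z :: "'k vec" assume z: "z \<in> carrier_vec r"
    show "\<sigma> id_diagram *\<^sub>v z = z" using sv[OF TL_diagrams.TL_id z] rep_id[OF rep Pc(1)[OF z]] QP[OF z] by simp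
    fix A B assume A: "A \<in> TL" and B: "B \<in> TL"
    obtain y where y: "y \<in> carrier_vec r" "\<rho> B *\<^sub>v (P *\<^sub>v z) = P *\<^sub>v y" using PW[OF B z] by blast
    have "\<sigma> B *\<^sub>v z = y" using sv[OF B z] y QP by simp
    then have "\<sigma> A *\<^sub>v (\<sigma> B *\<^sub>v z) = Q *\<^sub>v (\<rho> A *\<^sub>v (\<rho> B *\<^sub>v (P *\<^sub>v z)))" using sv[OF A y(1)] y by simp
    also have "\<dots> = lp A B \<cdot>\<^sub>v (\<sigma> (diag_comp n A B) *\<^sub>v z)"
      using act[OF A B Pc(1)[OF z]] mult_mat_vec[OF Q vec[OF TL_comp[OF A B] Pc(1)[OF z]]] sv[OF TL_comp[OF A B] z] by simp
    finally show "\<sigma> A *\<^sub>v (\<sigma> B *\<^sub>v z) = lp A B \<cdot>\<^sub>v (\<sigma> (diag_comp n A B) *\<^sub>v z)" .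
  qed (rule sc(1))
  have rep2: "is_rep n v (d - r) \<sigma>'"
  proof (rule is_rep_by_vec)
    fix z :: "'k vec" assume z: "z \<in> carrier_vec (d - r)"
    show "\<sigma>' id_diagram *\<^sub>v z = z" using sv'[OF TL_diagrams.TL_id z] rep_id[OF rep Pc(2)[OF z]] QP'[OF z] by simp
    fix A B assume A: "A \<in> TL" and B: "B \<in> TL"
    define x where "x = \<rho> B *\<^sub>v (P' *\<^sub>v z)"
    have x: "x \<in> carrier_vec d" using vec[OF B Pc(2)[OF z]] by (simp add: x_def)
    obtain y where y: "y \<in> carrier_vec r" "\<rho> A *\<^sub>v (P *\<^sub>v (Q *\<^sub>v x)) = P *\<^sub>v y" using PW[OF A Pc(3)[OF x]] by blast
    let ?w = "\<rho> A *\<^sub>v (P' *\<^sub>v (Q' *\<^sub>v x))"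
    have w: "?w \<in> carrier_vec d" using vec[OF A Pc(2)[OF Pc(4)[OF x]]] .
    have "\<rho> A *\<^sub>v x = \<rho> A *\<^sub>v (P *\<^sub>v (Q *\<^sub>v x) + P' *\<^sub>v (Q' *\<^sub>v x))" using split[OF x] by simp
    also have "\<dots> = P *\<^sub>v y + ?w" using rep_add[OF rep A Pc(1)[OF Pc(3)[OF x]] Pc(2)[OF Pc(4)[OF x]]] y by simp
    finally have "Q' *\<^sub>v (\<rho> A *\<^sub>v x) = Q' *\<^sub>v (P *\<^sub>v y) + Q' *\<^sub>v ?w"
      using mult_add_distrib_mat_vec[OF Q' Pc(1)[OF y(1)] w] by simp
    also have "\<dots> = Q' *\<^sub>v ?w" using QP0[OF y(1)] Pc(4)[OF w] by simp
    finally have "\<sigma>' A *\<^sub>v (\<sigma>' B *\<^sub>v z) = Q' *\<^sub>v (\<rho> A *\<^sub>v x)"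
      using sv'[OF B z] sv'[OF A Pc(4)[OF x]] by (simp add: x_def)
    also have "\<dots> = lp A B \<cdot>\<^sub>v (\<sigma>' (diag_comp n A B) *\<^sub>v z)"
      using act[OF A B Pc(2)[OF z]] mult_mat_vec[OF Q' vec[OF TL_comp[OF A B] Pc(2)[OF z]]] sv'[OF TL_comp[OF A B] z]
      by (simp add: x_def)
    finally show "\<sigma>' A *\<^sub>v (\<sigma>' B *\<^sub>v z) = lp A B \<cdot>\<^sub>v (\<sigma>' (diag_comp n A B) *\<^sub>v z)" .
  qed (rule sc(2))
  have kill1: "\<sigma> D = 0\<^sub>m r r" "\<sigma>' D = 0\<^sub>m (d - r) (d - r)" if "D \<in> TL" "nv D < t" for D
    using kill[OF that] P Q P' Q' by (auto simp: \<sigma>_def \<sigma>'_def)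
  have rot1: "\<sigma> (rot 2 D) = \<alpha> \<cdot>\<^sub>m \<sigma> D" "\<sigma>' (rot 2 D) = \<alpha> \<cdot>\<^sub>m \<sigma>' D" if D: "D \<in> TL" "nv D = t" for D
  proof -
    note cD = car[OF D(1)]
    have "(\<alpha> \<cdot>\<^sub>m \<rho> D) * P = \<alpha> \<cdot>\<^sub>m (\<rho> D * P)" "(\<alpha> \<cdot>\<^sub>m \<rho> D) * P' = \<alpha> \<cdot>\<^sub>m (\<rho> D * P')"
      using mult_smult_assoc_mat[OF cD P] mult_smult_assoc_mat[OF cD P'] by auto
    moreover have "Q * (\<alpha> \<cdot>\<^sub>m (\<rho> D * P)) = \<alpha> \<cdot>\<^sub>m (Q * (\<rho> D * P))" "Q' * (\<alpha> \<cdot>\<^sub>m (\<rho> D * P')) = \<alpha> \<cdot>\<^sub>m (Q' * (\<rho> D * P'))"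
      using mult_smult_distrib[OF Q, of "\<rho> D * P" r] mult_smult_distrib[OF Q', of "\<rho> D * P'" "d - r"] cD P P' by auto
    ultimately show "\<sigma> (rot 2 D) = \<alpha> \<cdot>\<^sub>m \<sigma> D" "\<sigma>' (rot 2 D) = \<alpha> \<cdot>\<^sub>m \<sigma>' D"
      using rt[OF D] by (auto simp: \<sigma>_def \<sigma>'_def)
  qed
  \<comment> \<open>If e vanished on W and on the quotient, it would square to zero. But e e is e
    with a nonzero loop factor, so e itself would vanish.\<close>
  have "\<sigma> (idem t) \<noteq> 0\<^sub>m r r \<or> \<sigma>' (idem t) \<noteq> 0\<^sub>m (d - r) (d - r)"
  proof (rule ccontr)
    assume "\<not> ?thesis"
    then have z: "\<sigma> (idem t) = 0\<^sub>m r r" "\<sigma>' (idem t) = 0\<^sub>m (d - r) (d - r)" by auto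
    let ?e = "\<rho> (idem t)"
    have e1: "?e *\<^sub>v (P *\<^sub>v w) = 0\<^sub>v d" if w: "w \<in> carrier_vec r" for w
    proof -
      obtain y where y: "y \<in> carrier_vec r" "?e *\<^sub>v (P *\<^sub>v w) = P *\<^sub>v y" using PW[OF e_TL w] by blast
      have "y = \<sigma> (idem t) *\<^sub>v w" using sv[OF e_TL w] y QP by simp
      then have "y = 0\<^sub>v r" using z zero_mat_vec[OF w] by simp
      then show ?thesis using y mult_zero_vec_mat[OF P] by simp
    qed
    have e2: "?e *\<^sub>v (?e *\<^sub>v (P' *\<^sub>v w)) = 0\<^sub>v d" if w: "w \<in> carrier_vec (d - r)" for w
    proof -
      define y where "y = ?e *\<^sub>v (P' *\<^sub>v w)"
      have y: "y \<in> carrier_vec d" using vec[OF e_TL Pc(2)[OF w]] by (simp add: y_def)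
      have "Q' *\<^sub>v y = 0\<^sub>v (d - r)" using sv'[OF e_TL w] z zero_mat_vec[OF w] by (simp add: y_def)
      then have "y = P *\<^sub>v (Q *\<^sub>v y) + 0\<^sub>v d" using split[OF y] mult_zero_vec_mat[OF P'] by simp
      also have "\<dots> = P *\<^sub>v (Q *\<^sub>v y)" using Pc(1)[OF Pc(3)[OF y]] by simp
      finally show ?thesis using e1[OF Pc(3)[OF y]] by (simp add: y_def)
    qed
    have "?e *\<^sub>v x = 0\<^sub>v d" if x: "x \<in> carrier_vec d" for x
    proof -
      note a = Pc(1)[OF Pc(3)[OF x]] and b = Pc(2)[OF Pc(4)[OF x]]
      have "?e *\<^sub>v x = ?e *\<^sub>v (P *\<^sub>v (Q *\<^sub>v x) + P' *\<^sub>v (Q' *\<^sub>v x))" using split[OF x] by simp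
      also have "\<dots> = ?e *\<^sub>v (P *\<^sub>v (Q *\<^sub>v x)) + ?e *\<^sub>v (P' *\<^sub>v (Q' *\<^sub>v x))" by (rule rep_add[OF rep e_TL a b])
      also have "\<dots> = ?e *\<^sub>v (P' *\<^sub>v (Q' *\<^sub>v x))" using e1[OF Pc(3)[OF x]] vec[OF e_TL b] by simp
      finally have "?e *\<^sub>v (?e *\<^sub>v x) = 0\<^sub>v d" using e2[OF Pc(4)[OF x]] by simp
      then have "lp (idem t) (idem t) \<cdot>\<^sub>v (?e *\<^sub>v x) = lp (idem t) (idem t) \<cdot>\<^sub>v 0\<^sub>v d"
        using act[OF e_TL e_TL x] e_e[OF t] by simp
      then show ?thesis using smult_vec_cancel[OF lp_ne] by blast
    qed
    then have "?e = 0\<^sub>m d d" using mat_eq_by_vec[OF car[OF e_TL] zero_carrier_mat[of d d]] zero_mat_vec by metis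
    then show False using e0 by simp
  qed
  then have "cellular t \<alpha> r \<sigma> \<or> cellular t \<alpha> (d - r) \<sigma>'"
    using rep1 rep2 kill1 rot1 by (auto simp: cellular_def)
  then show ?thesis using r r0 rd by (metis diff_less le_neq_implies_less neq0_conv order_less_le_trans)
qed

lemma exists_cellular_irrep:
  assumes t: "odd t" "t \<le> n - 2" and \<alpha>: "\<alpha> \<noteq> 0"
  shows "\<exists>d \<rho>. cellular t \<alpha> d \<rho> \<and> is_irrep n v d \<rho>"
proof -
  define d where "d = (LEAST d. \<exists>\<rho>. cellular t \<alpha> d \<rho>)"
  have "\<exists>\<rho>. cellular t \<alpha> d \<rho>" unfolding d_def by (rule LeastI_ex) (use cellrep_cellular[OF t \<alpha>] in blast)
  then obtain \<rho> where c: "cellular t \<alpha> d \<rho>" by blast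
  have min: "\<not> cellular t \<alpha> d' \<sigma>" if "d' < d" for d' \<sigma>
    using not_less_Least[of d' "\<lambda>d. \<exists>\<rho>. cellular t \<alpha> d \<rho>"] that unfolding d_def by blast
  have rep: "is_rep n v d \<rho>" using c by (simp add: cellular_def)
  have "d > 0"
  proof (rule ccontr)
    assume "\<not> d > 0"
    then have "\<rho> (idem t) = 0\<^sub>m d d" using rep_car[OF rep idem_TL[OF t]] by (intro eq_matI) auto
    then show False using c by (simp add: cellular_def)
  qed
  then have "is_irrep n v d \<rho>"
    unfolding is_irrep_def using rep cellular_split[OF t c] min by blast
  then show ?thesis using c by blast
qed

end

context tl
begin

section \<open>The trivial representation\<close>

lemma nv_id: "nv id_diagram = n"
proof -
  have "{a \<in> {1..int n}. snd (fst id_diagram (a, True)) = False} = {1..int n}" by (auto simp: id_diagram_def)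
  then show ?thesis by (simp add: num_vertical_def)
qed

lemma nv_E: "1 \<le> i \<Longrightarrow> i \<le> n \<Longrightarrow> nv (E_diagram n i) < n"
proof -
  assume i: "1 \<le> i" "i \<le> n"
  have "snd (fst (E_diagram n i) (int i, True)) = True" by (simp add: E_diagram_def)
  then show ?thesis
    using num_vertical_less_iff[OF TL_good[OF TL_diagrams.TL_E[OF i]], of True] by blast
qed

text \<open>Products never gain vertical edges, so a product with a factor other than the identity
  stays below n.\<close>

lemma TL_id_or: "D \<in> TL \<Longrightarrow> D = id_diagram \<or> nv D < n"
proof (induction rule: TL_diagrams.induct)
  case (TL_E i)
  then show ?case using nv_E by blast
next
  case (TL_mult A B)
  note c = num_vertical_comp[OF TL_good[OF TL_mult(1)] TL_good[OF TL_mult(2)]]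
  show ?case
  proof (cases "A = id_diagram")
    case True
    then show ?thesis using comp_id_left[OF TL_good[OF TL_mult(2)]] TL_mult by simp
  next
    case False
    then show ?thesis using TL_mult c by auto
  qed
qed simp

lemma trivial_zero:
  assumes "is_trivial_rep n v 1 \<sigma>" "D \<in> TL"
  shows "D = id_diagram \<or> \<sigma> D = 0\<^sub>m 1 1"
  using assms(2)
proof (induction rule: TL_diagrams.induct)
  case (TL_E i)
  then show ?case using assms(1) by (auto simp: is_trivial_rep_def)
next
  case (TL_mult A B)
  have rep: "is_rep n v 1 \<sigma>" using assms(1) by (simp add: is_trivial_rep_def)
  note c = rep_car[OF rep]
  show ?case
  proof (cases "A = id_diagram")
    case True
    then show ?thesis using comp_id_left[OF TL_good[OF TL_mult(2)]] TL_mult by simp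
  next
    case False
    then have "\<sigma> A * \<sigma> B = 0\<^sub>m 1 1" using TL_mult c[OF TL_mult(2)] by simp
    then have "lp A B \<cdot>\<^sub>m \<sigma> (diag_comp n A B) = 0\<^sub>m 1 1" using rep TL_mult by (simp add: is_rep_def)
    then have z: "(lp A B \<cdot>\<^sub>m \<sigma> (diag_comp n A B)) $$ (i, j) = 0\<^sub>m 1 1 $$ (i, j)" for i j by simp
    have "\<sigma> (diag_comp n A B) = 0\<^sub>m 1 1"
    proof (rule eq_matI)
      fix i j assume "i < dim_row (0\<^sub>m 1 1 :: 'k mat)" "j < dim_col (0\<^sub>m 1 1 :: 'k mat)"
      then show "\<sigma> (diag_comp n A B) $$ (i, j) = 0\<^sub>m 1 1 $$ (i, j)"
        using z[of i j] c[OF TL_comp[OF TL_mult(1,2)]] q_ne by auto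
    qed (use c[OF TL_comp[OF TL_mult(1,2)]] in auto)
    then show ?thesis by simp
  qed
qed simp

lemma invertible_one: "invertible_mat (1\<^sub>m d :: 'k mat)"
  by (auto simp: invertible_mat_def inverts_mat_def square_mat.simps intro!: exI[of _ "1\<^sub>m d"])

lemma irrep_one:
  assumes rep: "is_rep n v 1 \<sigma>"
  shows "is_irrep n v 1 \<sigma>"
  unfolding is_irrep_def
proof (intro conjI rep allI impI)
  fix W :: "'k vec set"
  assume "is_subspace 1 W \<and> (\<forall>D\<in>TL. \<forall>x\<in>W. \<sigma> D *\<^sub>v x \<in> W)"
  then have W: "W \<subseteq> carrier_vec 1" "0\<^sub>v 1 \<in> W" "\<And>c x. x \<in> W \<Longrightarrow> c \<cdot>\<^sub>v x \<in> W" by (auto simp: is_subspace_def)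
  show "W = {0\<^sub>v 1} \<or> W = carrier_vec 1"
  proof (cases "W = {0\<^sub>v 1}")
    case False
    then obtain x where x: "x \<in> W" "x \<noteq> 0\<^sub>v 1" using W(2) by blast
    have xc: "x \<in> carrier_vec 1" using x W by blast
    have x0: "x $ 0 \<noteq> 0"
    proof
      assume "x $ 0 = 0"
      then have "x = 0\<^sub>v 1" using xc by (intro eq_vecI) auto
      then show False using x by simp
    qed
    have "y \<in> W" if y: "y \<in> carrier_vec 1" for y
    proof -
      have "y = (y $ 0 / x $ 0) \<cdot>\<^sub>v x" using y xc x0 by (intro eq_vecI) auto
      then show ?thesis using W(3)[OF x(1)] by metis
    qed
    then show ?thesis using W(1) by blast
  qed simp
qed simp

text \<open>Sending every diagram other than the identity to 0 is multiplicative, because a product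
  with a factor other than the identity has fewer than n vertical edges.\<close>

lemma exists_trivial: "\<exists>\<sigma>. is_trivial_rep n v 1 \<sigma>"
proof -
  define \<sigma> :: "diagram \<Rightarrow> 'k mat" where "\<sigma> D = (if D = id_diagram then 1\<^sub>m 1 else 0\<^sub>m 1 1)" for D
  have ne: "D \<noteq> id_diagram" if "nv D < n" for D using that nv_id by auto
  have "\<sigma> A * \<sigma> B = lp A B \<cdot>\<^sub>m \<sigma> (diag_comp n A B)" if AB: "A \<in> TL" "B \<in> TL" for A B
  proof (cases "A = id_diagram")
    case True
    then show ?thesis using comp_id_left[OF TL_good[OF AB(2)]] num_loops_id by (auto simp: \<sigma>_def intro!: eq_matI)
  next
    case False
    then have "nv (diag_comp n A B) < n"
      using TL_id_or[OF AB(1)] num_vertical_comp(1)[OF TL_good[OF AB(1)] TL_good[OF AB(2)]] by simp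
    then have "diag_comp n A B \<noteq> id_diagram" by (rule ne)
    then show ?thesis using False by (simp add: \<sigma>_def)
  qed
  then have "is_rep n v 1 \<sigma>" unfolding is_rep_def by (auto simp: \<sigma>_def)
  moreover have "\<sigma> (E_diagram n i) = 0\<^sub>m 1 1" if "i \<in> {1..n}" for i
    using ne nv_E that by (auto simp: \<sigma>_def)
  ultimately show ?thesis by (auto simp: is_trivial_rep_def)
qed

lemma trivial_iso:
  assumes "is_trivial_rep n v 1 \<rho>1" "is_trivial_rep n v 1 \<rho>2"
  shows "rep_iso n 1 \<rho>1 1 \<rho>2"
proof -
  have "1\<^sub>m 1 * \<rho>1 D = \<rho>2 D * 1\<^sub>m 1" if "D \<in> TL" for D
  proof -
    have "\<rho>1 D = \<rho>2 D" "\<rho>2 D \<in> carrier_mat 1 1"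
      using trivial_zero[OF assms(1) that] trivial_zero[OF assms(2) that] assms that
      by (auto simp: is_trivial_rep_def is_rep_def)
    then show ?thesis by (simp only: left_mult_one_mat right_mult_one_mat)
  qed
  then show ?thesis unfolding rep_iso_def by (intro conjI bexI[of _ "1\<^sub>m 1"] ballI invertible_one) auto
qed

section \<open>The invariants of an irreducible representation\<close>

lemma t_prop_unique: "t_prop n d \<rho> t \<Longrightarrow> t_prop n d \<rho> t' \<Longrightarrow> t = t'"
proof -
  have "\<not> s < s'" if "t_prop n d \<rho> s" "t_prop n d \<rho> s'" for s s' :: nat
    using that unfolding t_prop_def by (meson le_less_trans)
  then show "t_prop n d \<rho> t \<Longrightarrow> t_prop n d \<rho> t' \<Longrightarrow> t = t'" by (metis linorder_neqE_nat)
qed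

lemma rep_t_eq: "t_prop n d \<rho> t \<Longrightarrow> rep_t n d \<rho> = t"
  unfolding rep_t_def using t_prop_unique by blast

lemma t_propD:
  assumes "t_prop n d \<rho> t"
  shows "D \<in> TL \<Longrightarrow> nv D < t \<Longrightarrow> \<rho> D = 0\<^sub>m d d" "\<exists>D\<in>TL. nv D = t \<and> \<rho> D \<noteq> 0\<^sub>m d d"
proof -
  show *: "D \<in> TL \<Longrightarrow> nv D < t \<Longrightarrow> \<rho> D = 0\<^sub>m d d" for D using assms by (simp add: t_prop_def)
  obtain D where D: "D \<in> TL" "nv D \<le> t" "\<rho> D \<noteq> 0\<^sub>m d d" using assms by (auto simp: t_prop_def)
  then show "\<exists>D\<in>TL. nv D = t \<and> \<rho> D \<noteq> 0\<^sub>m d d" using *[OF D(1)] by (metis le_neq_implies_less)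
qed

lemma exists_t_prop:
  assumes rep: "is_rep n v d \<rho>" and d: "d > 0"
  shows "\<exists>t. t_prop n d \<rho> t"
proof -
  define t where "t = (LEAST t. \<exists>D\<in>TL. nv D = t \<and> \<rho> D \<noteq> 0\<^sub>m d d)"
  have "\<rho> id_diagram = 1\<^sub>m d" using rep by (simp add: is_rep_def)
  moreover have "(1\<^sub>m d :: 'k mat) \<noteq> 0\<^sub>m d d"
  proof
    assume "(1\<^sub>m d :: 'k mat) = 0\<^sub>m d d"
    then have "(1\<^sub>m d :: 'k mat) $$ (0, 0) = 0\<^sub>m d d $$ (0, 0)" by simp
    then show False using d by simp
  qed
  ultimately have "\<exists>t. \<exists>D\<in>TL. nv D = t \<and> \<rho> D \<noteq> 0\<^sub>m d d" using TL_diagrams.TL_id by auto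
  from LeastI_ex[OF this] have 1: "\<exists>D\<in>TL. nv D = t \<and> \<rho> D \<noteq> 0\<^sub>m d d" unfolding t_def .
  have "\<rho> D = 0\<^sub>m d d" if "D \<in> TL" "nv D < t" for D
    using not_less_Least[OF that(2)[unfolded t_def]] that(1) by blast
  then have "t_prop n d \<rho> t" unfolding t_prop_def using 1 by auto
  then show ?thesis ..
qed

text \<open>t is the number of vertical edges of some diagram, hence odd like n. If t = n, all
  diagrams except the identity act as zero, every line is invariant, and the representation is the
  trivial one.\<close>

lemma nontrivial_t_bound:
  assumes I: "is_nontrivial_irrep n v d \<rho>" and tp: "t_prop n d \<rho> t"
  shows "odd t" "t \<le> n - 2"
proof -
  have irr: "is_irrep n v d \<rho>" and rep: "is_rep n v d \<rho>" and d: "d > 0"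
    using I by (auto simp: is_nontrivial_irrep_def is_irrep_def)
  obtain D where D: "D \<in> TL" "nv D = t" "\<rho> D \<noteq> 0\<^sub>m d d" using t_propD(2)[OF tp] by blast
  show "odd t" using odd_num_vertical[OF TL_good[OF D(1)] odd_n] D by simp
  have "t \<noteq> n"
  proof
    assume tn: "t = n"
    have z: "\<rho> D = 0\<^sub>m d d" if "D \<in> TL" "D \<noteq> id_diagram" for D
      using t_propD(1)[OF tp that(1)] TL_id_or[OF that(1)] that tn by blast
    define u :: "'k vec" where "u = unit_vec d 0"
    have u: "u \<in> carrier_vec d" "u \<noteq> 0\<^sub>v d" using d by (auto simp: u_def)
    have "d = 1"
    proof (rule ccontr)
      assume d1: "d \<noteq> 1"
      have "\<exists>k. unit_vec d 1 = k \<cdot>\<^sub>v u"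
      proof (rule irrep_full[OF rep irr u, where Pr = "\<lambda>x. \<exists>k. x = k \<cdot>\<^sub>v u"])
        show "\<exists>k. u = k \<cdot>\<^sub>v u" by (rule exI[of _ 1]) simp
        show "\<exists>k. 0\<^sub>v d = k \<cdot>\<^sub>v u" using zero_smult_vec0[OF u(1)] by metis
      next
        fix x y assume "\<exists>k. x = k \<cdot>\<^sub>v u" "\<exists>k. y = k \<cdot>\<^sub>v u"
        then show "\<exists>k. x + y = k \<cdot>\<^sub>v u" by (metis add_smult_distrib_vec)
      next
        fix x c assume "\<exists>k. x = k \<cdot>\<^sub>v u"
        then show "\<exists>k. c \<cdot>\<^sub>v x = k \<cdot>\<^sub>v u" by (metis smult_smult_assoc)
      next
        fix x D assume x: "x \<in> carrier_vec d" "D \<in> TL" "\<exists>k. x = k \<cdot>\<^sub>v u"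
        show "\<exists>k. \<rho> D *\<^sub>v x = k \<cdot>\<^sub>v u"
        proof (cases "D = id_diagram")
          case True
          then show ?thesis using rep_id[OF rep x(1)] x(3) by simp
        next
          case False
          then show ?thesis using z[OF x(2)] zero_mat_vec[OF x(1)] zero_smult_vec0[OF u(1)] by metis
        qed
      qed simp
      then obtain k where "unit_vec d 1 = k \<cdot>\<^sub>v u" by blast
      then have "unit_vec d 1 $ 1 = (k \<cdot>\<^sub>v u) $ 1" by simp
      then show False using d d1 by (simp add: u_def)
    qed
    moreover have "\<rho> (E_diagram n i) = 0\<^sub>m d d" if i: "i \<in> {1..n}" for i
    proof (rule z)
      show "E_diagram n i \<in> TL" using i TL_diagrams.TL_E by auto
      show "E_diagram n i \<noteq> id_diagram" using nv_E[of i] nv_id i by auto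
    qed
    ultimately have "is_trivial_rep n v 1 \<rho>" using rep by (auto simp: is_trivial_rep_def)
    then show False
      using I trivial_iso \<open>d = 1\<close> unfolding is_nontrivial_irrep_def by blast
  qed
  moreover have "t \<le> n" using TL_id_or[OF D(1)] nv_id D by auto
  ultimately have "t < n" by simp
  then show "t \<le> n - 2" using \<open>odd t\<close> odd_n by presburger
qed

text \<open>A diagram D with t vertical edges factors as A B with A e = A. If e acts as zero, so
  does A, and then D.\<close>

lemma idem_nonzero:
  assumes t: "odd t" "t \<le> n - 2" and rep: "is_rep n v d \<rho>" and tp: "t_prop n d \<rho> t"
  shows "\<rho> (idem t) \<noteq> 0\<^sub>m d d"
proof
  assume 0: "\<rho> (idem t) = 0\<^sub>m d d"
  obtain D where D: "D \<in> TL" "nv D = t" "\<rho> D \<noteq> 0\<^sub>m d d" using t_propD(2)[OF tp] by blast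
  obtain A B where AB: "A \<in> TL" "B \<in> TL" "diag_comp n A B = D" "diag_comp n A (idem t) = A"
    using TL_factor[OF t D(1,2)] by blast
  note vec = rep_vec[OF rep]
  have "\<rho> D *\<^sub>v x = 0\<^sub>v d" if x: "x \<in> carrier_vec d" for x
  proof -
    let ?y = "\<rho> B *\<^sub>v x"
    have y: "?y \<in> carrier_vec d" using vec[OF AB(2) x] .
    have "lp A (idem t) \<cdot>\<^sub>v (\<rho> A *\<^sub>v ?y) = \<rho> A *\<^sub>v (\<rho> (idem t) *\<^sub>v ?y)"
      using rep_act[OF rep AB(1) idem_TL[OF t] y] AB(4) by simp
    also have "\<dots> = lp A (idem t) \<cdot>\<^sub>v 0\<^sub>v d" using 0 zero_mat_vec[OF y] rep_zero[OF rep AB(1)] by simp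
    finally have "\<rho> A *\<^sub>v ?y = 0\<^sub>v d" using smult_vec_cancel[OF lp_ne] by blast
    then have "lp A B \<cdot>\<^sub>v (\<rho> D *\<^sub>v x) = lp A B \<cdot>\<^sub>v 0\<^sub>v d" using rep_act[OF rep AB(1,2) x] AB(3) by simp
    then show ?thesis using smult_vec_cancel[OF lp_ne] by blast
  qed
  then have "\<rho> D = 0\<^sub>m d d"
    using mat_eq_by_vec[OF rep_car[OF rep D(1)] zero_carrier_mat[of d d]] zero_mat_vec by metis
  then show False using D by simp
qed

lemma alpha_propI:
  assumes t: "odd t" and \<alpha>: "\<alpha> \<noteq> 0" and rot: "\<And>D. D \<in> TL \<Longrightarrow> nv D = t \<Longrightarrow> \<rho> (rot 2 D) = \<alpha> \<cdot>\<^sub>m \<rho> D"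
  shows "alpha_prop n \<rho> t \<alpha>"
  unfolding alpha_prop_def
proof (intro conjI \<alpha> allI impI)
  fix S1 S2 w
  assume "annular n S1 \<and> in_I n t S1 \<and> annular n S2 \<and> in_I n t S2 \<and>
    bracket n S1 S2 w \<in> TL \<and> bracket n S1 S2 (w + 2) \<in> TL"
  then have S: "annular n S1" "in_I n t S1" "annular n S2" "in_I n t S2" and b: "bracket n S1 S2 w \<in> TL" by auto
  have t0: "t > 0" using t by (simp add: odd_pos)
  show "\<rho> (bracket n S1 S2 (w + 2)) = \<alpha> \<cdot>\<^sub>m \<rho> (bracket n S1 S2 w)"
    unfolding bracket_rot[OF S t0] by (rule rot[OF b bracket_mk(3)[OF S t0]])
qed

text \<open>Both scalars are tested on \<open>idem t\<close>, presented as a bracket with offset 0,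
  where the representation does not vanish.\<close>

lemma alpha_prop_unique:
  assumes t: "odd t" "t \<le> n - 2" and rep: "is_rep n v d \<rho>" and tp: "t_prop n d \<rho> t"
    and 1: "alpha_prop n \<rho> t \<alpha>" and 2: "alpha_prop n \<rho> t \<beta>"
  shows "\<alpha> = \<beta>"
proof -
  let ?e = "idem t"
  let ?S = "row_inv n True ?e" and ?S' = "row_inv n False ?e"
  have e: "?e \<in> TL" "?e \<in> PD" "nv ?e = t" using idem_TL[OF t] TL_PD num_vertical_idem[OF t] by auto
  have t0: "t > 0" using t by (simp add: odd_pos)
  have S: "annular n ?S" "in_I n t ?S" "annular n ?S'" "in_I n t ?S'" using bracket_row_inv[OF e(2)] e(3) by auto
  have b: "bracket n ?S ?S' 0 = ?e" using bracket_row_inv(3)[OF e(2)] woff_idem[OF t] by simp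
  have b2: "bracket n ?S ?S' (0 + 2) \<in> TL"
    unfolding bracket_rot[OF S t0] b by (rule rot_TL[OF e(1)]) (use e t_less[OF t] in auto)
  have eq: "\<rho> (bracket n ?S ?S' (0 + 2)) = \<gamma> \<cdot>\<^sub>m \<rho> ?e" if "alpha_prop n \<rho> t \<gamma>" for \<gamma>
    using that S b2 b e(1) unfolding alpha_prop_def by metis
  have ab: "\<alpha> \<cdot>\<^sub>m \<rho> ?e = \<beta> \<cdot>\<^sub>m \<rho> ?e" using eq[OF 1] eq[OF 2] by simp
  note c = rep_car[OF rep e(1)]
  have "\<exists>i<d. \<exists>j<d. \<rho> ?e $$ (i, j) \<noteq> 0"
  proof (rule ccontr)
    assume "\<not> ?thesis"
    then have "\<rho> ?e = 0\<^sub>m d d" using c by (intro eq_matI) auto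
    then show False using idem_nonzero[OF t rep tp] by simp
  qed
  then obtain i j where ij: "i < d" "j < d" "\<rho> ?e $$ (i, j) \<noteq> 0" by blast
  have "(\<alpha> \<cdot>\<^sub>m \<rho> ?e) $$ (i, j) = (\<beta> \<cdot>\<^sub>m \<rho> ?e) $$ (i, j)" using ab by simp
  then show ?thesis using ij c by simp
qed

lemma nontrivial_tirrep:
  assumes I: "is_nontrivial_irrep n v d \<rho>"
  obtains t \<alpha> u where "odd t" "t \<le> n - 2" "t_prop n d \<rho> t" "alpha_prop n \<rho> t \<alpha>" "tirrep t \<alpha> d \<rho> u"
proof -
  have irr: "is_irrep n v d \<rho>" and rep: "is_rep n v d \<rho>" and d: "d > 0"
    using I by (auto simp: is_nontrivial_irrep_def is_irrep_def)
  obtain t where tp: "t_prop n d \<rho> t" using exists_t_prop[OF rep d] by blast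
  note t = nontrivial_t_bound[OF I tp]
  obtain \<alpha> u where u: "\<alpha> \<noteq> 0" "tvec t d \<rho> \<alpha> u"
    using exists_tvec[OF t rep idem_nonzero[OF t rep tp]] by blast
  have "tirrep t \<alpha> d \<rho> u" using irr u t_propD(1)[OF tp] by (simp add: tirrep_def)
  moreover have "alpha_prop n \<rho> t \<alpha>"
    by (rule alpha_propI[OF t(1) u(1)]) (rule rep_rot[OF t rep t_propD(1)[OF tp] u irr])
  ultimately show thesis using that t tp by blast
qed

lemma rep_invariant_eq:
  assumes t: "odd t" "t \<le> n - 2" and rep: "is_rep n v d \<rho>" and tp: "t_prop n d \<rho> t" and ap: "alpha_prop n \<rho> t \<alpha>"
  shows "rep_invariant n d \<rho> = (\<alpha>, t)"
proof -
  have "rep_alpha n d \<rho> = \<alpha>"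
    unfolding rep_alpha_def rep_t_eq[OF tp] using ap alpha_prop_unique[OF t rep tp _ ap] by blast
  then show ?thesis by (simp add: rep_invariant_def rep_t_eq[OF tp])
qed

lemma rep_iso_conj:
  assumes iso: "rep_iso n d1 \<rho>1 d2 \<rho>2" and rep: "is_rep n v d1 \<rho>1" "is_rep n v d2 \<rho>2"
  obtains P Q where "d2 = d1" "P \<in> carrier_mat d1 d1" "Q \<in> carrier_mat d1 d1"
    "\<And>D. D \<in> TL \<Longrightarrow> \<rho>1 D = Q * \<rho>2 D * P" "\<And>D. D \<in> TL \<Longrightarrow> \<rho>2 D = P * \<rho>1 D * Q"
proof -
  obtain P where P: "P \<in> carrier_mat d1 d1" "invertible_mat P" and d: "d2 = d1"
    and c: "\<And>D. D \<in> TL \<Longrightarrow> P * \<rho>1 D = \<rho>2 D * P"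
    using iso unfolding rep_iso_def by blast
  obtain Q where Q: "P * Q = 1\<^sub>m d1" "Q * P = 1\<^sub>m (dim_row Q)"
    using P by (auto simp: invertible_mat_def inverts_mat_def)
  have "dim_row Q = d1" using arg_cong[OF Q(2), of dim_col] P by simp
  moreover have "dim_col Q = d1" using arg_cong[OF Q(1), of dim_col] by simp
  ultimately have Qc: "Q \<in> carrier_mat d1 d1" by auto
  have QP: "Q * P = 1\<^sub>m d1" using Q(2) Qc by simp
  show thesis
  proof (rule that[OF d P(1) Qc])
    fix D assume D: "D \<in> TL"
    have r: "\<rho>1 D \<in> carrier_mat d1 d1" "\<rho>2 D \<in> carrier_mat d1 d1" using rep_car[OF rep(1) D] rep_car[OF rep(2) D] d by auto
    have "Q * \<rho>2 D * P = Q * (P * \<rho>1 D)" using assoc_mult_mat[OF Qc r(2) P(1)] c[OF D] by simp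
    also have "\<dots> = \<rho>1 D" using assoc_mult_mat[OF Qc P(1) r(1)] QP r by simp
    finally show "\<rho>1 D = Q * \<rho>2 D * P" by simp
    have "P * \<rho>1 D * Q = \<rho>2 D * (P * Q)" using assoc_mult_mat[OF r(2) P(1) Qc] c[OF D] by simp
    then show "\<rho>2 D = P * \<rho>1 D * Q" using Q r by simp
  qed
qed

lemma rep_iso_invariant:
  assumes iso: "rep_iso n d1 \<rho>1 d2 \<rho>2" and rep: "is_rep n v d1 \<rho>1" "is_rep n v d2 \<rho>2"
  shows "rep_invariant n d1 \<rho>1 = rep_invariant n d2 \<rho>2"
proof -
  obtain P Q where d: "d2 = d1" and PQ: "P \<in> carrier_mat d1 d1" "Q \<in> carrier_mat d1 d1"
    and 1: "\<And>D. D \<in> TL \<Longrightarrow> \<rho>1 D = Q * \<rho>2 D * P" and 2: "\<And>D. D \<in> TL \<Longrightarrow> \<rho>2 D = P * \<rho>1 D * Q"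
    using rep_iso_conj[OF iso rep] by metis
  have z: "\<rho>1 D = 0\<^sub>m d1 d1 \<longleftrightarrow> \<rho>2 D = 0\<^sub>m d1 d1" if "D \<in> TL" for D
    using 1[OF that] 2[OF that] PQ by (metis left_mult_zero_mat right_mult_zero_mat)
  have s: "X * (\<alpha> \<cdot>\<^sub>m A) * Y = \<alpha> \<cdot>\<^sub>m (X * A * Y)"
    if "X \<in> carrier_mat d1 d1" "A \<in> carrier_mat d1 d1" "Y \<in> carrier_mat d1 d1" for \<alpha> :: 'k and X A Y
    using mult_smult_distrib[OF that(1,2)] mult_smult_assoc_mat[OF mult_carrier_mat[OF that(1,2)] that(3)] by simp
  have sm: "\<rho>1 D = \<alpha> \<cdot>\<^sub>m \<rho>1 D' \<longleftrightarrow> \<rho>2 D = \<alpha> \<cdot>\<^sub>m \<rho>2 D'" if D: "D \<in> TL" "D' \<in> TL" for D D' \<alpha>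
  proof
    assume "\<rho>1 D = \<alpha> \<cdot>\<^sub>m \<rho>1 D'"
    then show "\<rho>2 D = \<alpha> \<cdot>\<^sub>m \<rho>2 D'" using 2[OF D(1)] 2[OF D(2)] s[OF PQ(1) rep_car[OF rep(1) D(2)] PQ(2)] by simp
  next
    assume "\<rho>2 D = \<alpha> \<cdot>\<^sub>m \<rho>2 D'"
    then show "\<rho>1 D = \<alpha> \<cdot>\<^sub>m \<rho>1 D'" using 1[OF D(1)] 1[OF D(2)] s[OF PQ(2) rep_car[OF rep(2) D(2), unfolded d] PQ(1)] by simp
  qed
  have "t_prop n d1 \<rho>1 = t_prop n d2 \<rho>2" unfolding t_prop_def d using z by (intro ext) blast
  moreover have "alpha_prop n \<rho>1 = alpha_prop n \<rho>2" unfolding alpha_prop_def using sm by (intro ext) blast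
  ultimately show ?thesis by (simp add: rep_invariant_def rep_alpha_def rep_t_def)
qed

text \<open>A representation isomorphic to the trivial one vanishes on \<open>idem t\<close>, a
  cellular one does not; so the irreducible cellular representation is nontrivial.\<close>

lemma exists_irrep_with_invariant:
  assumes t: "odd t" "t \<le> n - 2" and \<alpha>: "\<alpha> \<noteq> 0"
  shows "\<exists>d \<rho>. is_nontrivial_irrep n v d \<rho> \<and> rep_invariant n d \<rho> = (\<alpha>, t)"
proof -
  obtain d \<rho> where c: "cellular t \<alpha> d \<rho>" and irr: "is_irrep n v d \<rho>" using exists_cellular_irrep[OF t \<alpha>] by blast
  have rep: "is_rep n v d \<rho>" and e0: "\<rho> (idem t) \<noteq> 0\<^sub>m d d" using c by (auto simp: cellular_def)
  have e: "idem t \<in> TL" "nv (idem t) = t" using idem_TL[OF t] num_vertical_idem[OF t] by auto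
  have tp: "t_prop n d \<rho> t" unfolding t_prop_def using c e by (auto simp: cellular_def)
  have ap: "alpha_prop n \<rho> t \<alpha>" by (rule alpha_propI[OF t(1) \<alpha>]) (use c in \<open>simp add: cellular_def\<close>)
  have "\<not> rep_iso n d \<rho> 1 \<sigma>" if tr: "is_trivial_rep n v 1 \<sigma>" for \<sigma>
  proof
    assume iso: "rep_iso n d \<rho> 1 \<sigma>"
    have "is_rep n v 1 \<sigma>" using tr by (simp add: is_trivial_rep_def)
    from rep_iso_conj[OF iso rep this] obtain P Q where d: "1 = d" and PQ: "P \<in> carrier_mat d d" "Q \<in> carrier_mat d d"
      and 1: "\<And>D. D \<in> TL \<Longrightarrow> \<rho> D = Q * \<sigma> D * P" by metis
    have "idem t \<noteq> id_diagram" using e(2) nv_id t_less[OF t] by auto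
    then have "\<sigma> (idem t) = 0\<^sub>m d d" using trivial_zero[OF tr e(1)] d by simp
    then have "\<rho> (idem t) = 0\<^sub>m d d" using 1[OF e(1)] PQ by simp
    then show False using e0 by simp
  qed
  then have "is_nontrivial_irrep n v d \<rho>" using irr by (auto simp: is_nontrivial_irrep_def)
  then show ?thesis using rep_invariant_eq[OF t rep tp ap] by blast
qed

lemma nontrivial_well_defined:
  assumes I: "is_nontrivial_irrep n v d \<rho>"
  shows "\<exists>!t. t_prop n d \<rho> t" "\<exists>!\<alpha>. alpha_prop n \<rho> (rep_t n d \<rho>) \<alpha>"
    "odd (rep_t n d \<rho>)" "1 \<le> rep_t n d \<rho>" "rep_t n d \<rho> \<le> n - 2"
proof -
  obtain t \<alpha> u where t: "odd t" "t \<le> n - 2" and tp: "t_prop n d \<rho> t" and ap: "alpha_prop n \<rho> t \<alpha>"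
    by (rule nontrivial_tirrep[OF I])
  have rep: "is_rep n v d \<rho>" using I by (simp add: is_nontrivial_irrep_def is_irrep_def)
  note rt = rep_t_eq[OF tp]
  show "\<exists>!t. t_prop n d \<rho> t" using tp t_prop_unique by blast
  show "\<exists>!\<alpha>. alpha_prop n \<rho> (rep_t n d \<rho>) \<alpha>" unfolding rt using ap alpha_prop_unique[OF t rep tp] by blast
  show "odd (rep_t n d \<rho>)" "1 \<le> rep_t n d \<rho>" "rep_t n d \<rho> \<le> n - 2" unfolding rt using t odd_pos[OF t(1)] by linarith+
qed

lemma nontrivial_injective:
  assumes I: "is_nontrivial_irrep n v d1 \<rho>1" "is_nontrivial_irrep n v d2 \<rho>2"
    and eq: "rep_invariant n d1 \<rho>1 = rep_invariant n d2 \<rho>2"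
  shows "rep_iso n d1 \<rho>1 d2 \<rho>2"
proof -
  have rep: "is_rep n v d1 \<rho>1" "is_rep n v d2 \<rho>2" using I by (auto simp: is_nontrivial_irrep_def is_irrep_def)
  obtain t \<alpha> u where t: "odd t" "t \<le> n - 2" "t_prop n d1 \<rho>1 t" "alpha_prop n \<rho>1 t \<alpha>" and u: "tirrep t \<alpha> d1 \<rho>1 u"
    by (rule nontrivial_tirrep[OF I(1)])
  obtain t' \<alpha>' u' where t': "odd t'" "t' \<le> n - 2" "t_prop n d2 \<rho>2 t'" "alpha_prop n \<rho>2 t' \<alpha>'" and u': "tirrep t' \<alpha>' d2 \<rho>2 u'"
    by (rule nontrivial_tirrep[OF I(2)])
  have "t' = t" "\<alpha>' = \<alpha>"
    using eq rep_invariant_eq[OF t(1,2) rep(1) t(3,4)] rep_invariant_eq[OF t'(1,2) rep(2) t'(3,4)] by auto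
  then show ?thesis using tirrep_iso[OF t(1,2) u] u' by blast
qed

end

theorem theorem4p1p3:
  fixes n :: nat and F :: "'k::alg_closed_field set" and v :: 'k
  assumes "odd n" and "n \<ge> 3"
    and "is_subfield F" and "transcendental_over F v"
  shows
    \<comment> \<open>t and alpha are well defined and land in the target set\<close>
    "(\<forall>d \<rho>. is_nontrivial_irrep n v d \<rho> \<longrightarrow>
        (\<exists>!t. t_prop n d \<rho> t) \<and>
        (\<exists>!\<alpha>. alpha_prop n \<rho> (rep_t n d \<rho>) \<alpha>) \<and>
        odd (rep_t n d \<rho>) \<and> 1 \<le> rep_t n d \<rho> \<and> rep_t n d \<rho> \<le> n - 2)
   \<and> \<comment> \<open>constant on isomorphism classes\<close>
     (\<forall>d1 \<rho>1 d2 \<rho>2. is_nontrivial_irrep n v d1 \<rho>1 \<and> is_nontrivial_irrep n v d2 \<rho>2 \<and>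
        rep_iso n d1 \<rho>1 d2 \<rho>2 \<longrightarrow> rep_invariant n d1 \<rho>1 = rep_invariant n d2 \<rho>2)
   \<and> \<comment> \<open>injective on isomorphism classes\<close>
     (\<forall>d1 \<rho>1 d2 \<rho>2. is_nontrivial_irrep n v d1 \<rho>1 \<and> is_nontrivial_irrep n v d2 \<rho>2 \<and>
        rep_invariant n d1 \<rho>1 = rep_invariant n d2 \<rho>2 \<longrightarrow> rep_iso n d1 \<rho>1 d2 \<rho>2)
   \<and> \<comment> \<open>surjective onto the pairs (alpha, t)\<close>
     (\<forall>\<alpha> t. \<alpha> \<noteq> 0 \<and> odd t \<and> 1 \<le> t \<and> t \<le> n - 2 \<longrightarrow>
        (\<exists>d \<rho>. is_nontrivial_irrep n v d \<rho> \<and> rep_invariant n d \<rho> = (\<alpha>, t)))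
   \<and> \<comment> \<open>the trivial representation exists, is irreducible, and is unique up to isomorphism\<close>
     (\<exists>\<rho>. is_trivial_rep n v 1 \<rho> \<and> is_irrep n v 1 \<rho>)
   \<and> (\<forall>\<rho>1 \<rho>2. is_trivial_rep n v 1 \<rho>1 \<and> is_trivial_rep n v 1 \<rho>2 \<longrightarrow> rep_iso n 1 \<rho>1 1 \<rho>2)"
proof -
  interpret tl n v by unfold_locales (use assms qtwo_nonzero in auto)
  have triv: "\<exists>\<rho>. is_trivial_rep n v 1 \<rho> \<and> is_irrep n v 1 \<rho>"
    using exists_trivial irrep_one by (auto simp: is_trivial_rep_def)
  have rep: "is_rep n v d \<rho>" if "is_nontrivial_irrep n v d \<rho>" for d \<rho>
    using that by (simp add: is_nontrivial_irrep_def is_irrep_def)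
  show ?thesis
  proof (intro conjI allI impI triv)
    fix d1 \<rho>1 d2 \<rho>2
    assume "is_nontrivial_irrep n v d1 \<rho>1 \<and> is_nontrivial_irrep n v d2 \<rho>2 \<and> rep_iso n d1 \<rho>1 d2 \<rho>2"
    then show "rep_invariant n d1 \<rho>1 = rep_invariant n d2 \<rho>2" using rep_iso_invariant[OF _ rep rep] by blast
  next
    fix \<alpha> :: 'k and t
    assume "\<alpha> \<noteq> 0 \<and> odd t \<and> 1 \<le> t \<and> t \<le> n - 2"
    then show "\<exists>d \<rho>. is_nontrivial_irrep n v d \<rho> \<and> rep_invariant n d \<rho> = (\<alpha>, t)"
      using exists_irrep_with_invariant by blast
  qed (simp_all only: nontrivial_well_defined nontrivial_injective trivial_iso not_False_eq_True)
qed

end
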